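(* There exists a randomized algorithm that, given strings $X$ and $Y$, an integer $k\ge 0$, and a positive integer $\alpha=\mathcal{O}(k)$, returns YES if $\mathsf{ED}(X,Y)\le k$, and returns NO if $\mathsf{ED}(X,Y)>k+3(k+1)(\alpha-1)$. With high probability, the algorithm is correct and its running time is $\tilde{\mathcal{O}}\big(\frac{1}{\alpha}|X|+k^2+\frac{k}{\alpha}\sqrt{|X|k}\big)$.
   Context: Strings are finite sequences over an alphabet $\Sigma$; the algorithm has random access to the characters of $X$ and $Y$. $\mathsf{ED}(X,Y)$ denotes the edit distance (minimum number of character insertions, deletions and substitutions transforming $X$ into $Y$). The notation $\tilde{\mathcal{O}}$ hides factors polylogarithmic in the input size and in the inverse error probability; "with high probability" means with probability at least $1-1/N^{c}$ for an arbitrarily large constant $c$, where $N$ is the input size. *)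

theory Defs
  imports "HOL-Probability.Probability"
begin

section \<open>Edit distance\<close>

inductive_set edit_step :: "('a list \<times> 'a list) set" where
  insertion: "(u @ v, u @ a # v) \<in> edit_step"
| deletion: "(u @ a # v, u @ v) \<in> edit_step"
| substitution: "(u @ a # v, u @ b # v) \<in> edit_step"

definition edit_distance :: "'a list \<Rightarrow> 'a list \<Rightarrow> nat" where
  "edit_distance X Y = (LEAST n. (X, Y) \<in> edit_step ^^ n)"

text \<open>The minimum above is over a nonempty set.\<close>

lemma edit_step_delete_all: "(X, []) \<in> edit_step ^^ length X"
proof (induction X)
  case (Cons a X)
  have "(a # X, X) \<in> edit_step"
    using edit_step.deletion[of "[]" a X] by simp
  then show ?case
    using Cons relpow_Suc_I2 by (metis length_Cons)
qed simp

lemma edit_step_insert_all: "([], Y) \<in> edit_step ^^ length Y"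
proof (induction Y)
  case (Cons a Y)
  have "(Y, a # Y) \<in> edit_step"
    using edit_step.insertion[of "[]" Y a] by simp
  then show ?case
    using Cons by auto
qed simp

lemma edit_distance_exists: "\<exists>n. (X, Y) \<in> edit_step ^^ n"
  using edit_step_delete_all[of X] edit_step_insert_all[of Y]
  by (metis relpow_add relcomp.relcompI)


section \<open>The randomized word RAM\<close>

text \<open>
  Programs are finite structured programs over registers and a random-access memory, all holding
  \<open>w\<close>-bit words, represented as natural numbers below \<open>2 ^ w\<close>. The program is
  uniform: it depends neither on the input nor on \<open>w\<close>. Every instruction and every test of a
  branch or loop takes unit time. The two input strings are not copied into memory but are accessed
  one character at a time, so that sublinear running times are meaningful.
\<close>

datatype binop = Add | Sub | Mul | Div | Mod | Less | Eq | And | Or | Xor | Shl | Shr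

fun apply_op :: "nat \<Rightarrow> binop \<Rightarrow> nat \<Rightarrow> nat \<Rightarrow> nat" where
  "apply_op w Add a b = (a + b) mod 2 ^ w"
| "apply_op w Sub a b = (a + 2 ^ w - b) mod 2 ^ w"
| "apply_op w Mul a b = (a * b) mod 2 ^ w"
| "apply_op w Div a b = a div b"
| "apply_op w Mod a b = a mod b"
| "apply_op w Less a b = of_bool (a < b)"
| "apply_op w Eq a b = of_bool (a = b)"
| "apply_op w And a b = semiring_bit_operations_class.and a b"
| "apply_op w Or a b = semiring_bit_operations_class.or a b"
| "apply_op w Xor a b = semiring_bit_operations_class.xor a b"
| "apply_op w Shl a b = push_bit b a mod 2 ^ w"
| "apply_op w Shr a b = drop_bit b a"

text \<open>
  The arguments of type \<^typ>\<open>nat\<close> name registers, except for the literal of \<open>Const\<close>.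
\<close>

datatype stmt =
    Const nat nat
  | Op binop nat nat nat
  | Load nat nat
  | Store nat nat
  | ReadX nat nat
  | ReadY nat nat
  | Rand nat nat
  | Cond nat "stmt list" "stmt list"
  | Loop nat "stmt list"

record state =
  regs :: "nat \<Rightarrow> nat"
  mem :: "nat \<Rightarrow> nat"

definition set_reg :: "nat \<Rightarrow> nat \<Rightarrow> state \<Rightarrow> state" where
  "set_reg r v s = s\<lparr>regs := (regs s)(r := v)\<rparr>"

definition read_char :: "nat list \<Rightarrow> nat \<Rightarrow> nat" where
  "read_char X i = (if i < length X then X ! i else 0)"

text \<open>
  A configuration consists of the statements that remain to be executed and the current state; it
  is halted when no statement remains. One unit of time transforms a configuration as follows.
  \<open>Rand r t\<close> draws a fresh uniformly random integer between \<open>0\<close> (inclusive) and the value of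
  register \<open>t\<close> (exclusive).
\<close>

type_synonym config = "stmt list \<times> state"

fun step :: "nat \<Rightarrow> nat list \<Rightarrow> nat list \<Rightarrow> config \<Rightarrow> config pmf" where
  "step w X Y ([], s) = return_pmf ([], s)"
| "step w X Y (Const r v # K, s) = return_pmf (K, set_reg r (v mod 2 ^ w) s)"
| "step w X Y (Op f r t u # K, s) =
     return_pmf (K, set_reg r (apply_op w f (regs s t) (regs s u)) s)"
| "step w X Y (Load r t # K, s) = return_pmf (K, set_reg r (mem s (regs s t)) s)"
| "step w X Y (Store t r # K, s) =
     return_pmf (K, s\<lparr>mem := (mem s)(regs s t := regs s r)\<rparr>)"
| "step w X Y (ReadX r t # K, s) = return_pmf (K, set_reg r (read_char X (regs s t)) s)"
| "step w X Y (ReadY r t # K, s) = return_pmf (K, set_reg r (read_char Y (regs s t)) s)"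
| "step w X Y (Rand r t # K, s) =
     (if regs s t = 0 then return_pmf (K, set_reg r 0 s)
      else map_pmf (\<lambda>v. (K, set_reg r v s)) (pmf_of_set {..<regs s t}))"
| "step w X Y (Cond r p q # K, s) = return_pmf ((if regs s r \<noteq> 0 then p else q) @ K, s)"
| "step w X Y (Loop r p # K, s) =
     return_pmf (if regs s r \<noteq> 0 then p @ Loop r p # K else K, s)"

primrec run :: "nat \<Rightarrow> nat list \<Rightarrow> nat list \<Rightarrow> nat \<Rightarrow> config \<Rightarrow> config pmf" where
  "run w X Y 0 c = return_pmf c"
| "run w X Y (Suc T) c = bind_pmf (step w X Y c) (run w X Y T)"

definition init_state :: "nat list \<Rightarrow> nat list \<Rightarrow> nat \<Rightarrow> nat \<Rightarrow> state" where
  "init_state X Y k \<alpha> =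
     \<lparr>regs = (\<lambda>_. 0)(0 := length X, 1 := length Y, 2 := k, 3 := \<alpha>), mem = (\<lambda>_. 0)\<rparr>"

definition halted :: "config \<Rightarrow> bool" where
  "halted c \<longleftrightarrow> fst c = []"

text \<open>A halted configuration answers YES or NO, according to register \<open>0\<close>.\<close>

definition answers_yes :: "config \<Rightarrow> bool" where
  "answers_yes c \<longleftrightarrow> halted c \<and> regs (snd c) 0 \<noteq> 0"

definition answers_no :: "config \<Rightarrow> bool" where
  "answers_no c \<longleftrightarrow> halted c \<and> regs (snd c) 0 = 0"

text \<open>
  Each character, each length and each integer parameter occupies a single machine word.
\<close>

definition fits :: "nat \<Rightarrow> nat list \<Rightarrow> nat list \<Rightarrow> nat \<Rightarrow> nat \<Rightarrow> bool" where
  "fits w X Y k \<alpha> \<longleftrightarrow>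
     length X < 2 ^ w \<and> length Y < 2 ^ w \<and> k < 2 ^ w \<and> \<alpha> < 2 ^ w \<and>
     (\<forall>a \<in> set X \<union> set Y. a < 2 ^ w)"

text \<open>
  The number of input words: the characters of both strings and the two integers. In particular
  it is at least \<open>2\<close>, so that its logarithm is at least \<open>1\<close>.
\<close>

definition input_size :: "nat list \<Rightarrow> nat list \<Rightarrow> nat" where
  "input_size X Y = length X + length Y + 2"


section \<open>The gap edit distance problem\<close>

definition gap_correct :: "nat list \<Rightarrow> nat list \<Rightarrow> nat \<Rightarrow> nat \<Rightarrow> config \<Rightarrow> bool" where
  "gap_correct X Y k \<alpha> c \<longleftrightarrow>
     (edit_distance X Y \<le> k \<longrightarrow> answers_yes c) \<and>
     (edit_distance X Y > k + 3 * (k + 1) * (\<alpha> - 1) \<longrightarrow> answers_no c)"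

text \<open>
  The summand \<open>1\<close> only matters for \<open>X = []\<close> and \<open>k = 0\<close>, where the other terms vanish.
\<close>

definition time_bound :: "nat list \<Rightarrow> nat \<Rightarrow> nat \<Rightarrow> real" where
  "time_bound X k \<alpha> =
     1 + real (length X) / real \<alpha> + real k ^ 2 + real k / real \<alpha> * sqrt (real (length X) * real k)"

text \<open>
  Halted configurations are fixed by \<^const>\<open>step\<close>, so the configuration reached after \<open>T\<close> units
  of time is halted iff the running time is at most \<open>T\<close>.
\<close>

definition success_prob ::
  "stmt list \<Rightarrow> nat \<Rightarrow> nat list \<Rightarrow> nat list \<Rightarrow> nat \<Rightarrow> nat \<Rightarrow> nat \<Rightarrow> real" where
  "success_prob P w X Y k \<alpha> T =
     measure_pmf.prob (run w X Y T (P, init_state X Y k \<alpha>))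
       {c. halted c \<and> gap_correct X Y k \<alpha> c}"

end

(* Landau-Vishkin dynamic programming is run on groups of alpha consecutive diagonals instead of
   single diagonals: a table entry stores the furthest row reached in a group after i edits. Moving
   inside a group costs at most alpha - 1 insertions or deletions, and an extension along a group may
   overlook at most alpha - 1 mismatches, hence the factor 1 + 3 (alpha - 1) per edit.

   An extension query has to find an end point that lies beyond every exact match on the group and is
   still almost exact on one of its diagonals. The diagonals that match exactly on a window form an
   arithmetic progression whose difference is a period of the window. Outside the window the same
   periodicity either persists, which is certified up to few errors by random sampling at rate about
   log / alpha, or it breaks at a place found by binary search, and there all but few diagonals of the
   progression die; so logarithmically many rounds suffice.

   Certificates for intervals are precomputed in binary trees over chunks of the text, one tree per
   group of about max (alpha, sqrt (n / k)) diagonals, which balances the n / alpha samples per tree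
   against the k^2 / alpha queries; a query walks up and down its tree and intersects progressions. *)
theory Submission
  imports Defs
begin

text \<open>The error budget fixes the constants. A certificate may overlook fewer than
  \<open>aa\<close> deviations from a periodic string, and one deviation spoils at most two
  positions of a diagonal, so a certified diagonal has at most 2 (aa - 1) mismatches. A query chains
  at most 2 LT + 2 certificates; hence \<open>aa\<close> is \<alpha> divided by a multiple of the
  logarithm, which adds a logarithm to the sampling rate. Completeness needs no budget: a diagonal
  is discarded only when it is known not to match exactly, and the reported row dominates its exact
  match. Sets of diagonals must stay in constant space while they are filtered and intersected.
  Explicit progressions are awkward to intersect, so the scans rely on a closure property under
  reflection that survives intersection and from which the parameters of the progression can be read
  off. Randomness enters only in the sampling loop. Its failures are added up by a program logic
  whose judgements carry a time bound and a failure bound, so the union bound follows the syntax of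
  the program: polynomially many calls, each failing with an inverse polynomial probability of any
  chosen degree.\<close>

section \<open>Failure probability of a time-bounded run\<close>

text \<open>Running out of time counts as failure, hence the value 1 for unfinished code. For a
  0-1-valued \<open>h\<close> the result is the probability of missing the time bound or of halting
  in a bad state; other \<open>h\<close> act as continuations in \<open>loss_seq\<close>.\<close>

primrec loss :: "nat \<Rightarrow> nat list \<Rightarrow> nat list \<Rightarrow> nat \<Rightarrow> (state \<Rightarrow> ennreal) \<Rightarrow> config \<Rightarrow> ennreal" where
  "loss w X Y 0 h c = (if fst c = [] then h (snd c) else 1)"
| "loss w X Y (Suc n) h c = (\<integral>\<^sup>+ c'. loss w X Y n h c' \<partial>measure_pmf (step w X Y c))"

lemma loss_nil [simp]: "loss w X Y n h ([], s) = h s"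
  by (induction n) auto

text \<open>Unfinished code already has the largest value that \<open>h \<le> 1\<close> permits, and
  halted configurations are fixed, so additional time can only lower the loss.\<close>

lemma loss_mono_time1:
  assumes "\<And>s. h s \<le> 1"
  shows "loss w X Y (Suc n) h c \<le> loss w X Y n h c"
proof (induction n arbitrary: c)
  case 0
  have le1: "loss w X Y 0 h c' \<le> 1" for c'
    using assms by auto
  show ?case
  proof (cases "fst c = []")
    case True
    then obtain s where "c = ([], s)" by (cases c) auto
    then show ?thesis by simp
  next
    case False
    have "(\<integral>\<^sup>+ c'. loss w X Y 0 h c' \<partial>measure_pmf (step w X Y c)) \<le> (\<integral>\<^sup>+ c'. 1 \<partial>measure_pmf (step w X Y c))"
      using le1 by (intro nn_integral_mono) auto
    then show ?thesis using False by simp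
  qed
next
  case (Suc n)
  have "loss w X Y (Suc (Suc n)) h c = (\<integral>\<^sup>+ c'. loss w X Y (Suc n) h c' \<partial>measure_pmf (step w X Y c))" by simp
  also have "\<dots> \<le> (\<integral>\<^sup>+ c'. loss w X Y n h c' \<partial>measure_pmf (step w X Y c))"
    by (intro nn_integral_mono Suc.IH)
  finally show ?case by simp
qed

lemma loss_mono_time:
  assumes "\<And>s. h s \<le> 1" "m \<le> n"
  shows "loss w X Y n h c \<le> loss w X Y m h c"
  by (rule lift_Suc_antimono_le[of "\<lambda>n. loss w X Y n h c", OF loss_mono_time1 assms(2)]) (rule assms(1))

lemma loss_mono:
  assumes "\<And>s. h s \<le> g s"
  shows "loss w X Y n h c \<le> loss w X Y n g c"
proof (induction n arbitrary: c)
  case (Suc n)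
  then show ?case by (simp add: nn_integral_mono)
qed (use assms in auto)

lemma loss_le_1:
  assumes "\<And>s. h s \<le> 1"
  shows "loss w X Y n h c \<le> 1"
proof -
  have "loss w X Y n h c \<le> loss w X Y 0 h c" by (rule loss_mono_time[OF assms]) auto
  also have "\<dots> \<le> 1" using assms by auto
  finally show ?thesis .
qed

lemma loss_add_const:
  "loss w X Y n (\<lambda>s. h s + d) c \<le> loss w X Y n h c + d"
proof (induction n arbitrary: c)
  case (Suc n)
  have "loss w X Y (Suc n) (\<lambda>s. h s + d) c \<le> (\<integral>\<^sup>+ c'. loss w X Y n h c' + d \<partial>measure_pmf (step w X Y c))"
    by (simp add: nn_integral_mono Suc.IH)
  also have "\<dots> = loss w X Y (Suc n) h c + d"
    by (simp add: nn_integral_add)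
  finally show ?case .
qed auto

text \<open>An instruction looks only at the head of the code, also when \<open>Cond\<close> or
  \<open>Loop\<close> unfolds it, so a continuation may be appended before or after the
  step.\<close>

lemma step_append:
  assumes "i # c = p"
  shows "step w X Y (p @ K, s) = map_pmf (\<lambda>(c, s). (c @ K, s)) (step w X Y (p, s))"
  unfolding assms[symmetric]
  by (cases i) (auto simp: map_pmf_comp)

text \<open>The loss of the continuation \<open>K\<close> becomes the final cost of
  \<open>c\<close>. Only an inequality holds: \<open>c\<close> may halt before its \<open>n\<close>
  units are used up, and the remaining time then passes to \<open>K\<close>.\<close>

lemma loss_seq:
  assumes h: "\<And>s. h s \<le> 1"
  shows "loss w X Y (n + m) h (c @ K, s) \<le> loss w X Y n (\<lambda>s'. loss w X Y m h (K, s')) (c, s)"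
proof (induction n arbitrary: c s)
  case 0
  then show ?case using loss_le_1[OF h] by auto
next
  case (Suc n)
  show ?case
  proof (cases c)
    case Nil
    then show ?thesis using loss_mono_time[OF h, of m "Suc n + m"] by simp
  next
    case (Cons i c')
    have "loss w X Y (Suc n + m) h (c @ K, s) =
       (\<integral>\<^sup>+ x. loss w X Y (n + m) h x \<partial>measure_pmf (step w X Y (c @ K, s)))"
      by simp
    also have "\<dots> = (\<integral>\<^sup>+ x. loss w X Y (n + m) h (fst x @ K, snd x) \<partial>measure_pmf (step w X Y (c, s)))"
      unfolding step_append[OF Cons[symmetric]] by (simp add: case_prod_beta)
    also have "\<dots> \<le> (\<integral>\<^sup>+ x. loss w X Y n (\<lambda>s'. loss w X Y m h (K, s')) x \<partial>measure_pmf (step w X Y (c, s)))"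
      using Suc.IH[of "fst x" "snd x" for x] by (intro nn_integral_mono) auto
    finally show ?thesis by simp
  qed
qed

lemma loss_run:
  "loss w X Y n h c = (\<integral>\<^sup>+ c'. (if fst c' = [] then h (snd c') else 1) \<partial>measure_pmf (run w X Y n c))"
proof (induction n arbitrary: c)
  case (Suc n)
  then show ?case by (simp add: nn_integral_bind_pmf)
qed simp

section \<open>A structured language over the word RAM\<close>

text \<open>\<open>Ite\<close> evaluates one branch only, so a test can guard a subtraction that
  would otherwise wrap around.\<close>

datatype exp = C nat | V nat | B binop exp exp | Ld exp | Rx exp | Ry exp | Ite exp exp exp

type_synonym vals = "(nat \<Rightarrow> nat) \<times> (nat \<Rightarrow> nat)"

text \<open>Arithmetic without wrap-around. The remaining operations do not refer to the word
  length, so 0 stands in for it; the exception \<open>Shl\<close> is ruled out by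
  \<open>opsafe\<close>.\<close>

fun nop :: "binop \<Rightarrow> nat \<Rightarrow> nat \<Rightarrow> nat" where
  "nop Add a b = a + b"
| "nop Sub a b = a - b"
| "nop Mul a b = a * b"
| "nop f a b = apply_op 0 f a b"

fun opsafe :: "nat \<Rightarrow> binop \<Rightarrow> nat \<Rightarrow> nat \<Rightarrow> bool" where
  "opsafe w Add a b = (a + b < 2 ^ w)"
| "opsafe w Sub a b = (b \<le> a \<and> a < 2 ^ w)"
| "opsafe w Mul a b = (a * b < 2 ^ w)"
| "opsafe w Shl a b = False"
| "opsafe w f a b = True"

lemma opsafe_nop: "opsafe w f a b \<Longrightarrow> apply_op w f a b = nop f a b"
  by (cases f) (auto simp: mod_if le_mod_geq)

primrec nev :: "nat list \<Rightarrow> nat list \<Rightarrow> vals \<Rightarrow> exp \<Rightarrow> nat" where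
  "nev X Y s (C n) = n"
| "nev X Y s (V r) = fst s r"
| "nev X Y s (B f a b) = nop f (nev X Y s a) (nev X Y s b)"
| "nev X Y s (Ld a) = snd s (nev X Y s a)"
| "nev X Y s (Rx a) = read_char X (nev X Y s a)"
| "nev X Y s (Ry a) = read_char Y (nev X Y s a)"
| "nev X Y s (Ite a b c) = (if nev X Y s a \<noteq> 0 then nev X Y s b else nev X Y s c)"

primrec esafe :: "nat \<Rightarrow> nat list \<Rightarrow> nat list \<Rightarrow> vals \<Rightarrow> exp \<Rightarrow> bool" where
  "esafe w X Y s (C n) = (n < 2 ^ w)"
| "esafe w X Y s (V r) = (r < 100)"
| "esafe w X Y s (B f a b) = (esafe w X Y s a \<and> esafe w X Y s b \<and> opsafe w f (nev X Y s a) (nev X Y s b))"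
| "esafe w X Y s (Ld a) = esafe w X Y s a"
| "esafe w X Y s (Rx a) = esafe w X Y s a"
| "esafe w X Y s (Ry a) = esafe w X Y s a"
| "esafe w X Y s (Ite a b c) = (esafe w X Y s a \<and> (if nev X Y s a \<noteq> 0 then esafe w X Y s b else esafe w X Y s c))"

text \<open>Register \<open>d\<close> receives the value and the registers above it form an
  evaluation stack; program variables live below 100. \<open>Or\<close> of a register with itself is
  the copy instruction.\<close>

primrec cexp :: "nat \<Rightarrow> exp \<Rightarrow> stmt list" where
  "cexp d (C n) = [Const d n]"
| "cexp d (V r) = [Op Or d r r]"
| "cexp d (B f a b) = cexp d a @ cexp (Suc d) b @ [Op f d d (Suc d)]"
| "cexp d (Ld a) = cexp d a @ [Load d d]"
| "cexp d (Rx a) = cexp d a @ [ReadX d d]"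
| "cexp d (Ry a) = cexp d a @ [ReadY d d]"
| "cexp d (Ite a b c) = cexp d a @ [Cond d (cexp d b) (cexp d c)]"

text \<open>Charging both branches of \<open>Ite\<close> makes the bound independent of the
  state.\<close>

primrec te :: "exp \<Rightarrow> nat" where
  "te (C n) = 1"
| "te (V r) = 1"
| "te (B f a b) = te a + te b + 1"
| "te (Ld a) = te a + 1"
| "te (Rx a) = te a + 1"
| "te (Ry a) = te a + 1"
| "te (Ite a b c) = te a + te b + te c + 1"

definition proj :: "state \<Rightarrow> vals" where
  "proj s = (\<lambda>r. if r < 100 then regs s r else 0, mem s)"

lemma loss_Const: "loss w X Y (Suc m) h (Const r v # K, s) = loss w X Y m h (K, set_reg r (v mod 2 ^ w) s)"
  and loss_Op: "loss w X Y (Suc m) h (Op f r t u # K, s) = loss w X Y m h (K, set_reg r (apply_op w f (regs s t) (regs s u)) s)"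
  and loss_Load: "loss w X Y (Suc m) h (Load r t # K, s) = loss w X Y m h (K, set_reg r (mem s (regs s t)) s)"
  and loss_Store: "loss w X Y (Suc m) h (Store t r # K, s) = loss w X Y m h (K, s\<lparr>mem := (mem s)(regs s t := regs s r)\<rparr>)"
  and loss_ReadX: "loss w X Y (Suc m) h (ReadX r t # K, s) = loss w X Y m h (K, set_reg r (read_char X (regs s t)) s)"
  and loss_ReadY: "loss w X Y (Suc m) h (ReadY r t # K, s) = loss w X Y m h (K, set_reg r (read_char Y (regs s t)) s)"
  and loss_Cond: "loss w X Y (Suc m) h (Cond r p q # K, s) = loss w X Y m h ((if regs s r \<noteq> 0 then p else q) @ K, s)"
  and loss_Loop: "loss w X Y (Suc m) h (Loop r p # K, s) = loss w X Y m h (if regs s r \<noteq> 0 then p @ Loop r p # K else K, s)"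
  by simp_all

lemma regs_set_reg [simp]: "regs (set_reg r v s) = (regs s)(r := v)" "mem (set_reg r v s) = mem s"
  by (simp_all add: set_reg_def)

text \<open>Evaluation is deterministic, so a single state \<open>s'\<close> can be named before the
  continuation, the time and the cost function are chosen; all rules for commands use it in this
  form.\<close>

lemma cexp_correct:
  assumes "esafe w X Y (proj s) e" "100 \<le> d"
  shows "\<exists>s'. regs s' d = nev X Y (proj s) e \<and> (\<forall>r<d. regs s' r = regs s r) \<and> mem s' = mem s \<and>
    (\<forall>K m h. (\<forall>s. h s \<le> 1) \<longrightarrow> loss w X Y (te e + m) h (cexp d e @ K, s) \<le> loss w X Y m h (K, s'))"
  using assms
proof (induction e arbitrary: s d)
  case (C n)
  then show ?case
    by (intro exI[of _ "set_reg d n s"]) (auto simp: loss_Const simp del: loss.simps)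
next
  case (V r)
  then show ?case
    by (intro exI[of _ "set_reg d (regs s r) s"]) (auto simp: loss_Op proj_def simp del: loss.simps)
next
  case (B f a b)
  obtain s1 where s1: "regs s1 d = nev X Y (proj s) a" "\<forall>r<d. regs s1 r = regs s r" "mem s1 = mem s"
    "\<And>K m h. (\<forall>s. h s \<le> 1) \<Longrightarrow> loss w X Y (te a + m) h (cexp d a @ K, s) \<le> loss w X Y m h (K, s1)"
    using B.IH(1)[of s d] B.prems by auto
  have p1: "proj s1 = proj s" using s1 B.prems by (auto simp: proj_def)
  obtain s2 where s2: "regs s2 (Suc d) = nev X Y (proj s) b" "\<forall>r<Suc d. regs s2 r = regs s1 r" "mem s2 = mem s"
    "\<And>K m h. (\<forall>s. h s \<le> 1) \<Longrightarrow> loss w X Y (te b + m) h (cexp (Suc d) b @ K, s1) \<le> loss w X Y m h (K, s2)"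
    using B.IH(2)[of s1 "Suc d"] B.prems p1 s1 by auto
  let ?v = "nop f (nev X Y (proj s) a) (nev X Y (proj s) b)"
  show ?case
  proof (intro exI[of _ "set_reg d ?v s2"] conjI allI impI)
    fix K m and h :: "state \<Rightarrow> ennreal" assume h: "\<forall>s. h s \<le> 1"
    have "loss w X Y (te (B f a b) + m) h (cexp d (B f a b) @ K, s)
       \<le> loss w X Y (te b + (Suc m)) h (cexp (Suc d) b @ Op f d d (Suc d) # K, s1)"
      using s1(4)[OF h, of "te b + Suc m" "cexp (Suc d) b @ Op f d d (Suc d) # K"] by (simp add: ac_simps del: loss.simps)
    also have "\<dots> \<le> loss w X Y (Suc m) h (Op f d d (Suc d) # K, s2)"
      by (rule s2(4)[OF h])
    also have "\<dots> = loss w X Y m h (K, set_reg d ?v s2)"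
      using s1 s2 B.prems by (simp add: loss_Op opsafe_nop del: loss.simps)
    finally show "loss w X Y (te (B f a b) + m) h (cexp d (B f a b) @ K, s) \<le> loss w X Y m h (K, set_reg d ?v s2)" .
  qed (use s1 s2 in auto)
next
  case (Ld a)
  obtain s1 where s1: "regs s1 d = nev X Y (proj s) a" "\<forall>r<d. regs s1 r = regs s r" "mem s1 = mem s"
    "\<And>K m h. (\<forall>s. h s \<le> 1) \<Longrightarrow> loss w X Y (te a + m) h (cexp d a @ K, s) \<le> loss w X Y m h (K, s1)"
    using Ld.IH(1)[of s d] Ld.prems by auto
  have "\<forall>K m h. (\<forall>s. h s \<le> 1) \<longrightarrow> loss w X Y (te (Ld a) + m) h (cexp d (Ld a) @ K, s) \<le> loss w X Y m h (K, set_reg d (mem s1 (regs s1 d)) s1)"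
  proof (intro allI impI)
    fix K m and h :: "state \<Rightarrow> ennreal" assume h: "\<forall>s. h s \<le> 1"
    show "loss w X Y (te (Ld a) + m) h (cexp d (Ld a) @ K, s) \<le> loss w X Y m h (K, set_reg d (mem s1 (regs s1 d)) s1)"
      using s1(4)[OF h, of "Suc m" "Load d d # K"] by (simp add: loss_Load del: loss.simps)
  qed
  then show ?case using s1
    by (intro exI[of _ "set_reg d (mem s1 (regs s1 d)) s1"]) (auto simp: proj_def simp del: te.simps cexp.simps)
next
  case (Rx a)
  obtain s1 where s1: "regs s1 d = nev X Y (proj s) a" "\<forall>r<d. regs s1 r = regs s r" "mem s1 = mem s"
    "\<And>K m h. (\<forall>s. h s \<le> 1) \<Longrightarrow> loss w X Y (te a + m) h (cexp d a @ K, s) \<le> loss w X Y m h (K, s1)"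
    using Rx.IH(1)[of s d] Rx.prems by auto
  have "\<forall>K m h. (\<forall>s. h s \<le> 1) \<longrightarrow> loss w X Y (te (Rx a) + m) h (cexp d (Rx a) @ K, s) \<le> loss w X Y m h (K, set_reg d (read_char X (regs s1 d)) s1)"
  proof (intro allI impI)
    fix K m and h :: "state \<Rightarrow> ennreal" assume h: "\<forall>s. h s \<le> 1"
    show "loss w X Y (te (Rx a) + m) h (cexp d (Rx a) @ K, s) \<le> loss w X Y m h (K, set_reg d (read_char X (regs s1 d)) s1)"
      using s1(4)[OF h, of "Suc m" "ReadX d d # K"] by (simp add: loss_ReadX del: loss.simps)
  qed
  then show ?case using s1
    by (intro exI[of _ "set_reg d (read_char X (regs s1 d)) s1"]) (auto simp: proj_def simp del: te.simps cexp.simps)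
next
  case (Ry a)
  obtain s1 where s1: "regs s1 d = nev X Y (proj s) a" "\<forall>r<d. regs s1 r = regs s r" "mem s1 = mem s"
    "\<And>K m h. (\<forall>s. h s \<le> 1) \<Longrightarrow> loss w X Y (te a + m) h (cexp d a @ K, s) \<le> loss w X Y m h (K, s1)"
    using Ry.IH(1)[of s d] Ry.prems by auto
  have "\<forall>K m h. (\<forall>s. h s \<le> 1) \<longrightarrow> loss w X Y (te (Ry a) + m) h (cexp d (Ry a) @ K, s) \<le> loss w X Y m h (K, set_reg d (read_char Y (regs s1 d)) s1)"
  proof (intro allI impI)
    fix K m and h :: "state \<Rightarrow> ennreal" assume h: "\<forall>s. h s \<le> 1"
    show "loss w X Y (te (Ry a) + m) h (cexp d (Ry a) @ K, s) \<le> loss w X Y m h (K, set_reg d (read_char Y (regs s1 d)) s1)"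
      using s1(4)[OF h, of "Suc m" "ReadY d d # K"] by (simp add: loss_ReadY del: loss.simps)
  qed
  then show ?case using s1
    by (intro exI[of _ "set_reg d (read_char Y (regs s1 d)) s1"]) (auto simp: proj_def simp del: te.simps cexp.simps)
next
  case (Ite a b c)
  obtain s1 where s1: "regs s1 d = nev X Y (proj s) a" "\<forall>r<d. regs s1 r = regs s r" "mem s1 = mem s"
    "\<And>K m h. (\<forall>s. h s \<le> 1) \<Longrightarrow> loss w X Y (te a + m) h (cexp d a @ K, s) \<le> loss w X Y m h (K, s1)"
    using Ite.IH(1)[of s d] Ite.prems by auto
  have p1: "proj s1 = proj s" using s1 Ite.prems by (auto simp: proj_def)
  define e where "e = (if regs s1 d \<noteq> 0 then b else c)"
  obtain s2 where s2: "regs s2 d = nev X Y (proj s) e" "\<forall>r<d. regs s2 r = regs s1 r" "mem s2 = mem s"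
    "\<And>K m h. (\<forall>s. h s \<le> 1) \<Longrightarrow> loss w X Y (te e + m) h (cexp d e @ K, s1) \<le> loss w X Y m h (K, s2)"
    using Ite.IH(2,3)[of s1 d] Ite.prems p1 s1 by (auto simp: e_def split: if_splits)
  show ?case
  proof (intro exI[of _ s2] conjI allI impI)
    fix K m and h :: "state \<Rightarrow> ennreal" assume h: "\<forall>s. h s \<le> 1"
    have "loss w X Y (te (Ite a b c) + m) h (cexp d (Ite a b c) @ K, s)
       \<le> loss w X Y (Suc (te b + te c + m)) h (Cond d (cexp d b) (cexp d c) # K, s1)"
      using s1(4)[OF h, of "Suc (te b + te c + m)" "Cond d (cexp d b) (cexp d c) # K"] by (simp add: ac_simps del: loss.simps)
    also have "\<dots> = loss w X Y (te b + te c + m) h (cexp d e @ K, s1)"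
      by (simp add: loss_Cond e_def del: loss.simps)
    also have "\<dots> \<le> loss w X Y (te e + m) h (cexp d e @ K, s1)"
      using h by (intro loss_mono_time) (auto simp: e_def)
    also have "\<dots> \<le> loss w X Y m h (K, s2)" by (rule s2(4)[OF h])
    finally show "loss w X Y (te (Ite a b c) + m) h (cexp d (Ite a b c) @ K, s) \<le> loss w X Y m h (K, s2)" .
  qed (use s1 s2 in \<open>auto simp: e_def\<close>)
qed

section \<open>Commands and a logic for time and failure bounds\<close>

datatype com = Set nat exp | Put exp exp | Rnd nat exp | IfC exp com com | While exp com
  | Seq com com (infixr ";;" 60) | Skip

text \<open>\<open>Loop\<close> can only test a register. The guard is therefore evaluated into
  register 100 once before the loop and again at the end of each iteration.\<close>

primrec comp :: "com \<Rightarrow> stmt list" where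
  "comp (Set r e) = cexp 100 e @ [Op Or r 100 100]"
| "comp (Put a e) = cexp 100 a @ cexp 101 e @ [Store 100 101]"
| "comp (Rnd r e) = cexp 100 e @ [Rand r 100]"
| "comp (IfC e a b) = cexp 100 e @ [Cond 100 (comp a) (comp b)]"
| "comp (While e c) = cexp 100 e @ [Loop 100 (comp c @ cexp 100 e)]"
| "comp (Seq a b) = comp a @ comp b"
| "comp Skip = []"

text \<open>\<open>R w X Y c s t d Q\<close>: started in \<open>s\<close>, the command \<open>c\<close> reaches a state satisfying \<open>Q\<close>
  within \<open>t\<close> units of time, except with probability \<open>d\<close>.\<close>

definition R :: "nat \<Rightarrow> nat list \<Rightarrow> nat list \<Rightarrow> com \<Rightarrow> vals \<Rightarrow> nat \<Rightarrow> ennreal \<Rightarrow> (vals \<Rightarrow> bool) \<Rightarrow> bool" where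
  "R w X Y c s t d Q \<longleftrightarrow>
     (\<forall>s0. proj s0 = s \<longrightarrow> loss w X Y t (\<lambda>s'. if Q (proj s') then 0 else 1) (comp c, s0) \<le> d)"

lemma R_mono:
  assumes "R w X Y c s t d Q" "t \<le> t'" "d \<le> d'" "\<And>s'. Q s' \<Longrightarrow> Q' s'"
  shows "R w X Y c s t' d' Q'"
  unfolding R_def
proof (intro allI impI)
  fix s0 assume s0: "proj s0 = s"
  have "loss w X Y t' (\<lambda>s'. if Q' (proj s') then 0 else 1) (comp c, s0)
      \<le> loss w X Y t' (\<lambda>s'. if Q (proj s') then 0 else 1) (comp c, s0)"
    using assms(4) by (intro loss_mono) auto
  also have "\<dots> \<le> loss w X Y t (\<lambda>s'. if Q (proj s') then 0 else 1) (comp c, s0)"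
    using assms(2) by (intro loss_mono_time) auto
  also have "\<dots> \<le> d" using assms(1) s0 by (auto simp: R_def)
  finally show "loss w X Y t' (\<lambda>s'. if Q' (proj s') then 0 else 1) (comp c, s0) \<le> d'" using assms(3) by simp
qed

text \<open>This is the union bound: a bad intermediate state costs at most 1 and a good one at most
  \<open>d2\<close>, so the loss of the second part is below the indicator of a bad state plus
  \<open>d2\<close>.\<close>

lemma R_Seq:
  assumes "R w X Y c1 s t1 d1 Q1" "\<And>s'. Q1 s' \<Longrightarrow> R w X Y c2 s' t2 d2 Q"
  shows "R w X Y (c1 ;; c2) s (t1 + t2) (d1 + d2) Q"
  unfolding R_def
proof (intro allI impI)
  fix s0 assume s0: "proj s0 = s"
  let ?h = "\<lambda>s'. if Q (proj s') then 0 else 1 :: ennreal"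
  have "loss w X Y (t1 + t2) ?h (comp (c1 ;; c2), s0)
     \<le> loss w X Y t1 (\<lambda>s'. loss w X Y t2 ?h (comp c2, s')) (comp c1, s0)"
    using loss_seq[of ?h] by auto
  also have "\<dots> \<le> loss w X Y t1 (\<lambda>s'. (if Q1 (proj s') then 0 else 1) + d2) (comp c1, s0)"
  proof (rule loss_mono)
    fix s'
    show "loss w X Y t2 ?h (comp c2, s') \<le> (if Q1 (proj s') then 0 else 1) + d2"
    proof (cases "Q1 (proj s')")
      case True
      then show ?thesis using assms(2) by (auto simp: R_def)
    next
      case False
      have "loss w X Y t2 ?h (comp c2, s') \<le> 1" by (rule loss_le_1) auto
      also have "1 \<le> (1::ennreal) + d2" by simp
      finally show ?thesis using False by simp
    qed
  qed
  also have "\<dots> \<le> loss w X Y t1 (\<lambda>s'. if Q1 (proj s') then 0 else 1) (comp c1, s0) + d2"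
    by (rule loss_add_const)
  also have "\<dots> \<le> d1 + d2" using assms(1) s0 by (auto simp: R_def)
  finally show "loss w X Y (t1 + t2) ?h (comp (c1 ;; c2), s0) \<le> d1 + d2" .
qed

lemma R_Skip: "Q s \<Longrightarrow> R w X Y Skip s 0 0 Q"
  by (auto simp: R_def)

lemma R_Set:
  assumes "esafe w X Y s e" "r < 100" "Q ((fst s)(r := nev X Y s e), snd s)"
  shows "R w X Y (Set r e) s (te e + 1) 0 Q"
  unfolding R_def
proof (intro allI impI)
  fix s0 assume s0: "proj s0 = s"
  obtain s1 where s1: "regs s1 100 = nev X Y s e" "\<forall>r<100. regs s1 r = regs s0 r" "mem s1 = mem s0"
    "\<And>K m h. (\<forall>s. h s \<le> 1) \<Longrightarrow> loss w X Y (te e + m) h (cexp 100 e @ K, s0) \<le> loss w X Y m h (K, s1)"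
    using cexp_correct[of w X Y s0 e 100] assms s0 by auto
  let ?h = "\<lambda>s'. if Q (proj s') then 0 else 1 :: ennreal"
  have "proj (set_reg r (nev X Y s e) s1) = ((fst s)(r := nev X Y s e), snd s)"
    using s1 s0 assms(2) by (auto simp: proj_def fun_eq_iff)
  then show "loss w X Y (te e + 1) ?h (comp (Set r e), s0) \<le> 0"
    using s1(4)[of ?h 1 "[Op Or r 100 100]"] s1(1) assms(3) by (simp add: loss_Op)
qed

lemma R_Put:
  assumes "esafe w X Y s a" "esafe w X Y s e" "Q (fst s, (snd s)(nev X Y s a := nev X Y s e))"
  shows "R w X Y (Put a e) s (te a + te e + 1) 0 Q"
  unfolding R_def
proof (intro allI impI)
  fix s0 assume s0: "proj s0 = s"
  obtain s1 where s1: "regs s1 100 = nev X Y s a" "\<forall>r<100. regs s1 r = regs s0 r" "mem s1 = mem s0"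
    "\<And>K m h. (\<forall>s. h s \<le> 1) \<Longrightarrow> loss w X Y (te a + m) h (cexp 100 a @ K, s0) \<le> loss w X Y m h (K, s1)"
    using cexp_correct[of w X Y s0 a 100] assms s0 by auto
  have p1: "proj s1 = s" using s1 s0 by (auto simp: proj_def)
  obtain s2 where s2: "regs s2 101 = nev X Y s e" "\<forall>r<101. regs s2 r = regs s1 r" "mem s2 = mem s1"
    "\<And>K m h. (\<forall>s. h s \<le> 1) \<Longrightarrow> loss w X Y (te e + m) h (cexp 101 e @ K, s1) \<le> loss w X Y m h (K, s2)"
    using cexp_correct[of w X Y s1 e 101] assms p1 by auto
  let ?h = "\<lambda>s'. if Q (proj s') then 0 else 1 :: ennreal"
  have *: "proj (s2\<lparr>mem := (mem s2)(regs s2 100 := regs s2 101)\<rparr>) = (fst s, (snd s)(nev X Y s a := nev X Y s e))"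
    using s1 s2 s0 by (auto simp: proj_def fun_eq_iff)
  have "loss w X Y (te a + te e + 1) ?h (comp (Put a e), s0) \<le> loss w X Y (te e + 1) ?h (cexp 101 e @ [Store 100 101], s1)"
    using s1(4)[of ?h "te e + 1" "cexp 101 e @ [Store 100 101]"] by (simp add: ac_simps del: loss.simps)
  also have "\<dots> \<le> loss w X Y 1 ?h ([Store 100 101], s2)"
    using s2(4)[of ?h 1] by (simp del: loss.simps)
  also have "\<dots> = 0" using assms(3) * by (simp add: loss_Store)
  finally show "loss w X Y (te a + te e + 1) ?h (comp (Put a e), s0) \<le> 0" .
qed

lemma R_If:
  assumes "esafe w X Y s e" "nev X Y s e \<noteq> 0 \<Longrightarrow> R w X Y a s t d Q" "nev X Y s e = 0 \<Longrightarrow> R w X Y b s t d Q"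
  shows "R w X Y (IfC e a b) s (te e + 1 + t) d Q"
  unfolding R_def
proof (intro allI impI)
  fix s0 assume s0: "proj s0 = s"
  obtain s1 where s1: "regs s1 100 = nev X Y s e" "\<forall>r<100. regs s1 r = regs s0 r" "mem s1 = mem s0"
    "\<And>K m h. (\<forall>s. h s \<le> 1) \<Longrightarrow> loss w X Y (te e + m) h (cexp 100 e @ K, s0) \<le> loss w X Y m h (K, s1)"
    using cexp_correct[of w X Y s0 e 100] assms s0 by auto
  have p1: "proj s1 = s" using s1 s0 by (auto simp: proj_def)
  let ?h = "\<lambda>s'. if Q (proj s') then 0 else 1 :: ennreal"
  have "loss w X Y (te e + 1 + t) ?h (comp (IfC e a b), s0) \<le> loss w X Y (Suc t) ?h ([Cond 100 (comp a) (comp b)], s1)"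
    using s1(4)[of ?h "Suc t"] by (simp del: loss.simps)
  also have "\<dots> = loss w X Y t ?h (if nev X Y s e \<noteq> 0 then comp a else comp b, s1)"
    using s1 by (simp add: loss_Cond del: loss.simps)
  also have "\<dots> \<le> d" using assms(2,3) p1 by (auto simp: R_def)
  finally show "loss w X Y (te e + 1 + t) ?h (comp (IfC e a b), s0) \<le> d" .
qed

text \<open>After a successful test the remaining code is the body, the guard and the loop again,
  which is literally the code of \<open>c ;; While e c\<close>.\<close>

lemma Loop_unroll:
  fixes Q :: "vals \<Rightarrow> bool"
  defines "h \<equiv> \<lambda>s'. if Q (proj s') then 0 else 1 :: ennreal"
  assumes "R w X Y (c ;; While e c) s t d Q" "proj s1 = s" "regs s1 100 \<noteq> 0"
  shows "loss w X Y (Suc t) h ([Loop 100 (comp c @ cexp 100 e)], s1) \<le> d"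
  using assms by (simp add: loss_Loop R_def del: loss.simps)

lemma R_While_True:
  assumes "esafe w X Y s e" "nev X Y s e \<noteq> 0" "R w X Y (c ;; While e c) s t d Q"
  shows "R w X Y (While e c) s (te e + 1 + t) d Q"
  unfolding R_def
proof (intro allI impI)
  fix s0 assume s0: "proj s0 = s"
  obtain s1 where s1: "regs s1 100 = nev X Y s e" "\<forall>r<100. regs s1 r = regs s0 r" "mem s1 = mem s0"
    "\<And>K m h. (\<forall>s. h s \<le> 1) \<Longrightarrow> loss w X Y (te e + m) h (cexp 100 e @ K, s0) \<le> loss w X Y m h (K, s1)"
    using cexp_correct[of w X Y s0 e 100] assms s0 by auto
  have p1: "proj s1 = s" using s1 s0 by (auto simp: proj_def)
  let ?h = "\<lambda>s'. if Q (proj s') then 0 else 1 :: ennreal"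
  have "loss w X Y (te e + 1 + t) ?h (comp (While e c), s0) \<le> loss w X Y (Suc t) ?h ([Loop 100 (comp c @ cexp 100 e)], s1)"
    using s1(4)[of ?h "Suc t"] by (simp del: loss.simps)
  also have "\<dots> \<le> d" using Loop_unroll[OF assms(3) p1] s1 assms(2) by simp
  finally show "loss w X Y (te e + 1 + t) ?h (comp (While e c), s0) \<le> d" .
qed

lemma R_While_False:
  assumes "esafe w X Y s e" "nev X Y s e = 0" "Q s"
  shows "R w X Y (While e c) s (te e + 1) 0 Q"
  unfolding R_def
proof (intro allI impI)
  fix s0 assume s0: "proj s0 = s"
  obtain s1 where s1: "regs s1 100 = nev X Y s e" "\<forall>r<100. regs s1 r = regs s0 r" "mem s1 = mem s0"
    "\<And>K m h. (\<forall>s. h s \<le> 1) \<Longrightarrow> loss w X Y (te e + m) h (cexp 100 e @ K, s0) \<le> loss w X Y m h (K, s1)"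
    using cexp_correct[of w X Y s0 e 100] assms s0 by auto
  have p1: "proj s1 = s" using s1 s0 by (auto simp: proj_def)
  let ?h = "\<lambda>s'. if Q (proj s') then 0 else 1 :: ennreal"
  have "loss w X Y (te e + 1) ?h (comp (While e c), s0) \<le> loss w X Y (Suc 0) ?h ([Loop 100 (comp c @ cexp 100 e)], s1)"
    using s1(4)[of ?h 1] by (simp del: loss.simps)
  also have "\<dots> = 0" using s1 assms p1 by (simp add: loss_Loop)
  finally show "loss w X Y (te e + 1) ?h (comp (While e c), s0) \<le> 0" .
qed

text \<open>The measure bounds the number of iterations, so the time and the failure probability of
  the body are multiplied by its initial bound \<open>n\<close>.\<close>

lemma R_While:
  fixes \<mu> :: "vals \<Rightarrow> nat"
  assumes body: "\<And>s. I s \<Longrightarrow> nev X Y s e \<noteq> 0 \<Longrightarrow> R w X Y c s t d (\<lambda>s'. I s' \<and> \<mu> s' < \<mu> s)"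
    and pos: "\<And>s. I s \<Longrightarrow> nev X Y s e \<noteq> 0 \<Longrightarrow> 0 < \<mu> s"
    and safe: "\<And>s. I s \<Longrightarrow> esafe w X Y s e"
    and init: "I s" "\<mu> s \<le> n"
  shows "R w X Y (While e c) s (n * (t + te e + 1) + te e + 1) (of_nat n * d) (\<lambda>s'. I s' \<and> nev X Y s' e = 0)"
  using init
proof (induction n arbitrary: s)
  case 0
  then have "nev X Y s e = 0" using pos by fastforce
  then show ?case using R_While_False[OF safe] 0 by simp
next
  case (Suc n)
  show ?case
  proof (cases "nev X Y s e = 0")
    case True
    have "R w X Y (While e c) s (te e + 1) 0 (\<lambda>s'. I s' \<and> nev X Y s' e = 0)"
      by (rule R_While_False[OF safe]) (use True Suc in auto)
    then show ?thesis by (rule R_mono) auto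
  next
    case False
    have "R w X Y (c ;; While e c) s (t + (n * (t + te e + 1) + te e + 1)) (d + of_nat n * d) (\<lambda>s'. I s' \<and> nev X Y s' e = 0)"
      by (rule R_Seq[OF body]) (use Suc False in auto)
    from R_While_True[OF safe False this] show ?thesis
      by (rule R_mono) (use Suc in \<open>auto simp: algebra_simps\<close>)
  qed
qed

section \<open>Symbolic execution of straight-line code\<close>

text \<open>A functional semantics for code without loops and randomness; \<open>Rnd\<close> and
  \<open>While\<close> receive a dummy value and are excluded by \<open>bsafe\<close>.\<close>

primrec nexec :: "nat list \<Rightarrow> nat list \<Rightarrow> com \<Rightarrow> vals \<Rightarrow> vals" where
  "nexec X Y (Set r e) s = ((fst s)(r := nev X Y s e), snd s)"
| "nexec X Y (Put a e) s = (fst s, (snd s)(nev X Y s a := nev X Y s e))"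
| "nexec X Y (Rnd r e) s = s"
| "nexec X Y (IfC e a b) s = (if nev X Y s e \<noteq> 0 then nexec X Y a s else nexec X Y b s)"
| "nexec X Y (While e c) s = s"
| "nexec X Y (Seq a b) s = nexec X Y b (nexec X Y a s)"
| "nexec X Y Skip s = s"

primrec bsafe :: "nat \<Rightarrow> nat list \<Rightarrow> nat list \<Rightarrow> com \<Rightarrow> vals \<Rightarrow> bool" where
  "bsafe w X Y (Set r e) s = (r < 100 \<and> esafe w X Y s e)"
| "bsafe w X Y (Put a e) s = (esafe w X Y s a \<and> esafe w X Y s e)"
| "bsafe w X Y (Rnd r e) s = False"
| "bsafe w X Y (IfC e a b) s = (esafe w X Y s e \<and> (if nev X Y s e \<noteq> 0 then bsafe w X Y a s else bsafe w X Y b s))"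
| "bsafe w X Y (While e c) s = False"
| "bsafe w X Y (Seq a b) s = (bsafe w X Y a s \<and> bsafe w X Y b (nexec X Y a s))"
| "bsafe w X Y Skip s = True"

text \<open>Besides bounding straight-line code, this serves as a size measure for arbitrary
  programs, from which the constants of the time bounds are formed; there a loop counts as a single
  pass.\<close>

primrec tc :: "com \<Rightarrow> nat" where
  "tc (Set r e) = te e + 1"
| "tc (Put a e) = te a + te e + 1"
| "tc (Rnd r e) = te e + 1"
| "tc (IfC e a b) = te e + 1 + tc a + tc b"
| "tc (While e c) = te e + 1 + tc c"
| "tc (Seq a b) = tc a + tc b"
| "tc Skip = 0"

lemma R_block:
  assumes "bsafe w X Y c s"
  shows "R w X Y c s (tc c) 0 (\<lambda>s'. s' = nexec X Y c s)"
  using assms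
proof (induction c arbitrary: s)
  case (Set r e)
  then show ?case using R_Set[of w X Y s e r] by auto
next
  case (Put a e)
  then show ?case using R_Put[of w X Y s a e] by auto
next
  case (IfC e a b)
  have "R w X Y (IfC e a b) s (te e + 1 + (tc a + tc b)) 0 (\<lambda>s'. s' = nexec X Y (IfC e a b) s)"
  proof (rule R_If)
    assume "nev X Y s e \<noteq> 0"
    with IfC have "R w X Y a s (tc a) 0 (\<lambda>s'. s' = nexec X Y (IfC e a b) s)" by auto
    then show "R w X Y a s (tc a + tc b) 0 (\<lambda>s'. s' = nexec X Y (IfC e a b) s)" by (rule R_mono) auto
  next
    assume "nev X Y s e = 0"
    with IfC have "R w X Y b s (tc b) 0 (\<lambda>s'. s' = nexec X Y (IfC e a b) s)" by auto
    then show "R w X Y b s (tc a + tc b) 0 (\<lambda>s'. s' = nexec X Y (IfC e a b) s)" by (rule R_mono) auto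
  qed (use IfC in auto)
  then show ?case by (simp add: ac_simps)
next
  case (Seq a b)
  have "R w X Y (Seq a b) s (tc a + tc b) (0 + 0) (\<lambda>s'. s' = nexec X Y (Seq a b) s)"
    by (rule R_Seq[OF Seq.IH(1)]) (use Seq in auto)
  then show ?case by simp
qed (auto intro: R_Skip)

lemma R_block':
  assumes "bsafe w X Y c s" "Q (nexec X Y c s)" "tc c \<le> t"
  shows "R w X Y c s t d Q"
  by (rule R_mono[OF R_block[OF assms(1)]]) (use assms in auto)

lemma R_block_Seq:
  assumes "bsafe w X Y c s" "R w X Y c2 (nexec X Y c s) t d Q"
  shows "R w X Y (c ;; c2) s (tc c + t) d Q"
  using R_Seq[OF R_block[OF assms(1)], of c2 t d Q] assms(2) by simp

text \<open>The failure bound \<open>D v\<close> may depend on the drawn value and only its average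
  matters. The sampling loop relies on this, since certain draws remove the danger of failure
  altogether.\<close>

lemma R_Rnd:
  assumes "esafe w X Y s e" "r < 100" "nev X Y s e = N" "0 < N"
    and c: "\<And>v. v < N \<Longrightarrow> R w X Y c ((fst s)(r := v), snd s) t (D v) Q"
    and D: "(\<Sum>v<N. D v) \<le> of_nat N * d"
  shows "R w X Y (Rnd r e ;; c) s (te e + 1 + t) d Q"
  unfolding R_def
proof (intro allI impI)
  fix s0 assume s0: "proj s0 = s"
  obtain s1 where s1: "regs s1 100 = nev X Y s e" "\<forall>r<100. regs s1 r = regs s0 r" "mem s1 = mem s0"
    "\<And>K m h. (\<forall>s. h s \<le> 1) \<Longrightarrow> loss w X Y (te e + m) h (cexp 100 e @ K, s0) \<le> loss w X Y m h (K, s1)"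
    using cexp_correct[of w X Y s0 e 100] assms s0 by auto
  let ?h = "\<lambda>s'. if Q (proj s') then 0 else 1 :: ennreal"
  have p: "proj (set_reg r v s1) = ((fst s)(r := v), snd s)" for v
    using s1 s0 assms(2) by (auto simp: proj_def fun_eq_iff)
  have "loss w X Y (te e + 1 + t) ?h (comp (Rnd r e ;; c), s0)
      \<le> loss w X Y (Suc t) ?h (Rand r 100 # comp c, s1)"
    using s1(4)[of ?h "Suc t" "Rand r 100 # comp c"] by (simp del: loss.simps)
  also have "\<dots> = (\<integral>\<^sup>+ v. loss w X Y t ?h (comp c, set_reg r v s1) \<partial>measure_pmf (pmf_of_set {..<N}))"
    using s1 assms(3,4) by simp
  also have "\<dots> = (\<Sum>v<N. loss w X Y t ?h (comp c, set_reg r v s1)) / of_nat N"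
    using assms(4) by (subst nn_integral_pmf_of_set) auto
  also have "\<dots> \<le> (\<Sum>v<N. D v) / of_nat N"
    using c p by (intro divide_right_mono_ennreal sum_mono) (auto simp: R_def)
  also have "\<dots> \<le> of_nat N * d / of_nat N"
    by (intro divide_right_mono_ennreal D)
  also have "\<dots> = d"
    using assms(4) by (subst mult.commute) (simp add: ennreal_mult_divide_eq)
  finally show "loss w X Y (te e + 1 + t) ?h (comp (Rnd r e ;; c), s0) \<le> d" .
qed

lemma R_prob:
  assumes "R w X Y c s t (ennreal d) Q" "proj s0 = s" "0 \<le> d"
  shows "measure_pmf.prob (run w X Y t (comp c, s0)) {c'. fst c' = [] \<and> Q (proj (snd c'))} \<ge> 1 - d"
proof -
  let ?M = "measure_pmf (run w X Y t (comp c, s0))"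
  let ?A = "{c'. fst c' = [] \<and> Q (proj (snd c'))}"
  have "emeasure ?M (- ?A) = (\<integral>\<^sup>+ c'. indicator (- ?A) c' \<partial>?M)" by simp
  also have "\<dots> \<le> (\<integral>\<^sup>+ c'. (if fst c' = [] then (if Q (proj (snd c')) then 0 else 1) else 1) \<partial>?M)"
    by (intro nn_integral_mono) (auto simp: indicator_def)
  also have "\<dots> = loss w X Y t (\<lambda>s'. if Q (proj s') then 0 else 1) (comp c, s0)"
    by (simp add: loss_run)
  also have "\<dots> \<le> ennreal d" using assms by (auto simp: R_def)
  finally have "measure_pmf.prob (run w X Y t (comp c, s0)) (- ?A) \<le> d"
    using assms(3) by (simp add: measure_pmf.emeasure_eq_measure)
  moreover have "measure_pmf.prob (run w X Y t (comp c, s0)) (- ?A) = 1 - measure_pmf.prob (run w X Y t (comp c, s0)) ?A"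
    using measure_pmf.prob_compl[of ?A "run w X Y t (comp c, s0)"] by (simp add: Compl_eq_Diff_UNIV)
  ultimately show ?thesis by linarith
qed

section \<open>Alignments grown from the right end\<close>

section \<open>Alignments and edit distance\<close>

text \<open>An alignment is extended at the right end, in step with the prefixes of the dynamic
  program. The number is the cost charged and not the minimum: \<open>align_sub\<close> does not
  exclude equal symbols.\<close>

inductive align :: "nat \<Rightarrow> 'a list \<Rightarrow> 'a list \<Rightarrow> bool" where
  align_Nil: "align 0 [] []"
| align_match: "align i xs ys \<Longrightarrow> align i (xs @ [a]) (ys @ [a])"
| align_sub: "align i xs ys \<Longrightarrow> align (Suc i) (xs @ [a]) (ys @ [b])"
| align_del: "align i xs ys \<Longrightarrow> align (Suc i) (xs @ [a]) ys"
| align_ins: "align i xs ys \<Longrightarrow> align (Suc i) xs (ys @ [b])"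

lemma align_refl: "align 0 xs xs"
  by (induction xs rule: rev_induct) (auto intro: align.intros)

lemma align_length: "align i xs ys \<Longrightarrow> length xs \<le> i + length ys \<and> length ys \<le> i + length xs"
  by (induction rule: align.induct) auto

lemma align_append:
  assumes "align j xs2 ys2" "align i xs1 ys1"
  shows "align (i + j) (xs1 @ xs2) (ys1 @ ys2)"
  using assms
proof (induction rule: align.induct)
  case (align_match j xs ys a)
  then show ?case using align.align_match[of "i + j" "xs1 @ xs" "ys1 @ ys" a] by simp
next
  case (align_sub j xs ys a b)
  then show ?case using align.align_sub[of "i + j" "xs1 @ xs" "ys1 @ ys" a b] by simp
next
  case (align_del j xs ys a)
  then show ?case using align.align_del[of "i + j" "xs1 @ xs" "ys1 @ ys" a] by simp
next
  case (align_ins j xs ys a)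
  then show ?case using align.align_ins[of "i + j" "xs1 @ xs" "ys1 @ ys" a] by simp
qed auto

lemma align_delete_all: "align (length xs) xs []"
  by (induction xs rule: rev_induct) (auto intro: align.intros)

lemma align_single: "align (max 1 (length xs)) xs [b]"
proof (cases xs rule: rev_cases)
  case Nil
  then show ?thesis using align_ins[OF align_Nil, of b] by simp
next
  case (snoc xs' a)
  then show ?thesis using align_sub[OF align_delete_all, of xs' a b] by simp
qed

lemma align_split:
  assumes "align i xs (u @ v)"
  shows "\<exists>i1 i2 xs1 xs2. xs = xs1 @ xs2 \<and> i = i1 + i2 \<and> align i1 xs1 u \<and> align i2 xs2 v"
proof -
  have "align i xs ys \<Longrightarrow> ys = u @ v \<Longrightarrow>
     \<exists>i1 i2 xs1 xs2. xs = xs1 @ xs2 \<and> i = i1 + i2 \<and> align i1 xs1 u \<and> align i2 xs2 v" for ys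
  proof (induction arbitrary: v rule: align.induct)
    case align_Nil
    then show ?case using align.align_Nil by auto
  next
    case (align_match i xs ys a)
    show ?case
    proof (cases v rule: rev_cases)
      case Nil
      then show ?thesis using align.align_match[OF align_match(1), of a] align_match(3) align.align_Nil
        by (intro exI[of _ i] exI[of _ 0] exI[of _ "xs @ [a]"] exI[of _ "[]"]) auto
    next
      case (snoc v' b)
      then obtain i1 i2 xs1 xs2 where "xs = xs1 @ xs2" "i = i1 + i2" "align i1 xs1 u" "align i2 xs2 v'"
        using align_match by auto
      then show ?thesis using snoc align_match(3) align.align_match[of i2 xs2 v' a]
        by (intro exI[of _ i1] exI[of _ i2] exI[of _ xs1] exI[of _ "xs2 @ [a]"]) auto
    qed
  next
    case (align_sub i xs ys a c)
    show ?case
    proof (cases v rule: rev_cases)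
      case Nil
      then show ?thesis using align.align_sub[OF align_sub(1), of a c] align_sub(3) align.align_Nil
        by (intro exI[of _ "Suc i"] exI[of _ 0] exI[of _ "xs @ [a]"] exI[of _ "[]"]) auto
    next
      case (snoc v' b)
      then obtain i1 i2 xs1 xs2 where "xs = xs1 @ xs2" "i = i1 + i2" "align i1 xs1 u" "align i2 xs2 v'"
        using align_sub by auto
      then show ?thesis using snoc align_sub(3) align.align_sub[of i2 xs2 v' a c]
        by (intro exI[of _ i1] exI[of _ "Suc i2"] exI[of _ xs1] exI[of _ "xs2 @ [a]"]) auto
    qed
  next
    case (align_del i xs ys a)
    then obtain i1 i2 xs1 xs2 where "xs = xs1 @ xs2" "i = i1 + i2" "align i1 xs1 u" "align i2 xs2 v"
      by blast
    then show ?case using align.align_del[of i2 xs2 v a]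
      by (intro exI[of _ i1] exI[of _ "Suc i2"] exI[of _ xs1] exI[of _ "xs2 @ [a]"]) auto
  next
    case (align_ins i xs ys c)
    show ?case
    proof (cases v rule: rev_cases)
      case Nil
      then show ?thesis using align.align_ins[OF align_ins(1), of c] align_ins(3) align.align_Nil
        by (intro exI[of _ "Suc i"] exI[of _ 0] exI[of _ xs] exI[of _ "[]"]) auto
    next
      case (snoc v' b)
      then obtain i1 i2 xs1 xs2 where "xs = xs1 @ xs2" "i = i1 + i2" "align i1 xs1 u" "align i2 xs2 v'"
        using align_ins by auto
      then show ?thesis using snoc align_ins(3) align.align_ins[of i2 xs2 v' c]
        by (intro exI[of _ i1] exI[of _ "Suc i2"] exI[of _ xs1] exI[of _ xs2]) auto
    qed
  qed
  then show ?thesis using assms by blast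
qed

text \<open>Cutting the alignment at the edited position isolates the factor of \<open>xs\<close>
  aligned with the edited symbol. A factor aligned with one symbol at cost i has length at most i +
  1, so deleting it or turning it into one other symbol costs at most one more than before.\<close>

lemma align_step:
  assumes "align i xs ys" "(ys, zs) \<in> edit_step"
  shows "\<exists>i'\<le>Suc i. align i' xs zs"
  using assms(2)
proof cases
  case (insertion u v a)
  obtain i1 i2 xs1 xs2 where s: "xs = xs1 @ xs2" "i = i1 + i2" "align i1 xs1 u" "align i2 xs2 v"
    using align_split[of i xs u v] assms(1) insertion by auto
  have "align (Suc i1 + i2) (xs1 @ xs2) ((u @ [a]) @ v)"
    by (intro align_append s align_ins)
  then show ?thesis using s insertion by (intro exI[of _ "Suc i"]) auto
next
  case (deletion u a v)
  obtain i1 i2 xs1 xs2 where s: "xs = xs1 @ xs2" "i = i1 + i2" "align i1 xs1 u" "align i2 xs2 ([a] @ v)"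
    using align_split[of i xs u "a # v"] assms(1) deletion by auto
  obtain i3 i4 xs3 xs4 where t: "xs2 = xs3 @ xs4" "i2 = i3 + i4" "align i3 xs3 [a]" "align i4 xs4 v"
    using align_split[OF s(4)] by blast
  have "align (i1 + (length xs3 + i4)) (xs1 @ xs3 @ xs4) (u @ [] @ v)"
    by (intro align_append s t align_delete_all)
  then show ?thesis using s t deletion align_length[OF t(3)]
    by (intro exI[of _ "i1 + (length xs3 + i4)"]) auto
next
  case (substitution u a v b)
  obtain i1 i2 xs1 xs2 where s: "xs = xs1 @ xs2" "i = i1 + i2" "align i1 xs1 u" "align i2 xs2 ([a] @ v)"
    using align_split[of i xs u "a # v"] assms(1) substitution by auto
  obtain i3 i4 xs3 xs4 where t: "xs2 = xs3 @ xs4" "i2 = i3 + i4" "align i3 xs3 [a]" "align i4 xs4 v"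
    using align_split[OF s(4)] by blast
  have "align (i1 + (max 1 (length xs3) + i4)) (xs1 @ xs3 @ xs4) (u @ [b] @ v)"
    by (intro align_append s t align_single)
  then show ?thesis using s t substitution align_length[OF t(3)]
    by (intro exI[of _ "i1 + (max 1 (length xs3) + i4)"]) auto
qed

lemma relpow_align: "(xs, ys) \<in> edit_step ^^ n \<Longrightarrow> \<exists>i\<le>n. align i xs ys"
proof (induction n arbitrary: ys)
  case 0
  then show ?case using align_refl by auto
next
  case (Suc n)
  then obtain zs where "(xs, zs) \<in> edit_step ^^ n" "(zs, ys) \<in> edit_step" by auto
  with Suc.IH align_step show ?case by (meson Suc_le_mono order_trans)
qed

lemma edit_distance_relpow: "(X, Y) \<in> edit_step ^^ edit_distance X Y"
  unfolding edit_distance_def using edit_distance_exists[of X Y] by (metis LeastI_ex)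

lemma edit_distance_le: "(X, Y) \<in> edit_step ^^ n \<Longrightarrow> edit_distance X Y \<le> n"
  unfolding edit_distance_def by (rule Least_le)

lemma edit_distance_align: "\<exists>i\<le>edit_distance X Y. align i X Y"
  using relpow_align[OF edit_distance_relpow] .

lemma edit_step_append: "(u, v) \<in> edit_step \<Longrightarrow> (u @ zs, v @ zs) \<in> edit_step"
  by (auto elim!: edit_step.cases intro: edit_step.intros)

lemma relpow_edit_append: "(u, v) \<in> edit_step ^^ n \<Longrightarrow> (u @ zs, v @ zs) \<in> edit_step ^^ n"
  by (induction n arbitrary: v) (auto intro: edit_step_append)

lemma edit_step_del_last: "(xs @ [a], xs) \<in> edit_step"
  and edit_step_ins_last: "(xs, xs @ [a]) \<in> edit_step"
  and edit_step_sub_last: "(xs @ [a], xs @ [b]) \<in> edit_step"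
  using edit_step.deletion[of xs a "[]"] edit_step.insertion[of xs "[]" a] edit_step.substitution[of xs a "[]" b] by simp_all

lemma edit_distance_step:
  assumes "(Y, Z) \<in> edit_step"
  shows "edit_distance X Z \<le> Suc (edit_distance X Y)"
  using assms edit_distance_relpow[of X Y] by (intro edit_distance_le) auto

lemma edit_distance_step1:
  assumes "(Z, X) \<in> edit_step"
  shows "edit_distance Z Y \<le> Suc (edit_distance X Y)"
  using assms edit_distance_relpow[of X Y] by (intro edit_distance_le relpow_Suc_I2)

lemma edit_distance_snoc: "edit_distance (X @ [a]) (Y @ [a]) \<le> edit_distance X Y"
  by (intro edit_distance_le relpow_edit_append edit_distance_relpow)

lemma edit_distance_snoc2: "edit_distance (X @ [a]) (Y @ [b]) \<le> Suc (edit_distance X Y)"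
  using edit_distance_step[OF edit_step_sub_last[of Y a b], of "X @ [a]"] edit_distance_snoc[of X a Y] by linarith

lemma edit_distance_trivial: "edit_distance X Y \<le> length X + length Y"
  using relpow_add[of "length X" "length Y" edit_step] edit_step_delete_all[of X] edit_step_insert_all[of Y]
  by (intro edit_distance_le) auto

lemma edit_distance_length: "length X \<le> edit_distance X Y + length Y \<and> length Y \<le> edit_distance X Y + length X"
  using edit_distance_align[of X Y] align_length[of _ X Y] by fastforce

definition pdist :: "'a list \<Rightarrow> 'a list \<Rightarrow> nat \<Rightarrow> nat \<Rightarrow> nat" where
  "pdist X Y x y = edit_distance (take x X) (take y Y)"

lemma take_Suc_cases:
  "x < length X \<and> take (Suc x) X = take x X @ [X ! x] \<or> length X \<le> x \<and> take (Suc x) X = take x X"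
  by (cases "x < length X") (simp_all add: take_Suc_conv_app_nth)

lemma pdist_Suc1: "pdist X Y (Suc x) y \<le> Suc (pdist X Y x y)"
  and pdist_Suc1': "pdist X Y x y \<le> Suc (pdist X Y (Suc x) y)"
  and pdist_Suc2: "pdist X Y x (Suc y) \<le> Suc (pdist X Y x y)"
  and pdist_Suc2': "pdist X Y x y \<le> Suc (pdist X Y x (Suc y))"
  using take_Suc_cases[of x X] take_Suc_cases[of y Y]
    edit_distance_step1[OF edit_step_del_last[of "take x X" "X ! x"], of "take y Y"]
    edit_distance_step1[OF edit_step_ins_last[of "take x X" "X ! x"], of "take y Y"]
    edit_distance_step[OF edit_step_del_last[of "take y Y" "Y ! y"], of "take x X"]
    edit_distance_step[OF edit_step_ins_last[of "take y Y" "Y ! y"], of "take x X"]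
  by (auto simp: pdist_def)

lemma pdist_Suc_Suc: "pdist X Y (Suc x) (Suc y) \<le> Suc (pdist X Y x y)"
  using take_Suc_cases[of x X] take_Suc_cases[of y Y] pdist_Suc1[of X Y x y] pdist_Suc2[of X Y x y]
    edit_distance_snoc2[of "take x X" "X ! x" "take y Y" "Y ! y"]
  by (auto simp: pdist_def)

lemma pdist_match: "x < length X \<Longrightarrow> y < length Y \<Longrightarrow> X ! x = Y ! y \<Longrightarrow> pdist X Y (Suc x) (Suc y) \<le> pdist X Y x y"
  by (simp add: pdist_def take_Suc_conv_app_nth edit_distance_snoc)

lemma pdist_shift: "pdist X Y x (y + d) \<le> pdist X Y x y + d" "pdist X Y x y \<le> pdist X Y x (y + d) + d"
proof (induction d)
  case (Suc d)
  { case 1 then show ?case using Suc(1) pdist_Suc2[of X Y x "y + d"] by simp }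
  { case 2 then show ?case using Suc(2) pdist_Suc2'[of X Y x "y + d"] by simp }
qed auto

lemma pdist_diff: "pdist X Y x y \<le> pdist X Y x y' + (y - y') + (y' - y)"
proof (cases "y \<le> y'")
  case True
  then show ?thesis using pdist_shift(2)[of X Y x y "y' - y"] by simp
next
  case False
  then show ?thesis using pdist_shift(1)[of X Y x y' "y - y'"] by simp
qed

lemma pdist_close: "y - y' \<le> c \<Longrightarrow> y' - y \<le> c \<Longrightarrow> pdist X Y x y \<le> pdist X Y x y' + c"
  using pdist_diff[of X Y x y y'] by (cases "y \<le> y'") auto

section \<open>The alignment grid in diagonal coordinates\<close>

section \<open>Padded strings and diagonals\<close>

text \<open>Both strings are extended to infinite ones by padding symbols that match nothing, and the
  second one is shifted by \<open>k\<close>, so that the diagonals \<open>-k, \<dots>, k\<close> become \<open>0, \<dots>, 2k\<close>.\<close>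

definition padX :: "nat list \<Rightarrow> nat \<Rightarrow> nat \<times> nat" where
  "padX X v = (if v < length X then (2, X ! v) else (0, 0))"

definition padY :: "nat list \<Rightarrow> nat \<Rightarrow> nat \<Rightarrow> nat \<times> nat" where
  "padY Y k v = (if k \<le> v \<and> v - k < length Y then (2, Y ! (v - k)) else (1, 0))"

text \<open>Truncated subtraction sends points left of the grid to column 0, and \<open>take\<close>
  sends points beyond the end to the full string, so every diagonal can be treated alike.\<close>

definition ddist :: "nat list \<Rightarrow> nat list \<Rightarrow> nat \<Rightarrow> nat \<Rightarrow> nat \<Rightarrow> nat" where
  "ddist X Y k x j = pdist X Y x (x + j - k)"

definition exact :: "(nat \<Rightarrow> 'c) \<Rightarrow> (nat \<Rightarrow> 'c) \<Rightarrow> nat \<Rightarrow> nat \<Rightarrow> nat \<Rightarrow> bool" where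
  "exact x y s e j \<longleftrightarrow> (\<forall>v. s \<le> v \<longrightarrow> v < e \<longrightarrow> x v = y (v + j))"

definition mism :: "(nat \<Rightarrow> 'c) \<Rightarrow> (nat \<Rightarrow> 'c) \<Rightarrow> nat \<Rightarrow> nat \<Rightarrow> nat \<Rightarrow> nat" where
  "mism x y s e j = card {v. s \<le> v \<and> v < e \<and> x v \<noteq> y (v + j)}"

lemma mism_Suc: "s \<le> e \<Longrightarrow> mism x y s (Suc e) j = mism x y s e j + of_bool (x e \<noteq> y (e + j))"
proof -
  assume "s \<le> e"
  then have "{v. s \<le> v \<and> v < Suc e \<and> x v \<noteq> y (v + j)} =
     {v. s \<le> v \<and> v < e \<and> x v \<noteq> y (v + j)} \<union> (if x e \<noteq> y (e + j) then {e} else {})"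
    by (auto simp: less_Suc_eq)
  then show ?thesis by (auto simp: mism_def)
qed

lemma mism_self [simp]: "mism x y s s j = 0" by (auto simp: mism_def)

lemma mism_mono: "e \<le> e' \<Longrightarrow> mism x y s e j \<le> mism x y s e' j"
proof -
  assume "e \<le> e'"
  then have "{v. s \<le> v \<and> v < e \<and> x v \<noteq> y (v + j)} \<subseteq> {v. s \<le> v \<and> v < e' \<and> x v \<noteq> y (v + j)}" by auto
  then show ?thesis unfolding mism_def by (rule card_mono[rotated]) simp
qed

lemma mism_split: "s \<le> b \<Longrightarrow> b \<le> e \<Longrightarrow> mism x y s e j = mism x y s b j + mism x y b e j"
proof -
  assume "s \<le> b" "b \<le> e"
  then have "{v. s \<le> v \<and> v < e \<and> x v \<noteq> y (v + j)} =
    {v. s \<le> v \<and> v < b \<and> x v \<noteq> y (v + j)} \<union> {v. b \<le> v \<and> v < e \<and> x v \<noteq> y (v + j)}" by auto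
  moreover have "{v. s \<le> v \<and> v < b \<and> x v \<noteq> y (v + j)} \<inter> {v. b \<le> v \<and> v < e \<and> x v \<noteq> y (v + j)} = {}" by auto
  ultimately show ?thesis unfolding mism_def
    by (simp add: card_Un_disjoint)
qed

lemma mism_exact: "exact x y s e j \<Longrightarrow> mism x y s e j = 0"
  by (auto simp: mism_def exact_def)

lemma exact_sub: "exact x y s e j \<Longrightarrow> s \<le> s' \<Longrightarrow> e' \<le> e \<Longrightarrow> exact x y s' e' j"
  by (auto simp: exact_def)

lemma exact_padX: "exact (padX X) (padY Y k) s e j \<Longrightarrow> s < e \<Longrightarrow> e \<le> length X"
proof (rule ccontr)
  assume *: "exact (padX X) (padY Y k) s e j" "s < e" "\<not> e \<le> length X"
  then have "padX X (e - 1) = padY Y k (e - 1 + j)" by (auto simp: exact_def)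
  then show False using * by (auto simp: padX_def padY_def split: if_splits)
qed

lemma ddist_Suc: "ddist X Y k (Suc x) j \<le> ddist X Y k x j + of_bool (padX X x \<noteq> padY Y k (x + j))"
proof (cases "padX X x = padY Y k (x + j)")
  case True
  then have *: "x < length X" "k \<le> x + j" "x + j - k < length Y" "X ! x = Y ! (x + j - k)"
    by (auto simp: padX_def padY_def split: if_splits)
  then show ?thesis using pdist_match[of x X "x + j - k" Y] True by (simp add: ddist_def Suc_diff_le)
next
  case False
  show ?thesis
  proof (cases "k \<le> x + j")
    case True
    then show ?thesis using False pdist_Suc_Suc[of X Y x "x + j - k"] by (simp add: ddist_def Suc_diff_le)
  next
    case *: False
    then show ?thesis using False pdist_Suc1[of X Y x 0] by (simp add: ddist_def)
  qed
qed

lemma ddist_mism: "s \<le> e \<Longrightarrow> ddist X Y k e j \<le> ddist X Y k s j + mism (padX X) (padY Y k) s e j"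
proof (induction e rule: dec_induct)
  case (step e)
  then show ?case using ddist_Suc[of X Y k e j] by (simp add: mism_Suc)
qed simp

text \<open>Separates the final run of matches from the edit before it. This is one round of the
  greedy recursion read backwards: an edit followed by a slide along a diagonal.\<close>

lemma align_last_edit:
  assumes "align i xs ys" "xs = take x X" "ys = take y Y" "x \<le> length X" "y \<le> length Y"
  shows "\<exists>x0 y0. x0 \<le> x \<and> y0 \<le> y \<and> x - x0 = y - y0 \<and> (\<forall>u<x - x0. X ! (x0 + u) = Y ! (y0 + u)) \<and>
    (i = 0 \<and> x0 = 0 \<and> y0 = 0 \<or>
     (\<exists>i' x1 y1. i = Suc i' \<and> align i' (take x1 X) (take y1 Y) \<and>
       (x0 = Suc x1 \<and> y0 = Suc y1 \<or> x0 = Suc x1 \<and> y0 = y1 \<or> x0 = x1 \<and> y0 = Suc y1)))"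
proof -
  have snoc: "\<exists>x'. x = Suc x' \<and> zs = take x' Z \<and> a = Z ! x' \<and> x' < length Z"
    if "zs @ [a] = take x Z" "x \<le> length Z" for zs x and a :: 'a and Z
  proof -
    have "length (zs @ [a]) = x" using that by simp
    then have x: "x = Suc (length zs)" by simp
    then have "zs @ [a] = take (length zs) Z @ [Z ! length zs]"
      using that by (simp add: take_Suc_conv_app_nth)
    then show ?thesis using x that by auto
  qed
  show ?thesis using assms
  proof (induction arbitrary: x y rule: align.induct)
    case align_Nil
    then show ?case by (intro exI[of _ 0]) auto
  next
    case (align_match i xs ys a)
    obtain x' where x': "x = Suc x'" "xs = take x' X" "a = X ! x'" "x' < length X"
      using snoc[OF align_match(3,5)] by blast
    obtain y' where y': "y = Suc y'" "ys = take y' Y" "a = Y ! y'" "y' < length Y"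
      using snoc[OF align_match(4,6)] by blast
    from align_match.IH[OF x'(2) y'(2) less_imp_le[OF x'(4)] less_imp_le[OF y'(4)]] obtain x0 y0 where
      *: "x0 \<le> x'" "y0 \<le> y'" "x' - x0 = y' - y0" "\<forall>u<x' - x0. X ! (x0 + u) = Y ! (y0 + u)"
      "(i = 0 \<and> x0 = 0 \<and> y0 = 0 \<or>
     (\<exists>i' x1 y1. i = Suc i' \<and> align i' (take x1 X) (take y1 Y) \<and>
       (x0 = Suc x1 \<and> y0 = Suc y1 \<or> x0 = Suc x1 \<and> y0 = y1 \<or> x0 = x1 \<and> y0 = Suc y1)))" by blast
    have "X ! (x0 + u) = Y ! (y0 + u)" if "u < x - x0" for u
    proof (cases "u < x' - x0")
      case False
      then have "x0 + u = x'" "y0 + u = y'" using that * x' by auto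
      then show ?thesis using x' y' by simp
    qed (use * in auto)
    then show ?case using * x' y' by (intro exI[of _ x0] exI[of _ y0]) auto
  next
    case (align_sub i xs ys a b)
    obtain x' where "x = Suc x'" "xs = take x' X" using snoc[OF align_sub(3,5)] by blast
    moreover obtain y' where "y = Suc y'" "ys = take y' Y" using snoc[OF align_sub(4,6)] by blast
    ultimately show ?case using align_sub by (intro exI[of _ x] exI[of _ y]) auto
  next
    case (align_del i xs ys a)
    obtain x' where "x = Suc x'" "xs = take x' X" using snoc[OF align_del(3,5)] by blast
    then show ?case using align_del by (intro exI[of _ x] exI[of _ y]) auto
  next
    case (align_ins i xs ys b)
    obtain y' where "y = Suc y'" "ys = take y' Y" using snoc[OF align_ins(4,6)] by blast
    then show ?case using align_ins by (intro exI[of _ x] exI[of _ y]) auto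
  qed
qed

section \<open>Greedy dynamic programming over groups of diagonals\<close>

text \<open>A table entry \<open>Suc x\<close> for group \<open>g\<close> records that row \<open>x\<close> is reached on some diagonal of the
  group; the entry \<open>0\<close> means that the group is not reached.\<close>

definition reach_complete :: "nat list \<Rightarrow> nat list \<Rightarrow> nat \<Rightarrow> nat \<Rightarrow> nat \<Rightarrow> (nat \<Rightarrow> nat) \<Rightarrow> bool" where
  "reach_complete X Y k al i d \<longleftrightarrow> (\<forall>i' x y. i' \<le> i \<longrightarrow> x \<le> length X \<longrightarrow> y \<le> length Y \<longrightarrow>
     align i' (take x X) (take y Y) \<longrightarrow> Suc x \<le> d ((y + k - x) div al))"

text \<open>Each round pays 1 for the edit, at most 2 (al - 1) for changing the diagonal within or
  between groups, and al - 1 for overlooked mismatches; the initial round pays only 2 (al - 1). The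
  last al - 1 of the bound in the theorem is spent in \<open>reach_final\<close>.\<close>

definition reach_sound :: "nat list \<Rightarrow> nat list \<Rightarrow> nat \<Rightarrow> nat \<Rightarrow> nat \<Rightarrow> (nat \<Rightarrow> nat) \<Rightarrow> bool" where
  "reach_sound X Y k al i d \<longleftrightarrow> (\<forall>g. d g \<noteq> 0 \<longrightarrow> d g \<le> Suc (length X) \<and>
     (\<exists>j. j div al = g \<and> ddist X Y k (d g - 1) j \<le> i + (3 * i + 2) * (al - 1)))"

text \<open>The specification of an approximate longest common extension: complete for exact
  matches, sound only up to al - 1 mismatches. The gap between the two is what sampling
  needs.\<close>

definition lce_ok :: "nat list \<Rightarrow> nat list \<Rightarrow> nat \<Rightarrow> nat \<Rightarrow> nat \<Rightarrow> nat \<Rightarrow> nat \<Rightarrow> bool" where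
  "lce_ok X Y k al s g e \<longleftrightarrow> s \<le> e \<and> e \<le> length X \<and>
     (\<forall>j e'. j div al = g \<longrightarrow> s \<le> e' \<longrightarrow> e' \<le> length X \<longrightarrow> exact (padX X) (padY Y k) s e' j \<longrightarrow> e' \<le> e) \<and>
     (\<exists>j. j div al = g \<and> mism (padX X) (padY Y k) s e j \<le> al - 1)"

text \<open>The candidates are an edit inside the group, a deletion coming from the next group and
  an insertion coming from the previous one. Entries and result are shifted by one; a deletion
  advances the row, an insertion does not.\<close>

definition next_start :: "(nat \<Rightarrow> nat) \<Rightarrow> nat \<Rightarrow> nat" where
  "next_start d g = Max {if d g = 0 then 0 else Suc (d g), if d (Suc g) = 0 then 0 else Suc (d (Suc g)),
     if g = 0 then 0 else d (g - 1)}"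

lemma same_group:
  fixes j j' al :: nat assumes "0 < al" "j div al = j' div al" shows "j - j' \<le> al - 1"
proof -
  have "j div al * al + j mod al = j" "j' div al * al + j' mod al = j'"
    by (rule div_mult_mod_eq)+
  then have "j' div al * al + j mod al = j" "j' div al * al + j' mod al = j'"
    using assms(2) by simp_all
  moreover have "j mod al < al" using assms(1) by simp
  ultimately show ?thesis by linarith
qed

lemma next_group:
  fixes j j' al :: nat assumes "0 < al" "j div al = Suc (j' div al)" shows "j' < j" "j - j' \<le> 2 * al - 1"
proof -
  have "j div al * al + j mod al = j" "j' div al * al + j' mod al = j'"
    by (rule div_mult_mod_eq)+
  then have "j' div al * al + al + j mod al = j" "j' div al * al + j' mod al = j'"
    using assms(2) by simp_all
  moreover have "j mod al < al" "j' mod al < al" using assms(1) by simp_all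
  ultimately show "j' < j" "j - j' \<le> 2 * al - 1" by linarith+
qed

lemma exact_of_nth:
  assumes "x0 \<le> x" "x \<le> length X" "y0 \<le> y" "y \<le> length Y" "x - x0 = y - y0" "x \<le> y + k"
    "\<forall>u<x - x0. X ! (x0 + u) = Y ! (y0 + u)"
  shows "exact (padX X) (padY Y k) x0 x (y + k - x)"
  unfolding exact_def
proof (intro allI impI)
  fix v assume v: "x0 \<le> v" "v < x"
  have "v + (y + k - x) - k = y0 + (v - x0)" "k \<le> v + (y + k - x)" "v + (y + k - x) - k < length Y"
    using assms v by auto
  moreover have "X ! (x0 + (v - x0)) = Y ! (y0 + (v - x0))" using assms v by (metis diff_less_mono)
  then have "X ! v = Y ! (y0 + (v - x0))" using v by simp
  ultimately show "padX X v = padY Y k (v + (y + k - x))"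
    using assms v by (simp add: padX_def padY_def)
qed

lemma reach_init:
  assumes "0 < al" "lce_ok X Y k al 0 (k div al) e" "d = (\<lambda>g. if g = k div al then Suc e else 0)"
  shows "reach_complete X Y k al 0 d" "reach_sound X Y k al 0 d"
proof -
  show "reach_complete X Y k al 0 d"
    unfolding reach_complete_def
  proof (intro allI impI)
    fix i' x y :: nat assume *: "i' \<le> 0" "x \<le> length X" "y \<le> length Y" "align i' (take x X) (take y Y)"
    from align_last_edit[OF *(4) refl refl *(2,3)] *(1) have
      xy: "x = y" "\<forall>u<x. X ! u = Y ! u" by auto
    have "exact (padX X) (padY Y k) 0 x (y + k - x)"
      using exact_of_nth[of 0 x X 0 y Y k] xy * by auto
    then have "x \<le> e" using assms(2) * xy unfolding lce_ok_def by auto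
    then show "Suc x \<le> d ((y + k - x) div al)" using assms xy by simp
  qed
  obtain j where j: "j div al = k div al" "mism (padX X) (padY Y k) 0 e j \<le> al - 1" "e \<le> length X"
    using assms(2) by (auto simp: lce_ok_def)
  have "ddist X Y k 0 j \<le> al - 1"
    using pdist_diff[of X Y 0 "j - k" 0] same_group[OF assms(1) j(1)] edit_distance_le[of "[] :: nat list" "[]" 0]
    by (simp add: ddist_def pdist_def)
  then have "ddist X Y k e j \<le> 2 * (al - 1)" using ddist_mism[of 0 e X Y k j] j by linarith
  then show "reach_sound X Y k al 0 d" using j assms by (auto simp: reach_sound_def)
qed

text \<open>All cases pay 1 + c. Where the diagonal changes by up to c + 1, one of the unit moves is
  the edit itself. The first case arises when the row is clamped at the end of
  \<open>X\<close>.\<close>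

lemma ddist_switch:
  assumes "s = x1 \<and> x1 = length X \<and> j - j1 \<le> Suc c \<and> j1 - j \<le> Suc c \<or> s = x1 \<and> j1 < j \<and> j - j1 \<le> Suc c
     \<or> s = Suc x1 \<and> j - j1 \<le> c \<and> j1 - j \<le> c \<or> s = Suc x1 \<and> j < j1 \<and> j1 - j \<le> Suc c"
  shows "ddist X Y k s j \<le> ddist X Y k x1 j1 + 1 + c"
  using assms
proof (elim disjE conjE)
  assume *: "s = x1" "j - j1 \<le> Suc c" "j1 - j \<le> Suc c"
  then show ?thesis using pdist_close[of "x1 + j - k" "x1 + j1 - k" "Suc c" X Y x1] unfolding ddist_def by auto
next
  assume *: "s = x1" "j1 < j" "j - j1 \<le> Suc c"
  then show ?thesis using pdist_close[of "x1 + j - k" "x1 + j1 - k" "Suc c" X Y x1] unfolding ddist_def by auto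
next
  assume *: "s = Suc x1" "j - j1 \<le> c" "j1 - j \<le> c"
  have "ddist X Y k s j1 \<le> ddist X Y k x1 j1 + 1" using ddist_Suc[of X Y k x1 j1] *
    by (cases "padX X x1 = padY Y k (x1 + j1)") auto
  moreover have "ddist X Y k s j \<le> ddist X Y k s j1 + c"
    using pdist_close[of "s + j - k" "s + j1 - k" c X Y s] * unfolding ddist_def by auto
  ultimately show ?thesis by simp
next
  assume *: "s = Suc x1" "j < j1" "j1 - j \<le> Suc c"
  have "ddist X Y k s j \<le> pdist X Y x1 (s + j - k) + 1" using pdist_Suc1[of X Y x1 "s + j - k"] * by (simp add: ddist_def)
  moreover have "pdist X Y x1 (s + j - k) \<le> ddist X Y k x1 j1 + c"
    using pdist_close[of "s + j - k" "x1 + j1 - k" c X Y x1] * unfolding ddist_def by auto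
  ultimately show ?thesis by simp
qed

text \<open>Completeness is the greedy argument: an exact run restricts to a run from any later row
  of the same diagonal, so starting the extension as far down as possible loses nothing. Soundness
  adds the price of the switch and of the extension.\<close>

lemma reach_step:
  assumes "0 < al" "Suc i \<le> k"
    and comp: "reach_complete X Y k al i d" and sound: "reach_sound X Y k al i d"
    and GN: "2 * k div al < GN" and d0: "\<And>g. GN \<le> g \<Longrightarrow> d g = 0"
    and lce: "\<And>g. g < GN \<Longrightarrow> next_start d g \<noteq> 0 \<Longrightarrow> lce_ok X Y k al (min (next_start d g - 1) (length X)) g (d' g - 1) \<and> d' g \<noteq> 0"
    and z: "\<And>g. g < GN \<Longrightarrow> next_start d g = 0 \<Longrightarrow> d' g = 0"
    and d'0: "\<And>g. GN \<le> g \<Longrightarrow> d' g = 0"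
  shows "reach_complete X Y k al (Suc i) d'" "reach_sound X Y k al (Suc i) d'"
proof -
  have ge1: "d g \<noteq> 0 \<Longrightarrow> Suc (d g) \<le> next_start d g" for g by (auto simp: next_start_def)
  have ge2: "d (Suc g) \<noteq> 0 \<Longrightarrow> Suc (d (Suc g)) \<le> next_start d g" for g by (auto simp: next_start_def)
  have ge3: "d g \<le> next_start d (Suc g)" for g by (auto simp: next_start_def)
  have grp: "(y + k - x) div al < GN" if "align i' (take x X) (take y Y)" "i' \<le> k" "x \<le> length X" "y \<le> length Y" for i' x y
  proof -
    have "y \<le> i' + x" using align_length[OF that(1)] that by simp
    then have "y + k - x \<le> 2 * k" using that(2) by linarith
    then show ?thesis using GN div_le_mono[of "y + k - x" "2 * k" al] by linarith
  qed
  have key: "Suc x \<le> d' g" if "g < GN" "next_start d g \<noteq> 0" "x0 < next_start d g" "x0 \<le> x" "x \<le> length X"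
     "g = j div al" "exact (padX X) (padY Y k) x0 x j" for g x x0 j
  proof -
    let ?s = "min (next_start d g - 1) (length X)"
    note l = lce[OF that(1,2)]
    have s: "?s \<le> d' g - 1" using l by (auto simp: lce_ok_def)
    have "x \<le> d' g - 1"
    proof (cases "?s \<le> x")
      case True
      have "exact (padX X) (padY Y k) ?s x j"
        using exact_sub[OF that(7)] that by auto
      then show ?thesis using l True that by (auto simp: lce_ok_def)
    qed (use s in linarith)
    then show ?thesis using l by linarith
  qed
  show "reach_complete X Y k al (Suc i) d'"
    unfolding reach_complete_def
  proof (intro allI impI)
    fix i' x y assume *: "i' \<le> Suc i" "x \<le> length X" "y \<le> length Y" and a: "align i' (take x X) (take y Y)"
    have xy: "x \<le> y + i'" "y \<le> x + i'" using align_length[OF a] * by simp_all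
    obtain x0 y0 where
      0: "x0 \<le> x" "y0 \<le> y" "x - x0 = y - y0" "\<forall>u<x - x0. X ! (x0 + u) = Y ! (y0 + u)"
      "(i' = 0 \<and> x0 = 0 \<and> y0 = 0 \<or>
     (\<exists>i'' x1 y1. i' = Suc i'' \<and> align i'' (take x1 X) (take y1 Y) \<and>
       (x0 = Suc x1 \<and> y0 = Suc y1 \<or> x0 = Suc x1 \<and> y0 = y1 \<or> x0 = x1 \<and> y0 = Suc y1)))" using align_last_edit[OF a refl refl *(2,3)] by blast
    let ?j = "y + k - x"
    have ex: "exact (padX X) (padY Y k) x0 x ?j"
      using exact_of_nth[of x0 x X y0 y Y k] 0 * xy assms(2) by auto
    have j0: "?j = y0 + k - x0" using 0 xy * assms(2) by auto
    show "Suc x \<le> d' (?j div al)"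
    proof (cases "i' = 0")
      case True
      then have "Suc x \<le> d (?j div al)" using comp a * by (auto simp: reach_complete_def)
      then show ?thesis
        using key[of "?j div al" x x ?j] ge1[of "?j div al"] grp[OF a] * assms(2) by (auto simp: exact_def)
    next
      case False
      then obtain i'' x1 y1 where 1: "i' = Suc i''" "align i'' (take x1 X) (take y1 Y)"
         "x0 = Suc x1 \<and> y0 = Suc y1 \<or> x0 = Suc x1 \<and> y0 = y1 \<or> x0 = x1 \<and> y0 = Suc y1" using 0 by auto
      have l1: "x1 \<le> length X" "y1 \<le> length Y" using 0 1 * by auto
      have c1: "Suc x1 \<le> d ((y1 + k - x1) div al)"
        using comp 1 l1 * by (auto simp: reach_complete_def)
      have xy1: "x1 \<le> y1 + k" using align_length[OF 1(2)] l1 1 * assms(2) by auto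
      have "x0 < next_start d (?j div al)"
      proof (cases "?j div al = (y1 + k - x1) div al")
        case True
        then show ?thesis using ge1[of "?j div al"] c1 1 by auto
      next
        case False
        \<comment> \<open>A substitution keeps the diagonal. A change of group therefore comes from
          an insertion or a deletion, which moves to an adjacent diagonal and hence to a
          neighbouring group.\<close>
        then have "\<not> (x0 = Suc x1 \<and> y0 = Suc y1)" using j0 xy1 by auto
        with 1 consider "x0 = Suc x1" "y0 = y1" | "x0 = x1" "y0 = Suc y1" by auto
        then show ?thesis
        proof cases
          case 1
          then have e: "y1 + k - x1 = Suc ?j" using j0 xy1 xy 0 * assms(2) by auto
          then have "Suc ?j div al = Suc (?j div al)" using False by (auto simp: div_Suc split: if_splits)
          then show ?thesis using ge2[of "?j div al"] c1 e 1 by auto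
        next
          case 2
          then have e: "?j = Suc (y1 + k - x1)" using j0 xy1 by auto
          then have "?j div al = Suc ((y1 + k - x1) div al)" using False by (auto simp: div_Suc split: if_splits)
          then show ?thesis using ge3[of "(y1 + k - x1) div al"] c1 2 by auto
        qed
      qed
      then show ?thesis
        using key[of "?j div al" x0 x ?j] grp[OF a] ex 0 * assms(2) by auto
    qed
  qed
  show "reach_sound X Y k al (Suc i) d'"
    unfolding reach_sound_def
  proof (intro allI impI)
    fix g assume g: "d' g \<noteq> 0"
    then have gN: "g < GN" using d'0 by (meson not_le)
    then have ns: "next_start d g \<noteq> 0" using z[OF gN] g by auto
    define s where "s = min (next_start d g - 1) (length X)"
    from lce[OF gN ns] obtain j where j: "j div al = g" "mism (padX X) (padY Y k) s (d' g - 1) j \<le> al - 1"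
      "s \<le> d' g - 1" "d' g - 1 \<le> length X" by (auto simp: lce_ok_def s_def)
    have "next_start d g \<in> {if d g = 0 then 0 else Suc (d g), if d (Suc g) = 0 then 0 else Suc (d (Suc g)),
     if g = 0 then 0 else d (g - 1)}" unfolding next_start_def by (rule Max_in) auto
    with ns consider (a) "d g \<noteq> 0" "next_start d g = Suc (d g)" | (b) "d (Suc g) \<noteq> 0" "next_start d g = Suc (d (Suc g))"
      | (c) "g \<noteq> 0" "d (g - 1) \<noteq> 0" "next_start d g = d (g - 1)" by (auto split: if_splits)
    \<comment> \<open>Diagonals of neighbouring groups differ by at most 2 al - 1 = 1 + 2 (al - 1),
      where the 1 is the edit.\<close>
    then have "ddist X Y k s j \<le> (i + (3 * i + 2) * (al - 1)) + 1 + 2 * (al - 1)"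
    proof cases
      case a
      then obtain j1 where j1: "j1 div al = g" "ddist X Y k (d g - 1) j1 \<le> i + (3 * i + 2) * (al - 1)" "d g \<le> Suc (length X)"
        using sound by (auto simp: reach_sound_def)
      have "ddist X Y k s j \<le> ddist X Y k (d g - 1) j1 + 1 + 2 * (al - 1)"
      proof (rule ddist_switch)
        have "j - j1 \<le> al - 1" "j1 - j \<le> al - 1" using same_group[OF assms(1), of j j1] same_group[OF assms(1), of j1 j] j j1 by auto
        then show "s = d g - 1 \<and> d g - 1 = length X \<and> j - j1 \<le> Suc (2 * (al - 1)) \<and> j1 - j \<le> Suc (2 * (al - 1)) \<or> s = d g - 1 \<and> j1 < j \<and> j - j1 \<le> Suc (2 * (al - 1))
          \<or> s = Suc (d g - 1) \<and> j - j1 \<le> 2 * (al - 1) \<and> j1 - j \<le> 2 * (al - 1) \<or> s = Suc (d g - 1) \<and> j < j1 \<and> j1 - j \<le> Suc (2 * (al - 1))"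
          using a j1 by (auto simp: s_def min_def)
      qed
      then show ?thesis using j1 by linarith
    next
      case b
      then obtain j1 where j1: "j1 div al = Suc g" "ddist X Y k (d (Suc g) - 1) j1 \<le> i + (3 * i + 2) * (al - 1)" "d (Suc g) \<le> Suc (length X)"
        using sound by (auto simp: reach_sound_def)
      have "ddist X Y k s j \<le> ddist X Y k (d (Suc g) - 1) j1 + 1 + 2 * (al - 1)"
      proof (rule ddist_switch)
        have "j < j1" "j1 - j \<le> 2 * al - 1" using next_group[OF assms(1), of j1 j] j j1 by auto
        then show "s = d (Suc g) - 1 \<and> d (Suc g) - 1 = length X \<and> j - j1 \<le> Suc (2 * (al - 1)) \<and> j1 - j \<le> Suc (2 * (al - 1)) \<or> s = d (Suc g) - 1 \<and> j1 < j \<and> j - j1 \<le> Suc (2 * (al - 1))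
          \<or> s = Suc (d (Suc g) - 1) \<and> j - j1 \<le> 2 * (al - 1) \<and> j1 - j \<le> 2 * (al - 1) \<or> s = Suc (d (Suc g) - 1) \<and> j < j1 \<and> j1 - j \<le> Suc (2 * (al - 1))"
          using b j1 by (auto simp: s_def min_def)
      qed
      then show ?thesis using j1 by linarith
    next
      case c
      then obtain j1 where j1: "j1 div al = g - 1" "ddist X Y k (d (g - 1) - 1) j1 \<le> i + (3 * i + 2) * (al - 1)" "d (g - 1) \<le> Suc (length X)"
        using sound by (auto simp: reach_sound_def)
      have "ddist X Y k s j \<le> ddist X Y k (d (g - 1) - 1) j1 + 1 + 2 * (al - 1)"
      proof (rule ddist_switch)
        have "j1 < j" "j - j1 \<le> 2 * al - 1" using next_group[OF assms(1), of j j1] j j1 c by auto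
        moreover have "s = d (g - 1) - 1" unfolding s_def c(3) using j1(3) by linarith
        ultimately show "s = d (g - 1) - 1 \<and> d (g - 1) - 1 = length X \<and> j - j1 \<le> Suc (2 * (al - 1)) \<and> j1 - j \<le> Suc (2 * (al - 1)) \<or> s = d (g - 1) - 1 \<and> j1 < j \<and> j - j1 \<le> Suc (2 * (al - 1))
          \<or> s = Suc (d (g - 1) - 1) \<and> j - j1 \<le> 2 * (al - 1) \<and> j1 - j \<le> 2 * (al - 1) \<or> s = Suc (d (g - 1) - 1) \<and> j < j1 \<and> j1 - j \<le> Suc (2 * (al - 1))"
          by auto
      qed
      then show ?thesis using j1 by linarith
    qed
    then have "ddist X Y k (d' g - 1) j \<le> (i + (3 * i + 2) * (al - 1)) + 1 + 2 * (al - 1) + (al - 1)"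
      using ddist_mism[OF j(3), of X Y k j] j by linarith
    also have "\<dots> = Suc i + (3 * Suc i + 2) * (al - 1)" by (simp add: algebra_simps)
    finally show "d' g \<le> Suc (length X) \<and> (\<exists>j. j div al = g \<and> ddist X Y k (d' g - 1) j \<le> Suc i + (3 * Suc i + 2) * (al - 1))"
      using j g by (intro conjI exI[of _ j]) auto
  qed
qed

text \<open>Only the group of the end point is recorded, so soundness pays al - 1 once more to reach
  the diagonal of the end point itself.\<close>

lemma reach_final:
  assumes "0 < al" "reach_complete X Y k al k d" "reach_sound X Y k al k d" "length X \<le> length Y + k" "length Y \<le> length X + k"
  defines "g \<equiv> (length Y + k - length X) div al"
  shows "edit_distance X Y \<le> k \<Longrightarrow> d g = Suc (length X)"
    "d g = Suc (length X) \<Longrightarrow> edit_distance X Y \<le> k + 3 * (k + 1) * (al - 1)"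
proof -
  assume "edit_distance X Y \<le> k"
  then obtain i where "i \<le> k" "align i (take (length X) X) (take (length Y) Y)"
    using edit_distance_align[of X Y] by (metis le_trans order_refl take_all)
  then have "Suc (length X) \<le> d g" using assms(2) unfolding reach_complete_def g_def by blast
  then show "d g = Suc (length X)" using assms(3) unfolding reach_sound_def by (metis le_antisym not_less_eq_eq zero_le)
next
  assume "d g = Suc (length X)"
  then obtain j where j: "j div al = g" "ddist X Y k (length X) j \<le> k + (3 * k + 2) * (al - 1)"
    using assms(3) unfolding reach_sound_def by (metis diff_Suc_1 nat.simps(3))
  let ?j = "length Y + k - length X"
  have "j - ?j \<le> al - 1" "?j - j \<le> al - 1"
    using same_group[OF assms(1), of j ?j] same_group[OF assms(1), of ?j j] j by (simp_all add: g_def)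
  moreover have "?j \<le> j \<or> j \<le> ?j" by linarith
  ultimately have "pdist X Y (length X) (length Y) \<le> ddist X Y k (length X) j + (al - 1)"
    using pdist_close[of "length Y" "length X + j - k" "al - 1" X Y "length X"] assms(4) unfolding ddist_def by linarith
  also have "\<dots> \<le> k + (3 * k + 2) * (al - 1) + (al - 1)" using j by simp
  also have "\<dots> = k + 3 * (k + 1) * (al - 1)" by (simp add: algebra_simps)
  finally show "edit_distance X Y \<le> k + 3 * (k + 1) * (al - 1)" by (simp add: pdist_def)
qed

section \<open>Progressions as sets closed under reflection\<close>

section \<open>Exact windows and arithmetic progressions of diagonals\<close>

text \<open>Since n mod 0 = n, the step 0 yields the singleton of \<open>lo\<close>, so singletons
  need no separate representation.\<close>

definition ap :: "nat \<Rightarrow> nat \<Rightarrow> nat \<Rightarrow> nat set" where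
  "ap lo p hi = {j. lo \<le> j \<and> j \<le> hi \<and> (j - lo) mod p = 0}"

lemma ap_zero: "ap lo 0 hi = (if lo \<le> hi then {lo} else {})"
  by (auto simp: ap_def)

lemma ap_one: "ap lo 1 hi = {lo..hi}" "ap lo (Suc 0) hi = {lo..hi}"
  by (auto simp: ap_def)

lemma ap_iff: "j \<in> ap lo p hi \<longleftrightarrow> lo \<le> j \<and> j \<le> hi \<and> p dvd (j - lo)"
  by (auto simp: ap_def dvd_eq_mod_eq_0)

text \<open>Of three elements, the outer one nearer to the middle may be reflected in the middle
  one. The property is evidently preserved by intersections, holds for progressions and for window
  matches, and by \<open>scanned_insert\<close> it forces the elements to be evenly spaced.\<close>

definition midclosed :: "nat set \<Rightarrow> bool" where
  "midclosed F \<longleftrightarrow> (\<forall>a b c. a \<in> F \<longrightarrow> b \<in> F \<longrightarrow> c \<in> F \<longrightarrow> a < b \<longrightarrow> b < c \<longrightarrow>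
     (c - b \<le> b - a \<longrightarrow> b - (c - b) \<in> F) \<and> (b - a \<le> c - b \<longrightarrow> b + (b - a) \<in> F))"

lemma midclosed_Int: "midclosed F \<Longrightarrow> midclosed G \<Longrightarrow> midclosed (F \<inter> G)"
  unfolding midclosed_def by blast

lemma midclosed_ap: "midclosed (ap lo p hi)"
  unfolding midclosed_def
proof (intro allI impI)
  fix a b c assume *: "a \<in> ap lo p hi" "b \<in> ap lo p hi" "c \<in> ap lo p hi" "a < b" "b < c"
  have cb: "p dvd (c - b)" and ba: "p dvd (b - a)"
    using * dvd_diff_nat[of p "c - lo" "b - lo"] dvd_diff_nat[of p "b - lo" "a - lo"] by (auto simp: ap_iff)
  show "(c - b \<le> b - a \<longrightarrow> b - (c - b) \<in> ap lo p hi) \<and> (b - a \<le> c - b \<longrightarrow> b + (b - a) \<in> ap lo p hi)"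
  proof (intro conjI impI)
    assume "c - b \<le> b - a"
    then have "b - (c - b) - lo = (b - lo) - (c - b)" "lo \<le> b - (c - b)" "b - (c - b) \<le> hi"
      using * by (auto simp: ap_iff)
    then show "b - (c - b) \<in> ap lo p hi" using * cb dvd_diff_nat[of p "b - lo" "c - b"] by (auto simp: ap_iff)
  next
    assume "b - a \<le> c - b"
    then have "b + (b - a) - lo = (b - lo) + (b - a)" "lo \<le> b + (b - a)" "b + (b - a) \<le> hi"
      using * by (auto simp: ap_iff)
    moreover have "p dvd (b - lo) + (b - a)" using * ba by (intro dvd_add) (auto simp: ap_iff)
    ultimately show "b + (b - a) \<in> ap lo p hi" by (simp only: ap_iff)
  qed
qed

text \<open>The invariant of a left-to-right scan: the part of a mid-closed set seen so far is the progression
  given by its first element, its first gap and its last element.\<close>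

definition scanned :: "nat set \<Rightarrow> nat \<Rightarrow> nat \<Rightarrow> nat \<Rightarrow> nat \<Rightarrow> bool" where
  "scanned F ne lo p hi \<longleftrightarrow> (if ne = 0 then F = {} else
     F = ap lo p hi \<and> lo \<in> F \<and> hi \<in> F \<and> (p = 0 \<longrightarrow> lo = hi) \<and> p \<le> hi - lo)"

lemma scanned_first: "F = {J} \<Longrightarrow> ne \<noteq> 0 \<Longrightarrow> scanned F ne J 0 J"
  by (auto simp: scanned_def ap_def)

text \<open>Apply the closure to the last two elements hi - p, hi and the new J. If J - hi were
  smaller than p, reflecting J in hi would give an element between hi - p and hi; if it were larger,
  reflecting hi - p would give hi + p below J. The scan so far contains neither.\<close>

lemma scanned_insert:
  assumes mid: "midclosed F" and s: "scanned {j \<in> F. j < J} ne lo p hi" "ne \<noteq> 0" and J: "J \<in> F"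
  shows "scanned {j \<in> F. j < Suc J} ne lo (if p = 0 then J - lo else p) J"
proof -
  have F: "{j \<in> F. j < J} = ap lo p hi" "lo \<in> F" "lo < J" "hi \<in> F" "hi < J" "p = 0 \<Longrightarrow> lo = hi" "p \<le> hi - lo"
    using s by (auto simp: scanned_def)
  have "hi \<in> ap lo p hi" using F(1,4,5) by blast
  then have lohi: "lo \<le> hi" "p dvd (hi - lo)" by (simp_all add: ap_iff)
  have eq: "{j \<in> F. j < Suc J} = insert J (ap lo p hi)"
    unfolding F(1)[symmetric] using J by (auto simp: less_Suc_eq)
  show ?thesis
  proof (cases "p = 0")
    case True
    have "insert J (ap lo p hi) = ap lo (J - lo) J"
    proof (intro set_eqI iffI)
      fix j assume "j \<in> ap lo (J - lo) J"
      then have "lo \<le> j" "j \<le> J" "(J - lo) dvd (j - lo)" by (auto simp: ap_iff)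
      then have "j = lo \<or> j = J" using dvd_imp_le[of "J - lo" "j - lo"] F(3) by linarith
      then show "j \<in> insert J (ap lo p hi)" using True lohi by (auto simp: ap_zero)
    qed (use True F(3,6) in \<open>auto simp: ap_zero ap_iff split: if_splits\<close>)
    moreover have "lo \<in> {j \<in> F. j < Suc J}" "J \<in> {j \<in> F. j < Suc J}" using F(2,3) J by auto
    ultimately show ?thesis using eq True s(2) F(3) by (simp add: scanned_def)
  next
    case False
    have lt: "lo < hi" using False F(7) by linarith
    have a: "hi - p \<in> F" "hi - p < hi"
    proof -
      have "hi - p - lo = (hi - lo) - p" "lo \<le> hi - p" using F(7) False by linarith+
      moreover have "p dvd (hi - lo) - p" using lohi(2) by (simp only: dvd_diff_nat dvd_refl)
      ultimately have "p dvd (hi - p - lo)" "lo \<le> hi - p" by simp_all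
      then have "hi - p \<in> ap lo p hi" by (auto simp: ap_iff)
      then show "hi - p \<in> F" using F(1) by blast
      show "hi - p < hi" using False lt by simp
    qed
    have pe: "hi - (hi - p) = p" using F(7) by simp
    have mc: "J - hi \<le> p \<Longrightarrow> hi - (J - hi) \<in> F" "p \<le> J - hi \<Longrightarrow> hi + p \<in> F"
      using mid[unfolded midclosed_def, rule_format, of "hi - p" hi J] a F(4,5) J pe by auto
    have "J - hi = p"
    proof (rule ccontr)
      assume ne: "J - hi \<noteq> p"
      show False
      proof (cases "J - hi < p")
        case True
        then have "hi - (J - hi) \<in> F" using mc by simp
        moreover have "hi - (J - hi) < J" using F(5) by simp
        ultimately have "hi - (J - hi) \<in> ap lo p hi" using F(1) by blast
        then have "p dvd (hi - (J - hi) - lo)" "lo \<le> hi - (J - hi)" by (auto simp: ap_iff)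
        then have "p dvd ((hi - lo) - (hi - (J - hi) - lo))" using lohi(2) by (simp only: dvd_diff_nat)
        moreover have "(hi - lo) - (hi - (J - hi) - lo) = J - hi" using True F lohi
          \<open>lo \<le> hi - (J - hi)\<close> by linarith
        ultimately show False using True F(5) by (auto dest: dvd_imp_le)
      next
        case *: False
        then have "hi + p \<in> F" using mc by simp
        moreover have "hi + p < J" using * ne F(5) by linarith
        ultimately have "hi + p \<in> ap lo p hi" using F(1) by blast
        then show False using False by (auto simp: ap_iff)
      qed
    qed
    then have Jp: "J = hi + p" using F(5) by simp
    have "insert J (ap lo p hi) = ap lo p J"
    proof (intro set_eqI iffI)
      fix j assume "j \<in> insert J (ap lo p hi)"
      moreover have "hi + p - lo = (hi - lo) + p" using lohi by simp
      then have "p dvd hi + p - lo" using lohi(2) by (simp only: dvd_add dvd_refl)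
      ultimately show "j \<in> ap lo p J" using Jp lohi by (auto simp: ap_iff)
    next
      fix j assume *: "j \<in> ap lo p J"
      show "j \<in> insert J (ap lo p hi)"
      proof (cases "j \<le> hi")
        case False
        then have "p dvd ((j - lo) - (hi - lo))" using * lohi(2) by (simp only: dvd_diff_nat ap_iff)
        moreover have "(j - lo) - (hi - lo) = j - hi" "0 < j - hi" using lohi False by auto
        ultimately have "p \<le> j - hi" by (auto dest: dvd_imp_le)
        then show ?thesis using * Jp by (auto simp: ap_iff)
      qed (use * in \<open>auto simp: ap_iff\<close>)
    qed
    moreover have "lo \<in> {j \<in> F. j < Suc J}" "J \<in> {j \<in> F. j < Suc J}" using F(2,3) J by auto
    moreover have "p \<le> J - lo" using Jp lohi by simp
    ultimately show ?thesis using eq False s(2) by (simp add: scanned_def)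
  qed
qed

section \<open>Matches on a window and breaks of their common period\<close>

text \<open>Windows are four times as long as the range of the diagonals, so that any two matches overlap in
  most of the window; hence the matches have a common period.\<close>

definition winex :: "(nat \<Rightarrow> 'c) \<Rightarrow> (nat \<Rightarrow> 'c) \<Rightarrow> nat \<Rightarrow> nat \<Rightarrow> nat set" where
  "winex x y w q = {j. exact x y w (w + 4 * q) j}"

lemma winexD: "j \<in> winex x y w q \<Longrightarrow> w \<le> v \<Longrightarrow> v < w + 4 * q \<Longrightarrow> y (v + j) = x v"
  by (auto simp: winex_def exact_def)

lemma winex_sum: "j \<in> winex x y w q \<Longrightarrow> u = v + j \<Longrightarrow> w \<le> v \<Longrightarrow> v < w + 4 * q \<Longrightarrow> y u = x v"
  using winexD by blast

text \<open>Away from one border of the window the new match follows by shifting by the smaller gap.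
  Near that border the shift would leave the window, and a detour in the opposite direction by the
  larger gap is taken instead. The gaps add up to less than q, so in a window of length 4 q all
  positions used remain inside.\<close>

lemma midclosed_winex:
  "midclosed (winex x y w q \<inter> {G..<G + q})"
  unfolding midclosed_def
proof (intro allI impI)
  let ?E = "winex x y w q"
  fix a b c assume abc: "a \<in> ?E \<inter> {G..<G + q}" "b \<in> ?E \<inter> {G..<G + q}" "c \<in> ?E \<inter> {G..<G + q}" "a < b" "b < c"
  then have E: "a \<in> ?E" "b \<in> ?E" "c \<in> ?E" and q: "c - a < q" by auto
  have "b - (c - b) \<in> ?E" if le: "c - b \<le> b - a"
    unfolding winex_def exact_def
  proof (intro CollectI allI impI)
    fix v assume v: "w \<le> v" "v < w + 4 * q"
    have "y (v + (b - (c - b))) = x v"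
    proof (cases "w + (c - b) \<le> v")
      case True
      have "y (v + (b - (c - b))) = x (v - (c - b))"
        by (rule winex_sum[OF E(2)]) (use True v abc le in auto)
      also have "\<dots> = y (v + b)" by (rule winex_sum[OF E(3), symmetric]) (use True v abc in auto)
      also have "\<dots> = x v" using winexD[OF E(2) v] .
      finally show ?thesis .
    next
      case False
      let ?v = "v + ((b - a) - (c - b))"
      have r: "w \<le> ?v" "?v < w + 4 * q" "w \<le> v + (b - a)" "v + (b - a) < w + 4 * q" using False v q abc by auto
      have "y (v + (b - (c - b))) = x ?v"
        by (rule winex_sum[OF E(1) _ r(1,2)]) (use abc le in auto)
      also have "\<dots> = y (v + (b - a) + b)" by (rule winex_sum[OF E(3) _ r(1,2), symmetric]) (use abc le r in auto)
      also have "\<dots> = x (v + (b - a))" using winexD[OF E(2) r(3,4)] by simp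
      also have "\<dots> = y (v + b)" by (rule winex_sum[OF E(1) _ r(3,4), symmetric]) (use abc r in auto)
      also have "\<dots> = x v" using winexD[OF E(2) v] .
      finally show ?thesis .
    qed
    then show "x v = y (v + (b - (c - b)))" by simp
  qed
  moreover have "b + (b - a) \<in> ?E" if le: "b - a \<le> c - b"
    unfolding winex_def exact_def
  proof (intro CollectI allI impI)
    fix v assume v: "w \<le> v" "v < w + 4 * q"
    have "y (v + (b + (b - a))) = x v"
    proof (cases "v + (b - a) < w + 4 * q")
      case True
      have "y (v + (b + (b - a))) = x (v + (b - a))"
        by (rule winex_sum[OF E(2)]) (use True v abc in auto)
      also have "\<dots> = y (v + b)" by (rule winex_sum[OF E(1), symmetric]) (use True v abc in auto)
      also have "\<dots> = x v" using winexD[OF E(2) v] .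
      finally show ?thesis .
    next
      case False
      let ?v = "v - ((c - b) - (b - a))"
      have r: "w \<le> ?v" "?v < w + 4 * q" "w \<le> v - (c - b)" "v - (c - b) < w + 4 * q" "c - b \<le> v"
        using False v q abc by auto
      have "y (v + (b + (b - a))) = x ?v"
        by (rule winex_sum[OF E(3) _ r(1,2)]) (use abc le r in auto)
      also have "\<dots> = y (v - (c - b) + b)" by (rule winex_sum[OF E(1) _ r(1,2), symmetric]) (use abc le r r in auto)
      also have "\<dots> = x (v - (c - b))" using winexD[OF E(2) r(3,4)] by simp
      also have "\<dots> = y (v + b)" by (rule winex_sum[OF E(3) _ r(3,4), symmetric]) (use abc r r in auto)
      also have "\<dots> = x v" using winexD[OF E(2) v] .
      finally show ?thesis .
    qed
    then show "x v = y (v + (b + (b - a)))" by simp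
  qed
  ultimately show "(c - b \<le> b - a \<longrightarrow> b - (c - b) \<in> ?E \<inter> {G..<G + q}) \<and>
     (b - a \<le> c - b \<longrightarrow> b + (b - a) \<in> ?E \<inter> {G..<G + q})"
    using abc by auto
qed

text \<open>\<open>brk\<close>: an adjacent change of the period was found near the window at \<open>W\<close>, so that two
  diagonals at distance \<open>p\<close> cannot both match there. The alternative concerns the window at the end of
  the interval.\<close>

definition brk :: "(nat \<Rightarrow> 'c) \<Rightarrow> (nat \<Rightarrow> 'c) \<Rightarrow> nat \<Rightarrow> nat \<Rightarrow> nat \<Rightarrow> nat \<Rightarrow> nat \<Rightarrow> nat \<Rightarrow> bool" where
  "brk x y W EN q lo p hi \<longleftrightarrow>
     (\<forall>j. j \<in> ap lo p hi \<longrightarrow> j + p \<in> ap lo p hi \<longrightarrow> j \<in> winex x y W q \<longrightarrow> j + p \<in> winex x y W q \<longrightarrow> False) \<or>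
     W + 4 * q = EN \<and> \<not> ap lo p hi \<subseteq> winex x y W q"

text \<open>Diagonals of the progression meet a break at offset t of the second string up to d rows
  earlier. Starting d rows before the break makes it visible to all of them, and the minimum keeps
  the window inside the interval.\<close>

definition refwin :: "nat \<Rightarrow> nat \<Rightarrow> nat \<Rightarrow> nat \<Rightarrow> nat \<Rightarrow> nat" where
  "refwin ST EN q d t = min (ST + (t - d)) (EN - 4 * q)"

lemma brk_zero:
  assumes "x (ST + t) \<noteq> y (ST + lo + t)" "ST + 4 * q \<le> EN" "ST + t < EN" "0 < q"
  shows "brk x y (refwin ST EN q 0 t) EN q lo 0 lo"
proof -
  let ?W = "refwin ST EN q 0 t"
  have W: "?W \<le> ST + t" "ST + t < ?W + 4 * q" using assms by (auto simp: refwin_def)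
  then have "lo \<notin> winex x y ?W q" using winexD[of lo x y ?W q "ST + t"] assms(1) by (auto simp: ac_simps)
  then show ?thesis by (auto simp: brk_def ap_zero)
qed

text \<open>If j and j + p both matched, the symbol of y at ST + t + p + j would equal both symbols
  of x that differ.\<close>

lemma brk_X:
  assumes "x (ST + t) \<noteq> x (ST + t + p)" "ST + 4 * q \<le> EN" "ST + t + p < EN" "hi - lo < q" "p \<le> hi - lo"
  shows "brk x y (refwin ST EN q (hi - lo) t) EN q lo p hi"
proof -
  let ?W = "refwin ST EN q (hi - lo) t"
  have W: "?W \<le> ST + t" "ST + t + p < ?W + 4 * q" using assms by (auto simp: refwin_def)
  have "False" if "j \<in> winex x y ?W q" "j + p \<in> winex x y ?W q" for j
    using winexD[OF that(1), of "ST + t + p"] winexD[OF that(2), of "ST + t"] W assms(1) by (auto simp: ac_simps)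
  then show ?thesis by (auto simp: brk_def)
qed

text \<open>In the generic case diagonals j and j + p align one symbol of x with the two differing
  symbols of y. If the break is too close to the start, the match of \<open>lo\<close> on the first
  window carries it over to x; close to the end no such match is guaranteed, which is why
  \<open>brk\<close> has a second alternative.\<close>

lemma brk_Y:
  assumes "y (ST + lo + t) \<noteq> y (ST + lo + t + p)" "ST + 4 * q \<le> EN" "t + p < EN - ST + (hi - lo)"
    "hi - lo < q" "p \<le> hi - lo" "lo \<in> ap lo p hi" "hi \<in> ap lo p hi" "ap lo p hi \<subseteq> winex x y ST q"
  shows "brk x y (refwin ST EN q (hi - lo) t) EN q lo p hi"
proof -
  let ?W = "refwin ST EN q (hi - lo) t"
  consider (low) "?W = ST" "t < hi - lo" | (mid) "?W = ST + (t - (hi - lo))" "hi - lo \<le> t" | (high) "?W + 4 * q = EN" "?W \<le> ST + (t - (hi - lo))" "hi - lo \<le> t"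
  proof (cases "t < hi - lo")
    case True
    then show thesis using assms(2) by (intro low) (auto simp: refwin_def)
  next
    case False
    then show thesis using assms(2) mid high
      by (cases "ST + (t - (hi - lo)) \<le> EN - 4 * q") (simp_all add: refwin_def)
  qed
  then show ?thesis
  proof cases
    case low
    have False if "j \<in> winex x y ST q" "j + p \<in> winex x y ST q" for j
    proof -
      have lo: "lo \<in> winex x y ST q" using assms by auto
      have "y (ST + lo + t) = x (ST + t)" by (rule winex_sum[OF lo]) (use low assms in auto)
      moreover have "y (ST + lo + t + p) = x (ST + t + p)" by (rule winex_sum[OF lo]) (use low assms in auto)
      moreover have "y (ST + t + p + j) = x (ST + t + p)" by (rule winex_sum[OF that(1)]) (use low assms in auto)
      moreover have "y (ST + t + p + j) = x (ST + t)" by (rule winex_sum[OF that(2)]) (use low assms in auto)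
      ultimately show False using assms(1) by simp
    qed
    then show ?thesis using low by (auto simp: brk_def)
  next
    case mid
    have False if j: "j \<in> winex x y ?W q" "j + p \<in> winex x y ?W q" "j \<in> ap lo p hi" "j + p \<in> ap lo p hi" for j
    proof -
      let ?v = "ST + lo + t - j"
      have r: "?W \<le> ?v" "?v < ?W + 4 * q" "j \<le> ST + lo + t" using mid j assms by (auto simp: ap_iff)
      have "y (ST + lo + t) = x ?v" by (rule winex_sum[OF j(1) _ r(1,2)]) (use r in auto)
      moreover have "y (ST + lo + t + p) = x ?v" by (rule winex_sum[OF j(2) _ r(1,2)]) (use r in auto)
      ultimately show False using assms(1) by simp
    qed
    then show ?thesis by (auto simp: brk_def)
  next
    case high
    \<comment> \<open>Under the negation of the second alternative of \<open>brk\<close>, the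
      diagonal \<open>hi\<close> matches the last window and carries the break from y over to
      x.\<close>
    have False if j: "j \<in> winex x y ?W q" "j + p \<in> winex x y ?W q" and sub: "ap lo p hi \<subseteq> winex x y ?W q" for j
    proof -
      have hi: "hi \<in> winex x y ?W q" using assms sub by auto
      let ?v = "ST + lo + t - hi"
      have r: "?W \<le> ?v" "?v + p < ?W + 4 * q" "hi \<le> ST + lo + t" using high assms by (auto simp: ap_iff)
      have "y (ST + lo + t) = x ?v" by (rule winex_sum[OF hi]) (use r in auto)
      moreover have "y (ST + lo + t + p) = x (?v + p)" by (rule winex_sum[OF hi]) (use r in auto)
      moreover have "y (?v + p + j) = x (?v + p)" by (rule winex_sum[OF j(1)]) (use r in auto)
      moreover have "y (?v + p + j) = x ?v" by (rule winex_sum[OF j(2)]) (use r in auto)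
      ultimately show False using assms(1) by simp
    qed
    then show ?thesis using high by (auto simp: brk_def)
  qed
qed

text \<open>The survivors lie in the old progression, so their difference is a multiple of p. The
  break forbids p itself, which leaves at least 2 p, a singleton, or the special case of the last
  window.\<close>

lemma brk_progress:
  assumes "brk x y W EN q lo p hi" "scanned (ap lo p hi \<inter> winex x y W q) 1 lo' p' hi'" "p \<noteq> 0"
  shows "p' = 0 \<or> 2 * p \<le> p' \<or> W + 4 * q = EN \<and> \<not> ap lo p hi \<subseteq> winex x y (EN - 4 * q) q \<and> p \<le> p'"
proof (cases "p' = 0")
  case False
  have s: "ap lo p hi \<inter> winex x y W q = ap lo' p' hi'" "lo' \<in> ap lo p hi" "lo' \<in> winex x y W q" "lo' \<le> hi'" "p' \<le> hi' - lo'"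
    using assms(2) by (auto simp: scanned_def ap_iff)
  have "lo' + p' \<in> ap lo' p' hi'" using s by (auto simp: ap_iff)
  then have l: "lo' + p' \<in> ap lo p hi" "lo' + p' \<in> winex x y W q" using s(1) by blast+
  have "p dvd ((lo' + p' - lo) - (lo' - lo))" using l s by (simp only: dvd_diff_nat ap_iff)
  moreover have "(lo' + p' - lo) - (lo' - lo) = p'" using s by (auto simp: ap_iff)
  ultimately have pd: "p dvd p'" by simp
  then obtain c where c: "p' = p * c" by auto
  show ?thesis
  proof (cases "p' = p")
    case True
    then show ?thesis using assms(1) l s unfolding brk_def by auto
  next
    case ne: False
    have "c \<noteq> 0" "c \<noteq> 1" using c ne False by auto
    then have "2 \<le> c" by linarith
    then have "2 * p \<le> p'" using c by (simp add: mult.commute)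
    then show ?thesis by simp
  qed
qed simp

lemma brk_progress_zero:
  assumes "brk x y W EN q lo 0 lo" "scanned (ap lo 0 lo \<inter> winex x y W q) 1 lo' p' hi'"
  shows "W + 4 * q = EN \<and> \<not> ap lo 0 lo \<subseteq> winex x y (EN - 4 * q) q"
proof -
  have "lo \<in> winex x y W q" using assms(2) by (auto simp: scanned_def ap_zero)
  then show ?thesis using assms(1) by (auto simp: brk_def ap_zero)
qed

text \<open>Errors of all diagonals of a progression, bounded via the deviations from a common periodic string.\<close>

definition dev :: "(nat \<Rightarrow> 'c) \<Rightarrow> (nat \<Rightarrow> 'c) \<Rightarrow> nat \<Rightarrow> nat \<Rightarrow> nat \<Rightarrow> nat \<Rightarrow> nat \<Rightarrow> bool" where
  "dev x y ST EN lo p t \<longleftrightarrow> ST + t < EN \<and> x (ST + t) \<noteq> x (ST + t mod p) \<or> y (ST + lo + t) \<noteq> x (ST + t mod p)"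

text \<open>As p divides j - lo, both symbols of a mismatch have the same reference symbol, so one
  of them deviates from it. A deviation at t accounts for the rows ST + t and ST + t - (j - lo)
  only, hence the factor 2. For p = 0 the reference is x itself, because t mod 0 = t.\<close>

lemma mism_dev:
  assumes "card {t. t < D \<and> dev x y ST EN lo p t} \<le> c" "j \<in> ap lo p hi" "b \<le> EN" "b \<le> ST \<or> b - ST + (j - lo) \<le> D"
  shows "mism x y ST b j \<le> 2 * c"
proof (cases "b \<le> ST")
  case True
  then have "{v. ST \<le> v \<and> v < b \<and> x v \<noteq> y (v + j)} = {}" by auto
  then show ?thesis unfolding mism_def by (simp only: card.empty)
next
  case False
  let ?D = "{t. t < D \<and> dev x y ST EN lo p t}"
  have D: "b - ST + (j - lo) \<le> D" using assms(4) False by auto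
  have j: "lo \<le> j" "p dvd (j - lo)" using assms(2) by (auto simp: ap_iff)
  have "{v. ST \<le> v \<and> v < b \<and> x v \<noteq> y (v + j)} \<subseteq> (\<lambda>t. ST + t) ` ?D \<union> (\<lambda>t. ST + t - (j - lo)) ` ?D"
  proof
    fix v assume "v \<in> {v. ST \<le> v \<and> v < b \<and> x v \<noteq> y (v + j)}"
    then have v: "ST \<le> v" "v < b" "x v \<noteq> y (v + j)" by auto
    let ?t = "v - ST" and ?u = "v - ST + (j - lo)"
    have m: "?u mod p = ?t mod p" using j by (metis mod_add_right_eq add.right_neutral dvd_imp_mod_0)
    show "v \<in> (\<lambda>t. ST + t) ` ?D \<union> (\<lambda>t. ST + t - (j - lo)) ` ?D"
    proof (cases "x v = x (ST + ?t mod p)")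
      case True
      then have "y (v + j) \<noteq> x (ST + ?u mod p)" using v(3) unfolding m by metis
      moreover have "v + j = ST + lo + ?u" using v(1) j(1) by simp
      ultimately have "y (ST + lo + ?u) \<noteq> x (ST + ?u mod p)" by metis
      then have "dev x y ST EN lo p ?u" unfolding dev_def by blast
      moreover have "?u < D" using v(1,2) D by linarith
      ultimately have "?u \<in> ?D" by (simp only: mem_Collect_eq)
      moreover have "v = ST + ?u - (j - lo)" using v(1) by simp
      ultimately show ?thesis by blast
    next
      case False
      moreover have "ST + ?t = v" "v < EN" using v(1,2) assms(3) by simp_all
      ultimately have "dev x y ST EN lo p ?t" unfolding dev_def by simp
      moreover have "?t < D" using v(1,2) D by linarith
      ultimately have "?t \<in> ?D" by (simp only: mem_Collect_eq)
      moreover have "v = ST + ?t" using v(1) by simp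
      ultimately show ?thesis by blast
    qed
  qed
  then have "mism x y ST b j \<le> card ((\<lambda>t. ST + t) ` ?D \<union> (\<lambda>t. ST + t - (j - lo)) ` ?D)"
    unfolding mism_def by (intro card_mono) auto
  also have "\<dots> \<le> card ((\<lambda>t. ST + t) ` ?D) + card ((\<lambda>t. ST + t - (j - lo)) ` ?D)" by (rule card_Un_le)
  also have "\<dots> \<le> card ?D + card ?D" by (intro add_mono card_image_le) auto
  finally show ?thesis using assms(1) by simp
qed

section \<open>Overflow-free tests in one address space for both strings\<close>

section \<open>Expressions and the equality test on padded strings\<close>

abbreviation addE (infixl "+." 65) where "a +. b \<equiv> B Add a b"
abbreviation subE (infixl "-." 65) where "a -. b \<equiv> B Sub a b"
abbreviation mulE (infixl "*." 70) where "a *. b \<equiv> B Mul a b"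
abbreviation divE (infixl "div." 70) where "a div. b \<equiv> B Div a b"
abbreviation modE (infixl "mod." 70) where "a mod. b \<equiv> B Mod a b"
abbreviation lessE (infix "<." 50) where "a <. b \<equiv> B Less a b"
abbreviation eqE (infix "=." 50) where "a =. b \<equiv> B Eq a b"
abbreviation andE (infixr "&." 35) where "a &. b \<equiv> B And a b"
abbreviation notE :: "exp \<Rightarrow> exp" where "notE a \<equiv> a =. C 0"

lemma and_of_bool [simp]: "semiring_bit_operations_class.and (of_bool p) (of_bool q) = (of_bool (p \<and> q) :: nat)"
  by (cases p; cases q) simp_all

lemma of_bool_neq0 [simp]: "(of_bool p = (0::nat)) \<longleftrightarrow> \<not> p" "(0 < (of_bool p :: nat)) \<longleftrightarrow> p"
  by (cases p; simp)+

text \<open>Positions below register 9 refer to the first string, the others to the second one.\<close>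

definition chrE :: "exp \<Rightarrow> exp" where
  "chrE p = Ite (p <. V 9) (Rx p) (Ite (p -. V 9 <. V 2) (C 0) (Ry (p -. V 9 -. V 2)))"

text \<open>Computes the first component of the padded symbols, while \<open>chrE\<close> computes
  the second; characters read out of range are 0, as in the padding.\<close>

definition clsE :: "exp \<Rightarrow> exp" where
  "clsE p = Ite (p <. V 9) (Ite (p <. V 0) (C 2) (C 0))
     (Ite (p -. V 9 <. V 2) (C 1) (Ite (p -. V 9 -. V 2 <. V 1) (C 2) (C 1)))"

definition zeqE :: "exp \<Rightarrow> exp \<Rightarrow> exp" where
  "zeqE p q = (chrE p =. chrE q &. clsE p =. clsE q)"

definition minE :: "exp \<Rightarrow> exp \<Rightarrow> exp" where
  "minE a b = Ite (a <. b) a b"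

lemma nev_minE [simp]: "nev X Y s (minE a b) = min (nev X Y s a) (nev X Y s b)"
  by (simp add: minE_def)

lemma esafe_minE [simp]: "esafe w X Y s (minE a b) \<longleftrightarrow> esafe w X Y s a \<and> esafe w X Y s b"
  by (auto simp: minE_def)

definition inE :: "exp \<Rightarrow> exp \<Rightarrow> exp \<Rightarrow> exp \<Rightarrow> exp" where
  "inE a lo p hi = Ite (a <. lo) (C 0) (Ite (hi <. a) (C 0) ((a -. lo) mod. p =. C 0))"

lemma nev_inE [simp]: "nev X Y s (inE a lo p hi) = of_bool (nev X Y s a \<in> ap (nev X Y s lo) (nev X Y s p) (nev X Y s hi))"
  by (auto simp: inE_def ap_def)

lemma esafe_inE [simp]: "esafe w X Y s a \<Longrightarrow> esafe w X Y s lo \<Longrightarrow> esafe w X Y s p \<Longrightarrow> esafe w X Y s hi \<Longrightarrow>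
   nev X Y s a < 2 ^ w \<Longrightarrow> esafe w X Y s (inE a lo p hi)"
  by (auto simp: inE_def)

text \<open>\<open>Bd\<close> bounds the lengths, indices and addresses that occur, and the factor
  16 leaves room for sums of several of them, so that overflow freedom becomes linear arithmetic.
  \<open>LB\<close> bounds the number of halvings in a search.\<close>

locale params =
  fixes w :: nat and X Y :: "nat list" and k al L aa rr M TT H ZB TB rho GN cc Bd LB :: nat
  assumes Bd: "16 * Bd \<le> 2 ^ w" "100 \<le> Bd" "2 * Bd \<le> 2 ^ LB" "H \<le> Bd" "length X \<le> H" "k \<le> Bd" "length Y \<le> Bd" "cc \<le> Bd" "L \<le> Bd" "cc * L \<le> Bd"
    and aa: "1 \<le> aa" and L1: "1 \<le> L"
begin

abbreviation "x \<equiv> padX X"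
abbreviation "y \<equiv> padY Y k"

text \<open>Placing y at address \<open>H\<close> behind x lets one equality test compare symbols of
  either string with symbols of either string.\<close>

definition zz :: "nat \<Rightarrow> nat \<times> nat" where
  "zz p = (if p < H then x p else y (p - H))"

lemma zz_add: "zz (H + t) = y t" and zz_less: "p < H \<Longrightarrow> zz p = x p"
  by (simp_all add: zz_def)

definition env :: "(nat \<Rightarrow> nat) \<Rightarrow> bool" where
  "env v \<longleftrightarrow> v 0 = length X \<and> v 1 = length Y \<and> v 2 = k \<and> v 3 = al \<and> v 4 = L \<and> v 5 = aa \<and> v 6 = rr \<and> v 7 = M \<and>
     v 8 = TT \<and> v 9 = H \<and> v 10 = ZB \<and> v 11 = TB \<and> v 13 = rho \<and> v 14 = GN"

lemma envD: "env v \<Longrightarrow> v 0 = length X" "env v \<Longrightarrow> v (Suc 0) = length Y" "env v \<Longrightarrow> v 2 = k" "env v \<Longrightarrow> v 3 = al" "env v \<Longrightarrow> v 4 = L" "env v \<Longrightarrow> v 5 = aa"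
   "env v \<Longrightarrow> v 6 = rr" "env v \<Longrightarrow> v 7 = M" "env v \<Longrightarrow> v 8 = TT" "env v \<Longrightarrow> v 9 = H" "env v \<Longrightarrow> v 10 = ZB" "env v \<Longrightarrow> v 11 = TB"
   "env v \<Longrightarrow> v 13 = rho" "env v \<Longrightarrow> v 14 = GN"
  by (auto simp: env_def)

lemma env_cong: "env v \<Longrightarrow> (\<And>r. r < 15 \<Longrightarrow> v' r = v r) \<Longrightarrow> env v'"
  by (simp add: env_def)

lemma chr_cls:
  assumes "env v"
  shows "(nev X Y (v, m) (clsE p), nev X Y (v, m) (chrE p)) = zz (nev X Y (v, m) p)"
  using Bd(5) by (auto simp: clsE_def chrE_def zz_def padX_def padY_def envD[OF assms] read_char_def)

lemma nev_zeqE: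
  assumes "env v"
  shows "nev X Y (v, m) (zeqE p q) = of_bool (zz (nev X Y (v, m) p) = zz (nev X Y (v, m) q))"
  using chr_cls[OF assms, of m p, symmetric] chr_cls[OF assms, of m q, symmetric]
  by (simp add: zeqE_def conj_commute)

lemma esafe_zeqE:
  assumes "env v" "esafe w X Y (v, m) p" "esafe w X Y (v, m) q" "nev X Y (v, m) p < 2 ^ w" "nev X Y (v, m) q < 2 ^ w"
  shows "esafe w X Y (v, m) (zeqE p q)"
proof -
  have "2 < (2::nat) ^ w" using Bd(1,2) by linarith
  then show ?thesis using assms(2-)
    by (auto simp: zeqE_def clsE_def chrE_def envD[OF assms(1)])
qed

end

section \<open>Z-values for the diagonals of a window\<close>

section \<open>The Z-algorithm\<close>

text \<open>The value at i of the Z-function of the prefix of \<open>s\<close> of length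
  \<open>N\<close>.\<close>

definition islcp :: "(nat \<Rightarrow> 'c) \<Rightarrow> nat \<Rightarrow> nat \<Rightarrow> nat \<Rightarrow> bool" where
  "islcp s N i z \<longleftrightarrow> i + z \<le> N \<and> (\<forall>u<z. s u = s (i + u)) \<and> (i + z = N \<or> s z \<noteq> s (i + z))"

definition sposE :: "exp \<Rightarrow> exp" where
  "sposE q = Ite (q <. C 4 *. V 23) (V 45 +. q) (V 9 +. V 45 +. V 22 +. (q -. C 4 *. V 23))"

definition zbody :: com where
  "zbody = IfC (Ite (V 90 +. V 91 <. C 9 *. V 23) (zeqE (sposE (V 91)) (sposE (V 90 +. V 91))) (C 0))
      (Set 91 (V 91 +. C 1))
      (Put (V 10 +. V 90) (V 91);;
       IfC (V 93 <. V 90 +. V 91) (Set 92 (V 90);; Set 93 (V 90 +. V 91)) Skip;;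
       Set 90 (V 90 +. C 1);;
       Set 91 (Ite (V 90 <. V 93) (minE (V 93 -. V 90) (Ld (V 10 +. (V 90 -. V 92)))) (C 0)))"

definition zrun :: com where
  "zrun = (Set 90 (C 1);; Set 91 (C 0);; Set 92 (C 0);; Set 93 (C 0));;
     While (V 90 <. C 9 *. V 23) zbody"

definition Kz :: nat where "Kz = 20 * (tc zrun + 10)"

text \<open>The Z-box extends from l to r. The clause
  \<open>r \<le> i + z \<or> islcp s N i z\<close> says that a candidate ending inside the box is
  already final, so every successful comparison advances the frontier max r (i + z); this yields
  linear time.\<close>

definition zinv :: "(nat \<Rightarrow> 'c) \<Rightarrow> nat \<Rightarrow> nat \<Rightarrow> (nat \<Rightarrow> nat) \<Rightarrow> nat \<Rightarrow> nat \<Rightarrow> nat \<Rightarrow> nat \<Rightarrow> bool" where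
  "zinv s N ZB m i z l r \<longleftrightarrow> 1 \<le> i \<and> i \<le> N \<and> i + z \<le> N \<and> r \<le> N \<and>
     (\<forall>i'. 1 \<le> i' \<longrightarrow> i' < i \<longrightarrow> islcp s N i' (m (ZB + i'))) \<and>
     (\<forall>u<z. s u = s (i + u)) \<and> (r \<le> i + z \<or> islcp s N i z) \<and>
     (0 < r \<longrightarrow> 1 \<le> l \<and> l < i \<and> (\<forall>u. l \<le> u \<longrightarrow> u < r \<longrightarrow> s u = s (u - l)))"

lemma zinvD:
  assumes "zinv s N ZB m i z l r"
  shows "1 \<le> i" "i \<le> N" "i + z \<le> N" "r \<le> N" "\<And>i'. 1 \<le> i' \<Longrightarrow> i' < i \<Longrightarrow> islcp s N i' (m (ZB + i'))"
    "\<And>u. u < z \<Longrightarrow> s u = s (i + u)" "r \<le> i + z \<or> islcp s N i z" "0 < r \<Longrightarrow> 1 \<le> l" "0 < r \<Longrightarrow> l < i"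
    "\<And>u. l \<le> u \<Longrightarrow> u < r \<Longrightarrow> s u = s (u - l)"
  using assms unfolding zinv_def by blast+

lemma islcpD:
  assumes "islcp s N i z"
  shows "i + z \<le> N" "\<And>u. u < z \<Longrightarrow> s u = s (i + u)" "i + z < N \<Longrightarrow> s z \<noteq> s (i + z)"
  using assms unfolding islcp_def by (blast, blast, linarith)

lemma zinv_extend:
  assumes "zinv s N ZB m i z l r" "i + z < N" "s z = s (i + z)"
  shows "zinv s N ZB m i (Suc z) l r" "r \<le> i + z"
proof -
  note I = zinvD[OF assms(1)]
  show r: "r \<le> i + z" using I(7) islcpD(3)[of s N i z] assms(2,3) by blast
  have "\<forall>u<Suc z. s u = s (i + u)" using I(6) assms(3) less_Suc_eq by blast
  then show "zinv s N ZB m i (Suc z) l r"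
    unfolding zinv_def using I r assms(2) by (metis Suc_leI add_Suc_right le_Suc_eq)
qed

text \<open>Inside the box the text at Suc i repeats the text at Suc i - l'. The Z-value stored
  there carries over, cut off at the end of the box; if it is strictly smaller, its terminating
  mismatch carries over too and the value is final.\<close>

lemma zinv_next:
  assumes inv: "zinv s N ZB m i z l r" and i: "i < N" and stop: "\<not> (i + z < N \<and> s z = s (i + z))"
    and m': "m' = m(ZB + i := z)"
    and lr: "(l', r') = (if r < i + z then (i, i + z) else (l, r))"
    and z': "z' = (if Suc i < r' then min (r' - Suc i) (m' (ZB + (Suc i - l'))) else 0)"
  shows "zinv s N ZB m' (Suc i) z' l' r'" "r' = max r (i + z)"
proof -
  note I = zinvD[OF inv]
  have lcp: "islcp s N i z" unfolding islcp_def using I(3,6) stop by (metis le_neq_implies_less)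
  have all: "islcp s N i' (m' (ZB + i'))" if "1 \<le> i'" "i' < Suc i" for i'
  proof (cases "i' = i")
    case False
    then show ?thesis using I(5)[of i'] that by (simp add: m')
  qed (use lcp in \<open>simp add: m'\<close>)
  have r'1: "r' \<le> N" "r' = max r (i + z)" using lr I(3,4) by (auto split: if_splits)
  have r'2: "0 < r' \<Longrightarrow> 1 \<le> l' \<and> l' < Suc i"
    using lr I(1,8,9) by (auto split: if_splits)
  have r'3: "s u = s (u - l')" if "0 < r'" "l' \<le> u" "u < r'" for u
  proof (cases "r < i + z")
    case True
    then have "s (u - i) = s (i + (u - i))" using that lr islcpD(2)[OF lcp, of "u - i"] by simp
    then show ?thesis using True that lr by simp
  next
    case False
    then show ?thesis using I(10)[of u] that lr by simp
  qed
  show "r' = max r (i + z)" by (rule r'1)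
  have z0: "(\<forall>u<z'. s u = s (Suc i + u)) \<and> (r' \<le> Suc i + z' \<or> islcp s N (Suc i) z') \<and> Suc i + z' \<le> N"
  proof (cases "Suc i < r'")
    case True
    let ?d = "Suc i - l'" and ?Z = "m' (ZB + (Suc i - l'))"
    have l': "1 \<le> l'" "l' < Suc i" using r'2 True by auto
    have d: "islcp s N ?d ?Z" by (rule all) (use l' in auto)
    have shift: "s (Suc i + u) = s (?d + u)" if "Suc i + u < r'" for u
    proof -
      have "Suc i + u - l' = ?d + u" using l' by simp
      then show ?thesis using r'3[of "Suc i + u"] that l' by simp
    qed
    have zz: "z' = min (r' - Suc i) ?Z" using z' True by simp
    have a: "s u = s (Suc i + u)" if "u < z'" for u
    proof -
      have "u < ?Z" "Suc i + u < r'" using that zz by auto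
      then show ?thesis using islcpD(2)[OF d, of u] shift[of u] by metis
    qed
    have b: "r' \<le> Suc i + z' \<or> islcp s N (Suc i) z'"
    proof (cases "?Z < r' - Suc i")
      case True
      then have z: "z' = ?Z" "Suc i + z' < r'" using zz by auto
      have "?d + z' < N" using z r'1 by linarith
      then have "s z' \<noteq> s (?d + z')" using islcpD(3)[OF d] z(1) by metis
      then have "s z' \<noteq> s (Suc i + z')" using shift[OF z(2)] by metis
      then show ?thesis using a z(2) r'1(1) unfolding islcp_def by (meson less_imp_le order_trans)
    next
      case False
      then show ?thesis using zz True by linarith
    qed
    have "Suc i + z' \<le> N" using zz True r'1(1) by linarith
    then show ?thesis using a b by blast
  next
    case False
    then show ?thesis using z' i by auto
  qed
  show "zinv s N ZB m' (Suc i) z' l' r'"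
    unfolding zinv_def using z0 r'1(1) r'2 r'3 all i by (metis Suc_leI le_add1 plus_1_eq_Suc)
qed

context params begin

text \<open>The 4 Q symbols of x in the window, followed by the 5 Q symbols of y that are met by its
  Q diagonals. Diagonal j then matches the window exactly when the Z-value at 4 Q + (j - G) reaches
  4 Q.\<close>

definition winstr :: "nat \<Rightarrow> nat \<Rightarrow> nat \<Rightarrow> nat \<Rightarrow> nat \<times> nat" where
  "winstr W G Q i = (if i < 4 * Q then x (W + i) else y (W + G + (i - 4 * Q)))"

lemma zbody_correct:
  assumes e: "env v" and r: "v 22 = G" "v 23 = Q" "v 45 = W"
    and b: "W + 4 * Q \<le> H" "9 * Q \<le> Bd" "G \<le> Bd" "ZB \<le> Bd"
    and inv: "zinv (winstr W G Q) (9 * Q) ZB m (v 90) (v 91) (v 92) (v 93)" and lt: "v 90 < 9 * Q"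
  shows "R w X Y zbody (v, m) (tc zbody) 0 (\<lambda>(v', m'). (\<forall>r<90. v' r = v r) \<and>
     (\<forall>a. a < ZB \<or> ZB + 9 * Q \<le> a \<longrightarrow> m' a = m a) \<and>
     zinv (winstr W G Q) (9 * Q) ZB m' (v' 90) (v' 91) (v' 92) (v' 93) \<and>
     (9 * Q - v' 90) + (9 * Q - max (v' 93) (v' 90 + v' 91)) < (9 * Q - v 90) + (9 * Q - max (v 93) (v 90 + v 91)))"
proof -
  let ?s = "winstr W G Q" and ?N = "9 * Q"
  let ?i = "v 90" and ?z = "v 91" and ?l = "v 92" and ?r = "v 93"
  have bnd: "1 \<le> ?i" "?i + ?z \<le> ?N" "?r \<le> ?N" "?l \<le> ?i \<or> ?r = 0" using inv by (auto simp: zinv_def)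
  have sp: "nev X Y (v, m) (sposE q) = (if nev X Y (v, m) q < 4 * Q then W + nev X Y (v, m) q else H + W + G + (nev X Y (v, m) q - 4 * Q))" for q
    by (simp add: sposE_def r envD[OF e])
  have zsp: "zz (nev X Y (v, m) (sposE q)) = ?s (nev X Y (v, m) q)" for q
  proof (cases "nev X Y (v, m) q < 4 * Q")
    case False
    have "nev X Y (v, m) (sposE q) = H + (W + G + (nev X Y (v, m) q - 4 * Q))" using False by (simp add: sp)
    then show ?thesis using False by (simp only: zz_add winstr_def if_False)
  qed (use b in \<open>simp add: sp zz_def winstr_def\<close>)
  have ss: "esafe w X Y (v, m) (sposE q)" if "esafe w X Y (v, m) q" "nev X Y (v, m) q \<le> ?N" for q
    using that b Bd by (auto simp: sposE_def r envD[OF e])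
  have zs: "esafe w X Y (v, m) (zeqE (sposE (V 91)) (sposE (V 90 +. V 91)))" if "?i + ?z < ?N"
  proof (rule esafe_zeqE[OF e])
    show "esafe w X Y (v, m) (sposE (V 91))" "esafe w X Y (v, m) (sposE (V 90 +. V 91))"
      using that b Bd by (auto intro!: ss)
    show "nev X Y (v, m) (sposE (V 91)) < 2 ^ w" "nev X Y (v, m) (sposE (V 90 +. V 91)) < 2 ^ w"
      using that b Bd by (auto simp: sp)
  qed
  show ?thesis
  proof (cases "?i + ?z < ?N \<and> ?s ?z = ?s (?i + ?z)")
    case True
    note ex = zinv_extend[OF inv True[THEN conjunct1] True[THEN conjunct2]]
    have "nexec X Y zbody (v, m) = (v(91 := ?z + 1), m)"
      using True by (simp add: zbody_def nev_zeqE[OF e] zsp r)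
    moreover have "bsafe w X Y zbody (v, m)"
      using True zs b Bd bnd by (simp add: zbody_def nev_zeqE[OF e] zsp r)
    ultimately show ?thesis
      using ex True by (intro R_block') auto
  next
    case False
    define m' where "m' = m(ZB + ?i := ?z)"
    define l' where "l' = (if ?r < ?i + ?z then ?i else ?l)"
    define r' where "r' = (if ?r < ?i + ?z then ?i + ?z else ?r)"
    define z' where "z' = (if Suc ?i < r' then min (r' - Suc ?i) (m' (ZB + (Suc ?i - l'))) else 0)"
    have nx: "zinv ?s ?N ZB m' (Suc ?i) z' l' r'" "r' = max ?r (?i + ?z)"
      using zinv_next[OF inv lt False m'_def, of l' r' z'] by (auto simp: l'_def r'_def z'_def)
    have ll: "l' \<le> Suc ?i" if "Suc ?i < r'" using bnd that by (auto simp: l'_def r'_def split: if_splits)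
    have "nexec X Y zbody (v, m) = (v(92 := l', 93 := r', 90 := Suc ?i, 91 := z'), m')"
      using False by (auto simp: zbody_def nev_zeqE[OF e] zsp r m'_def l'_def r'_def z'_def envD[OF e] fun_eq_iff)
    moreover have "bsafe w X Y zbody (v, m)"
      using False zs b Bd bnd ll by (auto simp: zbody_def nev_zeqE[OF e] zsp r envD[OF e] l'_def r'_def split: if_splits)
    ultimately show ?thesis
      using nx lt bnd by (intro R_block') (auto simp: m'_def)
  qed
qed

lemma zrun_correct:
  assumes e: "env v" and r: "v 22 = G" "v 23 = Q" "v 45 = W"
    and b: "W + 4 * Q \<le> H" "9 * Q \<le> Bd" "G \<le> Bd" "ZB \<le> Bd" "1 \<le> Q"
  shows "R w X Y zrun (v, m) (Kz * Q) 0 (\<lambda>(v', m'). (\<forall>r<90. v' r = v r) \<and>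
     (\<forall>a. a < ZB \<or> ZB + 9 * Q \<le> a \<longrightarrow> m' a = m a) \<and>
     (\<forall>i. 1 \<le> i \<longrightarrow> i < 9 * Q \<longrightarrow> islcp (winstr W G Q) (9 * Q) i (m' (ZB + i))))"
proof -
  let ?s = "winstr W G Q" and ?N = "9 * Q"
  let ?I = "\<lambda>(v', m'). (\<forall>r<90. v' r = v r) \<and> (\<forall>a. a < ZB \<or> ZB + 9 * Q \<le> a \<longrightarrow> m' a = m a) \<and>
     zinv ?s ?N ZB m' (v' 90) (v' 91) (v' 92) (v' 93)"
  \<comment> \<open>Each iteration advances the position or the frontier and neither decreases; both
    are at most 9 Q, hence at most 18 Q iterations.\<close>
  let ?mu = "\<lambda>(v', m' :: nat \<Rightarrow> nat). (9 * Q - v' 90) + (9 * Q - max (v' 93) (v' 90 + v' 91))"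
  let ?v = "v(90 := 1, 91 := 0, 92 := 0, 93 := 0)"
  have W: "R w X Y (While (V 90 <. C 9 *. V 23) zbody) (?v, m) (18 * Q * (tc zbody + te (V 90 <. C 9 *. V 23) + 1) + te (V 90 <. C 9 *. V 23) + 1)
     (of_nat (18 * Q) * 0) (\<lambda>s'. ?I s' \<and> nev X Y s' (V 90 <. C 9 *. V 23) = 0)"
  proof (rule R_While[where \<mu> = ?mu])
    fix s assume I: "?I s" and g: "nev X Y s (V 90 <. C 9 *. V 23) \<noteq> 0"
    obtain v1 m1 where s: "s = (v1, m1)" by (cases s)
    have ag: "\<forall>r<90. v1 r = v r" using I s by auto
    have e1: "env v1" by (rule env_cong[OF e]) (use ag in auto)
    have r1: "v1 22 = G" "v1 23 = Q" "v1 45 = W" using ag r by auto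
    show "R w X Y zbody s (tc zbody) 0 (\<lambda>s'. ?I s' \<and> ?mu s' < ?mu s)"
      unfolding s
      by (rule R_mono[OF zbody_correct[OF e1 r1 b(1-4)]]) (use I s g r1 in \<open>auto split: prod.splits\<close>)
  next
    fix s assume "?I s" "nev X Y s (V 90 <. C 9 *. V 23) \<noteq> 0"
    then show "0 < ?mu s" using r by (cases s) auto
  next
    fix s assume "?I s"
    then show "esafe w X Y s (V 90 <. C 9 *. V 23)" using r b Bd by (cases s) auto
  next
    show "?I (?v, m)" using b by (auto simp: zinv_def)
    show "?mu (?v, m) \<le> 18 * Q" by auto
  qed
  have "R w X Y zrun (v, m) (tc (Set 90 (C 1);; Set 91 (C 0);; Set 92 (C 0);; Set 93 (C 0)) +
     (18 * Q * (tc zbody + te (V 90 <. C 9 *. V 23) + 1) + te (V 90 <. C 9 *. V 23) + 1)) (of_nat (18 * Q) * 0)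
      (\<lambda>s'. ?I s' \<and> nev X Y s' (V 90 <. C 9 *. V 23) = 0)"
    unfolding zrun_def
    by (rule R_block_Seq) (use W Bd in auto)
  then show ?thesis
  proof (rule R_mono)
    have "1 * 20 \<le> Q * 20" using b by simp
    then show "tc (Set 90 (C 1);; Set 91 (C 0);; Set 92 (C 0);; Set 93 (C 0)) +
     (18 * Q * (tc zbody + te (V 90 <. C 9 *. V 23) + 1) + te (V 90 <. C 9 *. V 23) + 1) \<le> Kz * Q"
      using b by (simp add: Kz_def zrun_def algebra_simps)
  next
    fix s assume *: "?I s \<and> nev X Y s (V 90 <. C 9 *. V 23) = 0"
    obtain v1 m1 where s: "s = (v1, m1)" by (cases s)
    then have "v1 90 = 9 * Q" using * r by (auto simp: zinv_def)
    then show "(\<lambda>(v', m'). (\<forall>r<90. v' r = v r) \<and>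
     (\<forall>a. a < ZB \<or> ZB + 9 * Q \<le> a \<longrightarrow> m' a = m a) \<and>
     (\<forall>i. 1 \<le> i \<longrightarrow> i < 9 * Q \<longrightarrow> islcp (winstr W G Q) (9 * Q) i (m' (ZB + i)))) s"
      using * s by (auto simp: zinv_def)
  qed simp
qed

end

context params begin

lemma winstr_lcp:
  assumes "islcp (winstr W G Q) (9 * Q) (4 * Q + (j - G)) z" "G \<le> j" "j < G + Q"
  shows "4 * Q \<le> z \<longleftrightarrow> j \<in> winex x y W Q"
    "z < 4 * Q \<Longrightarrow> exact x y W (W + z) j \<and> x (W + z) \<noteq> y (W + z + j)"
proof -
  let ?s = "winstr W G Q"
  have X: "?s u = x (W + u)" if "u < 4 * Q" for u using that by (simp add: winstr_def)
  have Y: "?s (4 * Q + (j - G) + u) = y (W + u + j)" for u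
  proof -
    have "4 * Q + (j - G) + u - 4 * Q = (j - G) + u" by simp
    moreover have "W + G + (j - G + u) = W + u + j" using assms(2) by simp
    moreover have "\<not> 4 * Q + (j - G) + u < 4 * Q" by simp
    ultimately show ?thesis by (simp only: winstr_def if_False)
  qed
  note D = islcpD[OF assms(1)]
  have ex: "exact x y W (W + z') j" if "z' \<le> z" "z' \<le> 4 * Q" for z'
    unfolding exact_def
  proof (intro allI impI)
    fix v assume v: "W \<le> v" "v < W + z'"
    have "?s (v - W) = ?s (4 * Q + (j - G) + (v - W))" by (rule D(2)) (use v that in auto)
    moreover have "?s (v - W) = x v" using X[of "v - W"] v that by simp
    moreover have "?s (4 * Q + (j - G) + (v - W)) = y (v + j)" using Y[of "v - W"] v by simp
    ultimately show "x v = y (v + j)" by metis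
  qed
  show 2: "exact x y W (W + z) j \<and> x (W + z) \<noteq> y (W + z + j)" if z: "z < 4 * Q"
  proof
    show "exact x y W (W + z) j" using ex[of z] z by simp
    have "4 * Q + (j - G) + z < 9 * Q" using z assms(2,3) by linarith
    then have "?s z \<noteq> ?s (4 * Q + (j - G) + z)" by (rule D(3))
    then show "x (W + z) \<noteq> y (W + z + j)" using X[OF z] Y[of z] by metis
  qed
  show "4 * Q \<le> z \<longleftrightarrow> j \<in> winex x y W Q"
  proof
    assume "4 * Q \<le> z"
    then show "j \<in> winex x y W Q" using ex[of "4 * Q"] by (simp add: winex_def)
  next
    assume j: "j \<in> winex x y W Q"
    show "4 * Q \<le> z"
    proof (rule ccontr)
      assume "\<not> 4 * Q \<le> z"
      then show False using 2 winexD[OF j, of "W + z"] by simp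
    qed
  qed
qed

end

section \<open>Scanning a group of diagonals for the surviving progression\<close>

section \<open>Intersecting progressions\<close>

lemma scannedD:
  assumes "scanned F ne lo p hi" "ne \<noteq> 0"
  shows "F = ap lo p hi" "lo \<in> F" "hi \<in> F" "p = 0 \<Longrightarrow> lo = hi" "p \<le> hi - lo"
proof -
  note assms(1)[unfolded scanned_def if_not_P[OF assms(2)]]
  then show "F = ap lo p hi" "lo \<in> F" "hi \<in> F" "p = 0 \<Longrightarrow> lo = hi" "p \<le> hi - lo" by blast+
qed

text \<open>The threshold in register 49 gives the scan two uses: 4 Q selects the matches of a
  window, 0 turns it into the intersection of two progressions. Register 84 keeps the largest
  Z-value among the rejected diagonals.\<close>

definition fbody :: com where
  "fbody = IfC (inE (V 85) (V 40) (V 41) (V 42) &. inE (V 85) (V 46) (V 47) (V 48))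
      (Set 86 (Ld (V 10 +. (C 4 *. V 23 +. (V 85 -. V 22))));;
       IfC (V 86 <. V 49) (IfC (V 84 <. V 86) (Set 84 (V 86)) Skip)
         (IfC (V 80 =. C 0) (Set 80 (C 1);; Set 81 (V 85);; Set 82 (C 0);; Set 83 (V 85))
            (IfC (V 82 =. C 0) (Set 82 (V 85 -. V 81)) Skip;; Set 83 (V 85))))
      Skip;;
    Set 85 (V 85 +. C 1)"

definition fold :: com where
  "fold = (Set 80 (C 0);; Set 81 (C 0);; Set 82 (C 0);; Set 83 (C 0);; Set 84 (C 0);; Set 85 (V 22));;
     While (V 85 <. V 22 +. V 23) fbody"

definition Kf :: nat where "Kf = 2 * (tc fold + 10)"

context params begin

text \<open>First element, first gap and last element determine F because F is mid-closed; the
  recorded maximum takes care of the diagonals of A outside F.\<close>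

lemma fold_correct:
  assumes e: "env v" and r: "v 22 = G" "v 23 = Q"
    and b: "9 * Q \<le> Bd" "G \<le> Bd" "ZB \<le> Bd" "1 \<le> Q"
    and A: "A = ap (v 40) (v 41) (v 42) \<inter> ap (v 46) (v 47) (v 48) \<inter> {G..<G + Q}"
    and F: "F = {j \<in> A. v 49 \<le> m (ZB + (4 * Q + (j - G)))}" and mid: "midclosed F"
  shows "R w X Y fold (v, m) (Kf * Q) 0 (\<lambda>(v', m'). (\<forall>r<80. v' r = v r) \<and> m' = m \<and> v' 80 \<le> 1 \<and>
     scanned F (v' 80) (v' 81) (v' 82) (v' 83) \<and>
     (\<forall>j\<in>A. m (ZB + (4 * Q + (j - G))) < v 49 \<longrightarrow> m (ZB + (4 * Q + (j - G))) \<le> v' 84) \<and>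
     (v' 84 = 0 \<or> (\<exists>j\<in>A. m (ZB + (4 * Q + (j - G))) < v 49 \<and> v' 84 = m (ZB + (4 * Q + (j - G))))))"
proof -
  let ?z = "\<lambda>j. m (ZB + (4 * Q + (j - G)))"
  let ?J = "\<lambda>v' J. (\<forall>r<80. v' r = v r) \<and> v' 80 \<le> 1 \<and> G \<le> J \<and> J \<le> G + Q \<and>
     scanned {j \<in> F. j < J} (v' 80) (v' 81) (v' 82) (v' 83) \<and>
     (\<forall>j\<in>A. j < J \<longrightarrow> ?z j < v 49 \<longrightarrow> ?z j \<le> v' 84) \<and>
     (v' 84 = 0 \<or> (\<exists>j\<in>A. ?z j < v 49 \<and> v' 84 = ?z j))"
  let ?I = "\<lambda>(v', m'). ?J v' (v' 85) \<and> m' = m"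
  let ?mu = "\<lambda>(v', m' :: nat \<Rightarrow> nat). G + Q - v' 85"
  let ?g = "V 85 <. V 22 +. V 23"
  let ?v = "v(80 := 0, 81 := 0, 82 := 0, 83 := 0, 84 := 0, 85 := G)"
  have W: "R w X Y (While ?g fbody) (?v, m) (Q * (tc fbody + te ?g + 1) + te ?g + 1)
     (of_nat Q * 0) (\<lambda>s'. ?I s' \<and> nev X Y s' ?g = 0)"
  proof (rule R_While[where \<mu> = ?mu])
    fix s assume I: "?I s" and g: "nev X Y s ?g \<noteq> 0"
    obtain v1 where s: "s = (v1, m)" using I by (cases s) auto
    let ?i = "v1 85"
    have ag: "\<forall>r<80. v1 r = v r" using I s by auto
    have e1: "env v1" by (rule env_cong[OF e]) (use ag in auto)
    have r1: "v1 22 = G" "v1 23 = Q" "v1 49 = v 49" "v1 40 = v 40" "v1 41 = v 41" "v1 42 = v 42"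
       "v1 46 = v 46" "v1 47 = v 47" "v1 48 = v 48" using ag r by auto
    have i: "G \<le> ?i" "?i < G + Q" using I s g r1 by auto
    have sc: "scanned {j \<in> F. j < ?i} (v1 80) (v1 81) (v1 82) (v1 83)" using I s by auto
    define z where "z = ?z ?i"
    have safe: "bsafe w X Y fbody s"
    proof -
      have lt: "v1 80 \<noteq> 0 \<longrightarrow> v1 81 < ?i"
        using scannedD(2)[OF sc] by blast
      have "?i < 2 ^ w" "4 < (2::nat) ^ w" "4 * Q < 2 ^ w" "4 * Q + (?i - G) < 2 ^ w" "ZB + (4 * Q + (?i - G)) < 2 ^ w" "?i + 1 < 2 ^ w" "1 < (2::nat) ^ w"
        using i b Bd by linarith+
      then show ?thesis using lt i unfolding s fbody_def by (auto simp: r1 envD[OF e1])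
    qed
    show "R w X Y fbody s (tc fbody) 0 (\<lambda>s'. ?I s' \<and> ?mu s' < ?mu s)"
    proof (rule R_block'[OF safe])
      show "?I (nexec X Y fbody s) \<and> ?mu (nexec X Y fbody s) < ?mu s"
      proof (cases "?i \<in> A")
        case False
        then have n: "nexec X Y fbody s = (v1(85 := Suc ?i), m)"
          using i unfolding s fbody_def by (auto simp: r1 A)
        have "{j \<in> F. j < Suc ?i} = {j \<in> F. j < ?i}" using False F by (auto simp: less_Suc_eq)
        then show ?thesis unfolding n using I s i False by (auto simp: less_Suc_eq)
      next
        case True
        then have inA: "?i \<in> ap (v 40) (v 41) (v 42)" "?i \<in> ap (v 46) (v 47) (v 48)" using A by auto
        show ?thesis
        proof (cases "z < v 49")
          case zl: True
          then have n: "nexec X Y fbody s = (v1(86 := z, 84 := max (v1 84) z, 85 := Suc ?i), m)"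
            using inA unfolding s fbody_def by (auto simp: r1 z_def envD[OF e1] max_def fun_eq_iff)
          have eq: "{j \<in> F. j < Suc ?i} = {j \<in> F. j < ?i}" using zl F by (auto simp: less_Suc_eq z_def)
          have zm: "max (v1 84) z = 0 \<or> (\<exists>j\<in>A. ?z j < v 49 \<and> max (v1 84) z = ?z j)"
          proof -
            have 1: "\<exists>j\<in>A. ?z j < v 49 \<and> z = ?z j" using True zl unfolding z_def by blast
            have 2: "v1 84 = 0 \<or> (\<exists>j\<in>A. ?z j < v 49 \<and> v1 84 = ?z j)" using I unfolding s by blast
            show ?thesis
            proof (cases "v1 84 \<le> z")
              case True
              then have "max (v1 84) z = z" by simp
              then show ?thesis using 1 by metis
            next
              case False
              then have "max (v1 84) z = v1 84" by simp
              then show ?thesis using 2 by metis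
            qed
          qed
          have za: "\<forall>j\<in>A. j < Suc ?i \<longrightarrow> ?z j < v 49 \<longrightarrow> ?z j \<le> max (v1 84) z"
            using I s by (auto simp: less_Suc_eq z_def max_def le_max_iff_disj)
          show ?thesis unfolding n using I s i zm za eq by auto
        next
          case zl: False
          have iF: "?i \<in> F" using True zl F by (simp add: z_def)
          define p where "p = (if v1 80 = 0 then 0 else if v1 82 = 0 then ?i - v1 81 else v1 82)"
          have n: "nexec X Y fbody s = (v1(86 := z, 80 := (if v1 80 = 0 then 1 else v1 80), 81 := (if v1 80 = 0 then ?i else v1 81), 82 := p, 83 := ?i, 85 := Suc ?i), m)"
            using inA zl unfolding s fbody_def by (auto simp: r1 z_def envD[OF e1] p_def fun_eq_iff)
          have sc': "scanned {j \<in> F. j < Suc ?i} (if v1 80 = 0 then 1 else v1 80) (if v1 80 = 0 then ?i else v1 81) p ?i"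
          proof (cases "v1 80 = 0")
            case True
            then have "{j \<in> F. j < ?i} = {}" using sc by (simp add: scanned_def)
            then have "{j \<in> F. j < Suc ?i} = {?i}" using iF by (auto simp: less_Suc_eq)
            then show ?thesis using True by (auto simp: p_def intro!: scanned_first)
          next
            case False
            then show ?thesis using scanned_insert[OF mid sc False iF] by (simp add: p_def)
          qed
          have za: "\<forall>j\<in>A. j < Suc ?i \<longrightarrow> ?z j < v 49 \<longrightarrow> ?z j \<le> v1 84"
            using I s zl by (auto simp: less_Suc_eq z_def)
          show ?thesis unfolding n using I s i za sc' by auto
        qed
      qed
    qed simp
  next
    fix s assume "?I s" "nev X Y s ?g \<noteq> 0"
    then show "0 < ?mu s" using r by (cases s) auto
  next
    fix s assume "?I s"
    then show "esafe w X Y s ?g" using r b Bd by (cases s) auto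
  next
    show "?I (?v, m)" using F A by (auto simp: scanned_def)
    show "?mu (?v, m) \<le> Q" by auto
  qed
  have "R w X Y fold (v, m) (tc (Set 80 (C 0);; Set 81 (C 0);; Set 82 (C 0);; Set 83 (C 0);; Set 84 (C 0);; Set 85 (V 22)) +
     (Q * (tc fbody + te ?g + 1) + te ?g + 1)) (of_nat Q * 0) (\<lambda>s'. ?I s' \<and> nev X Y s' ?g = 0)"
    unfolding fold_def
    by (rule R_block_Seq) (use W Bd r in auto)
  then show ?thesis
  proof (rule R_mono)
    have "1 * 20 \<le> Q * 20" using b by simp
    then show "tc (Set 80 (C 0);; Set 81 (C 0);; Set 82 (C 0);; Set 83 (C 0);; Set 84 (C 0);; Set 85 (V 22)) +
     (Q * (tc fbody + te ?g + 1) + te ?g + 1) \<le> Kf * Q"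
      using b by (simp add: Kf_def fold_def algebra_simps)
  next
    fix s assume *: "?I s \<and> nev X Y s ?g = 0"
    obtain v1 where s: "s = (v1, m)" using * by (cases s) auto
    then have J: "v1 85 = G + Q" using * r by auto
    have "{j \<in> F. j < G + Q} = F" using F A by auto
    moreover have "\<forall>j\<in>A. j < G + Q" using A by auto
    ultimately show "(\<lambda>(v', m'). (\<forall>r<80. v' r = v r) \<and> m' = m \<and> v' 80 \<le> 1 \<and>
     scanned F (v' 80) (v' 81) (v' 82) (v' 83) \<and>
     (\<forall>j\<in>A. ?z j < v 49 \<longrightarrow> ?z j \<le> v' 84) \<and>
     (v' 84 = 0 \<or> (\<exists>j\<in>A. ?z j < v 49 \<and> v' 84 = ?z j))) s"
      using * s J by auto
  qed simp
qed

end

section \<open>Sampling for an early deviation\<close>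

section \<open>Random sampling\<close>

text \<open>Register 70 holds the least deviating offset seen and 71 the base address of the string
  that deviates there. Keeping the least offset is what makes the part before it clean, up to few
  deviations.\<close>

definition sbody :: com where
  "sbody = Set 72 (V 72 -. C 1);;
     IfC (V 73 <. V 70)
       (IfC (Ite (V 73 <. V 21 -. V 20) (notE (zeqE (V 20 +. V 73) (V 20 +. V 73 mod. V 41))) (C 0))
          (Set 70 (V 73);; Set 71 (V 20))
          (IfC (notE (zeqE (V 9 +. V 20 +. V 40 +. V 73) (V 20 +. V 73 mod. V 41)))
             (Set 70 (V 73);; Set 71 (V 9 +. V 20 +. V 40)) Skip)) Skip"

definition sample :: "nat \<Rightarrow> com" where
  "sample cc = (Set 74 (V 21 -. V 20 +. (V 42 -. V 40));; Set 70 (V 74);; Set 71 (C 0);;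
     Set 72 ((V 74 div. V 5 +. C 1) *. (C cc *. V 4)));;
     While (V 72) (Rnd 73 (V 74);; sbody)"

definition Ks :: nat where "Ks = 2 * (tc (sample 0) + 10)"

text \<open>The elements with fewer than c predecessors are the c smallest ones. Drawing any of
  these leaves fewer than c elements below the drawn one, so each of them is a successful
  sample.\<close>

lemma card_first:
  fixes S :: "nat set"
  assumes "finite S" "c \<le> card S"
  shows "c \<le> card {t \<in> S. card {t' \<in> S. t' < t} < c}"
  using assms(2)
proof (induction c)
  case (Suc c)
  let ?T = "\<lambda>c. {t \<in> S. card {t' \<in> S. t' < t} < c}"
  have fin: "finite (?T (Suc c))" using assms(1) by simp
  have sub: "?T c \<subseteq> ?T (Suc c)" by auto
  have IH: "c \<le> card (?T c)" using Suc by simp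
  show ?case
  proof (cases "Suc c \<le> card (?T c)")
    case True
    then show ?thesis using card_mono[OF fin sub] by linarith
  next
    case False
    then have c: "card (?T c) = c" using IH by simp
    have "S - ?T c \<noteq> {}"
    proof
      assume "S - ?T c = {}"
      then have "S = ?T c" by auto
      then show False using c Suc.prems by simp
    qed
    then have t: "Min (S - ?T c) \<in> S - ?T c" using assms(1) by (intro Min_in) auto
    let ?t = "Min (S - ?T c)"
    have "{t' \<in> S. t' < ?t} \<subseteq> ?T c"
    proof
      fix t' assume t': "t' \<in> {t' \<in> S. t' < ?t}"
      show "t' \<in> ?T c"
      proof (rule ccontr)
        assume "t' \<notin> ?T c"
        then have "t' \<in> S - ?T c" using t' by blast
        then have "?t \<le> t'" using assms(1) by (intro Min_le) auto
        then show False using t' by simp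
      qed
    qed
    then have "card {t' \<in> S. t' < ?t} \<le> c" using card_mono[of "?T c"] assms(1) c by fastforce
    then have "insert ?t (?T c) \<subseteq> ?T (Suc c)" using t sub by auto
    then have "card (insert ?t (?T c)) \<le> card (?T (Suc c))" using fin by (rule card_mono[rotated])
    then show ?thesis using t c assms(1) by simp
  qed
qed simp

text \<open>With success probability aa / len, about len / aa draws all fail with probability at
  most 1 / e, which is below 1 / 2; the factor \<open>n\<close> repeats this.\<close>

lemma half_power:
  fixes len aa n :: nat
  assumes "1 \<le> aa" "aa \<le> len"
  shows "(1 - real aa / real len) ^ ((len div aa + 1) * n) \<le> (1/2) ^ n"
proof -
  let ?q = "real aa / real len" and ?K = "len div aa + 1"
  have q: "0 \<le> 1 - ?q" using assms by (simp add: field_simps)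
  have "len \<le> aa * ?K" using assms by (metis add.commute div_mult_mod_eq less_imp_le mod_less_divisor mult.commute mult_Suc_right nat_add_left_cancel_le plus_1_eq_Suc less_le_trans zero_less_one)
  then have "real len \<le> real aa * real ?K" by (metis of_nat_le_iff of_nat_mult)
  then have qK: "1 \<le> ?q * real ?K" using assms by (simp add: field_simps)
  have "1 - ?q \<le> exp (- ?q)" using exp_ge_add_one_self[of "- ?q"] by simp
  then have "(1 - ?q) ^ ?K \<le> exp (- ?q) ^ ?K" using q by (intro power_mono) auto
  also have "\<dots> = exp (- (?q * real ?K))" using exp_of_nat2_mult[of "- ?q" ?K] by (simp only: mult_minus_left)
  also have "\<dots> \<le> exp (- 1)" using qK by simp
  also have "\<dots> \<le> 1 / 2"
  proof -
    have "2 \<le> exp (1::real)" using exp_ge_add_one_self[of 1] by simp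
    then show ?thesis by (simp add: exp_minus field_simps)
  qed
  finally have "((1 - ?q) ^ ?K) ^ n \<le> (1/2) ^ n" using q by (intro power_mono) auto
  then show ?thesis by (simp only: power_mult)
qed

lemma R_trivial: "1 \<le> d \<Longrightarrow> R w X Y c s t d Q"
  unfolding R_def by (auto intro: order_trans[OF loss_le_1])

lemma R_assoc: "R w X Y ((a ;; b) ;; c) s t d Q = R w X Y (a ;; (b ;; c)) s t d Q"
  by (simp add: R_def)

context params begin

definition fail0 :: ennreal where "fail0 = ennreal ((1/2) ^ (cc * L))"

definition found :: "nat \<Rightarrow> nat \<Rightarrow> nat \<Rightarrow> nat \<Rightarrow> nat \<Rightarrow> nat \<Rightarrow> bool" where
  "found ST EN lo p t BB \<longleftrightarrow> BB = ST \<and> ST + t < EN \<and> x (ST + t) \<noteq> x (ST + t mod p) \<or>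
     BB = H + ST + lo \<and> y (ST + lo + t) \<noteq> x (ST + t mod p)"

text \<open>Induction on the remaining draws. Once fewer than \<open>aa\<close> deviations lie below
  the current minimum, this stays so and the failure bound is 0. Otherwise a draw hits one of the
  \<open>aa\<close> least deviations with probability at least aa / len and ends the danger, so n
  remaining draws fail with probability at most (1 - aa / len) ^ n.\<close>

lemma sample_correct:
  assumes e: "env v" and r: "v 20 = ST" "v 21 = EN" "v 40 = lo" "v 41 = p" "v 42 = hi"
    and b: "lo \<le> hi" "hi - lo < Q" "p \<le> hi - lo" "p = 0 \<longrightarrow> hi = lo" "ST + 4 * Q \<le> EN" "EN \<le> H" "hi \<le> Bd"
      "len = EN - ST + (hi - lo)" "(len + 1) * (cc * L) \<le> Bd"
  shows "R w X Y (sample cc) (v, m) (Ks * ((len div aa + 1) * (cc * L) + 1)) fail0 (\<lambda>(v', m'). (\<forall>r<70. v' r = v r) \<and> m' = m \<and>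
     v' 74 = len \<and> v' 70 \<le> len \<and> (v' 70 < len \<longrightarrow> found ST EN lo p (v' 70) (v' 71)) \<and>
     card {t. t < v' 70 \<and> dev x y ST EN lo p t} < aa)"
proof -
  let ?dev = "dev x y ST EN lo p"
  let ?g = "V 72"
  let ?SI = "\<lambda>v'. (\<forall>r<70. v' r = v r) \<and> v' 74 = len \<and> v' 70 \<le> len \<and> (v' 70 < len \<longrightarrow> found ST EN lo p (v' 70) (v' 71))"
  let ?good = "\<lambda>v'. card {t. t < v' 70 \<and> ?dev t} < aa"
  let ?Q = "\<lambda>(v', m'). ?SI v' \<and> m' = m \<and> ?good v'"
  let ?q = "real aa / real len"
  let ?tb = "te (V 74) + 1 + tc sbody + te ?g + 1"
  have len: "0 < len" "len \<le> EN - ST + Q" "EN - ST \<le> len" using b by auto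
  have loop: "R w X Y (While ?g (Rnd 73 (V 74) ;; sbody)) (v1, m) (n * ?tb + te ?g + 1) (if ?good v1 then 0 else ennreal ((1 - ?q) ^ n)) ?Q"
    if "?SI v1" "v1 72 = n" "n < 2 ^ w" for n v1
    using that
  proof (induction n arbitrary: v1)
    case 0
    show ?case
    proof (cases "?good v1")
      case True
      have "R w X Y (While ?g (Rnd 73 (V 74) ;; sbody)) (v1, m) (te ?g + 1) 0 ?Q"
        by (rule R_While_False) (use 0 True in auto)
      then show ?thesis using True by simp
    next
      case False
      then show ?thesis by (intro R_trivial) simp
    qed
  next
    case (Suc n)
    have ag: "\<forall>r<70. v1 r = v r" using Suc by auto
    have e1: "env v1" by (rule env_cong[OF e]) (use ag in auto)
    have r1: "v1 20 = ST" "v1 21 = EN" "v1 40 = lo" "v1 41 = p" "v1 42 = hi" "v1 74 = len" "v1 70 \<le> len" using ag r Suc by auto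
    define upd where "upd t = (v1(73 := t, 72 := n))(70 := (if t < v1 70 \<and> ?dev t then t else v1 70),
        71 := (if t < v1 70 \<and> ?dev t then (if ST + t < EN \<and> x (ST + t) \<noteq> x (ST + t mod p) then ST else H + ST + lo) else v1 71))" for t
    have body: "bsafe w X Y sbody (v1(73 := t), m)" "nexec X Y sbody (v1(73 := t), m) = (upd t, m)" if t: "t < len" for t
    proof -
      let ?w = "v1(73 := t, 72 := n)"
      have e2: "env ?w" using e1 by (simp add: env_def)
      have tp: "ST + t mod p < EN"
      proof (cases "p = 0")
        case False
        then have "t mod p < p" by simp
        then show ?thesis using b by linarith
      qed (use b t in auto)
      have z1: "zz (nev X Y (?w, m) (V 20 +. V 73 mod. V 41)) = x (ST + t mod p)"
        using tp b by (simp add: r1 zz_less)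
      have z2: "zz (nev X Y (?w, m) (V 9 +. V 20 +. V 40 +. V 73)) = y (ST + lo + t)"
        by (simp add: r1 envD[OF e1] zz_add add.assoc)
      have z3: "zz (nev X Y (?w, m) (V 20 +. V 73)) = x (ST + t)" if "ST + t < EN"
        using that b by (simp add: r1 zz_less)
      have lt: "t < EN - ST \<longleftrightarrow> ST + t < EN" using b by auto
      have bb: "ST + t mod p < 2 ^ w" "H + ST < 2 ^ w" "H + ST + lo < 2 ^ w" "H + ST + lo + t < 2 ^ w" "ST + t < 2 ^ w" "EN < 2 ^ w" "ST \<le> EN" "1 < (2::nat) ^ w" "Suc n < 2 ^ w"
        using tp b t len Bd Suc(4) by linarith+
      have s1: "esafe w X Y (?w, m) (V 20 +. V 73 mod. V 41)" "esafe w X Y (?w, m) (V 9 +. V 20 +. V 40 +. V 73)" "esafe w X Y (?w, m) (V 20 +. V 73)"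
        using bb by (simp_all add: r1 envD[OF e1])
      have s2: "esafe w X Y (?w, m) (zeqE (V 20 +. V 73) (V 20 +. V 73 mod. V 41))" "esafe w X Y (?w, m) (zeqE (V 9 +. V 20 +. V 40 +. V 73) (V 20 +. V 73 mod. V 41))"
        by (rule esafe_zeqE[OF e2]; use s1 bb in \<open>simp add: r1 envD[OF e1]\<close>)+
      have n1: "nev X Y (?w, m) (zeqE (V 20 +. V 73) (V 20 +. V 73 mod. V 41)) = of_bool (x (ST + t) = x (ST + t mod p))" if "ST + t < EN"
        unfolding nev_zeqE[OF e2] z1 z3[OF that] ..
      have n2: "nev X Y (?w, m) (zeqE (V 9 +. V 20 +. V 40 +. V 73) (V 20 +. V 73 mod. V 41)) = of_bool (y (ST + lo + t) = x (ST + t mod p))"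
        unfolding nev_zeqE[OF e2] z1 z2 ..
      have st: "nexec X Y (Set 72 (V 72 -. C 1)) (v1(73 := t), m) = (?w, m)" using Suc(3) by auto
      have "bsafe w X Y (Set 72 (V 72 -. C 1)) (v1(73 := t), m)" using Suc(3) bb by simp
      then show "bsafe w X Y sbody (v1(73 := t), m)"
        unfolding sbody_def bsafe.simps(6) st
        using s2 bb by (simp add: r1 lt envD[OF e1])
      show "nexec X Y sbody (v1(73 := t), m) = (upd t, m)"
        unfolding sbody_def nexec.simps(6) st
        by (cases "ST + t < EN") (auto simp: r1 lt n1 n2 upd_def dev_def fun_eq_iff envD[OF e1])
    qed
    have SI: "?SI (upd t)" "upd t 72 = n" "upd t 70 \<le> v1 70" if "t < len" for t
      using Suc(2) that by (auto simp: upd_def found_def dev_def)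
    let ?D = "\<lambda>t. if ?good (upd t) then 0 else ennreal ((1 - ?q) ^ n)"
    let ?T = "n * ?tb + te ?g + 1"
    have step: "R w X Y (sbody ;; While ?g (Rnd 73 (V 74) ;; sbody)) (v1(73 := t), m) (tc sbody + ?T) (?D t) ?Q" if t: "t < len" for t
    proof (rule R_block_Seq[OF body(1)[OF t]])
      show "R w X Y (While ?g (Rnd 73 (V 74) ;; sbody)) (nexec X Y sbody (v1(73 := t), m)) ?T (?D t) ?Q"
        unfolding body(2)[OF t] by (rule Suc.IH) (use SI[OF t] Suc(4) in auto)
    qed
    have q: "0 \<le> 1 - ?q \<or> len < aa" using len by (auto simp: field_simps)
    have sum: "(\<Sum>t<len. ?D t) \<le> of_nat len * (if ?good v1 then 0 else ennreal ((1 - ?q) ^ Suc n))"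
    proof (cases "?good v1")
      case True
      have "?good (upd t)" if "t < len" for t
      proof -
        have "{t'. t' < upd t 70 \<and> ?dev t'} \<subseteq> {t'. t' < v1 70 \<and> ?dev t'}" using SI(3)[OF that] by auto
        then have "card {t'. t' < upd t 70 \<and> ?dev t'} \<le> card {t'. t' < v1 70 \<and> ?dev t'}" by (intro card_mono) auto
        then show ?thesis using True by linarith
      qed
      then show ?thesis using True by simp
    next
      case False
      let ?S = "{t. t < v1 70 \<and> ?dev t}"
      let ?B = "{t \<in> ?S. card {t' \<in> ?S. t' < t} < aa}"
      have cB: "aa \<le> card ?B" using False by (intro card_first) auto
      have Bsub: "?B \<subseteq> {..<len}" using r1 by auto
      then have cl: "card ?B \<le> len" using card_mono[of "{..<len}" ?B] by simp
      have q: "0 \<le> 1 - ?q" using cB cl len by (simp add: field_simps)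
      have good: "?good (upd t)" if "t \<in> ?B" for t
      proof -
        have "upd t 70 = t" using that by (auto simp: upd_def)
        moreover have "{t'. t' < t \<and> ?dev t'} = {t' \<in> ?S. t' < t}" using that by auto
        ultimately show ?thesis using that by simp
      qed
      have "(\<Sum>t<len. ?D t) \<le> (\<Sum>t<len. if t \<in> ?B then 0 else ennreal ((1 - ?q) ^ n))"
        using good by (intro sum_mono) auto
      also have "\<dots> = (\<Sum>t\<in>{..<len} - ?B. ennreal ((1 - ?q) ^ n))"
        by (intro sum.mono_neutral_cong_right) auto
      also have "\<dots> = of_nat (card ({..<len} - ?B)) * ennreal ((1 - ?q) ^ n)" by simp
      also have "card ({..<len} - ?B) = len - card ?B" using Bsub by (subst card_Diff_subset) (auto intro: finite_subset)
      also have "of_nat (len - card ?B) * ennreal ((1 - ?q) ^ n) \<le> of_nat (len - aa) * ennreal ((1 - ?q) ^ n)"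
        using cB by (intro mult_right_mono) auto
      also have "\<dots> = ennreal (real (len - aa) * (1 - ?q) ^ n)"
        using q by (simp add: ennreal_mult ennreal_of_nat_eq_real_of_nat)
      also have "real (len - aa) = real len * (1 - ?q)" using len cB cl by (simp add: of_nat_diff field_simps)
      also have "ennreal (real len * (1 - ?q) * (1 - ?q) ^ n) = of_nat len * ennreal ((1 - ?q) ^ Suc n)"
        using q by (simp add: ennreal_mult ennreal_of_nat_eq_real_of_nat mult.assoc)
      finally show ?thesis using False by simp
    qed
    have "R w X Y (Rnd 73 (V 74) ;; (sbody ;; While ?g (Rnd 73 (V 74) ;; sbody))) (v1, m) (te (V 74) + 1 + (tc sbody + ?T))
       (if ?good v1 then 0 else ennreal ((1 - ?q) ^ Suc n)) ?Q"
      by (rule R_Rnd[where N = len and D = ?D]) (use step sum len r1 in auto)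
    then have "R w X Y ((Rnd 73 (V 74) ;; sbody) ;; While ?g (Rnd 73 (V 74) ;; sbody)) (v1, m) (te (V 74) + 1 + (tc sbody + ?T))
       (if ?good v1 then 0 else ennreal ((1 - ?q) ^ Suc n)) ?Q" by (simp only: R_assoc)
    then have "R w X Y (While ?g (Rnd 73 (V 74) ;; sbody)) (v1, m) (te ?g + 1 + (te (V 74) + 1 + (tc sbody + ?T)))
       (if ?good v1 then 0 else ennreal ((1 - ?q) ^ Suc n)) ?Q"
      by (rule R_While_True[rotated 2]) (use Suc in auto)
    then show ?case by (rule R_mono) auto
  qed
  let ?n = "(len div aa + 1) * (cc * L)"
  let ?init = "Set 74 (V 21 -. V 20 +. (V 42 -. V 40));; Set 70 (V 74);; Set 71 (C 0);; Set 72 ((V 74 div. V 5 +. C 1) *. (C cc *. V 4))"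
  let ?v = "v(74 := len, 70 := len, 71 := 0, 72 := ?n)"
  have nb: "?n \<le> (len + 1) * (cc * L)" by (intro mult_right_mono) (auto simp: div_le_dividend)
  then have n: "?n < 2 ^ w" using b Bd by linarith
  have n': "len div aa + 1 < 2 ^ w" "len < 2 ^ w" using div_le_dividend[of len aa] b Bd len by linarith+
  have "R w X Y (sample cc) (v, m) (tc ?init + (?n * ?tb + te ?g + 1)) (if ?good ?v then 0 else ennreal ((1 - ?q) ^ ?n)) ?Q"
    unfolding sample_def
  proof (rule R_block_Seq)
    have s: "EN < 2 ^ w" "ST \<le> EN" "hi < 2 ^ w" "cc < 2 ^ w" "cc * L < 2 ^ w" "1 < (2::nat) ^ w" using b Bd by linarith+
    show "bsafe w X Y ?init (v, m)"
      using b n n' s by (simp add: r envD[OF e])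
    have i: "nexec X Y ?init (v, m) = (?v, m)" using b by (simp add: r envD[OF e])
    show "R w X Y (While ?g (Rnd 73 (V 74) ;; sbody)) (nexec X Y ?init (v, m)) (?n * ?tb + te ?g + 1) (if ?good ?v then 0 else ennreal ((1 - ?q) ^ ?n)) ?Q"
      unfolding i by (rule loop) (use n in auto)
  qed
  then show ?thesis
  proof (rule R_mono)
    show "tc ?init + (?n * ?tb + te ?g + 1) \<le> Ks * (?n + 1)"
    proof -
      have "tc ?init + te ?g + 1 \<le> Ks" "?tb \<le> Ks" by (simp_all add: Ks_def sample_def)
      then have "tc ?init + te ?g + 1 + ?n * ?tb \<le> Ks + ?n * Ks" by (intro add_mono mult_left_mono) auto
      then show ?thesis by (simp add: algebra_simps)
    qed
    show "(if ?good ?v then 0 else ennreal ((1 - ?q) ^ ?n)) \<le> fail0"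
    proof (cases "?good ?v")
      case False
      have "{t. t < len \<and> ?dev t} \<subseteq> {..<len}" by auto
      then have "card {t. t < len \<and> ?dev t} \<le> len" using card_mono[of "{..<len}"] by fastforce
      then have "aa \<le> len" using False by simp
      then show ?thesis using half_power[OF aa, of len "cc * L"] False by (simp add: fail0_def ennreal_leI)
    qed simp
  qed auto
qed

end

section \<open>Extending a progression over an interval\<close>

section \<open>Certifying an interval\<close>

definition winstep :: com where
  "winstep = zrun ;; (Set 46 (V 40) ;; Set 47 (V 41) ;; Set 48 (V 42) ;; Set 49 (C 4 *. V 23)) ;; fold"

definition Kw :: nat where "Kw = Kz + Kf + tc winstep"

context params begin

text \<open>The Z-values settle both sides at once: the survivors are the diagonals reaching 4 Q,
  and the largest smaller value bounds where exact matches of the others can end, whenever they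
  started at or before the window.\<close>

lemma winstep_correct:
  assumes e: "env v" and r: "v 22 = G" "v 23 = Q" "v 45 = W" "v 40 = lo" "v 41 = p" "v 42 = hi"
    and b: "W + 4 * Q \<le> H" "9 * Q \<le> Bd" "G + Q \<le> Bd" "ZB + 9 * Q \<le> Bd" "1 \<le> Q" "G \<le> lo" "hi < G + Q"
  shows "R w X Y winstep (v, m) (Kw * Q) 0 (\<lambda>(v', m'). (\<forall>r<46. v' r = v r) \<and> (\<forall>r. 50 \<le> r \<and> r < 80 \<longrightarrow> v' r = v r) \<and>
     (\<forall>a. a < ZB \<or> ZB + 9 * Q \<le> a \<longrightarrow> m' a = m a) \<and>
     scanned (ap lo p hi \<inter> winex x y W Q) (v' 80) (v' 81) (v' 82) (v' 83) \<and>
     (\<forall>j\<in>ap lo p hi. j \<notin> winex x y W Q \<longrightarrow> (\<forall>s e. s \<le> W \<longrightarrow> exact x y s e j \<longrightarrow> e \<le> W + v' 84)) \<and>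
     (v' 84 = 0 \<or> (\<exists>j\<in>ap lo p hi. v' 84 < 4 * Q \<and> exact x y W (W + v' 84) j)))"
    (is "R w X Y winstep (v, m) _ 0 ?P")
proof -
  let ?mid = "Set 46 (V 40) ;; Set 47 (V 41) ;; Set 48 (V 42) ;; Set 49 (C 4 *. V 23)"
  let ?A = "ap lo p hi"
  have A: "?A \<subseteq> {G..<G + Q}" using b by (auto simp: ap_iff)
  have b': "9 * Q \<le> Bd" "G \<le> Bd" "ZB \<le> Bd" "1 \<le> Q" using b by linarith+
  have "R w X Y winstep (v, m) (Kz * Q + (tc ?mid + Kf * Q)) (0 + 0) ?P"
    unfolding winstep_def
  proof (rule R_Seq[OF zrun_correct[OF e r(1-3) b(1) b']])
    fix s assume "(\<lambda>(v', m'). (\<forall>r<90. v' r = v r) \<and>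
     (\<forall>a. a < ZB \<or> ZB + 9 * Q \<le> a \<longrightarrow> m' a = m a) \<and>
     (\<forall>i. 1 \<le> i \<longrightarrow> i < 9 * Q \<longrightarrow> islcp (winstr W G Q) (9 * Q) i (m' (ZB + i)))) s"
    then obtain v1 m1 where s: "s = (v1, m1)" and v1: "\<forall>r<90. v1 r = v r"
      and m1: "\<forall>a. a < ZB \<or> ZB + 9 * Q \<le> a \<longrightarrow> m1 a = m a"
      and lcp: "\<And>i. 1 \<le> i \<Longrightarrow> i < 9 * Q \<Longrightarrow> islcp (winstr W G Q) (9 * Q) i (m1 (ZB + i))" by (cases s) auto
    let ?z = "\<lambda>j. m1 (ZB + (4 * Q + (j - G)))"
    have z: "4 * Q \<le> ?z j \<longleftrightarrow> j \<in> winex x y W Q" "?z j < 4 * Q \<Longrightarrow> exact x y W (W + ?z j) j \<and> x (W + ?z j) \<noteq> y (W + ?z j + j)"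
      if "j \<in> ?A" for j
    proof -
      have j: "G \<le> j" "j < G + Q" using A that by auto
      have "islcp (winstr W G Q) (9 * Q) (4 * Q + (j - G)) (?z j)" by (rule lcp) (use j b in auto)
      from winstr_lcp[OF this j] show "4 * Q \<le> ?z j \<longleftrightarrow> j \<in> winex x y W Q" "?z j < 4 * Q \<Longrightarrow> exact x y W (W + ?z j) j \<and> x (W + ?z j) \<noteq> y (W + ?z j + j)" by blast+
    qed
    let ?v2 = "v1(46 := lo, 47 := p, 48 := hi, 49 := 4 * Q)"
    have n: "nexec X Y ?mid s = (?v2, m1)" using v1 r by (simp add: s)
    have e2: "env ?v2" by (rule env_cong[OF e]) (use v1 in auto)
    have mid: "midclosed (?A \<inter> winex x y W Q)"
    proof -
      have "?A \<inter> winex x y W Q = ?A \<inter> (winex x y W Q \<inter> {G..<G + Q})" using A by auto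
      then show ?thesis by (simp only: midclosed_Int midclosed_ap midclosed_winex)
    qed
    have F: "?A \<inter> winex x y W Q = {j \<in> ?A. ?v2 49 \<le> ?z j}" using z(1) by auto
    have A2: "?A = ap (?v2 40) (?v2 41) (?v2 42) \<inter> ap (?v2 46) (?v2 47) (?v2 48) \<inter> {G..<G + Q}"
      using A v1 r by auto
    have r2: "?v2 22 = G" "?v2 23 = Q" using v1 r by auto
    note fc = fold_correct[OF e2 r2 b' A2 F mid]
    show "R w X Y (?mid ;; fold) s (tc ?mid + Kf * Q) 0 ?P"
    proof (rule R_block_Seq)
      show "bsafe w X Y ?mid s" using v1 r b Bd by (simp add: s)
      show "R w X Y fold (nexec X Y ?mid s) (Kf * Q) 0 ?P"
        unfolding n
      proof (rule R_mono[OF fc])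
        fix s' assume *: "(\<lambda>(v', m'). (\<forall>r<80. v' r = ?v2 r) \<and> m' = m1 \<and> v' 80 \<le> 1 \<and>
     scanned (?A \<inter> winex x y W Q) (v' 80) (v' 81) (v' 82) (v' 83) \<and>
     (\<forall>j\<in>?A. ?z j < ?v2 49 \<longrightarrow> ?z j \<le> v' 84) \<and>
     (v' 84 = 0 \<or> (\<exists>j\<in>?A. ?z j < ?v2 49 \<and> v' 84 = ?z j))) s'"
        obtain v' m' where s': "s' = (v', m')" by (cases s')
        have k: "e \<le> W + v' 84" if j: "j \<in> ?A" "j \<notin> winex x y W Q" "s \<le> W" "exact x y s e j" for j s e
        proof -
          have zl: "?z j < 4 * Q" using z(1)[OF j(1)] j(2) by auto
          have "?z j \<le> v' 84" using * zl j(1) by (auto simp: s')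
          moreover have "e \<le> W + ?z j"
          proof (rule ccontr)
            assume "\<not> e \<le> W + ?z j"
            then have "x (W + ?z j) = y (W + ?z j + j)" using j(3,4) by (auto simp: exact_def)
            then show False using z(2)[OF j(1) zl] by simp
          qed
          ultimately show ?thesis by linarith
        qed
        have "v' 84 = 0 \<or> (\<exists>j\<in>?A. v' 84 < 4 * Q \<and> exact x y W (W + v' 84) j)"
        proof (cases "v' 84 = 0")
          case False
          then obtain j where "j \<in> ?A" "?z j < 4 * Q" "v' 84 = ?z j" using * by (auto simp: s')
          then show ?thesis using z(2)[of j] by metis
        qed simp
        then show "?P s'" using * k m1 v1 unfolding s' by auto
      qed auto
    qed
  qed
  then show ?thesis
  proof (rule R_mono)
    have "tc ?mid * 1 \<le> tc winstep * Q" using b(5) by (intro mult_mono) (auto simp: winstep_def)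
    then show "Kz * Q + (tc ?mid + Kf * Q) \<le> Kw * Q" by (simp only: Kw_def add_mult_distrib)
  qed auto
qed

end

definition bbody :: com where
  "bbody = Set 78 ((V 76 +. V 77) div. C 2);;
    IfC (zeqE (V 71 +. V 79 +. V 78 *. V 41) (V 20 +. V 79)) (Set 76 (V 78)) (Set 77 (V 78))"

text \<open>Along the residue class of the deviation modulo p, the first symbol agrees with the
  reference and the last one does not. Agreement need not be monotone, but halving still finds an
  adjacent pair at distance p whose symbols differ.\<close>

definition bsearch :: com where
  "bsearch = (Set 79 (V 70 mod. V 41);; Set 76 (C 0);; Set 77 (V 70 div. V 41));;
    While (V 76 +. C 1 <. V 77) bbody;;
    Set 60 (V 79 +. V 76 *. V 41)"

text \<open>The binary logarithm rounded up, which drops with every halving of a search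
  interval.\<close>

definition bits :: "nat \<Rightarrow> nat" where "bits d = (LEAST e. d \<le> 2 ^ e)"

lemma bits_le: "d \<le> 2 ^ e \<Longrightarrow> bits d \<le> e"
  unfolding bits_def by (rule Least_le)

lemma bits_ge: "d \<le> 2 ^ bits d"
  unfolding bits_def by (rule LeastI[of _ d]) (simp add: less_imp_le)

lemma bits_half: "2 \<le> d \<Longrightarrow> 2 * d' \<le> d + 1 \<Longrightarrow> bits d' < bits d"
proof -
  assume d: "2 \<le> d" "2 * d' \<le> d + 1"
  then obtain e where e: "bits d = Suc e" using bits_ge[of d] by (cases "bits d") auto
  then have "2 * d' \<le> 2 * 2 ^ e + 1" using bits_ge[of d] d by simp
  then have "d' \<le> 2 ^ e" by linarith
  then show ?thesis using bits_le e by (metis less_Suc_eq_le)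
qed

definition Kb :: nat where "Kb = 2 * (tc bsearch + 10)"

context params begin

lemma bsearch_correct:
  assumes e: "env v" and r: "v 20 = ST" "v 41 = p" "v 70 = t" "v 71 = BB"
    and p: "0 < p" and b: "ST + p \<le> H" "BB + t + p \<le> 7 * Bd" "t \<le> 2 * Bd"
    and f0: "zz (BB + t mod p) = x (ST + t mod p)" and f1: "zz (BB + t) \<noteq> x (ST + t mod p)"
  shows "R w X Y bsearch (v, m) (Kb * (LB + 1)) 0 (\<lambda>(v', m'). (\<forall>r. r \<noteq> 60 \<and> r < 76 \<longrightarrow> v' r = v r) \<and> m' = m \<and>
     zz (BB + v' 60) = x (ST + t mod p) \<and> zz (BB + v' 60 + p) \<noteq> x (ST + t mod p) \<and> v' 60 + p \<le> t)" (is "R w X Y bsearch (v, m) _ 0 ?P")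
proof -
  let ?t0 = "t mod p" and ?n = "t div p"
  let ?c = "x (ST + ?t0)"
  let ?f = "\<lambda>i. zz (BB + ?t0 + i * p)"
  let ?g = "V 76 +. C 1 <. V 77"
  let ?I = "\<lambda>(v', m'). (\<forall>r<76. v' r = v r) \<and> m' = m \<and> v' 79 = ?t0 \<and> v' 76 < v' 77 \<and> v' 77 \<le> ?n \<and> ?f (v' 76) = ?c \<and> ?f (v' 77) \<noteq> ?c"
  let ?mu = "\<lambda>(v', m' :: nat \<Rightarrow> nat). bits (v' 77 - v' 76)"
  let ?init = "Set 79 (V 70 mod. V 41);; Set 76 (C 0);; Set 77 (V 70 div. V 41)"
  let ?v = "v(79 := ?t0, 76 := 0, 77 := ?n)"
  have tn: "t = ?t0 + ?n * p" by simp
  have n0: "0 < ?n"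
  proof (rule ccontr)
    assume "\<not> 0 < ?n"
    then have "t mod p = t" using tn by simp
    then show False using f0 f1 by simp
  qed
  have np: "?n \<le> t" by simp
  have t0p: "?t0 < p" using p by simp
  have W: "R w X Y (While ?g bbody) (?v, m) (LB * (tc bbody + te ?g + 1) + te ?g + 1) (of_nat LB * 0) (\<lambda>s'. ?I s' \<and> nev X Y s' ?g = 0)"
  proof (rule R_While[where \<mu> = ?mu])
    fix s assume I: "?I s" and g: "nev X Y s ?g \<noteq> 0"
    obtain v1 where s: "s = (v1, m)" using I by (cases s) auto
    have ag: "\<forall>r<76. v1 r = v r" using I s by auto
    have e1: "env v1" by (rule env_cong[OF e]) (use ag in auto)
    have r1: "v1 20 = ST" "v1 41 = p" "v1 71 = BB" "v1 79 = ?t0" using ag r I s by auto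
    let ?a = "v1 76" and ?b = "v1 77"
    let ?mid = "(?a + ?b) div 2"
    have ab: "?a < ?b" "?b \<le> ?n" "Suc ?a < ?b" using I g s by auto
    have mid: "?a < ?mid" "?mid < ?b" using ab by linarith+
    let ?w = "v1(78 := ?mid)"
    have e2: "env ?w" using e1 by (simp add: env_def)
    have mp: "?mid * p \<le> ?n * p" using mid ab by (intro mult_right_mono) auto
    then have mt: "?t0 + ?mid * p \<le> t" using tn by linarith
    have z1: "zz (nev X Y (?w, m) (V 71 +. V 79 +. V 78 *. V 41)) = ?f ?mid" by (simp add: r1 ac_simps)
    have z2: "zz (nev X Y (?w, m) (V 20 +. V 79)) = ?c" using b t0p by (simp add: r1 zz_less)
    have bb: "?mid < 2 ^ w" "?mid * p < 2 ^ w" "BB + ?t0 < 2 ^ w" "BB + ?t0 + ?mid * p < 2 ^ w" "ST + ?t0 < 2 ^ w" "?a + ?b < 2 ^ w" "2 < (2::nat) ^ w" "?a + 1 < 2 ^ w"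
      using mt b Bd t0p mid ab np by linarith+
    have sz: "esafe w X Y (?w, m) (zeqE (V 71 +. V 79 +. V 78 *. V 41) (V 20 +. V 79))"
      by (rule esafe_zeqE[OF e2]) (use bb in \<open>simp_all add: r1 ac_simps\<close>)
    have nz: "nev X Y (?w, m) (zeqE (V 71 +. V 79 +. V 78 *. V 41) (V 20 +. V 79)) = of_bool (?f ?mid = ?c)"
      unfolding nev_zeqE[OF e2] z1 z2 ..
    show "R w X Y bbody s (tc bbody) 0 (\<lambda>s'. ?I s' \<and> ?mu s' < ?mu s)"
    proof (rule R_block')
      show "bsafe w X Y bbody s" using sz bb by (simp add: s bbody_def)
      have m1: "bits (?b - ?mid) < bits (?b - ?a)" "bits (?mid - ?a) < bits (?b - ?a)"
        by (rule bits_half; use mid ab in linarith)+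
      show "?I (nexec X Y bbody s) \<and> ?mu (nexec X Y bbody s) < ?mu s"
        using I ab mid m1 nz by (auto simp: s bbody_def)
    qed simp
  next
    fix s assume "?I s" and g: "nev X Y s ?g \<noteq> 0"
    obtain v1 m1 where s: "s = (v1, m1)" by (cases s) auto
    have "2 \<le> v1 77 - v1 76" using g by (auto simp: s)
    then have "bits 1 < bits (v1 77 - v1 76)" by (intro bits_half) auto
    then show "0 < ?mu s" by (simp add: s)
  next
    fix s assume I: "?I s"
    obtain v1 where s: "s = (v1, m)" using I by (cases s) auto
    have "v1 76 < v1 77" "v1 77 \<le> ?n" using I s by auto
    then have "v1 76 + 1 < 2 ^ w" "1 < (2::nat) ^ w" using np b Bd by linarith+
    then show "esafe w X Y s ?g" by (simp add: s)
  next
    have "BB + t = t + BB" by simp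
    then have "zz (t + BB) \<noteq> ?c" using f1 by metis
    then show "?I (?v, m)" using n0 f0 by auto
    have "?n \<le> 2 ^ LB" using np b Bd by linarith
    then show "?mu (?v, m) \<le> LB" by (auto intro: bits_le)
  qed
  have "R w X Y bsearch (v, m) (tc ?init + ((LB * (tc bbody + te ?g + 1) + te ?g + 1) + tc (Set 60 (V 79 +. V 76 *. V 41)))) (of_nat LB * 0 + 0) ?P"
    unfolding bsearch_def
  proof (rule R_block_Seq)
    show "bsafe w X Y ?init (v, m)" using Bd by simp
    have i: "nexec X Y ?init (v, m) = (?v, m)" by (simp add: r)
    show "R w X Y (While ?g bbody ;; Set 60 (V 79 +. V 76 *. V 41)) (nexec X Y ?init (v, m)) ((LB * (tc bbody + te ?g + 1) + te ?g + 1) + tc (Set 60 (V 79 +. V 76 *. V 41))) (of_nat LB * 0 + 0) ?P"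
      unfolding i
    proof (rule R_Seq[OF W])
      fix s assume I: "?I s \<and> nev X Y s ?g = 0"
      obtain v1 where s: "s = (v1, m)" using I by (cases s) auto
      have b1: "v1 77 = Suc (v1 76)" "v1 77 \<le> ?n" "v1 79 = ?t0" "v1 41 = p" "\<forall>r<76. v1 r = v r" "?f (v1 76) = ?c" "?f (v1 77) \<noteq> ?c" using I s r by auto
      have "Suc (v1 76) * p \<le> ?n * p" using b1 by (intro mult_right_mono) auto
      then have "v1 76 * p + p \<le> ?n * p" by simp
      then have tt: "?t0 + v1 76 * p + p \<le> t" using tn by linarith
      then have "?t0 + v1 76 * p < 2 ^ w" "v1 76 * p < 2 ^ w" using b Bd by linarith+
      then show "R w X Y (Set 60 (V 79 +. V 76 *. V 41)) s (tc (Set 60 (V 79 +. V 76 *. V 41))) 0 ?P"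
        using b1 tt by (intro R_block') (auto simp: s ac_simps)
    qed
  qed
  then show ?thesis
  proof (rule R_mono)
    have "tc ?init + (te ?g + 1) + tc (Set 60 (V 79 +. V 76 *. V 41)) \<le> Kb" "tc bbody + te ?g + 1 \<le> Kb" by (simp_all add: Kb_def bsearch_def)
    then have "tc ?init + (te ?g + 1) + tc (Set 60 (V 79 +. V 76 *. V 41)) + LB * (tc bbody + te ?g + 1) \<le> Kb + LB * Kb" by (intro add_mono mult_left_mono) auto
    then show "tc ?init + ((LB * (tc bbody + te ?g + 1) + te ?g + 1) + tc (Set 60 (V 79 +. V 76 *. V 41))) \<le> Kb * (LB + 1)"
      by (simp add: algebra_simps)
  qed auto
qed

end

text \<open>For period 0 the deviation found is a mismatch of the only diagonal left, so no search
  is made. The rest computes \<open>refwin\<close>.\<close>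

definition ebreak :: com where
  "ebreak = IfC (V 41 =. C 0) (Set 60 (V 70)) bsearch;;
    Set 45 (V 20 +. Ite (V 60 <. V 42 -. V 40) (C 0) (V 60 -. (V 42 -. V 40)));;
    IfC (V 21 -. C 4 *. V 23 <. V 45) (Set 45 (V 21 -. C 4 *. V 23)) Skip"

definition Kbr :: nat where "Kbr = Kb + tc ebreak + 10"

context params begin

lemma ebreak_correct:
  assumes e: "env v" and r: "v 20 = ST" "v 21 = EN" "v 23 = Q" "v 40 = lo" "v 41 = p" "v 42 = hi" "v 70 = t" "v 71 = BB"
    and b: "lo \<le> hi" "hi - lo < Q" "p \<le> hi - lo" "p = 0 \<longrightarrow> hi = lo" "ST + 4 * Q \<le> EN" "EN \<le> H" "hi \<le> Bd" "Q \<le> Bd"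
      "t < EN - ST + (hi - lo)"
    and A: "lo \<in> ap lo p hi" "hi \<in> ap lo p hi" "ap lo p hi \<subseteq> winex x y ST Q"
    and f: "found ST EN lo p t BB"
  shows "R w X Y ebreak (v, m) (Kbr * (LB + 1)) 0 (\<lambda>(v', m'). (\<forall>r. r \<noteq> 60 \<and> r \<noteq> 45 \<and> r < 76 \<longrightarrow> v' r = v r) \<and> m' = m \<and>
     brk x y (v' 45) EN Q lo p hi \<and> ST \<le> v' 45 \<and> v' 45 + 4 * Q \<le> EN \<and> (v' 45 \<le> ST \<or> v' 45 - ST + (hi - lo) \<le> t))" (is "R w X Y ebreak (v, m) _ 0 ?P")
proof -
  let ?c2 = "Set 45 (V 20 +. Ite (V 60 <. V 42 -. V 40) (C 0) (V 60 -. (V 42 -. V 40)));;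
    IfC (V 21 -. C 4 *. V 23 <. V 45) (Set 45 (V 21 -. C 4 *. V 23)) Skip"
  let ?M = "\<lambda>(v', m'). (\<forall>r. r \<noteq> 60 \<and> r < 76 \<longrightarrow> v' r = v r) \<and> m' = m \<and> v' 60 \<le> t \<and>
     brk x y (refwin ST EN Q (hi - lo) (v' 60)) EN Q lo p hi"
  have t: "t \<le> 2 * Bd" using b Bd by linarith
  have 1: "R w X Y (IfC (V 41 =. C 0) (Set 60 (V 70)) bsearch) (v, m) (te (V 41 =. C 0) + 1 + (Kb * (LB + 1) + 10)) 0 ?M"
  proof (rule R_If)
    assume "nev X Y (v, m) (V 41 =. C 0) \<noteq> 0"
    then have p: "p = 0" "hi = lo" using r b by auto
    have ne: "x (ST + t) \<noteq> y (ST + lo + t)" using f p by (auto simp: found_def)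
    have "brk x y (refwin ST EN Q 0 t) EN Q lo 0 lo" by (rule brk_zero[of x ST t y lo]) (use ne b p in auto)
    then show "R w X Y (Set 60 (V 70)) (v, m) (Kb * (LB + 1) + 10) 0 ?M"
      using p r by (intro R_block') auto
  next
    assume "nev X Y (v, m) (V 41 =. C 0) = 0"
    then have p: "0 < p" using r by auto
    have tp: "t mod p < p" using p by simp
    have loE: "lo \<in> winex x y ST Q" using A by auto
    have STp: "ST + p \<le> H" using b by linarith
    have BBb: "BB + t + p \<le> 7 * Bd" using f b t Bd unfolding found_def by (elim disjE conjE) linarith+
    have f0: "zz (BB + t mod p) = x (ST + t mod p)" using f unfolding found_def
    proof (elim disjE conjE)
      assume "BB = ST" then show ?thesis using tp STp by (simp add: zz_less)
    next
      assume B: "BB = H + ST + lo"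
      \<comment> \<open>The diagonal \<open>lo\<close> matches the first window, which contains the
        whole first period.\<close>
      have "y (ST + lo + t mod p) = x (ST + t mod p)" by (rule winex_sum[OF loE]) (use tp b in auto)
      then show ?thesis using B by (simp add: zz_add add.assoc)
    qed
    have f1: "zz (BB + t) \<noteq> x (ST + t mod p)" using f b unfolding found_def by (auto simp: zz_less zz_add add.assoc)
    show "R w X Y bsearch (v, m) (Kb * (LB + 1) + 10) 0 ?M"
    proof (rule R_mono[OF bsearch_correct[OF e r(1) r(5) r(7,8) p STp BBb t f0 f1]])
      fix s assume *: "(\<lambda>(v', m'). (\<forall>r. r \<noteq> 60 \<and> r < 76 \<longrightarrow> v' r = v r) \<and> m' = m \<and>
        zz (BB + v' 60) = x (ST + t mod p) \<and> zz (BB + v' 60 + p) \<noteq> x (ST + t mod p) \<and> v' 60 + p \<le> t) s"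
      obtain v' where s: "s = (v', m)" using * by (cases s) auto
      have d: "zz (BB + v' 60) \<noteq> zz (BB + v' 60 + p)" "v' 60 + p \<le> t" using * s by auto
      have "brk x y (refwin ST EN Q (hi - lo) (v' 60)) EN Q lo p hi"
        using f unfolding found_def
      proof (elim disjE conjE)
        assume B: "BB = ST" "ST + t < EN"
        have "x (ST + v' 60) \<noteq> x (ST + v' 60 + p)" using d B b by (simp add: zz_less)
        then show ?thesis by (intro brk_X[of x ST "v' 60" p]) (use B b d in auto)
      next
        assume B: "BB = H + ST + lo"
        have "y (ST + lo + v' 60) \<noteq> y (ST + lo + v' 60 + p)" using d B by (simp add: zz_add add.assoc)
        then show ?thesis by (intro brk_Y[of y ST lo "v' 60" p]) (use b d A in auto)
      qed
      then show "?M s" using * s by auto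
    qed auto
  qed (use Bd in auto)
  have "R w X Y ebreak (v, m) ((te (V 41 =. C 0) + 1 + (Kb * (LB + 1) + 10)) + tc ?c2) (0 + 0) ?P"
    unfolding ebreak_def
  proof (rule R_Seq[OF 1])
    fix s assume M: "?M s"
    obtain v1 where s: "s = (v1, m)" using M by (cases s) auto
    have v1: "\<forall>r. r \<noteq> 60 \<and> r < 76 \<longrightarrow> v1 r = v r" "v1 60 \<le> t" "brk x y (refwin ST EN Q (hi - lo) (v1 60)) EN Q lo p hi" using M s by auto
    have r1: "v1 20 = ST" "v1 21 = EN" "v1 23 = Q" "v1 40 = lo" "v1 42 = hi" using v1 r by auto
    let ?W = "refwin ST EN Q (hi - lo) (v1 60)"
    have W: "ST \<le> ?W" "?W + 4 * Q \<le> EN" "?W \<le> ST \<or> ?W - ST + (hi - lo) \<le> t" using b v1(2) by (auto simp: refwin_def)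
    have n: "nexec X Y ?c2 s = (v1(45 := ?W), m)"
    proof -
      have "(if v1 60 < hi - lo then 0 else v1 60 - (hi - lo)) = v1 60 - (hi - lo)" by simp
      then show ?thesis by (auto simp: s r1 refwin_def min_def fun_eq_iff)
    qed
    have "bsafe w X Y ?c2 s"
    proof -
      have "v1 60 < 2 ^ w" "ST + v1 60 < 2 ^ w" "hi < 2 ^ w" "EN < 2 ^ w" "4 * Q < 2 ^ w" "4 * Q \<le> EN" "4 < (2::nat) ^ w" "0 < (2::nat) ^ w"
        "ST + (v1 60 - (hi - lo)) < 2 ^ w" "ST < 2 ^ w" using b v1(2) t Bd by linarith+
      then show ?thesis using b by (auto simp: s r1)
    qed
    then show "R w X Y ?c2 s (tc ?c2) 0 ?P" using v1 W n by (intro R_block') auto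
  qed
  then show ?thesis
  proof (rule R_mono)
    have "te (V 41 =. C 0) + 1 + 10 + tc ?c2 \<le> (tc ebreak + 10) * 1" by (simp add: ebreak_def)
    also have "\<dots> \<le> (tc ebreak + 10) * (LB + 1)" by (intro mult_left_mono) auto
    finally show "(te (V 41 =. C 0) + 1 + (Kb * (LB + 1) + 10)) + tc ?c2 \<le> Kbr * (LB + 1)"
      by (simp add: Kbr_def add_mult_distrib)
  qed auto
qed

end

text \<open>The number of times the period of a progression can still double.\<close>

definition lam :: "nat \<Rightarrow> nat \<Rightarrow> nat" where
  "lam q p = (if p = 0 then 0 else Suc (LEAST e. q < p * 2 ^ e))"

lemma lam_ex: fixes p q :: nat shows "p \<noteq> 0 \<Longrightarrow> q < p * 2 ^ (LEAST e. q < p * 2 ^ e)"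
proof (rule LeastI_ex)
  assume "p \<noteq> 0"
  have "q < 2 ^ q" by simp
  also have "(2::nat) ^ q \<le> p * 2 ^ q" using \<open>p \<noteq> 0\<close> by simp
  finally show "\<exists>e. q < p * 2 ^ e" ..
qed

lemma lam_le: "q < p * 2 ^ e \<Longrightarrow> lam q p \<le> Suc e"
  by (auto simp: lam_def Least_le)

lemma lam_mono: "p \<noteq> 0 \<Longrightarrow> p \<le> p' \<Longrightarrow> lam q p' \<le> lam q p"
proof -
  assume p: "p \<noteq> 0" "p \<le> p'"
  have "q < p * 2 ^ (LEAST e. q < p * 2 ^ e)" using lam_ex p by blast
  also have "\<dots> \<le> p' * 2 ^ (LEAST e. q < p * 2 ^ e)" using p by (intro mult_le_mono1)
  finally have "lam q p' \<le> Suc (LEAST e. q < p * 2 ^ e)" by (rule lam_le)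
  then show ?thesis using p by (simp add: lam_def)
qed

lemma lam_double: "p \<noteq> 0 \<Longrightarrow> p \<le> q \<Longrightarrow> 2 * p \<le> p' \<Longrightarrow> lam q p' < lam q p"
proof -
  assume p: "p \<noteq> 0" "p \<le> q" "2 * p \<le> p'"
  let ?e = "LEAST e. q < p * 2 ^ e"
  have ex: "q < p * 2 ^ ?e" using lam_ex p by blast
  then obtain e where e: "?e = Suc e" using p by (cases ?e) auto
  have "q < p * 2 ^ Suc e" using ex e by metis
  then have "q < (2 * p) * 2 ^ e" by simp
  also have "\<dots> \<le> p' * 2 ^ e" using p by (intro mult_le_mono1) auto
  finally have "lam q p' \<le> Suc e" by (rule lam_le)
  then show ?thesis using p e by (simp add: lam_def)
qed

lemma lam_zero: "lam q 0 = 0" "p \<noteq> 0 \<Longrightarrow> 0 < lam q p"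
  by (auto simp: lam_def)

context params begin

definition apok :: "nat \<Rightarrow> nat \<Rightarrow> nat \<Rightarrow> nat \<Rightarrow> nat \<Rightarrow> bool" where
  "apok G Q lo p hi \<longleftrightarrow> lo \<le> hi \<and> G \<le> lo \<and> hi < G + Q \<and> p \<le> Q \<and> (p = 0 \<longrightarrow> lo = hi)"

text \<open>\<open>PO\<close> dominates the exact matches of the discarded diagonals and is itself
  almost exact on some diagonal, while the survivors are certified up to the next window
  \<open>W\<close>. By the last clause, after the first round the survivors match the first window,
  whose beginning is the periodic reference of the sampling.\<close>

definition einv where
  "einv ST EN G Q A0 lo p hi PO W \<longleftrightarrow> apok G Q lo p hi \<and> ap lo p hi \<subseteq> A0 \<and>
     (\<forall>j\<in>A0. exact x y ST EN j \<longrightarrow> j \<in> ap lo p hi) \<and> ST \<le> PO \<and> PO \<le> EN \<and>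
     (\<forall>j\<in>A0. j \<notin> ap lo p hi \<longrightarrow> (\<forall>e. exact x y ST e j \<longrightarrow> e \<le> PO)) \<and>
     (\<exists>j\<in>A0. mism x y ST PO j \<le> 2 * (aa - 1)) \<and> (\<forall>j\<in>ap lo p hi. mism x y ST W j \<le> 2 * (aa - 1)) \<and>
     ST \<le> W \<and> W + 4 * Q \<le> EN \<and> (W = ST \<or> ap lo p hi \<subseteq> winex x y ST Q)"

definition epost where
  "epost ST EN G Q A0 ne lo p hi PO \<longleftrightarrow> ST \<le> PO \<and> PO \<le> EN \<and> (\<exists>j\<in>A0. mism x y ST PO j \<le> 2 * (aa - 1)) \<and>
     (if ne = (0::nat) then \<forall>j\<in>A0. \<not> exact x y ST EN j \<and> (\<forall>e. exact x y ST e j \<longrightarrow> e \<le> PO)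
      else PO = EN \<and> apok G Q lo p hi \<and> ap lo p hi \<subseteq> A0 \<and> (\<forall>j\<in>A0. exact x y ST EN j \<longrightarrow> j \<in> ap lo p hi) \<and>
        (\<forall>j\<in>ap lo p hi. mism x y ST EN j \<le> 2 * (aa - 1)))"

text \<open>Three resources are consumed: the first round, which starts without a known break; the
  possible doublings of the period; and the one round in which the window at the end of the interval
  removes a diagonal.\<close>

definition emeas where
  "emeas EN Q lo p hi W = (if brk x y W EN Q lo p hi then 0 else 1) + lam Q p +
     (if ap lo p hi \<subseteq> winex x y (EN - 4 * Q) Q then 0 else 1 :: nat)"

lemma einv_init:
  assumes "apok G Q lo p hi" "ST + 4 * Q \<le> EN"
  shows "einv ST EN G Q (ap lo p hi) lo p hi ST ST"
proof -
  have "lo \<in> ap lo p hi" using assms by (auto simp: apok_def ap_iff)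
  then show ?thesis using assms by (auto simp: einv_def)
qed

text \<open>The new end point is almost exact because the diagonal providing it is certified up to W
  and exact from W on. It dominates the newly discarded diagonals since their exact matches cannot
  pass their first mismatch in the window.\<close>

lemma einv_prune:
  assumes inv: "einv ST EN G Q A0 lo p hi PO W"
    and S: "scanned (ap lo p hi \<inter> winex x y W Q) ne lo' p' hi'"
    and k: "\<forall>j\<in>ap lo p hi. j \<notin> winex x y W Q \<longrightarrow> (\<forall>s e. s \<le> W \<longrightarrow> exact x y s e j \<longrightarrow> e \<le> W + ZM)"
    and ZM: "ZM = 0 \<or> (\<exists>j\<in>ap lo p hi. ZM < 4 * Q \<and> exact x y W (W + ZM) j)"
    and PO': "PO' = max PO (W + ZM)"
  shows "ST \<le> PO'" "PO' \<le> EN" "\<exists>j\<in>A0. mism x y ST PO' j \<le> 2 * (aa - 1)"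
    "\<forall>j\<in>A0. j \<notin> ap lo p hi \<inter> winex x y W Q \<longrightarrow> (\<forall>e. exact x y ST e j \<longrightarrow> e \<le> PO')"
    "\<forall>j\<in>A0. exact x y ST EN j \<longrightarrow> j \<in> ap lo p hi \<inter> winex x y W Q"
    "ne \<noteq> 0 \<Longrightarrow> apok G Q lo' p' hi' \<and> ap lo' p' hi' = ap lo p hi \<inter> winex x y W Q \<and> lo' \<in> ap lo' p' hi' \<and> hi' \<in> ap lo' p' hi' \<and> p' \<le> hi' - lo' \<and> ap lo' p' hi' \<subseteq> winex x y ST Q"
proof -
  let ?A = "ap lo p hi"
  have I: "apok G Q lo p hi" "?A \<subseteq> A0" "\<And>j. j \<in> A0 \<Longrightarrow> exact x y ST EN j \<Longrightarrow> j \<in> ?A" "ST \<le> PO" "PO \<le> EN"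
    "\<And>j e. j \<in> A0 \<Longrightarrow> j \<notin> ?A \<Longrightarrow> exact x y ST e j \<Longrightarrow> e \<le> PO"
    "\<exists>j\<in>A0. mism x y ST PO j \<le> 2 * (aa - 1)" "\<And>j. j \<in> ?A \<Longrightarrow> mism x y ST W j \<le> 2 * (aa - 1)"
    "ST \<le> W" "W + 4 * Q \<le> EN" "W = ST \<or> ?A \<subseteq> winex x y ST Q"
    using inv unfolding einv_def by blast+
  have loA: "lo \<in> ?A" using I(1) by (auto simp: apok_def ap_iff)
  show "ST \<le> PO'" using I(4) PO' by simp
  show "PO' \<le> EN"
    using I(5,10) ZM unfolding PO' by auto
  show "\<exists>j\<in>A0. mism x y ST PO' j \<le> 2 * (aa - 1)"
  proof (cases "W + ZM \<le> PO")
    case True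
    then show ?thesis using I(7) PO' by (simp add: max_def)
  next
    case False
    then have P: "PO' = W + ZM" using PO' by simp
    show ?thesis
    proof (cases "ZM = 0")
      case True
      then show ?thesis using I(8)[OF loA] loA I(2) P by auto
    next
      case False
      then obtain j where j: "j \<in> ?A" "exact x y W (W + ZM) j" using ZM by auto
      have "mism x y ST (W + ZM) j = mism x y ST W j + mism x y W (W + ZM) j" using I(9) by (intro mism_split) auto
      then show ?thesis using I(8)[OF j(1)] mism_exact[OF j(2)] j(1) I(2) P by (intro bexI[of _ j]) auto
    qed
  qed
  show "\<forall>j\<in>A0. j \<notin> ?A \<inter> winex x y W Q \<longrightarrow> (\<forall>e. exact x y ST e j \<longrightarrow> e \<le> PO')"
  proof (intro ballI impI allI)
    fix j e assume j: "j \<in> A0" "j \<notin> ?A \<inter> winex x y W Q" "exact x y ST e j"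
    show "e \<le> PO'"
    proof (cases "j \<in> ?A")
      case True
      then have "e \<le> W + ZM" using k j I(9) by blast
      then show ?thesis using PO' by simp
    next
      case False
      then have "e \<le> PO" using I(6) j by blast
      then show ?thesis using PO' by simp
    qed
  qed
  show "\<forall>j\<in>A0. exact x y ST EN j \<longrightarrow> j \<in> ?A \<inter> winex x y W Q"
  proof (intro ballI impI)
    fix j assume j: "j \<in> A0" "exact x y ST EN j"
    have "j \<in> winex x y W Q" unfolding winex_def using exact_sub[OF j(2) I(9,10)] by blast
    then show "j \<in> ?A \<inter> winex x y W Q" using I(3) j by blast
  qed
  assume "ne \<noteq> 0"
  note s = scannedD[OF S this]
  have l: "lo' \<in> ?A" "hi' \<in> ?A" using s(2,3) by blast+
  then have b: "G \<le> lo'" "hi' < G + Q" using I(1) by (auto simp: apok_def ap_iff)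
  have le: "lo' \<le> hi'" using s(1,2) by (auto simp: ap_iff)
  have "apok G Q lo' p' hi'" unfolding apok_def using b le s(4,5) by auto
  moreover have "ap lo' p' hi' \<subseteq> winex x y ST Q" using I(11) s(1) by blast
  ultimately show "apok G Q lo' p' hi' \<and> ap lo' p' hi' = ?A \<inter> winex x y W Q \<and> lo' \<in> ap lo' p' hi' \<and> hi' \<in> ap lo' p' hi' \<and> p' \<le> hi' - lo' \<and> ap lo' p' hi' \<subseteq> winex x y ST Q"
    using s by metis
qed

text \<open>If the old window was not at a known break, the first summand drops. Otherwise
  \<open>brk_progress\<close> doubles the period or leaves a singleton, unless the window is the
  last one; then all survivors match there and the third summand drops.\<close>

lemma emeas_decr:
  assumes "apok G Q lo p hi" "scanned (ap lo p hi \<inter> winex x y W Q) ne lo' p' hi'" "ne \<noteq> 0" "W + 4 * Q \<le> EN"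
    and b: "brk x y W' EN Q lo' p' hi'"
  shows "emeas EN Q lo' p' hi' W' < emeas EN Q lo p hi W"
proof -
  let ?A = "ap lo p hi" and ?A' = "ap lo' p' hi'"
  note s = scannedD[OF assms(2,3)]
  have S1: "scanned (?A \<inter> winex x y W Q) 1 lo' p' hi'" 
    using assms(2) unfolding scanned_def if_not_P[OF assms(3)] if_not_P[OF one_neq_zero] .
  have sub: "?A' \<subseteq> ?A" "?A' \<subseteq> winex x y W Q" using s(1) by blast+
  have lamle: "lam Q p' \<le> lam Q p"
  proof (cases "p' = 0")
    case True
    then show ?thesis by (simp add: lam_zero)
  next
    case False
    have l: "lo' \<in> ?A'" "lo' + p' \<in> ?A'" using s(2,5) False s(1) by (auto simp: ap_iff)
    then have l: "lo' \<in> ?A" "lo' + p' \<in> ?A" using sub by blast+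
    show ?thesis
    proof (cases "p = 0")
      case True
      then show ?thesis using l False by (auto simp: ap_zero split: if_splits)
    next
      case pn: False
      have "p dvd ((lo' + p' - lo) - (lo' - lo))" using l by (simp only: dvd_diff_nat ap_iff)
      moreover have "(lo' + p' - lo) - (lo' - lo) = p'" using l by (auto simp: ap_iff)
      ultimately have "p \<le> p'" using False by (auto dest: dvd_imp_le)
      then show ?thesis using pn by (intro lam_mono)
    qed
  qed
  have Ele: "(if ?A' \<subseteq> winex x y (EN - 4 * Q) Q then 0 else 1 :: nat) \<le> (if ?A \<subseteq> winex x y (EN - 4 * Q) Q then 0 else 1)"
    using sub(1) by auto
  show ?thesis
  proof (cases "brk x y W EN Q lo p hi")
    case False
    then show ?thesis using b lamle Ele unfolding emeas_def by simp
  next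
    case True
    have Eend: "?A' \<subseteq> winex x y (EN - 4 * Q) Q" if "W + 4 * Q = EN"
    proof -
      have "EN - 4 * Q = W" using that by simp
      then show ?thesis using sub(2) by simp
    qed
    have "lam Q p' < lam Q p \<or> W + 4 * Q = EN \<and> \<not> ?A \<subseteq> winex x y (EN - 4 * Q) Q"
    proof (cases "p = 0")
      case True0: True
      then have "lo = hi" using assms(1) by (auto simp: apok_def)
      then show ?thesis using brk_progress_zero[of x y W EN Q lo] True True0 S1 by metis
    next
      case pn: False
      from brk_progress[OF True S1 pn] show ?thesis
      proof (elim disjE)
        assume "p' = 0" then show ?thesis using lam_zero(2)[OF pn, of Q] by (simp add: lam_zero(1))
      next
        assume "2 * p \<le> p'"
        then show ?thesis using lam_double[OF pn _ \<open>2 * p \<le> p'\<close>, of Q] assms(1) by (auto simp: apok_def)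
      qed auto
    qed
    then show ?thesis
    proof
      assume "lam Q p' < lam Q p"
      then show ?thesis using True b Ele unfolding emeas_def by simp
    next
      assume *: "W + 4 * Q = EN \<and> \<not> ?A \<subseteq> winex x y (EN - 4 * Q) Q"
      then show ?thesis using True b lamle Eend unfolding emeas_def by simp
    qed
  qed
qed

end

definition ebody :: "nat \<Rightarrow> com" where
  "ebody cc = winstep ;; IfC (V 44 <. V 45 +. V 84) (Set 44 (V 45 +. V 84)) Skip ;;
    IfC (V 80 =. C 0) (Set 61 (C 0))
     ((Set 40 (V 81) ;; Set 41 (V 82) ;; Set 42 (V 83)) ;; sample cc ;;
      IfC (V 70 =. V 74) (Set 44 (V 21) ;; Set 43 (C 1) ;; Set 61 (C 0)) ebreak)"

definition extend :: "nat \<Rightarrow> com" where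
  "extend cc = (Set 44 (V 20) ;; Set 45 (V 20) ;; Set 61 (C 1) ;; Set 43 (C 0)) ;; While (V 61) (ebody cc)"

definition Ke :: nat where "Ke = 4 * (Kw + Ks + Kbr + tc (extend 0) + 20)"

context params begin

definition ecost :: "nat \<Rightarrow> nat \<Rightarrow> nat" where
  "ecost Q len = Q + ((len + Q) div aa + 1) * (cc * L) + LB + 1"

definition ebase where
  "ebase v m ST EN G Q v' m' \<longleftrightarrow> (\<forall>r<40. v' r = v r) \<and> (\<forall>a. a < ZB \<or> ZB + 9 * Q \<le> a \<longrightarrow> m' a = (m a :: nat))"

definition epre where
  "epre ST EN G Q \<longleftrightarrow> ST + 4 * Q \<le> EN \<and> EN \<le> H \<and> 9 * Q \<le> Bd \<and> G + Q \<le> Bd \<and> ZB + 9 * Q \<le> Bd \<and> 1 \<le> Q \<and>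
     (EN - ST + Q + 1) * (cc * L) \<le> Bd"

lemma ebody_correct:
  assumes e: "env v" and r: "v 20 = ST" "v 21 = EN" "v 22 = G" "v 23 = Q" "v 61 \<noteq> 0" "v 43 = 0"
    and pre: "epre ST EN G Q"
    and inv: "einv ST EN G Q A0 (v 40) (v 41) (v 42) (v 44) (v 45)"
  shows "R w X Y (ebody cc) (v, m) ((Kw + Ks + Kbr + tc (extend 0)) * ecost Q (EN - ST)) fail0 (\<lambda>(v', m'). ebase v m ST EN G Q v' m' \<and>
     (if v' 61 = 0 then epost ST EN G Q A0 (v' 43) (v' 40) (v' 41) (v' 42) (v' 44)
      else v' 43 = 0 \<and> einv ST EN G Q A0 (v' 40) (v' 41) (v' 42) (v' 44) (v' 45) \<and>
        emeas EN Q (v' 40) (v' 41) (v' 42) (v' 45) < emeas EN Q (v 40) (v 41) (v 42) (v 45)))" (is "R w X Y _ _ ?T _ ?P")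
proof -
  let ?lo = "v 40" and ?p = "v 41" and ?hi = "v 42" and ?W = "v 45" and ?PO = "v 44"
  let ?A = "ap ?lo ?p ?hi"
  have P: "ST + 4 * Q \<le> EN" "EN \<le> H" "9 * Q \<le> Bd" "G + Q \<le> Bd" "ZB + 9 * Q \<le> Bd" "1 \<le> Q" "(EN - ST + Q + 1) * (cc * L) \<le> Bd"
    using pre by (auto simp: epre_def)
  have ok: "apok G Q ?lo ?p ?hi" and W: "ST \<le> ?W" "?W + 4 * Q \<le> EN" using inv by (auto simp: einv_def)
  have bw: "?W + 4 * Q \<le> H" "G \<le> ?lo" "?hi < G + Q" using ok W P by (auto simp: apok_def)
  let ?c1 = "IfC (V 44 <. V 45 +. V 84) (Set 44 (V 45 +. V 84)) Skip"
  let ?c2 = "Set 40 (V 81) ;; Set 41 (V 82) ;; Set 42 (V 83)"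
  let ?c3 = "IfC (V 70 =. V 74) (Set 44 (V 21) ;; Set 43 (C 1) ;; Set 61 (C 0)) ebreak"
  let ?len = "EN - ST + Q"
  let ?ts = "Ks * ((?len div aa + 1) * (cc * L) + 1)"
  let ?t3 = "te (V 70 =. V 74) + 1 + (Kbr * (LB + 1) + tc (Set 44 (V 21) ;; Set 43 (C 1) ;; Set 61 (C 0)))"
  let ?t2 = "te (V 80 =. C 0) + 1 + (10 + (tc ?c2 + (?ts + ?t3)))"
  have "R w X Y (ebody cc) (v, m) (Kw * Q + (tc ?c1 + ?t2)) (0 + fail0) ?P"
    unfolding ebody_def
  proof (rule R_Seq[OF winstep_correct[OF e r(3,4) refl refl refl refl bw(1) P(3,4,5,6) bw(2,3)]])
    fix s assume *: "(\<lambda>(v', m'). (\<forall>r<46. v' r = v r) \<and> (\<forall>r. 50 \<le> r \<and> r < 80 \<longrightarrow> v' r = v r) \<and>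
     (\<forall>a. a < ZB \<or> ZB + 9 * Q \<le> a \<longrightarrow> m' a = m a) \<and>
     scanned (?A \<inter> winex x y ?W Q) (v' 80) (v' 81) (v' 82) (v' 83) \<and>
     (\<forall>j\<in>?A. j \<notin> winex x y ?W Q \<longrightarrow> (\<forall>s e. s \<le> ?W \<longrightarrow> exact x y s e j \<longrightarrow> e \<le> ?W + v' 84)) \<and>
     (v' 84 = 0 \<or> (\<exists>j\<in>?A. v' 84 < 4 * Q \<and> exact x y ?W (?W + v' 84) j))) s"
    obtain v1 m1 where s: "s = (v1, m1)" by (cases s)
    have v1: "\<And>r. r < 46 \<Longrightarrow> v1 r = v r" "\<And>r. 50 \<le> r \<Longrightarrow> r < 80 \<Longrightarrow> v1 r = v r"
      and m1: "\<And>a. a < ZB \<or> ZB + 9 * Q \<le> a \<Longrightarrow> m1 a = m a"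
      and S: "scanned (?A \<inter> winex x y ?W Q) (v1 80) (v1 81) (v1 82) (v1 83)"
      and K: "\<forall>j\<in>?A. j \<notin> winex x y ?W Q \<longrightarrow> (\<forall>s e. s \<le> ?W \<longrightarrow> exact x y s e j \<longrightarrow> e \<le> ?W + v1 84)"
      and Z: "v1 84 = 0 \<or> (\<exists>j\<in>?A. v1 84 < 4 * Q \<and> exact x y ?W (?W + v1 84) j)"
      using * unfolding s prod.case by blast+
    define PO' where "PO' = max ?PO (?W + v1 84)"
    note pr = einv_prune[OF inv S K Z PO'_def]
    let ?v2 = "v1(44 := PO')"
    have zm: "v1 84 \<le> 4 * Q" using Z by auto
    have n1: "nexec X Y ?c1 s = (?v2, m1)" using v1 by (auto simp: s PO'_def max_def fun_eq_iff)
    have e2: "env ?v2" by (rule env_cong[OF e]) (use v1 in auto)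
    have r2: "?v2 20 = ST" "?v2 21 = EN" "?v2 22 = G" "?v2 23 = Q" "?v2 61 = v 61" "?v2 43 = 0"
      using v1 r by auto
    have bs1: "bsafe w X Y ?c1 s"
    proof -
      have "?W + v1 84 < 2 ^ w" using zm W P Bd by linarith
      then show ?thesis using v1 by (simp add: s)
    qed
    show "R w X Y (?c1 ;; IfC (V 80 =. C 0) (Set 61 (C 0)) (?c2 ;; sample cc ;; ?c3)) s (tc ?c1 + ?t2) fail0 ?P"
    proof (rule R_block_Seq[OF bs1], unfold n1, rule R_If)
      show "esafe w X Y (?v2, m1) (V 80 =. C 0)" using Bd by simp
    next
      assume "nev X Y (?v2, m1) (V 80 =. C 0) \<noteq> 0"
      then have z: "v1 80 = 0" by simp
      then have em: "?A \<inter> winex x y ?W Q = {}" using S by (simp add: scanned_def)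
      have post: "epost ST EN G Q A0 0 lo1 p1 hi1 PO'" for lo1 p1 hi1
        unfolding epost_def using pr(1-5) unfolding em by auto
      show "R w X Y (Set 61 (C 0)) (?v2, m1) (10 + (tc ?c2 + (?ts + ?t3))) fail0 ?P"
        by (rule R_block') (use post r2 v1 m1 Bd in \<open>auto simp: ebase_def\<close>)
    next
      assume "nev X Y (?v2, m1) (V 80 =. C 0) = 0"
      then have ne: "v1 80 \<noteq> 0" by simp
      define lo where "lo = v1 81"
      define p where "p = v1 82"
      define hi where "hi = v1 83"
      have ok': "apok G Q lo p hi" and A': "ap lo p hi = ?A \<inter> winex x y ?W Q" and mem: "lo \<in> ap lo p hi" "hi \<in> ap lo p hi"
        and pl: "p \<le> hi - lo" and AST: "ap lo p hi \<subseteq> winex x y ST Q"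
        using pr(6)[OF ne] unfolding lo_def p_def hi_def by blast+
      have sub0: "ap lo p hi \<subseteq> A0" using A' inv by (auto simp: einv_def)
      let ?v3 = "?v2(40 := lo, 41 := p, 42 := hi)"
      have n2: "nexec X Y ?c2 (?v2, m1) = (?v3, m1)" by (simp add: lo_def p_def hi_def)
      have e3: "env ?v3" by (rule env_cong[OF e2]) auto
      have r3: "?v3 20 = ST" "?v3 21 = EN" "?v3 40 = lo" "?v3 41 = p" "?v3 42 = hi" "?v3 23 = Q" using r2 by auto
      define len where "len = EN - ST + (hi - lo)"
      have b3: "lo \<le> hi" "hi - lo < Q" "p = 0 \<longrightarrow> hi = lo" "hi \<le> Bd" using ok' P by (auto simp: apok_def)
      have lenQ: "len \<le> ?len" using b3 by (auto simp: len_def)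
      have lb: "(len + 1) * (cc * L) \<le> Bd"
      proof -
        have "(len + 1) * (cc * L) \<le> (EN - ST + Q + 1) * (cc * L)" using lenQ by (intro mult_right_mono) auto
        then show ?thesis using P(7) by linarith
      qed
      have R3: "R w X Y (sample cc) (?v3, m1) ?ts fail0 (\<lambda>(v', m'). (\<forall>r<70. v' r = ?v3 r) \<and> m' = m1 \<and>
         v' 74 = len \<and> v' 70 \<le> len \<and> (v' 70 < len \<longrightarrow> found ST EN lo p (v' 70) (v' 71)) \<and>
         card {t. t < v' 70 \<and> dev x y ST EN lo p t} < aa)"
      proof (rule R_mono[OF sample_correct[OF e3 r3(1-5) b3(1,2) pl b3(3) P(1,2) b3(4) len_def lb]])
        have "len div aa \<le> ?len div aa" using lenQ by (rule div_le_mono)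
        then show "Ks * ((len div aa + 1) * (cc * L) + 1) \<le> ?ts" by (intro mult_le_mono2 add_mono mult_right_mono) auto
      qed auto
      have "R w X Y (?c2 ;; sample cc ;; ?c3) (?v2, m1) (tc ?c2 + (?ts + ?t3)) (fail0 + 0) ?P"
      proof (rule R_block_Seq)
        show "bsafe w X Y ?c2 (?v2, m1)" by simp
        show "R w X Y (sample cc ;; ?c3) (nexec X Y ?c2 (?v2, m1)) (?ts + ?t3) (fail0 + 0) ?P"
          unfolding n2
        proof (rule R_Seq[OF R3])
          fix s assume *: "(\<lambda>(v', m'). (\<forall>r<70. v' r = ?v3 r) \<and> m' = m1 \<and>
         v' 74 = len \<and> v' 70 \<le> len \<and> (v' 70 < len \<longrightarrow> found ST EN lo p (v' 70) (v' 71)) \<and>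
         card {t. t < v' 70 \<and> dev x y ST EN lo p t} < aa) s"
          obtain v4 where s4: "s = (v4, m1)" using * by (cases s) auto
          have v4: "\<And>r. r < 70 \<Longrightarrow> v4 r = ?v3 r" "v4 74 = len" "v4 70 \<le> len" "v4 70 < len \<Longrightarrow> found ST EN lo p (v4 70) (v4 71)"
            "card {t. t < v4 70 \<and> dev x y ST EN lo p t} \<le> aa - 1" using * unfolding s4 by auto
          have r4: "v4 20 = ST" "v4 21 = EN" "v4 23 = Q" "v4 40 = lo" "v4 41 = p" "v4 42 = hi" "v4 44 = PO'" "v4 43 = 0" "v4 61 = v 61"
            using v4(1) r3 r2 by auto
          have e4: "env v4" by (rule env_cong[OF e3]) (use v4 in auto)
          have v40: "v4 r = v r" if "r < 40" for r using v4(1)[of r] v1(1)[of r] that by simp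
          \<comment> \<open>Diagonal j reads the second string at offsets shifted by j - lo, at most
            hi - lo. This is why rows are certified only up to hi - lo before the deviation.\<close>
          have ms: "mism x y ST b j \<le> 2 * (aa - 1)" if "j \<in> ap lo p hi" "b \<le> EN" "b \<le> ST \<or> b - ST + (hi - lo) \<le> v4 70" for b j
          proof (rule mism_dev[OF v4(5) that(1,2)])
            have "j \<le> hi" using that(1) by (auto simp: ap_iff)
            then show "b \<le> ST \<or> b - ST + (j - lo) \<le> v4 70" using that(3) by linarith
          qed
          have cmp: "\<forall>j\<in>A0. exact x y ST EN j \<longrightarrow> j \<in> ap lo p hi" using pr(5) A' by simp
          have ded: "\<forall>j\<in>A0. j \<notin> ap lo p hi \<longrightarrow> (\<forall>e. exact x y ST e j \<longrightarrow> e \<le> PO')" using pr(4) A' by simp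
          show "R w X Y ?c3 s ?t3 0 ?P"
            unfolding s4
          proof (rule R_If)
            assume "nev X Y (v4, m1) (V 70 =. V 74) \<noteq> 0"
            then have full: "v4 70 = len" using v4 by auto
            have msE: "\<forall>j\<in>ap lo p hi. mism x y ST EN j \<le> 2 * (aa - 1)" using ms[of _ EN] full by (auto simp: len_def)
            have ex0: "\<exists>j\<in>A0. mism x y ST EN j \<le> 2 * (aa - 1)" using mem msE sub0 by blast
            have "epost ST EN G Q A0 (Suc 0) lo p hi EN"
              unfolding epost_def using ex0 msE cmp ok' sub0 P(1) by simp
            then show "R w X Y (Set 44 (V 21) ;; Set 43 (C 1) ;; Set 61 (C 0)) (v4, m1) (Kbr * (LB + 1) + tc (Set 44 (V 21) ;; Set 43 (C 1) ;; Set 61 (C 0))) 0 ?P"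
              by (intro R_block') (use r4 v40 m1 Bd in \<open>auto simp: ebase_def\<close>)
          next
            assume "nev X Y (v4, m1) (V 70 =. V 74) = 0"
            then have lt: "v4 70 < len" using v4 by auto
            note fd = v4(4)[OF lt]
            have Q1: "Q \<le> Bd" using P by linarith
            show "R w X Y ebreak (v4, m1) (Kbr * (LB + 1) + tc (Set 44 (V 21) ;; Set 43 (C 1) ;; Set 61 (C 0))) 0 ?P"
            proof (rule R_mono[OF ebreak_correct[OF e4 r4(1-6) refl refl b3(1,2) pl b3(3) P(1,2) b3(4) Q1 lt[unfolded len_def] mem AST fd]])
              fix s assume *: "(\<lambda>(v', m'). (\<forall>r. r \<noteq> 60 \<and> r \<noteq> 45 \<and> r < 76 \<longrightarrow> v' r = v4 r) \<and> m' = m1 \<and>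
     brk x y (v' 45) EN Q lo p hi \<and> ST \<le> v' 45 \<and> v' 45 + 4 * Q \<le> EN \<and> (v' 45 \<le> ST \<or> v' 45 - ST + (hi - lo) \<le> v4 70)) s"
              obtain v5 where s5: "s = (v5, m1)" using * by (cases s) auto
              have v5: "\<And>r. r \<noteq> 60 \<Longrightarrow> r \<noteq> 45 \<Longrightarrow> r < 76 \<Longrightarrow> v5 r = v4 r" and bk: "brk x y (v5 45) EN Q lo p hi"
                and W5: "ST \<le> v5 45" "v5 45 + 4 * Q \<le> EN" "v5 45 \<le> ST \<or> v5 45 - ST + (hi - lo) \<le> v4 70"
                using * unfolding s5 by auto
              have r5: "v5 40 = lo" "v5 41 = p" "v5 42 = hi" "v5 44 = PO'" "v5 43 = 0" "v5 61 \<noteq> 0" using v5 r4 r by auto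
              have msW: "\<forall>j\<in>ap lo p hi. mism x y ST (v5 45) j \<le> 2 * (aa - 1)" using ms[of _ "v5 45"] W5 by auto
              have "einv ST EN G Q A0 lo p hi PO' (v5 45)"
                unfolding einv_def using ok' sub0 cmp pr(1-3) ded msW W5 AST by blast
              moreover have "emeas EN Q lo p hi (v5 45) < emeas EN Q ?lo ?p ?hi ?W"
                by (rule emeas_decr[OF ok S[folded lo_def p_def hi_def] ne W(2) bk])
              moreover have "ebase v m ST EN G Q v5 m1" unfolding ebase_def using v5 v40 m1 by auto
              ultimately show "?P s" unfolding s5 using r5 by simp
            qed auto
          qed simp
        qed
      qed
      then show "R w X Y (?c2 ;; sample cc ;; ?c3) (?v2, m1) (10 + (tc ?c2 + (?ts + ?t3))) fail0 ?P"
        by (rule R_mono) auto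
    qed
  qed
  then show ?thesis
  proof (rule R_mono)
    let ?c4 = "Set 44 (V 21) ;; Set 43 (C 1) ;; Set 61 (C 0)"
    have k: "tc ?c1 + (te (V 80 =. C 0) + 1 + 10 + tc ?c2 + te (V 70 =. V 74) + 1 + tc ?c4) \<le> tc (extend 0)"
      by (simp add: extend_def ebody_def ebreak_def bsearch_def winstep_def bbody_def zeqE_def chrE_def clsE_def)
    let ?E = "ecost Q (EN - ST)"
    have "Kw * Q \<le> Kw * ?E" "Ks * ((?len div aa + 1) * (cc * L) + 1) \<le> Ks * ?E" "Kbr * (LB + 1) \<le> Kbr * ?E"
      by (intro mult_le_mono2; simp add: ecost_def)+
    moreover have "tc (extend 0) * 1 \<le> tc (extend 0) * ?E" by (intro mult_le_mono2) (simp add: ecost_def)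
    ultimately have "Kw * Q + Ks * ((?len div aa + 1) * (cc * L) + 1) + Kbr * (LB + 1) + tc (extend 0) \<le> (Kw + Ks + Kbr + tc (extend 0)) * ?E"
      unfolding add_mult_distrib[of _ _ ?E] by linarith
    then show "Kw * Q + (tc ?c1 + ?t2) \<le> (Kw + Ks + Kbr + tc (extend 0)) * ?E" using k by linarith
  qed auto
qed

lemma extend_correct:
  assumes e: "env v" and r: "v 20 = ST" "v 21 = EN" "v 22 = G" "v 23 = Q"
    and pre: "epre ST EN G Q"
    and ok: "apok G Q (v 40) (v 41) (v 42)"
  shows "R w X Y (extend cc) (v, m) (Ke * (LB + 4) * ecost Q (EN - ST)) (of_nat (LB + 4) * fail0) (\<lambda>(v', m'). ebase v m ST EN G Q v' m' \<and>
     epost ST EN G Q (ap (v 40) (v 41) (v 42)) (v' 43) (v' 40) (v' 41) (v' 42) (v' 44))" (is "R w X Y _ _ _ _ ?P")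
proof -
  let ?A0 = "ap (v 40) (v 41) (v 42)"
  let ?I = "\<lambda>(v', m'). ebase v m ST EN G Q v' m' \<and> (if v' 61 = 0 then epost ST EN G Q ?A0 (v' 43) (v' 40) (v' 41) (v' 42) (v' 44)
     else v' 43 = 0 \<and> einv ST EN G Q ?A0 (v' 40) (v' 41) (v' 42) (v' 44) (v' 45))"
  let ?mu = "\<lambda>(v', m' :: nat \<Rightarrow> nat). if v' 61 = 0 then 0 else Suc (emeas EN Q (v' 40) (v' 41) (v' 42) (v' 45))"
  let ?g = "V 61"
  let ?tb = "(Kw + Ks + Kbr + tc (extend 0)) * ecost Q (EN - ST)"
  let ?init = "Set 44 (V 20) ;; Set 45 (V 20) ;; Set 61 (C 1) ;; Set 43 (C 0)"
  let ?v = "v(44 := ST, 45 := ST, 61 := 1, 43 := 0)"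
  have P: "ST + 4 * Q \<le> EN" "EN \<le> H" "9 * Q \<le> Bd" "G + Q \<le> Bd" "ZB + 9 * Q \<le> Bd" "1 \<le> Q" "(EN - ST + Q + 1) * (cc * L) \<le> Bd"
    using pre by (auto simp: epre_def)
  have W: "R w X Y (While ?g (ebody cc)) (?v, m) ((LB + 4) * (?tb + te ?g + 1) + te ?g + 1) (of_nat (LB + 4) * fail0) (\<lambda>s'. ?I s' \<and> nev X Y s' ?g = 0)"
  proof (rule R_While[where \<mu> = ?mu])
    fix s assume I: "?I s" and g: "nev X Y s ?g \<noteq> 0"
    obtain v1 m1 where s: "s = (v1, m1)" by (cases s)
    have n: "v1 61 \<noteq> 0" using g by (simp add: s)
    have eb: "ebase v m ST EN G Q v1 m1" and z: "v1 43 = 0" and inv: "einv ST EN G Q ?A0 (v1 40) (v1 41) (v1 42) (v1 44) (v1 45)"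
      using I n by (auto simp: s)
    have ag: "\<forall>r<40. v1 r = v r" using eb by (auto simp: ebase_def)
    have e1: "env v1" by (rule env_cong[OF e]) (use ag in auto)
    have r1: "v1 20 = ST" "v1 21 = EN" "v1 22 = G" "v1 23 = Q" using ag r by auto
    show "R w X Y (ebody cc) s ?tb fail0 (\<lambda>s'. ?I s' \<and> ?mu s' < ?mu s)"
      unfolding s
    proof (rule R_mono[OF ebody_correct[OF e1 r1 n z pre inv]])
      fix s' assume *: "(\<lambda>(v', m'). ebase v1 m1 ST EN G Q v' m' \<and>
     (if v' 61 = 0 then epost ST EN G Q ?A0 (v' 43) (v' 40) (v' 41) (v' 42) (v' 44)
      else v' 43 = 0 \<and> einv ST EN G Q ?A0 (v' 40) (v' 41) (v' 42) (v' 44) (v' 45) \<and>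
        emeas EN Q (v' 40) (v' 41) (v' 42) (v' 45) < emeas EN Q (v1 40) (v1 41) (v1 42) (v1 45))) s'"
      obtain v2 m2 where s': "s' = (v2, m2)" by (cases s')
      have "ebase v1 m1 ST EN G Q v2 m2" using * by (simp add: s')
      then have eb2: "ebase v m ST EN G Q v2 m2" using eb by (simp add: ebase_def)
      show "?I s' \<and> ?mu s' < ?mu (v1, m1)" using * eb2 n by (auto simp: s' split: if_splits)
    qed auto
  next
    fix s assume "?I s" "nev X Y s ?g \<noteq> 0"
    then show "0 < ?mu s" by (cases s) auto
  next
    fix s show "esafe w X Y s ?g" by simp
  next
    show "?I (?v, m)" using einv_init[OF ok P(1)] by (auto simp: ebase_def)
    \<comment> \<open>Hence \<open>emeas\<close> is at most 1 + (LB + 1) + 1, and the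
      \<open>Suc\<close> in the loop measure makes LB + 4 rounds.\<close>
    have "lam Q (v 41) \<le> Suc LB"
    proof (cases "v 41 = 0")
      case False
      have "Q < 2 ^ LB" using P Bd by linarith
      also have "(2::nat) ^ LB \<le> v 41 * 2 ^ LB" using False by simp
      finally show ?thesis by (rule lam_le)
    qed (simp add: lam_zero)
    then show "?mu (?v, m) \<le> LB + 4" by (auto simp: emeas_def)
  qed
  have "R w X Y (extend cc) (v, m) (tc ?init + ((LB + 4) * (?tb + te ?g + 1) + te ?g + 1)) (of_nat (LB + 4) * fail0) (\<lambda>s'. ?I s' \<and> nev X Y s' ?g = 0)"
    unfolding extend_def[of cc]
  proof (rule R_block_Seq)
    show "bsafe w X Y ?init (v, m)" using Bd by simp
    have i: "nexec X Y ?init (v, m) = (?v, m)" by (simp add: r)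
    show "R w X Y (While ?g (ebody cc)) (nexec X Y ?init (v, m)) ((LB + 4) * (?tb + te ?g + 1) + te ?g + 1) (of_nat (LB + 4) * fail0) (\<lambda>s'. ?I s' \<and> nev X Y s' ?g = 0)"
      unfolding i by (rule W)
  qed
  then show ?thesis
  proof (rule R_mono)
    let ?K = "Kw + Ks + Kbr + tc (extend 0)" and ?E = "ecost Q (EN - ST)"
    have E1: "1 \<le> ?E" by (simp add: ecost_def)
    have "tc ?init + te ?g + 1 \<le> ?K + 20" by simp
    also have "\<dots> \<le> (?K + 20) * ((LB + 4) * ?E)" using E1 by simp
    finally have a: "tc ?init + te ?g + 1 \<le> (?K + 20) * ((LB + 4) * ?E)" .
    have "(LB + 4) * (?tb + te ?g + 1) \<le> (LB + 4) * ((?K + 20) * ?E)" using E1 by (intro mult_le_mono2) (simp add: add_mult_distrib)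
    also have "\<dots> = (?K + 20) * ((LB + 4) * ?E)" by (simp only: ac_simps)
    finally have "tc ?init + ((LB + 4) * (?tb + te ?g + 1) + te ?g + 1) \<le> 2 * ((?K + 20) * ((LB + 4) * ?E))" using a by linarith
    also have "\<dots> \<le> Ke * ((LB + 4) * ?E)"
      unfolding mult.assoc[symmetric] Ke_def by (intro mult_le_mono1) simp
    finally show "tc ?init + ((LB + 4) * (?tb + te ?g + 1) + te ?g + 1) \<le> Ke * (LB + 4) * ?E" by (simp only: mult.assoc)
  next
    fix s assume "?I s \<and> nev X Y s ?g = 0"
    then show "?P s" by (cases s) auto
  qed auto
qed

end

section \<open>Heap-ordered trees of certificates\<close>

section \<open>A tree of certified intervals\<close>

definition isect :: com where
  "isect = (Set 46 (Ld (V 28 +. C 1)) ;; Set 47 (Ld (V 28 +. C 2)) ;; Set 48 (Ld (V 28 +. C 3)) ;; Set 49 (C 0)) ;; fold"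

definition adopt :: com where
  "adopt = Set 40 (V 81) ;; Set 41 (V 82) ;; Set 42 (V 83)"

text \<open>The assumption \<open>aac\<close> is the error budget of a query: at most 2 LT + 2
  certificates with 2 (aa - 1) errors each. By \<open>TM\<close> the leaves cover more than the
  first string, and \<open>HH\<close> leaves room for intervals that overhang its end.
  \<open>rr = al * rho\<close> makes each group of diagonals fall into a single tree.\<close>

locale treep = params +
  fixes nsg LT :: nat
  assumes al: "1 \<le> al" "rr = al * rho" "1 \<le> rho" and M: "4 * rr \<le> M" and TT: "TT = 2 ^ LT"
    and TM: "length X < TT * M" and HH: "TT * M + length X + 4 * M \<le> H"
    and mem: "ZB + 9 * rr \<le> TB" "TB + nsg * (8 * TT) + 8 * TT + 8 \<le> Bd"
    and samp: "(H + rr + 1) * (cc * L) \<le> Bd" and rng: "nsg * rr + rr \<le> Bd" "9 * rr \<le> Bd"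
    and aac: "2 * (aa - 1) * (2 * LT + 2) \<le> al - 1" and GN: "GN \<le> nsg * rho"
begin

text \<open>Four words per node, and 2 TT node slots per tree.\<close>

definition adr :: "nat \<Rightarrow> nat \<Rightarrow> nat" where "adr SG h = TB + SG * (8 * TT) + h * 4"

text \<open>Heap numbering: the block of length 2 ^ a at t is an ancestor of leaf TT + t, the root
  is 1 and the children of h are 2 h and 2 h + 1.\<close>

definition hidx :: "nat \<Rightarrow> nat \<Rightarrow> nat" where "hidx a t = (TT + t) div 2 ^ a"

definition nodeset :: "(nat \<Rightarrow> nat) \<Rightarrow> nat \<Rightarrow> nat set" where
  "nodeset m a = (if m a = 0 then {} else ap (m (a + 1)) (m (a + 2)) (m (a + 3)))"

definition node_good :: "(nat \<Rightarrow> nat) \<Rightarrow> nat \<Rightarrow> nat \<Rightarrow> nat \<Rightarrow> bool" where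
  "node_good m SG a t \<longleftrightarrow> (let d = adr SG (hidx a t) in
     (m d \<noteq> 0 \<longrightarrow> apok (SG * rr) rr (m (d + 1)) (m (d + 2)) (m (d + 3))) \<and>
     (\<forall>j. SG * rr \<le> j \<longrightarrow> j < SG * rr + rr \<longrightarrow> exact x y (t * M) ((t + 2 ^ a) * M) j \<longrightarrow> j \<in> nodeset m d) \<and>
     (\<forall>j\<in>nodeset m d. mism x y (t * M) ((t + 2 ^ a) * M) j \<le> 2 * (aa - 1)))"

definition tree_good :: "(nat \<Rightarrow> nat) \<Rightarrow> bool" where
  "tree_good m \<longleftrightarrow> (\<forall>SG a t. SG < nsg \<longrightarrow> a \<le> LT \<longrightarrow> t < TT \<longrightarrow> 2 ^ a dvd t \<longrightarrow> node_good m SG a t)"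

lemma rr1: "1 \<le> rr" "al \<le> rr" "rho \<le> rr" using al by auto

lemma M1: "1 \<le> M" "4 \<le> M" using M rr1 by auto

lemma dvd_fits:
  assumes "a \<le> LT" "t < TT" "2 ^ a dvd t"
  shows "t + 2 ^ a \<le> TT"
proof -
  obtain c where c: "t = 2 ^ a * c" using assms(3) by blast
  obtain d where d: "TT = 2 ^ a * d" using TT assms(1) by (metis le_imp_power_dvd dvdE)
  have "c < d" using assms(2) c d by simp
  then have "2 ^ a * (c + 1) \<le> 2 ^ a * d" by (intro mult_le_mono2) simp
  then show ?thesis using c d by simp
qed

lemma hidx_eq:
  assumes "a \<le> LT" "2 ^ a dvd t"
  shows "hidx a t = 2 ^ (LT - a) + t div 2 ^ a" "hidx a t * 2 ^ a = TT + t"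
proof -
  have "(2::nat) ^ a dvd TT" using TT assms(1) by (simp add: le_imp_power_dvd)
  then have "hidx a t = TT div 2 ^ a + t div 2 ^ a" unfolding hidx_def by (simp add: div_plus_div_distrib_dvd_left)
  also have "TT div 2 ^ a = 2 ^ (LT - a)" using TT assms(1) by (simp add: power_diff)
  finally show "hidx a t = 2 ^ (LT - a) + t div 2 ^ a" .
  have "(2::nat) ^ a dvd TT + t" using \<open>(2::nat) ^ a dvd TT\<close> assms(2) by simp
  then show "hidx a t * 2 ^ a = TT + t" unfolding hidx_def by (rule dvd_div_mult_self)
qed

lemma hidx_bounds:
  assumes "a \<le> LT" "2 ^ a dvd t" "t < TT"
  shows "2 ^ (LT - a) \<le> hidx a t" "hidx a t < 2 * 2 ^ (LT - a)" "hidx a t < 2 * TT"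
proof -
  show "2 ^ (LT - a) \<le> hidx a t" using hidx_eq[OF assms(1,2)] by simp
  have "t div 2 ^ a < 2 ^ (LT - a)"
  proof -
    have "t < 2 ^ (LT - a) * 2 ^ a" using assms(1,3) TT by (simp add: power_add[symmetric])
    then show ?thesis by (simp add: less_mult_imp_div_less)
  qed
  then show "hidx a t < 2 * 2 ^ (LT - a)" using hidx_eq[OF assms(1,2)] by simp
  moreover have "(2::nat) ^ (LT - a) \<le> TT" unfolding TT by (intro power_increasing) auto
  ultimately show "hidx a t < 2 * TT" by linarith
qed

text \<open>Level a uses the numbers from 2 ^ (LT - a) to below twice that, so different levels are
  disjoint, and within a level the number determines t.\<close>

lemma hidx_inj:
  assumes "a \<le> LT" "2 ^ a dvd t" "t < TT" "a' \<le> LT" "2 ^ a' dvd t'" "t' < TT" "hidx a t = hidx a' t'"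
  shows "a = a' \<and> t = t'"
proof -
  have *: "a' \<le> a" if "a \<le> LT" "2 ^ a dvd t" "t < TT" "a' \<le> LT" "2 ^ a' dvd t'" "t' < TT" "hidx a t = hidx a' t'" for a a' t t'
  proof (rule ccontr)
    assume "\<not> a' \<le> a"
    then have "Suc (LT - a') \<le> LT - a" using that by linarith
    then have "(2::nat) ^ Suc (LT - a') \<le> 2 ^ (LT - a)" by (intro power_increasing) auto
    then show False using hidx_bounds[OF that(1-3)] hidx_bounds[OF that(4-6)] that(7) by simp
  qed
  have "a = a'" using *[OF assms] *[OF assms(4-6,1-3) assms(7)[symmetric]] by simp
  moreover from this have "TT + t = TT + t'"
    using hidx_eq(2)[OF assms(1,2)] hidx_eq(2)[OF assms(4,5)] assms(7) by metis
  ultimately show ?thesis by simp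
qed

lemma adr_disj:
  assumes "SG < nsg" "a \<le> LT" "2 ^ a dvd t" "t < TT" "SG' < nsg" "a' \<le> LT" "2 ^ a' dvd t'" "t' < TT"
    "(SG, a, t) \<noteq> (SG', a', t')" "i < 4" "i' < 4"
  shows "adr SG (hidx a t) + i \<noteq> adr SG' (hidx a' t') + i'"
proof
  assume eq: "adr SG (hidx a t) + i = adr SG' (hidx a' t') + i'"
  let ?h = "hidx a t" and ?h' = "hidx a' t'"
  have e: "4 * (SG * (2 * TT) + ?h) + i = 4 * (SG' * (2 * TT) + ?h') + i'" using eq by (simp add: adr_def)
  have q: "A = B" if "4 * A + i = 4 * B + i'" "i < 4" "i' < 4" for A B i i' :: nat using that by presburger
  have e2: "SG * (2 * TT) + ?h = SG' * (2 * TT) + ?h'" by (rule q[OF e assms(10,11)])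
  have h: "?h < 2 * TT" "?h' < 2 * TT" using hidx_bounds assms by auto
  have "(SG * (2 * TT) + ?h) div (2 * TT) = SG" "(SG' * (2 * TT) + ?h') div (2 * TT) = SG'"
    using h by simp_all
  then have "SG = SG'" using e2 by metis
  moreover from this have "?h = ?h'" using e2 by simp
  ultimately show False using hidx_inj[of a t a' t'] assms by auto
qed

lemma adr_bound: "SG < nsg \<Longrightarrow> h < 2 * TT \<Longrightarrow> adr SG h + 8 \<le> Bd" "TB \<le> adr SG h" "ZB + 9 * rr \<le> adr SG h"
proof -
  assume "SG < nsg" "h < 2 * TT"
  then have "SG * (8 * TT) \<le> nsg * (8 * TT)" by (intro mult_le_mono1) simp
  then show "adr SG h + 8 \<le> Bd" using mem(2) \<open>h < 2 * TT\<close> unfolding adr_def by linarith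
qed (use mem in \<open>auto simp: adr_def\<close>)

lemma node_good_cong:
  assumes "node_good m SG a t" "\<And>i. i < 4 \<Longrightarrow> m' (adr SG (hidx a t) + i) = m (adr SG (hidx a t) + i)"
  shows "node_good m' SG a t"
proof -
  let ?d = "adr SG (hidx a t)"
  have 0: "m' ?d = m ?d" using assms(2)[of 0] by simp
  have 1: "m' (?d + 1) = m (?d + 1)" by (rule assms(2)) simp
  have 2: "m' (?d + 2) = m (?d + 2)" by (rule assms(2)) simp
  have 3: "m' (?d + 3) = m (?d + 3)" by (rule assms(2)) simp
  show ?thesis using assms(1) unfolding node_good_def nodeset_def Let_def 0 1 2 3 .
qed

lemma isect_correct:
  assumes e: "env v" and r: "v 22 = G" "v 23 = Q" "v 28 = d"
    and b: "9 * Q \<le> Bd" "G \<le> Bd" "1 \<le> Q" "d + 3 \<le> Bd" and ok: "apok G Q (v 40) (v 41) (v 42)" and nz: "m d \<noteq> 0"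
  shows "R w X Y isect (v, m) (Kf * Q + tc isect) 0 (\<lambda>(v', m'). (\<forall>r<46. v' r = v r) \<and> m' = m \<and>
     scanned (ap (v 40) (v 41) (v 42) \<inter> nodeset m d) (v' 80) (v' 81) (v' 82) (v' 83))"
proof -
  let ?c = "Set 46 (Ld (V 28 +. C 1)) ;; Set 47 (Ld (V 28 +. C 2)) ;; Set 48 (Ld (V 28 +. C 3)) ;; Set 49 (C 0)"
  let ?v = "v(46 := m (d + 1), 47 := m (d + 2), 48 := m (d + 3), 49 := 0)"
  have n: "nexec X Y ?c (v, m) = (?v, m)" by (simp add: r)
  have e2: "env ?v" by (rule env_cong[OF e]) auto
  have r2: "?v 22 = G" "?v 23 = Q" using r by auto
  have ZBb: "ZB \<le> Bd" using mem by linarith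
  let ?A = "ap (v 40) (v 41) (v 42) \<inter> nodeset m d"
  have A: "?A = ap (?v 40) (?v 41) (?v 42) \<inter> ap (?v 46) (?v 47) (?v 48) \<inter> {G..<G + Q}"
    using ok nz by (auto simp: apok_def ap_iff nodeset_def)
  have F: "?A = {j \<in> ?A. ?v 49 \<le> m (ZB + (4 * Q + (j - G)))}" by auto
  have mid: "midclosed ?A" using nz by (simp add: nodeset_def midclosed_Int midclosed_ap)
  have "R w X Y isect (v, m) (tc ?c + Kf * Q) 0 (\<lambda>(v', m'). (\<forall>r<46. v' r = v r) \<and> m' = m \<and>
     scanned ?A (v' 80) (v' 81) (v' 82) (v' 83))"
    unfolding isect_def
  proof (rule R_block_Seq)
    show "bsafe w X Y ?c (v, m)" using b Bd by (simp add: r)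
    show "R w X Y fold (nexec X Y ?c (v, m)) (Kf * Q) 0 (\<lambda>(v', m'). (\<forall>r<46. v' r = v r) \<and> m' = m \<and>
     scanned ?A (v' 80) (v' 81) (v' 82) (v' 83))"
      unfolding n
      by (rule R_mono[OF fold_correct[OF e2 r2 b(1,2) ZBb b(3) A F mid]]) auto
  qed
  then show ?thesis by (rule R_mono) (auto simp: isect_def)
qed

end

text \<open>Multiplying the heap number of the parent by 8 gives the offset of its left child; the
  right child is stored four words further.\<close>

definition bchild :: com where
  "bchild = Set 28 (V 29 +. ((V 8 +. V 24) div. V 25) *. C 8) ;;
    IfC (Ite (Ld (V 28)) (Ld (V 28 +. C 4)) (C 0))
      ((Set 40 (Ld (V 28 +. C 1)) ;; Set 41 (Ld (V 28 +. C 2)) ;; Set 42 (Ld (V 28 +. C 3)) ;; Set 28 (V 28 +. C 4)) ;; isect ;; adopt)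
      (Set 80 (C 0))"

definition bleaf :: com where
  "bleaf = Set 40 (V 22) ;; Set 41 (C 1) ;; Set 42 (V 22 +. V 23 -. C 1) ;; Set 80 (C 1)"

definition bstore :: com where
  "bstore = Set 28 (V 29 +. ((V 8 +. V 24) div. V 25) *. C 4) ;;
    Put (V 28) (V 43) ;; Put (V 28 +. C 1) (V 40) ;; Put (V 28 +. C 2) (V 41) ;; Put (V 28 +. C 3) (V 42)"

text \<open>The children only propose candidates; the parent interval is certified afresh by
  \<open>extend\<close>. Errors therefore do not accumulate along the levels, and a node of any
  height has at most 2 (aa - 1) mismatches per diagonal.\<close>

definition bnode :: "nat \<Rightarrow> com" where
  "bnode cc = IfC (V 25 =. C 1) bleaf bchild ;;
    IfC (V 80) ((Set 20 (V 24 *. V 7) ;; Set 21 ((V 24 +. V 25) *. V 7)) ;; extend cc) (Set 43 (C 0)) ;;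
    bstore"

definition Kn :: nat where "Kn = Ke + Kf + 2 * tc (bnode 0) + 10"

context treep begin

text \<open>Construction proceeds by tree, then level, then position, so the children of a node are
  complete before the node itself.\<close>

definition nodes_done :: "(nat \<Rightarrow> nat) \<Rightarrow> nat \<Rightarrow> nat \<Rightarrow> nat \<Rightarrow> bool" where
  "nodes_done m SG a t \<longleftrightarrow> (\<forall>SG' a' t'. SG' < nsg \<longrightarrow> a' \<le> LT \<longrightarrow> t' < TT \<longrightarrow> 2 ^ a' dvd t' \<longrightarrow>
     (SG' < SG \<or> SG' = SG \<and> (a' < a \<or> a' = a \<and> t' < t)) \<longrightarrow> node_good m SG' a' t')"

text \<open>An exact match on the interval restricts to both halves, so the intersection of the two
  child progressions misses none, and an empty child refutes all diagonals at once. A leaf starts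
  from the progression of all diagonals.\<close>

lemma bnode_select:
  assumes e: "env v" and r: "v 22 = SG * rr" "v 23 = rr" "v 24 = t" "v 25 = 2 ^ a" "v 29 = adr SG 0"
    and b: "SG < nsg" "a \<le> LT" "t < TT" "2 ^ a dvd t" and dn: "nodes_done m SG a t"
  shows "R w X Y (IfC (V 25 =. C 1) bleaf bchild) (v, m) (Kf * rr + tc (bnode 0)) 0 (\<lambda>(v', m'). (\<forall>r. r < 40 \<and> r \<noteq> 28 \<longrightarrow> v' r = v r) \<and> m' = m \<and>
     (v' 80 \<noteq> 0 \<longrightarrow> apok (SG * rr) rr (v' 40) (v' 41) (v' 42)) \<and>
     (\<forall>j. SG * rr \<le> j \<longrightarrow> j < SG * rr + rr \<longrightarrow> exact x y (t * M) ((t + 2 ^ a) * M) j \<longrightarrow> v' 80 \<noteq> 0 \<and> j \<in> ap (v' 40) (v' 41) (v' 42)))"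
    (is "R w X Y _ _ _ _ ?P")
proof -
  have rb: "SG * rr + rr \<le> Bd"
  proof -
    have "SG * rr \<le> nsg * rr" using b by (intro mult_le_mono1) simp
    then show ?thesis using rng by linarith
  qed
  have wb: "16 * Bd \<le> 2 ^ w" "100 \<le> Bd" by (rule Bd)+
  have "R w X Y (IfC (V 25 =. C 1) bleaf bchild) (v, m) (te (V 25 =. C 1) + 1 + (Kf * rr + (tc bleaf + tc bchild))) 0 ?P"
  proof (rule R_If)
    show "esafe w X Y (v, m) (V 25 =. C 1)" using wb by simp
  next
    assume "nev X Y (v, m) (V 25 =. C 1) \<noteq> 0"
    have "R w X Y bleaf (v, m) (tc bleaf) 0 ?P"
    proof (rule R_block')
      show "bsafe w X Y bleaf (v, m)" using rb rr1 wb by (simp add: bleaf_def r)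
      show "?P (nexec X Y bleaf (v, m))" using rr1 by (auto simp: bleaf_def r apok_def ap_one)
    qed simp
    then show "R w X Y bleaf (v, m) (Kf * rr + (tc bleaf + tc bchild)) 0 ?P" by (rule R_mono) auto
  next
    assume "nev X Y (v, m) (V 25 =. C 1) = 0"
    then have "a \<noteq> 0" using r by auto
    then obtain a1 where a1: "a = Suc a1" by (cases a) auto
    let ?h1 = "hidx a1 t" and ?h2 = "hidx a1 (t + 2 ^ a1)"
    have t2: "2 ^ a1 dvd t" "2 ^ a1 dvd t + 2 ^ a1" "t + 2 ^ a1 < TT" "a1 \<le> LT"
    proof -
      have "2 ^ a1 dvd (2::nat) ^ a" by (simp add: a1)
      then show "2 ^ a1 dvd t" using b(4) by (rule dvd_trans)
      then show "2 ^ a1 dvd t + 2 ^ a1" by simp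
      have "0 < (2::nat) ^ a1" by simp
      moreover have "t + 2 * 2 ^ a1 \<le> TT" using dvd_fits[OF b(2-4)] a1 by simp
      ultimately show "t + 2 ^ a1 < TT" by linarith
      show "a1 \<le> LT" using b a1 by simp
    qed
    have h: "hidx a t * 8 = ?h1 * 4" "?h2 = ?h1 + 1"
    proof -
      have "hidx a t * 2 * 2 ^ a1 = ?h1 * 2 ^ a1"
        using hidx_eq(2)[OF b(2,4)] hidx_eq(2)[OF t2(4,1)] a1 by (simp only: power_Suc ac_simps)
      moreover have "(0::nat) < 2 ^ a1" by simp
      ultimately have "hidx a t * 2 = ?h1" by (metis mult_right_cancel not_gr_zero)
      then show "hidx a t * 8 = ?h1 * 4" by simp
      have "?h2 * 2 ^ a1 = (?h1 + 1) * 2 ^ a1"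
        using hidx_eq(2)[OF t2(4,2)] hidx_eq(2)[OF t2(4,1)] by (simp add: add_mult_distrib)
      moreover have "(0::nat) < 2 ^ a1" by simp
      ultimately show "?h2 = ?h1 + 1" by (metis mult_right_cancel not_gr_zero)
    qed
    define d where "d = adr SG ?h1"
    have d2: "adr SG ?h2 = d + 4" unfolding d_def h(2) by (simp add: adr_def)
    have db: "d + 8 \<le> Bd" unfolding d_def by (rule adr_bound(1)[OF b(1) hidx_bounds(3)[OF t2(4,1) b(3)]])
    have g1: "node_good m SG a1 t" using dn b t2 a1 unfolding nodes_done_def by auto
    have g2: "node_good m SG a1 (t + 2 ^ a1)" using dn b t2 a1 unfolding nodes_done_def by auto
    have split: "j \<in> nodeset m d \<and> j \<in> nodeset m (d + 4)"
      if j: "SG * rr \<le> j" "j < SG * rr + rr" "exact x y (t * M) ((t + 2 ^ a) * M) j" for j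
    proof -
      have le: "(t + 2 ^ a1) * M \<le> (t + 2 ^ a) * M" "t * M \<le> (t + 2 ^ a1) * M" by (intro mult_le_mono1; simp add: a1)+
      have eq: "t + 2 ^ a = (t + 2 ^ a1) + 2 ^ a1" by (simp add: a1)
      have "exact x y (t * M) ((t + 2 ^ a1) * M) j" by (rule exact_sub[OF j(3) order_refl le(1)])
      moreover have "exact x y ((t + 2 ^ a1) * M) ((t + 2 ^ a1 + 2 ^ a1) * M) j" unfolding eq[symmetric] by (rule exact_sub[OF j(3) le(2) order_refl])
      ultimately show ?thesis using g1 g2 j(1,2) unfolding node_good_def Let_def d2 d_def[symmetric] by blast
    qed
    let ?c1 = "Set 28 (V 29 +. ((V 8 +. V 24) div. V 25) *. C 8)"
    let ?c2 = "Set 40 (Ld (V 28 +. C 1)) ;; Set 41 (Ld (V 28 +. C 2)) ;; Set 42 (Ld (V 28 +. C 3)) ;; Set 28 (V 28 +. C 4)"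
    let ?g = "Ite (Ld (V 28)) (Ld (V 28 +. C 4)) (C 0)"
    let ?v1 = "v(28 := d)"
    have hd: "(TT + t) div 2 ^ a = hidx a t" by (simp add: hidx_def)
    have dd: "adr SG 0 + hidx a t * 8 = d" unfolding h(1) d_def by (simp add: adr_def)
    have n1: "nexec X Y ?c1 (v, m) = (?v1, m)" using dd by (simp add: r envD[OF e] hd)
    have s1: "bsafe w X Y ?c1 (v, m)"
    proof -
      have "TT \<le> Bd" "hidx a t * 8 \<le> Bd" using mem(2) dd db by linarith+
      then show ?thesis using dd db b wb by (simp add: r envD[OF e] hd)
    qed
    have "R w X Y bchild (v, m) (tc ?c1 + (te ?g + 1 + (tc ?c2 + (Kf * rr + tc isect + tc adopt) + 10))) 0 ?P"
      unfolding bchild_def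
    proof (rule R_block_Seq[OF s1], unfold n1, rule R_If)
      show "esafe w X Y (?v1, m) ?g" using db wb by simp
    next
      assume "nev X Y (?v1, m) ?g = 0"
      then have "nodeset m d = {} \<or> nodeset m (d + 4) = {}" by (auto simp: nodeset_def split: if_splits)
      then have no: "\<not> exact x y (t * M) ((t + 2 ^ a) * M) j" if "SG * rr \<le> j" "j < SG * rr + rr" for j using split that by auto
      show "R w X Y (Set 80 (C 0)) (?v1, m) (tc ?c2 + (Kf * rr + tc isect + tc adopt) + 10) 0 ?P"
        by (rule R_block') (use no wb in auto)
    next
      assume "nev X Y (?v1, m) ?g \<noteq> 0"
      then have nz: "m d \<noteq> 0" "m (d + 4) \<noteq> 0" by (auto split: if_splits)
      let ?v2 = "v(40 := m (d + 1), 41 := m (d + 2), 42 := m (d + 3), 28 := d + 4)"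
      have n2: "nexec X Y ?c2 (?v1, m) = (?v2, m)" by (simp add: fun_eq_iff)
      have e2: "env ?v2" by (rule env_cong[OF e]) auto
      have r2: "?v2 22 = SG * rr" "?v2 23 = rr" "?v2 28 = d + 4" using r by auto
      have ok: "apok (SG * rr) rr (?v2 40) (?v2 41) (?v2 42)" using g1 nz unfolding node_good_def Let_def d_def[symmetric] by simp
      have A: "ap (?v2 40) (?v2 41) (?v2 42) = nodeset m d" using nz by (simp add: nodeset_def)
      have b2: "9 * rr \<le> Bd" "SG * rr \<le> Bd" "1 \<le> rr" "d + 4 + 3 \<le> Bd" using rng rb rr1 db by auto
      have "R w X Y (?c2 ;; isect ;; adopt) (?v1, m) (tc ?c2 + ((Kf * rr + tc isect) + tc adopt)) (0 + 0) ?P"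
      proof (rule R_block_Seq)
        show "bsafe w X Y ?c2 (?v1, m)" using db wb by simp
        show "R w X Y (isect ;; adopt) (nexec X Y ?c2 (?v1, m)) ((Kf * rr + tc isect) + tc adopt) (0 + 0) ?P"
          unfolding n2
        proof (rule R_Seq[OF isect_correct[where m = m and d = "d + 4", OF e2 r2 b2 ok nz(2)]])
          fix s assume *: "(\<lambda>(v', m'). (\<forall>r<46. v' r = ?v2 r) \<and> m' = m \<and>
             scanned (ap (?v2 40) (?v2 41) (?v2 42) \<inter> nodeset m (d + 4)) (v' 80) (v' 81) (v' 82) (v' 83)) s"
          obtain v3 where s: "s = (v3, m)" using * by (cases s) auto
          have v3: "\<And>r. r < 46 \<Longrightarrow> v3 r = ?v2 r" and S: "scanned (nodeset m d \<inter> nodeset m (d + 4)) (v3 80) (v3 81) (v3 82) (v3 83)"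
            using * unfolding s A by auto
          let ?v4 = "v3(40 := v3 81, 41 := v3 82, 42 := v3 83)"
          have n3: "nexec X Y adopt s = (?v4, m)" by (simp add: s adopt_def)
          have ok4: "apok (SG * rr) rr (v3 81) (v3 82) (v3 83)" if "v3 80 \<noteq> 0"
          proof -
            note sd = scannedD[OF S that]
            have "v3 81 \<in> nodeset m d" "v3 83 \<in> nodeset m d" using sd by blast+
            then show ?thesis using ok sd(4,5) sd(1,2) unfolding A[symmetric] by (auto simp: apok_def ap_iff)
          qed
          have cmp: "v3 80 \<noteq> 0 \<and> j \<in> ap (v3 81) (v3 82) (v3 83)"
            if j: "SG * rr \<le> j" "j < SG * rr + rr" "exact x y (t * M) ((t + 2 ^ a) * M) j" for j
          proof -
            have jn: "j \<in> nodeset m d \<inter> nodeset m (d + 4)" using split[OF j] by blast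
            have ne: "v3 80 \<noteq> 0"
            proof
              assume "v3 80 = 0"
              then have "nodeset m d \<inter> nodeset m (d + 4) = {}" using S unfolding scanned_def by (simp only: if_True)
              then show False using jn by blast
            qed
            then show ?thesis using scannedD(1)[OF S ne] jn by blast
          qed
          show "R w X Y adopt s (tc adopt) 0 ?P"
          proof (rule R_block')
            show "bsafe w X Y adopt s" by (simp add: adopt_def)
            show "?P (nexec X Y adopt s)" unfolding n3 using ok4 cmp v3 by auto
          qed simp
        qed
      qed
      then show "R w X Y (?c2 ;; isect ;; adopt) (?v1, m) (tc ?c2 + (Kf * rr + tc isect + tc adopt) + 10) 0 ?P"
        by (rule R_mono) auto
    qed
    then show "R w X Y bchild (v, m) (Kf * rr + (tc bleaf + tc bchild)) 0 ?P"
      by (rule R_mono) (auto simp: bchild_def bleaf_def isect_def adopt_def)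
  qed
  then show ?thesis by (rule R_mono) (auto simp: bnode_def)
qed

lemma bnode_correct:
  assumes e: "env v" and r: "v 22 = SG * rr" "v 23 = rr" "v 24 = t" "v 25 = 2 ^ a" "v 29 = adr SG 0"
    and b: "SG < nsg" "a \<le> LT" "t < TT" "2 ^ a dvd t" and dn: "nodes_done m SG a t"
  shows "R w X Y (bnode cc) (v, m) (Kn * (LB + 4) * ecost rr (2 ^ a * M)) (of_nat (LB + 4) * fail0) (\<lambda>(v', m').
     (\<forall>r. r < 40 \<and> r \<noteq> 28 \<and> r \<noteq> 20 \<and> r \<noteq> 21 \<longrightarrow> v' r = v r) \<and> (\<forall>d<ZB. m' d = m d) \<and> nodes_done m' SG a (t + 2 ^ a))"
    (is "R w X Y _ _ _ _ ?P")
proof -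
  let ?ST = "t * M" and ?EN = "(t + 2 ^ a) * M" and ?G = "SG * rr"
  let ?sel = "IfC (V 25 =. C 1) bleaf bchild"
  let ?c1 = "Set 20 (V 24 *. V 7) ;; Set 21 ((V 24 +. V 25) *. V 7)"
  let ?mid = "IfC (V 80) (?c1 ;; extend cc) (Set 43 (C 0))"
  have rb: "SG * rr + rr \<le> Bd"
  proof -
    have "SG * rr \<le> nsg * rr" using b by (intro mult_le_mono1) simp
    then show ?thesis using rng by linarith
  qed
  have fit: "t + 2 ^ a \<le> TT" by (rule dvd_fits[OF b(2-4)])
  have ENM: "?EN \<le> TT * M" "?ST \<le> TT * M" using fit b by (intro mult_le_mono1; simp)+
  have ST4: "?ST + 4 * rr \<le> ?EN"
  proof -
    have "M \<le> 2 ^ a * M" by simp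
    then have "4 * rr \<le> 2 ^ a * M" using M by linarith
    then show ?thesis by (simp add: add_mult_distrib)
  qed
  have ENH: "?EN \<le> H" using ENM HH by linarith
  have len: "?EN - ?ST = 2 ^ a * M" by (simp add: add_mult_distrib)
  have pre: "epre ?ST ?EN ?G rr"
  proof -
    have "(?EN - ?ST + rr + 1) * (cc * L) \<le> (H + rr + 1) * (cc * L)" using ENH by (intro mult_le_mono1) linarith
    then have 1: "(?EN - ?ST + rr + 1) * (cc * L) \<le> Bd" using samp by linarith
    have "ZB + 9 * rr \<le> Bd" using mem by linarith
    then show ?thesis unfolding epre_def using 1 ST4 ENH rng(2) rb rr1(1) by blast
  qed
  have wb: "16 * Bd \<le> 2 ^ w" "100 \<le> Bd" "H \<le> Bd" by (rule Bd)+
  define d where "d = adr SG (hidx a t)"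
  have db: "d + 8 \<le> Bd" unfolding d_def by (rule adr_bound(1)[OF b(1) hidx_bounds(3)[OF b(2,4,3)]])
  let ?T = "Ke * (LB + 4) * ecost rr (2 ^ a * M)"
  let ?S = "\<lambda>(v', m'). (\<forall>r. r < 40 \<and> r \<noteq> 28 \<longrightarrow> v' r = v r) \<and> m' = m \<and>
     (v' 80 \<noteq> 0 \<longrightarrow> apok (SG * rr) rr (v' 40) (v' 41) (v' 42)) \<and>
     (\<forall>j. SG * rr \<le> j \<longrightarrow> j < SG * rr + rr \<longrightarrow> exact x y (t * M) ((t + 2 ^ a) * M) j \<longrightarrow> v' 80 \<noteq> 0 \<and> j \<in> ap (v' 40) (v' 41) (v' 42))"
  let ?E = "\<lambda>(v', m'). (\<forall>r. r < 40 \<and> r \<noteq> 28 \<and> r \<noteq> 20 \<and> r \<noteq> 21 \<longrightarrow> v' r = v r) \<and> (\<forall>d. d < ZB \<or> ZB + 9 * rr \<le> d \<longrightarrow> m' d = m d) \<and>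
     (v' 43 \<noteq> 0 \<longrightarrow> apok ?G rr (v' 40) (v' 41) (v' 42) \<and> (\<forall>j\<in>ap (v' 40) (v' 41) (v' 42). mism x y ?ST ?EN j \<le> 2 * (aa - 1))) \<and>
     (\<forall>j. ?G \<le> j \<longrightarrow> j < ?G + rr \<longrightarrow> exact x y ?ST ?EN j \<longrightarrow> v' 43 \<noteq> 0 \<and> j \<in> ap (v' 40) (v' 41) (v' 42))"
  have "R w X Y (bnode cc) (v, m) ((Kf * rr + tc (bnode 0)) + ((te (V 80) + 1 + (tc ?c1 + ?T + 10)) + tc bstore)) (0 + (of_nat (LB + 4) * fail0 + 0)) ?P"
    unfolding bnode_def[of cc]
  proof (rule R_Seq[OF bnode_select[OF assms]])
    fix s assume S: "?S s"
    obtain v1 where s: "s = (v1, m)" using S by (cases s) auto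
    have v1: "\<And>r. r < 40 \<Longrightarrow> r \<noteq> 28 \<Longrightarrow> v1 r = v r" using S by (simp add: s)
    have ok: "v1 80 \<noteq> 0 \<Longrightarrow> apok ?G rr (v1 40) (v1 41) (v1 42)"
      and cmp: "\<And>j. ?G \<le> j \<Longrightarrow> j < ?G + rr \<Longrightarrow> exact x y ?ST ?EN j \<Longrightarrow> v1 80 \<noteq> 0 \<and> j \<in> ap (v1 40) (v1 41) (v1 42)"
      using S unfolding s prod.case by blast+
    have e1: "env v1" by (rule env_cong[OF e]) (use v1 in auto)
    have r1: "v1 24 = t" "v1 25 = 2 ^ a" "v1 22 = ?G" "v1 23 = rr" using v1 r by auto
    have mid: "R w X Y ?mid s (te (V 80) + 1 + (tc ?c1 + ?T + 10)) (of_nat (LB + 4) * fail0) ?E"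
      unfolding s
    proof (rule R_If)
      show "esafe w X Y (v1, m) (V 80)" by simp
    next
      assume "nev X Y (v1, m) (V 80) = 0"
      then show "R w X Y (Set 43 (C 0)) (v1, m) (tc ?c1 + ?T + 10) (of_nat (LB + 4) * fail0) ?E"
        using v1 cmp wb by (intro R_block') auto
    next
      assume nz: "nev X Y (v1, m) (V 80) \<noteq> 0"
      let ?v2 = "v1(20 := ?ST, 21 := ?EN)"
      have n2: "nexec X Y ?c1 (v1, m) = (?v2, m)" by (simp add: r1 envD[OF e1])
      have e2: "env ?v2" by (rule env_cong[OF e1]) auto
      have r2: "?v2 20 = ?ST" "?v2 21 = ?EN" "?v2 22 = ?G" "?v2 23 = rr" using r1 by auto
      have ok2: "apok ?G rr (?v2 40) (?v2 41) (?v2 42)" using ok nz by simp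
      have "R w X Y (?c1 ;; extend cc) (v1, m) (tc ?c1 + ?T) (of_nat (LB + 4) * fail0) ?E"
      proof (rule R_block_Seq)
        have "t + 2 ^ a < 2 ^ w" "?ST < 2 ^ w" "?EN < 2 ^ w" using fit mem(2) ENM HH wb by linarith+
        then show "bsafe w X Y ?c1 (v1, m)" by (simp add: r1 envD[OF e1])
        show "R w X Y (extend cc) (nexec X Y ?c1 (v1, m)) ?T (of_nat (LB + 4) * fail0) ?E"
          unfolding n2
        proof (rule R_mono[OF extend_correct[OF e2 r2 pre ok2, unfolded len]])
          fix s' assume *: "(\<lambda>(v', m'). ebase ?v2 m ?ST ?EN ?G rr v' m' \<and>
             epost ?ST ?EN ?G rr (ap (?v2 40) (?v2 41) (?v2 42)) (v' 43) (v' 40) (v' 41) (v' 42) (v' 44)) s'"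
          obtain v3 m3 where s': "s' = (v3, m3)" by (cases s')
          have eb: "ebase ?v2 m ?ST ?EN ?G rr v3 m3" and ep: "epost ?ST ?EN ?G rr (ap (v1 40) (v1 41) (v1 42)) (v3 43) (v3 40) (v3 41) (v3 42) (v3 44)"
            using * by (simp_all add: s')
          have fr: "\<forall>r. r < 40 \<and> r \<noteq> 28 \<and> r \<noteq> 20 \<and> r \<noteq> 21 \<longrightarrow> v3 r = v r" using eb v1 unfolding ebase_def by auto
          have fm: "\<forall>d. d < ZB \<or> ZB + 9 * rr \<le> d \<longrightarrow> m3 d = m d" using eb unfolding ebase_def by blast
          have p1: "apok ?G rr (v3 40) (v3 41) (v3 42) \<and> (\<forall>j\<in>ap (v3 40) (v3 41) (v3 42). mism x y ?ST ?EN j \<le> 2 * (aa - 1))" if "v3 43 \<noteq> 0"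
            using ep that unfolding epost_def by simp
          have p2: "v3 43 \<noteq> 0 \<and> j \<in> ap (v3 40) (v3 41) (v3 42)" if j: "?G \<le> j" "j < ?G + rr" "exact x y ?ST ?EN j" for j
          proof -
            have j1: "j \<in> ap (v1 40) (v1 41) (v1 42)" using cmp[OF j] by simp
            show ?thesis using ep j1 j(3) unfolding epost_def by (cases "v3 43 = 0") auto
          qed
          show "?E s'" unfolding s' using fr fm p1 p2 by simp
        qed auto
      qed
      then show "R w X Y (?c1 ;; extend cc) (v1, m) (tc ?c1 + ?T + 10) (of_nat (LB + 4) * fail0) ?E"
        by (rule R_mono) auto
    qed
    show "R w X Y (?mid ;; bstore) s ((te (V 80) + 1 + (tc ?c1 + ?T + 10)) + tc bstore) (of_nat (LB + 4) * fail0 + 0) ?P"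
    proof (rule R_Seq[OF mid])
      fix s' assume E: "?E s'"
      obtain v3 m3 where s': "s' = (v3, m3)" by (cases s')
      have v3: "\<And>r. r < 40 \<Longrightarrow> r \<noteq> 28 \<Longrightarrow> r \<noteq> 20 \<Longrightarrow> r \<noteq> 21 \<Longrightarrow> v3 r = v r" using E by (simp add: s')
      have m3: "\<And>d. d < ZB \<or> ZB + 9 * rr \<le> d \<Longrightarrow> m3 d = m d"
        and p1: "v3 43 \<noteq> 0 \<Longrightarrow> apok ?G rr (v3 40) (v3 41) (v3 42) \<and> (\<forall>j\<in>ap (v3 40) (v3 41) (v3 42). mism x y ?ST ?EN j \<le> 2 * (aa - 1))"
        and p2: "\<And>j. ?G \<le> j \<Longrightarrow> j < ?G + rr \<Longrightarrow> exact x y ?ST ?EN j \<Longrightarrow> v3 43 \<noteq> 0 \<and> j \<in> ap (v3 40) (v3 41) (v3 42)"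
        using E unfolding s' prod.case by blast+
      have e3: "env v3" by (rule env_cong[OF e]) (use v3 in auto)
      have r3: "v3 24 = t" "v3 25 = 2 ^ a" "v3 29 = adr SG 0" using v3 r by auto
      have hd: "(TT + t) div 2 ^ a = hidx a t" by (simp add: hidx_def)
      have dd: "adr SG 0 + hidx a t * 4 = d" by (simp add: d_def adr_def)
      let ?m4 = "m3(d := v3 43, d + 1 := v3 40, d + 2 := v3 41, d + 3 := v3 42)"
      have n4: "nexec X Y bstore s' = (v3(28 := d), ?m4)" using dd by (simp add: s' bstore_def r3 envD[OF e3] hd)
      have bs: "bsafe w X Y bstore s'"
      proof -
        have "TT \<le> Bd" "hidx a t * 4 \<le> Bd" using mem(2) dd db by linarith+
        then show ?thesis using dd db b wb by (simp add: s' bstore_def r3 envD[OF e3] hd)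
      qed
      have lowm: "\<forall>d'<ZB. ?m4 d' = m d'"
      proof (intro allI impI)
        fix d' assume "d' < ZB"
        moreover have "ZB \<le> d" using adr_bound(3)[of SG "hidx a t"] unfolding d_def by linarith
        ultimately show "?m4 d' = m d'" using m3[of d'] by simp
      qed
      have new: "node_good ?m4 SG a t"
      proof -
        have ns: "nodeset ?m4 d = (if v3 43 = 0 then {} else ap (v3 40) (v3 41) (v3 42))" by (simp add: nodeset_def)
        show ?thesis unfolding node_good_def Let_def d_def[symmetric] ns
          using p1 p2 by auto
      qed
      have "nodes_done ?m4 SG a (t + 2 ^ a)"
        unfolding nodes_done_def
      proof (intro allI impI)
        fix SG' a' t' assume *: "SG' < nsg" "a' \<le> LT" "t' < TT" "2 ^ a' dvd t'"
          "SG' < SG \<or> SG' = SG \<and> (a' < a \<or> a' = a \<and> t' < t + 2 ^ a)"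
        show "node_good ?m4 SG' a' t'"
        proof (cases "(SG', a', t') = (SG, a, t)")
          case True
          then show ?thesis using new by simp
        next
          case False
          \<comment> \<open>No multiple of 2 ^ a lies strictly between t and t + 2 ^ a.\<close>
          have "t' < t" if "SG' = SG" "a' = a" "t' < t + 2 ^ a"
          proof (rule ccontr)
            assume "\<not> t' < t"
            moreover have "t' \<noteq> t" using False that by simp
            ultimately have "t < t'" by simp
            moreover have "2 ^ a dvd (t' - t)" using * b that by (intro dvd_diff_nat) auto
            ultimately have "2 ^ a \<le> t' - t" by (intro dvd_imp_le) auto
            then show False using that \<open>t < t'\<close> by linarith
          qed
          then have "node_good m SG' a' t'" using dn * unfolding nodes_done_def by blast
          then show ?thesis
          proof (rule node_good_cong)
            fix i :: nat assume i: "i < 4"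
            let ?d' = "adr SG' (hidx a' t') + i"
            have neq: "?d' \<noteq> d + i'" if "i' < 4" for i'
              unfolding d_def by (rule adr_disj) (use * b False i that in auto)
            have "?m4 ?d' = m3 ?d'" using neq[of 0] neq[of 1] neq[of 2] neq[of 3] by simp
            also have "\<dots> = m ?d'" by (rule m3) (use adr_bound(3)[of SG' "hidx a' t'"] in auto)
            finally show "?m4 ?d' = m ?d'" .
          qed
        qed
      qed
      then show "R w X Y bstore s' (tc bstore) 0 ?P"
        using bs lowm v3 unfolding n4 by (intro R_block') (auto simp: n4)
    qed
  qed
  then show ?thesis
  proof (rule R_mono)
    let ?F = "(LB + 4) * ecost rr (2 ^ a * M)"
    have "1 * ecost rr (2 ^ a * M) \<le> ?F" by (intro mult_le_mono1) simp
    moreover have "rr \<le> ecost rr (2 ^ a * M)" "1 \<le> ecost rr (2 ^ a * M)" by (auto simp: ecost_def)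
    ultimately have E: "rr \<le> ?F" "1 \<le> ?F" by linarith+
    have c: "tc (bnode 0) + te (V 80) + 1 + tc ?c1 + 10 + tc bstore \<le> 2 * tc (bnode 0) + 10" by (simp add: bnode_def)
    have "Kf * rr \<le> Kf * ?F" using E by (intro mult_le_mono2)
    moreover have "2 * tc (bnode 0) + 10 \<le> (2 * tc (bnode 0) + 10) * ?F" using E(2) by (metis mult.right_neutral mult_le_mono2)
    ultimately have "Kf * rr + (2 * tc (bnode 0) + 10) + Ke * ?F \<le> (Kf + (2 * tc (bnode 0) + 10) + Ke) * ?F" by (simp only: add_mult_distrib)
    moreover have "\<dots> = Kn * ?F" by (simp only: Kn_def ac_simps)
    ultimately show "(Kf * rr + tc (bnode 0)) + ((te (V 80) + 1 + (tc ?c1 + ?T + 10)) + tc bstore) \<le> Kn * (LB + 4) * ecost rr (2 ^ a * M)"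
      using c unfolding mult.assoc by linarith
  qed auto
qed

end

section \<open>Building all trees level by level\<close>

definition blevel :: "nat \<Rightarrow> com" where
  "blevel cc = Set 24 (C 0) ;; While (V 24 <. V 8) (bnode cc ;; Set 24 (V 24 +. V 25))"

definition bsuper :: "nat \<Rightarrow> com" where
  "bsuper cc = (Set 22 (V 27 *. V 6) ;; Set 23 (V 6) ;; Set 29 (V 11 +. V 27 *. (C 8 *. V 8)) ;; Set 25 (C 1)) ;;
     While (notE (V 8 <. V 25)) (blevel cc ;; Set 25 (C 2 *. V 25))"

definition build :: "nat \<Rightarrow> com" where
  "build cc = Set 27 (C 0) ;; While (V 27 <. V 12) (bsuper cc ;; Set 27 (V 27 +. C 1))"

definition Kt :: nat where "Kt = Kn + tc (build 0) + 100"

context treep begin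

definition lcost :: nat where
  "lcost = (LB + 4) * (TT * (rr + ((M + rr) div aa + 2) * (cc * L) + LB + 1))"

lemma mult_div_le: "(c * b) div (d::nat) \<le> c * (b div d + 1)"
proof (cases "d = 0")
  case False
  have "b \<le> d * (b div d + 1)"
    using False by (metis add.commute div_mult_mod_eq less_imp_le mod_less_divisor mult.commute mult_Suc_right nat_add_left_cancel_le not_gr_zero plus_1_eq_Suc)
  then have "c * b \<le> d * (c * (b div d + 1))" by (metis mult.left_commute mult_le_mono2)
  then have "(c * b) div d \<le> (d * (c * (b div d + 1))) div d" by (rule div_le_mono)
  then show ?thesis using False by simp
qed simp

text \<open>From one level to the next the intervals double while their number halves, so up to
  rounding every level costs the same as the leaves.\<close>

lemma ecost_level: "a \<le> LT \<Longrightarrow> 2 ^ (LT - a) * ((LB + 4) * ecost rr (2 ^ a * M)) \<le> lcost"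
proof -
  assume a: "a \<le> LT"
  let ?n = "2 ^ (LT - a) :: nat" and ?c = "2 ^ a :: nat"
  have nc: "?n * ?c = TT" using a TT by (simp add: power_add[symmetric])
  have nT: "?n \<le> TT" unfolding TT by (intro power_increasing) auto
  have "2 ^ a * M + rr \<le> ?c * (M + rr)" by (simp add: add_mult_distrib2)
  then have "(2 ^ a * M + rr) div aa \<le> ?c * ((M + rr) div aa + 1)"
    using div_le_mono[of "2 ^ a * M + rr" "?c * (M + rr)" aa] mult_div_le[of ?c "M + rr" aa] by linarith
  then have "?n * ((2 ^ a * M + rr) div aa + 1) \<le> ?n * (?c * ((M + rr) div aa + 1) + 1)" by (intro mult_le_mono2) simp
  also have "\<dots> = TT * ((M + rr) div aa + 1) + ?n" unfolding nc[symmetric] by (simp add: add_mult_distrib2)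
  also have "\<dots> \<le> TT * ((M + rr) div aa + 2)" using nT by simp
  finally have 1: "?n * (((2 ^ a * M + rr) div aa + 1) * (cc * L)) \<le> TT * (((M + rr) div aa + 2) * (cc * L))"
    unfolding mult.assoc[symmetric] by (intro mult_le_mono1)
  have "?n * ecost rr (2 ^ a * M) = ?n * rr + ?n * (((2 ^ a * M + rr) div aa + 1) * (cc * L)) + ?n * (LB + 1)"
    by (simp only: ecost_def add_mult_distrib2 add.assoc)
  also have "\<dots> \<le> TT * rr + TT * (((M + rr) div aa + 2) * (cc * L)) + TT * (LB + 1)"
    using nT 1 by (intro add_mono mult_le_mono1)
  also have "\<dots> = TT * (rr + ((M + rr) div aa + 2) * (cc * L) + LB + 1)"
    by (simp only: add_mult_distrib2 add.assoc)
  finally have "(LB + 4) * (?n * ecost rr (2 ^ a * M)) \<le> lcost" unfolding lcost_def by (rule mult_le_mono2)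
  then show ?thesis by (simp only: mult.left_commute)
qed

lemma lcost_ge: "TT \<le> lcost" "1 \<le> lcost"
proof -
  have "1 * (TT * 1) \<le> lcost" unfolding lcost_def by (intro mult_le_mono) auto
  moreover have "1 \<le> TT" using TT by simp
  ultimately show "TT \<le> lcost" "1 \<le> lcost" by simp_all
qed

lemma div_less_step:
  assumes "t < 2 ^ a * n" "2 ^ a dvd (t::nat)"
  shows "n - (t + 2 ^ a) div 2 ^ a < n - t div 2 ^ a" "0 < n - t div 2 ^ a"
proof -
  have "(t + 2 ^ a) div 2 ^ a = t div 2 ^ a + 1" by simp
  moreover have "t div 2 ^ a < n" using assms(1) by (simp add: less_mult_imp_div_less mult.commute)
  ultimately show "n - (t + 2 ^ a) div 2 ^ a < n - t div 2 ^ a" "0 < n - t div 2 ^ a" by simp_all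
qed

lemma blevel_correct:
  assumes e: "env v" and r: "v 22 = SG * rr" "v 23 = rr" "v 25 = 2 ^ a" "v 29 = adr SG 0"
    and b: "SG < nsg" "a \<le> LT" and dn: "nodes_done m SG a 0"
  shows "R w X Y (blevel cc) (v, m) ((Kn + 20) * lcost + 10 * lcost) (of_nat (TT * (LB + 4)) * fail0) (\<lambda>(v', m').
     (\<forall>r. r < 40 \<and> r \<noteq> 28 \<and> r \<noteq> 20 \<and> r \<noteq> 21 \<and> r \<noteq> 24 \<longrightarrow> v' r = v r) \<and> (\<forall>d<ZB. m' d = m d) \<and> nodes_done m' SG (Suc a) 0)"
    (is "R w X Y _ _ _ _ ?P")
proof -
  let ?n = "2 ^ (LT - a) :: nat"
  have nT: "2 ^ a * ?n = TT" using b TT by (simp add: power_add[symmetric])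
  have wb: "16 * Bd \<le> 2 ^ w" "100 \<le> Bd" "H \<le> Bd" by (rule Bd)+
  have TB: "TT \<le> Bd" using mem(2) by linarith
  let ?g = "V 24 <. V 8"
  let ?I = "\<lambda>(v', m'). (\<forall>r. r < 40 \<and> r \<noteq> 28 \<and> r \<noteq> 20 \<and> r \<noteq> 21 \<and> r \<noteq> 24 \<longrightarrow> v' r = v r) \<and> (\<forall>d<ZB. m' d = m d) \<and>
     nodes_done m' SG a (v' 24) \<and> 2 ^ a dvd v' 24 \<and> v' 24 \<le> TT"
  let ?mu = "\<lambda>(v', m' :: nat \<Rightarrow> nat). ?n - v' 24 div 2 ^ a"
  let ?tn = "Kn * (LB + 4) * ecost rr (2 ^ a * M)"
  let ?d = "of_nat (LB + 4) * fail0"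
  have W: "R w X Y (While ?g (bnode cc ;; Set 24 (V 24 +. V 25))) (v(24 := 0), m) (?n * ((?tn + 4) + te ?g + 1) + te ?g + 1) (of_nat ?n * (?d + 0))
     (\<lambda>s'. ?I s' \<and> nev X Y s' ?g = 0)"
  proof (rule R_While[where \<mu> = ?mu])
    fix s assume I: "?I s" and g: "nev X Y s ?g \<noteq> 0"
    obtain v1 m1 where s: "s = (v1, m1)" by (cases s)
    have v1: "\<And>r. r < 40 \<Longrightarrow> r \<noteq> 28 \<Longrightarrow> r \<noteq> 20 \<Longrightarrow> r \<noteq> 21 \<Longrightarrow> r \<noteq> 24 \<Longrightarrow> v1 r = v r" using I by (simp add: s)
    have e1: "env v1" by (rule env_cong[OF e]) (use v1 in auto)
    have r1: "v1 22 = SG * rr" "v1 23 = rr" "v1 25 = 2 ^ a" "v1 29 = adr SG 0" using v1 r by auto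
    have t: "v1 24 < TT" "2 ^ a dvd v1 24" "nodes_done m1 SG a (v1 24)" "\<forall>d<ZB. m1 d = m d" using I g by (auto simp: s envD[OF e1])
    show "R w X Y (bnode cc ;; Set 24 (V 24 +. V 25)) s (?tn + 4) (?d + 0) (\<lambda>s'. ?I s' \<and> ?mu s' < ?mu s)"
      unfolding s
    proof (rule R_Seq[OF bnode_correct[OF e1 r1(1,2) refl r1(3,4) b t(1-3)]])
      fix s' assume *: "(\<lambda>(v', m'). (\<forall>r. r < 40 \<and> r \<noteq> 28 \<and> r \<noteq> 20 \<and> r \<noteq> 21 \<longrightarrow> v' r = v1 r) \<and> (\<forall>d<ZB. m' d = m1 d) \<and> nodes_done m' SG a (v1 24 + 2 ^ a)) s'"
      obtain v2 m2 where s': "s' = (v2, m2)" by (cases s')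
      have v2: "\<And>r. r < 40 \<Longrightarrow> r \<noteq> 28 \<Longrightarrow> r \<noteq> 20 \<Longrightarrow> r \<noteq> 21 \<Longrightarrow> v2 r = v1 r" and m2: "\<forall>d<ZB. m2 d = m1 d" "nodes_done m2 SG a (v1 24 + 2 ^ a)"
        using * by (simp_all add: s')
      have fit: "v1 24 + 2 ^ a \<le> TT" by (rule dvd_fits[OF b(2) t(1,2)])
      have n: "nexec X Y (Set 24 (V 24 +. V 25)) s' = (v2(24 := v1 24 + 2 ^ a), m2)" using v2 r1 by (simp add: s')
      show "R w X Y (Set 24 (V 24 +. V 25)) s' 4 0 (\<lambda>s'. ?I s' \<and> ?mu s' < ?mu (v1, m1))"
      proof (rule R_block')
        show "bsafe w X Y (Set 24 (V 24 +. V 25)) s'" using fit TB wb v2 r1 by (simp add: s')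
        show "?I (nexec X Y (Set 24 (V 24 +. V 25)) s') \<and> ?mu (nexec X Y (Set 24 (V 24 +. V 25)) s') < ?mu (v1, m1)"
          unfolding n using v2 v1 m2 t fit div_less_step(1)[of "v1 24" a ?n] nT by simp
      qed simp
    qed
  next
    fix s assume I: "?I s" and g: "nev X Y s ?g \<noteq> 0"
    obtain v1 m1 where s: "s = (v1, m1)" by (cases s)
    have "v1 8 = TT" using I envD(9)[OF e] by (simp add: s)
    then show "0 < ?mu s" using I g div_less_step(2)[of "v1 24" a ?n] nT by (simp add: s)
  next
    fix s assume "?I s"
    then show "esafe w X Y s ?g" by (cases s) auto
  next
    show "?I (v(24 := 0), m)" using dn by simp
    show "?mu (v(24 := 0), m) \<le> ?n" by simp
  qed
  have "R w X Y (blevel cc) (v, m) (tc (Set 24 (C 0)) + (?n * ((?tn + 4) + te ?g + 1) + te ?g + 1)) (of_nat ?n * (?d + 0)) (\<lambda>s'. ?I s' \<and> nev X Y s' ?g = 0)"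
    unfolding blevel_def
    by (rule R_block_Seq) (use W wb in auto)
  then show ?thesis
  proof (rule R_mono)
    have "?n * ?tn = Kn * (?n * ((LB + 4) * ecost rr (2 ^ a * M)))" by (simp only: ac_simps)
    also have "\<dots> \<le> Kn * lcost" by (intro mult_le_mono2 ecost_level b)
    finally have 1: "?n * ?tn \<le> Kn * lcost" .
    have "?n \<le> TT" unfolding TT by (intro power_increasing) auto
    then have "?n * 8 \<le> 8 * lcost" using lcost_ge by linarith
    moreover have "?n * ((?tn + 4) + te ?g + 1) = ?n * ?tn + ?n * 8" by (simp add: algebra_simps)
    ultimately have "?n * ((?tn + 4) + te ?g + 1) \<le> Kn * lcost + 8 * lcost" using 1 by linarith
    moreover have "tc (Set 24 (C 0)) + te ?g + 1 \<le> 10 * lcost" using lcost_ge by simp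
    ultimately show "tc (Set 24 (C 0)) + (?n * ((?tn + 4) + te ?g + 1) + te ?g + 1) \<le> (Kn + 20) * lcost + 10 * lcost"
      unfolding add_mult_distrib by linarith
    have "?n \<le> TT" unfolding TT by (intro power_increasing) auto
    then have "(of_nat ?n :: ennreal) \<le> of_nat TT" by (simp only: of_nat_le_iff)
    then have "of_nat ?n * (of_nat (LB + 4) * fail0) \<le> of_nat TT * (of_nat (LB + 4) * fail0)" by (intro mult_right_mono) auto
    then show "of_nat ?n * (?d + 0) \<le> of_nat (TT * (LB + 4)) * fail0" by (simp only: of_nat_mult mult.assoc add_0_right)
  next
    fix s assume *: "?I s \<and> nev X Y s ?g = 0"
    obtain v1 m1 where s: "s = (v1, m1)" by (cases s)
    have "v1 8 = TT" using * envD(9)[OF e] by (simp add: s)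
    then have t: "v1 24 = TT" using * by (simp add: s)
    have "nodes_done m1 SG (Suc a) 0" using * unfolding s nodes_done_def by (auto simp: less_Suc_eq t)
    then show "?P s" using * by (simp add: s)
  qed
qed

lemma bsuper_correct:
  assumes e: "env v" and r: "v 27 = SG" and b: "SG < nsg" and dn: "nodes_done m SG 0 0"
  shows "R w X Y (bsuper cc) (v, m) ((LT + 1) * ((Kn + 60) * lcost) + tc (bsuper 0)) (of_nat ((LT + 1) * TT * (LB + 4)) * fail0) (\<lambda>(v', m').
     (\<forall>r. (r < 20 \<or> r = 27) \<longrightarrow> v' r = v r) \<and> (\<forall>d<ZB. m' d = m d) \<and> nodes_done m' (Suc SG) 0 0)"
    (is "R w X Y _ _ _ _ ?P")
proof -
  have wb: "16 * Bd \<le> 2 ^ w" "100 \<le> Bd" "H \<le> Bd" by (rule Bd)+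
  have TB: "2 * TT \<le> Bd" using mem(2) by linarith
  let ?g = "notE (V 8 <. V 25)"
  let ?c = "Set 22 (V 27 *. V 6) ;; Set 23 (V 6) ;; Set 29 (V 11 +. V 27 *. (C 8 *. V 8)) ;; Set 25 (C 1)"
  let ?v0 = "v(22 := SG * rr, 23 := rr, 29 := adr SG 0, 25 := 1)"
  let ?I = "\<lambda>(v', m'). (\<forall>r. (r < 20 \<or> r = 27 \<or> r = 22 \<or> r = 23 \<or> r = 29) \<longrightarrow> v' r = ?v0 r) \<and> (\<forall>d<ZB. m' d = m d) \<and>
     (\<exists>a\<le>Suc LT. v' 25 = 2 ^ a \<and> nodes_done m' SG a 0)"
  let ?mu = "\<lambda>(v', m' :: nat \<Rightarrow> nat). Suc LT - bits (v' 25)"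
  have bits2: "bits (2 ^ a) = a" for a
  proof (rule antisym)
    show "bits (2 ^ a) \<le> a" by (rule bits_le) simp
    have "(2::nat) ^ a \<le> 2 ^ bits (2 ^ a)" by (rule bits_ge)
    then show "a \<le> bits (2 ^ a)" by (simp add: power_increasing_iff)
  qed
  let ?tl = "(Kn + 20) * lcost + 10 * lcost"
  let ?d = "of_nat (TT * (LB + 4)) * fail0"
  have W: "R w X Y (While ?g (blevel cc ;; Set 25 (C 2 *. V 25))) (?v0, m) ((LT + 1) * ((?tl + 4) + te ?g + 1) + te ?g + 1) (of_nat (LT + 1) * (?d + 0))
     (\<lambda>s'. ?I s' \<and> nev X Y s' ?g = 0)"
  proof (rule R_While[where \<mu> = ?mu])
    fix s assume I: "?I s" and g: "nev X Y s ?g \<noteq> 0"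
    obtain v1 m1 where s: "s = (v1, m1)" by (cases s)
    have v1: "\<And>r. r < 20 \<or> r = 27 \<or> r = 22 \<or> r = 23 \<or> r = 29 \<Longrightarrow> v1 r = ?v0 r" using I unfolding s prod.case by blast
    have e1: "env v1" by (rule env_cong[OF e]) (use v1 in auto)
    have r1: "v1 22 = SG * rr" "v1 23 = rr" "v1 29 = adr SG 0" using v1 by auto
    obtain a where a: "v1 25 = 2 ^ a" "nodes_done m1 SG a 0" using I by (auto simp: s)
    have m1: "\<forall>d<ZB. m1 d = m d" using I by (simp add: s)
    have "v1 25 \<le> TT" using g by (auto simp: s envD[OF e1])
    then have aL: "a \<le> LT" using a TT by (simp add: power_increasing_iff)
    show "R w X Y (blevel cc ;; Set 25 (C 2 *. V 25)) s (?tl + 4) (?d + 0) (\<lambda>s'. ?I s' \<and> ?mu s' < ?mu s)"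
      unfolding s
    proof (rule R_Seq[OF blevel_correct[OF e1 r1(1,2) a(1) r1(3) b aL a(2)]])
      fix s' assume *: "(\<lambda>(v', m'). (\<forall>r. r < 40 \<and> r \<noteq> 28 \<and> r \<noteq> 20 \<and> r \<noteq> 21 \<and> r \<noteq> 24 \<longrightarrow> v' r = v1 r) \<and> (\<forall>d<ZB. m' d = m1 d) \<and> nodes_done m' SG (Suc a) 0) s'"
      obtain v2 m2 where s': "s' = (v2, m2)" by (cases s')
      have v2: "\<And>r. r < 40 \<Longrightarrow> r \<noteq> 28 \<Longrightarrow> r \<noteq> 20 \<Longrightarrow> r \<noteq> 21 \<Longrightarrow> r \<noteq> 24 \<Longrightarrow> v2 r = v1 r" and m2: "\<forall>d<ZB. m2 d = m1 d" "nodes_done m2 SG (Suc a) 0"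
        using * by (simp_all add: s')
      have n: "nexec X Y (Set 25 (C 2 *. V 25)) s' = (v2(25 := 2 ^ Suc a), m2)" using v2 a by (simp add: s')
      have fr: "\<forall>r. (r < 20 \<or> r = 27 \<or> r = 22 \<or> r = 23 \<or> r = 29) \<longrightarrow> (v2(25 := 2 ^ Suc a)) r = ?v0 r"
      proof (intro allI impI)
        fix r :: nat assume r: "r < 20 \<or> r = 27 \<or> r = 22 \<or> r = 23 \<or> r = 29"
        then have "v2 r = v1 r" by (intro v2) auto
        moreover have "r \<noteq> 25" using r by auto
        ultimately show "(v2(25 := 2 ^ Suc a)) r = ?v0 r" using v1[OF r] by (metis fun_upd_other)
      qed
      have ex: "\<exists>a'\<le>Suc LT. (v2(25 := 2 ^ Suc a)) 25 = 2 ^ a' \<and> nodes_done m2 SG a' 0" using aL m2 by (intro exI[of _ "Suc a"]) simp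
      have mu: "Suc LT - bits (2 ^ Suc a) < Suc LT - bits (v1 25)" unfolding a(1) bits2 using aL by simp
      show "R w X Y (Set 25 (C 2 *. V 25)) s' 4 0 (\<lambda>s'. ?I s' \<and> ?mu s' < ?mu (v1, m1))"
      proof (rule R_block')
        have "(2::nat) ^ a \<le> TT" unfolding TT using aL by (intro power_increasing) auto
        then have "2 * 2 ^ a < (2::nat) ^ w" using TB wb by linarith
        then show "bsafe w X Y (Set 25 (C 2 *. V 25)) s'" using v2[of 25] a wb by (simp add: s')
        show "?I (nexec X Y (Set 25 (C 2 *. V 25)) s') \<and> ?mu (nexec X Y (Set 25 (C 2 *. V 25)) s') < ?mu (v1, m1)"
          unfolding n prod.case using fr ex mu m1 m2 by (simp only: fun_upd_same simp_thms) simp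
      qed simp
    qed
  next
    fix s assume I: "?I s" and g: "nev X Y s ?g \<noteq> 0"
    obtain v1 m1 where s: "s = (v1, m1)" by (cases s)
    obtain a where a: "v1 25 = 2 ^ a" using I by (auto simp: s)
    have "v1 8 = TT" using I envD(9)[OF e] by (simp add: s)
    then have "a \<le> LT" using g a TT by (auto simp: s power_increasing_iff)
    then show "0 < ?mu s" by (simp add: s a bits2)
  next
    fix s assume "?I s"
    then show "esafe w X Y s ?g" by (cases s) auto
  next
    have "bits 1 = 0" using bits2[of 0] by simp
    then show "?mu (?v0, m) \<le> LT + 1" by simp
    have "\<exists>a\<le>Suc LT. ?v0 25 = 2 ^ a \<and> nodes_done m SG a 0" using dn by (intro exI[of _ 0]) simp
    then show "?I (?v0, m)" by simp
  qed
  have "R w X Y (bsuper cc) (v, m) (tc ?c + ((LT + 1) * ((?tl + 4) + te ?g + 1) + te ?g + 1)) (of_nat (LT + 1) * (?d + 0)) (\<lambda>s'. ?I s' \<and> nev X Y s' ?g = 0)"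
    unfolding bsuper_def
  proof (rule R_block_Seq)
    have n: "nexec X Y ?c (v, m) = (?v0, m)" by (simp add: r envD[OF e] adr_def)
    have "SG * rr \<le> nsg * rr" "SG * (8 * TT) \<le> nsg * (8 * TT)" using b by (intro mult_le_mono1; simp)+
    then have "SG * rr < 2 ^ w" "SG * (8 * TT) < 2 ^ w" "TB + SG * (8 * TT) < 2 ^ w" "8 * TT < 2 ^ w" "8 < (2::nat) ^ w" "1 < (2::nat) ^ w" using rng mem(2) wb by linarith+
    then show "bsafe w X Y ?c (v, m)" by (simp add: r envD[OF e])
    show "R w X Y (While ?g (blevel cc ;; Set 25 (C 2 *. V 25))) (nexec X Y ?c (v, m)) ((LT + 1) * ((?tl + 4) + te ?g + 1) + te ?g + 1) (of_nat (LT + 1) * (?d + 0)) (\<lambda>s'. ?I s' \<and> nev X Y s' ?g = 0)"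
      unfolding n by (rule W)
  qed
  then show ?thesis
  proof (rule R_mono)
    have "(?tl + 4) + te ?g + 1 \<le> (Kn + 60) * lcost" using lcost_ge by (simp add: add_mult_distrib)
    then have "(LT + 1) * ((?tl + 4) + te ?g + 1) \<le> (LT + 1) * ((Kn + 60) * lcost)" by (intro mult_le_mono2)
    moreover have "tc ?c + te ?g + 1 \<le> tc (bsuper 0)" by (simp add: bsuper_def)
    ultimately show "tc ?c + ((LT + 1) * ((?tl + 4) + te ?g + 1) + te ?g + 1) \<le> (LT + 1) * ((Kn + 60) * lcost) + tc (bsuper 0)" by linarith
    show "of_nat (LT + 1) * (?d + 0) \<le> of_nat ((LT + 1) * TT * (LB + 4)) * fail0"
      by (simp only: of_nat_mult mult.assoc add_0_right order_refl)
  next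
    fix s assume *: "?I s \<and> nev X Y s ?g = 0"
    obtain v1 m1 where s: "s = (v1, m1)" by (cases s)
    obtain a where a: "a \<le> Suc LT" "v1 25 = 2 ^ a" "nodes_done m1 SG a 0" using * by (auto simp: s)
    have "v1 8 = TT" using * envD(9)[OF e] by (simp add: s)
    then have "TT < 2 ^ a" using * a by (auto simp: s)
    then have "LT < a" using TT by (simp add: power_strict_increasing_iff)
    then have "a = Suc LT" using a by simp
    have "nodes_done m1 (Suc SG) 0 0"
      unfolding nodes_done_def
    proof (intro allI impI)
      fix SG' a' t' assume *: "SG' < nsg" "a' \<le> LT" "t' < TT" "2 ^ a' dvd t'"
        "SG' < Suc SG \<or> SG' = Suc SG \<and> (a' < 0 \<or> a' = 0 \<and> t' < 0)"
      then have "SG' < SG \<or> SG' = SG \<and> a' < a" using \<open>a = Suc LT\<close> by auto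
      then show "node_good m1 SG' a' t'" using a(3) * unfolding nodes_done_def by blast
    qed
    then show "?P s" using * by (simp add: s)
  qed
qed

lemma build_correct:
  assumes e: "env v" and r: "v 12 = nsg"
  shows "R w X Y (build cc) (v, m) (Kt * ((nsg + 1) * ((LT + 1) * lcost))) (of_nat (nsg * ((LT + 1) * TT * (LB + 4))) * fail0) (\<lambda>(v', m').
     (\<forall>r<20. v' r = v r) \<and> (\<forall>d<ZB. m' d = m d) \<and> tree_good m')"
    (is "R w X Y _ _ _ _ ?P")
proof -
  have wb: "16 * Bd \<le> 2 ^ w" "100 \<le> Bd" "H \<le> Bd" by (rule Bd)+
  have nb: "nsg \<le> Bd" using rng(1) rr1 by (metis add_leD1 le_trans mult.right_neutral mult_le_mono2)
  let ?g = "V 27 <. V 12"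
  let ?I = "\<lambda>(v', m'). (\<forall>r<20. v' r = v r) \<and> (\<forall>d<ZB. m' d = m d) \<and> v' 27 \<le> nsg \<and> nodes_done m' (v' 27) 0 0"
  let ?mu = "\<lambda>(v', m' :: nat \<Rightarrow> nat). nsg - v' 27"
  let ?ts = "(LT + 1) * ((Kn + 60) * lcost) + tc (bsuper 0)"
  let ?d = "of_nat ((LT + 1) * TT * (LB + 4)) * fail0"
  have W: "R w X Y (While ?g (bsuper cc ;; Set 27 (V 27 +. C 1))) (v(27 := 0), m) (nsg * ((?ts + 4) + te ?g + 1) + te ?g + 1) (of_nat nsg * (?d + 0))
     (\<lambda>s'. ?I s' \<and> nev X Y s' ?g = 0)"
  proof (rule R_While[where \<mu> = ?mu])
    fix s assume I: "?I s" and g: "nev X Y s ?g \<noteq> 0"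
    obtain v1 m1 where s: "s = (v1, m1)" by (cases s)
    have v1: "\<And>r. r < 20 \<Longrightarrow> v1 r = v r" and I1: "\<forall>d<ZB. m1 d = m d" "nodes_done m1 (v1 27) 0 0" using I by (auto simp: s)
    have e1: "env v1" by (rule env_cong[OF e]) (use v1 in auto)
    have lt: "v1 27 < nsg" using g v1 r by (simp add: s)
    show "R w X Y (bsuper cc ;; Set 27 (V 27 +. C 1)) s (?ts + 4) (?d + 0) (\<lambda>s'. ?I s' \<and> ?mu s' < ?mu s)"
      unfolding s
    proof (rule R_Seq[OF bsuper_correct[OF e1 refl lt I1(2)]])
      fix s' assume *: "(\<lambda>(v', m'). (\<forall>r. (r < 20 \<or> r = 27) \<longrightarrow> v' r = v1 r) \<and> (\<forall>d<ZB. m' d = m1 d) \<and> nodes_done m' (Suc (v1 27)) 0 0) s'"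
      then show "R w X Y (Set 27 (V 27 +. C 1)) s' 4 0 (\<lambda>s'. ?I s' \<and> ?mu s' < ?mu (v1, m1))"
        using v1 I1 lt nb wb by (intro R_block') (auto split: prod.splits)
    qed
  next
    fix s assume "?I s" "nev X Y s ?g \<noteq> 0"
    then show "0 < ?mu s" using r by (cases s) auto
  next
    fix s assume "?I s"
    then show "esafe w X Y s ?g" by (cases s) auto
  next
    show "?I (v(27 := 0), m)" by (simp add: nodes_done_def)
    show "?mu (v(27 := 0), m) \<le> nsg" by simp
  qed
  have "R w X Y (build cc) (v, m) (tc (Set 27 (C 0)) + (nsg * ((?ts + 4) + te ?g + 1) + te ?g + 1)) (of_nat nsg * (?d + 0)) (\<lambda>s'. ?I s' \<and> nev X Y s' ?g = 0)"
    unfolding build_def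
    by (rule R_block_Seq) (use W wb in auto)
  then show ?thesis
  proof (rule R_mono)
    let ?F = "(LT + 1) * lcost"
    have F: "1 \<le> ?F" using lcost_ge by simp
    have "?ts + 4 + te ?g + 1 \<le> (Kn + 60 + tc (bsuper 0) + 10) * ?F"
    proof -
      have "?ts = (Kn + 60) * ?F + tc (bsuper 0)" by (simp only: ac_simps)
      moreover have "(tc (bsuper 0) + 10) * 1 \<le> (tc (bsuper 0) + 10) * ?F" using F by (rule mult_le_mono2)
      ultimately show ?thesis by (simp add: add_mult_distrib)
    qed
    then have "nsg * (?ts + 4 + te ?g + 1) \<le> nsg * ((Kn + 60 + tc (bsuper 0) + 10) * ?F)" by (rule mult_le_mono2)
    moreover have "tc (Set 27 (C 0)) + te ?g + 1 \<le> (Kn + 60 + tc (bsuper 0) + 10) * ?F"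
    proof -
      have "60 * 1 \<le> (Kn + 60 + tc (bsuper 0) + 10) * ?F" using F by (intro mult_le_mono) simp
      then show ?thesis by simp
    qed
    ultimately have "tc (Set 27 (C 0)) + (nsg * ((?ts + 4) + te ?g + 1) + te ?g + 1) \<le> (nsg + 1) * ((Kn + 60 + tc (bsuper 0) + 10) * ?F)"
      unfolding add_mult_distrib[of nsg 1] mult_1 by linarith
    also have "\<dots> \<le> (nsg + 1) * (Kt * ?F)" by (intro mult_le_mono2 mult_le_mono1) (simp add: Kt_def build_def)
    also have "\<dots> = Kt * ((nsg + 1) * ?F)" by (simp only: ac_simps)
    finally show "tc (Set 27 (C 0)) + (nsg * ((?ts + 4) + te ?g + 1) + te ?g + 1) \<le> Kt * ((nsg + 1) * ?F)" .
    show "of_nat nsg * (?d + 0) \<le> of_nat (nsg * ((LT + 1) * TT * (LB + 4))) * fail0"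
      by (simp only: of_nat_mult mult.assoc add_0_right order_refl)
  next
    fix s assume *: "?I s \<and> nev X Y s ?g = 0"
    obtain v1 m1 where s: "s = (v1, m1)" by (cases s)
    have "v1 27 = nsg" using * r by (auto simp: s)
    then show "?P s" using * by (auto simp: s nodes_done_def tree_good_def)
  qed
qed

end

section \<open>Walking up and down a tree to answer a query\<close>

section \<open>Extension queries\<close>

definition qtry :: com where
  "qtry = IfC (V 24 <. V 8) (Set 28 (V 29 +. ((V 8 +. V 24) div. V 25) *. C 4) ;; IfC (Ld (V 28)) isect (Set 80 (C 0))) (Set 80 (C 0))"

text \<open>The walk behaves like a binary counter. If the quotient of t by 2 ^ a is odd, the block
  at t must be consumed before the level may rise; otherwise t is already aligned to the larger
  blocks. A refuted block clears register 26 and ends the ascent.\<close>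

definition qup :: com where
  "qup = IfC ((V 24 div. V 25) mod. C 2)
     (qtry ;; IfC (V 80) (Set 24 (V 24 +. V 25) ;; Set 25 (C 2 *. V 25) ;; adopt) (Set 26 (C 0)))
     (Set 25 (C 2 *. V 25))"

definition qdown :: com where
  "qdown = Set 25 (V 25 div. C 2) ;; qtry ;; IfC (V 80) (Set 24 (V 24 +. V 25) ;; adopt) Skip"

text \<open>The exact matches are now known to end before the next chunk is over; one more extension
  locates the end point inside it.\<close>

definition qlast :: "nat \<Rightarrow> com" where
  "qlast cc = (Set 20 (V 24 *. V 7) ;; Set 21 (V 20 +. V 7)) ;; extend cc"

definition qwinit :: com where
  "qwinit = Set 24 (V 21 div. V 7) ;; Set 29 (V 11 +. (V 16 div. V 13) *. (C 8 *. V 8)) ;; Set 25 (C 1) ;; Set 26 (C 1)"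

definition qwalk :: com where
  "qwalk = qwinit ;; While (Ite (V 26) (V 25 <. V 8) (C 0)) qup ;; While (C 1 <. V 25) qdown"

text \<open>The first interval runs to the first chunk boundary more than 4 al rows away, because a
  window of that length has to fit into it.\<close>

definition qinit :: com where
  "qinit = Set 22 (V 16 *. V 3) ;; Set 23 (V 3) ;; Set 40 (V 22) ;; Set 41 (C 1) ;; Set 42 (V 22 +. V 3 -. C 1) ;;
     Set 20 (V 15) ;; Set 21 (((V 15 +. C 4 *. V 3) div. V 7 +. C 1) *. V 7)"

definition query :: "nat \<Rightarrow> com" where
  "query cc = qinit ;; extend cc ;; IfC (V 43) (qwalk ;; qlast cc) Skip"

definition Kq :: nat where "Kq = 2 * Ke + 10 * Kf + 100 * tc (query 0) + 100 * tc qtry + 1000"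

context treep begin

definition grp :: "nat \<Rightarrow> nat set" where "grp g = {g * al..<g * al + al}"

lemma grp_div: "j \<in> grp g \<longleftrightarrow> j div al = g"
proof
  assume "j \<in> grp g"
  then show "j div al = g" by (intro div_nat_eqI) (auto simp: grp_def mult.commute)
next
  assume "j div al = g"
  moreover have "j div al * al + j mod al = j" "j mod al < al" using al(1) by simp_all
  ultimately show "j \<in> grp g" unfolding grp_def atLeastLessThan_iff by (metis le_add1 nat_add_left_cancel_less)
qed

text \<open>The counter c is the number of tree nodes used; the additional 1 is the certificate of
  the first interval.\<close>

definition qs where
  "qs x0 g A t c \<longleftrightarrow> A \<noteq> {} \<and> A \<subseteq> grp g \<and> x0 \<le> t * M \<and> (\<forall>j\<in>A. mism x y x0 (t * M) j \<le> 2 * (aa - 1) * (1 + c)) \<and>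
     (\<forall>j\<in>grp g - A. \<forall>e. exact x y x0 e j \<longrightarrow> e \<le> t * M)"

text \<open>Complements \<open>qs\<close> from the other side: there matches are certified up to a
  chunk boundary, here they are known not to pass one.\<close>

definition qd where "qd x0 A T \<longleftrightarrow> (\<forall>j\<in>A. \<forall>e. exact x y x0 e j \<longrightarrow> e \<le> T * M)"

lemma qs_step:
  assumes s: "qs x0 g A t c" and A': "A' \<noteq> {}" "A' \<subseteq> A" "\<And>j. j \<in> A \<Longrightarrow> exact x y (t * M) (u * M) j \<Longrightarrow> j \<in> A'"
    "\<And>j. j \<in> A' \<Longrightarrow> mism x y (t * M) (u * M) j \<le> 2 * (aa - 1)" and tu: "t \<le> u"
  shows "qs x0 g A' u (Suc c)"
proof -
  have tm: "t * M \<le> u * M" using tu by simp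
  have x0: "x0 \<le> t * M" using s by (simp add: qs_def)
  have "mism x y x0 (u * M) j \<le> 2 * (aa - 1) * (1 + Suc c)" if "j \<in> A'" for j
  proof -
    have "mism x y x0 (t * M) j \<le> 2 * (aa - 1) * (1 + c)" using s that A'(2) unfolding qs_def by blast
    moreover have "mism x y x0 (u * M) j = mism x y x0 (t * M) j + mism x y (t * M) (u * M) j" by (rule mism_split[OF x0 tm])
    ultimately show ?thesis using A'(4)[OF that] by simp
  qed
  moreover have "e \<le> u * M" if j: "j \<in> grp g - A'" and e: "exact x y x0 e j" for j e
  proof (cases "j \<in> A")
    case True
    then have "\<not> exact x y (t * M) (u * M) j" using A'(3) j by blast
    then show ?thesis using exact_sub[OF e x0, of "u * M"] by linarith
  next
    case False
    then have "e \<le> t * M" using s j e unfolding qs_def by blast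
    then show ?thesis using tm by linarith
  qed
  ultimately show ?thesis using s A'(1,2) x0 tm unfolding qs_def by (meson le_trans subset_trans)
qed

lemma qd_none:
  assumes s: "qs x0 g A t c" and "\<And>j. j \<in> A \<Longrightarrow> \<not> exact x y (t * M) (u * M) j"
  shows "qd x0 A u"
  unfolding qd_def
proof (intro ballI allI impI)
  fix j e assume "j \<in> A" "exact x y x0 e j"
  moreover have "x0 \<le> t * M" using s by (simp add: qs_def)
  ultimately show "e \<le> u * M" using assms(2) exact_sub[of x y x0 e j "t * M" "u * M"] by (meson nat_le_linear)
qed

text \<open>Exact matches cannot leave the first string because of its padding, and
  \<open>TM\<close> places the end of the tree beyond it.\<close>

lemma qd_top:
  assumes "x0 \<le> t * M" "t \<le> u" "TT \<le> u"
  shows "qd x0 A u"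
  unfolding qd_def
proof (intro ballI allI impI)
  fix j e assume e: "exact x y x0 e j"
  have "x0 < e \<Longrightarrow> e \<le> length X" using exact_padX[OF e] .
  moreover have "TT * M \<le> u * M" "t * M \<le> u * M" using assms by simp_all
  ultimately show "e \<le> u * M" using TM assms(1) by linarith
qed

lemma qd_sub: "qd x0 A u \<Longrightarrow> A' \<subseteq> A \<Longrightarrow> qd x0 A' u"
  unfolding qd_def by blast

text \<open>Groups of \<open>al\<close> diagonals do not straddle trees, as \<open>rr\<close> is a
  multiple of \<open>al\<close>.\<close>

lemma grp_super: "grp g \<subseteq> {g div rho * rr..<g div rho * rr + rr}"
proof -
  have "g div rho * rho + g mod rho = g" "g mod rho < rho" using al(3) by simp_all
  then have "g div rho * rho \<le> g" "g + 1 \<le> (g div rho + 1) * rho" unfolding add_mult_distrib mult_1 by linarith+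
  then have "g div rho * rho * al \<le> g * al" "(g + 1) * al \<le> (g div rho + 1) * rho * al" by (intro mult_le_mono1; simp)+
  then show ?thesis unfolding al(2) grp_def by (auto simp: algebra_simps)
qed

lemma ap_ne: "apok G Q lo p hi \<Longrightarrow> lo \<in> ap lo p hi" "apok G Q lo p hi \<Longrightarrow> ap lo p hi \<subseteq> {G..<G + Q}"
  by (auto simp: apok_def ap_def)

lemma ap_nonempty: "apok G Q lo p hi \<Longrightarrow> ap lo p hi \<noteq> {}"
  using ap_ne(1) by blast

text \<open>The node was computed for the \<open>rr\<close> diagonals of its tree. It can serve each
  group of \<open>al\<close> among them because its completeness and its error bound are statements
  about single diagonals.\<close>

lemma qtry_correct:
  assumes e: "env v" and r: "v 22 = g * al" "v 23 = al" "v 24 = t" "v 25 = 2 ^ a" "v 29 = adr (g div rho) 0"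
    and ok: "apok (g * al) al (v 40) (v 41) (v 42)" and tg: "tree_good m"
    and b: "a \<le> LT" "2 ^ a dvd t" "t \<le> TT + 1" "g < GN"
  shows "R w X Y qtry (v, m) (Kf * al + 10 * tc qtry) 0 (\<lambda>(v', m'). (\<forall>r<40. r \<noteq> 28 \<longrightarrow> v' r = v r) \<and> (\<forall>r<43. r \<noteq> 28 \<longrightarrow> v' r = v r) \<and> m' = m \<and>
     (v' 80 = 0 \<longrightarrow> (\<forall>j\<in>ap (v 40) (v 41) (v 42). \<not> exact x y (t * M) ((t + 2 ^ a) * M) j)) \<and>
     (v' 80 \<noteq> 0 \<longrightarrow> t + 2 ^ a \<le> TT \<and> apok (g * al) al (v' 81) (v' 82) (v' 83) \<and> ap (v' 81) (v' 82) (v' 83) \<subseteq> ap (v 40) (v 41) (v 42) \<and>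
        (\<forall>j\<in>ap (v 40) (v 41) (v 42). exact x y (t * M) ((t + 2 ^ a) * M) j \<longrightarrow> j \<in> ap (v' 81) (v' 82) (v' 83)) \<and>
        (\<forall>j\<in>ap (v' 81) (v' 82) (v' 83). mism x y (t * M) ((t + 2 ^ a) * M) j \<le> 2 * (aa - 1))))" (is "R w X Y _ _ _ _ ?P")
proof -
  have wb: "16 * Bd \<le> 2 ^ w" "100 \<le> Bd" "H \<le> Bd" by (rule Bd)+
  have TB: "TT + 8 \<le> Bd" using mem(2) by linarith
  let ?in = "Set 28 (V 29 +. ((V 8 +. V 24) div. V 25) *. C 4) ;; IfC (Ld (V 28)) isect (Set 80 (C 0))"
  let ?c1 = "Set 28 (V 29 +. ((V 8 +. V 24) div. V 25) *. C 4)"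
  define d where "d = adr (g div rho) (hidx a t)"
  let ?A = "ap (v 40) (v 41) (v 42)"
  have SG: "g div rho < nsg" using b(4) GN al(3) by (metis less_le_trans less_mult_imp_div_less)
  have "R w X Y qtry (v, m) (te (V 24 <. V 8) + 1 + (tc ?c1 + (te (Ld (V 28)) + 1 + (Kf * al + tc isect + 2)))) 0 ?P"
    unfolding qtry_def
  proof (rule R_If)
    show "esafe w X Y (v, m) (V 24 <. V 8)" by simp
  next
    assume "nev X Y (v, m) (V 24 <. V 8) = 0"
    then have "TT \<le> t" using r by (simp add: envD[OF e])
    \<comment> \<open>Behind the last leaf the padding excludes exact matches, so a missing node is
      treated as an empty one.\<close>
    have "\<not> exact x y (t * M) ((t + 2 ^ a) * M) j" for j
    proof
      assume ex: "exact x y (t * M) ((t + 2 ^ a) * M) j"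
      have "t * M < (t + 2 ^ a) * M" using M1 by simp
      from exact_padX[OF ex this] have "(t + 2 ^ a) * M \<le> length X" .
      moreover have "TT * M \<le> (t + 2 ^ a) * M" using \<open>TT \<le> t\<close> by simp
      ultimately show False using TM by linarith
    qed
    then show "R w X Y (Set 80 (C 0)) (v, m) (tc ?c1 + (te (Ld (V 28)) + 1 + (Kf * al + tc isect + 2))) 0 ?P"
      using wb by (intro R_block') auto
  next
    assume "nev X Y (v, m) (V 24 <. V 8) \<noteq> 0"
    then have lt: "t < TT" using r by (simp add: envD[OF e])
    let ?v1 = "v(28 := d)"
    have hd: "(TT + t) div 2 ^ a = hidx a t" by (simp add: hidx_def)
    have dd: "adr (g div rho) 0 + hidx a t * 4 = d" by (simp add: d_def adr_def)
    have n1: "nexec X Y ?c1 (v, m) = (?v1, m)" using dd by (simp add: r envD[OF e] hd)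
    have db: "d + 8 \<le> Bd" unfolding d_def by (rule adr_bound(1)[OF SG hidx_bounds(3)[OF b(1,2) lt]])
    have s1: "bsafe w X Y ?c1 (v, m)"
    proof -
      have "hidx a t * 4 \<le> Bd" using dd db by linarith
      then show ?thesis using dd db TB lt wb by (simp add: r envD[OF e] hd)
    qed
    have e1: "env ?v1" by (rule env_cong[OF e]) auto
    have good: "node_good m (g div rho) a t" using tg SG b(1,2) lt unfolding tree_good_def by blast
    have inS: "ap (v 40) (v 41) (v 42) \<subseteq> grp g" using ap_ne(2)[OF ok] by (simp add: grp_def)
    have comp: "j \<in> nodeset m d" if "j \<in> ?A" "exact x y (t * M) ((t + 2 ^ a) * M) j" for j
    proof -
      have "j \<in> {g div rho * rr..<g div rho * rr + rr}" using inS grp_super that(1) by blast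
      then show ?thesis using good that(2) unfolding node_good_def Let_def d_def by simp
    qed
    show "R w X Y ?in (v, m) (tc ?c1 + (te (Ld (V 28)) + 1 + (Kf * al + tc isect + 2))) 0 ?P"
    proof (rule R_block_Seq[OF s1], unfold n1, rule R_If)
      show "esafe w X Y (?v1, m) (Ld (V 28))" using db wb by simp
    next
      assume "nev X Y (?v1, m) (Ld (V 28)) = 0"
      then have "nodeset m d = {}" by (simp add: nodeset_def)
      then have "\<forall>j\<in>?A. \<not> exact x y (t * M) ((t + 2 ^ a) * M) j" using comp by blast
      then show "R w X Y (Set 80 (C 0)) (?v1, m) (Kf * al + tc isect + 2) 0 ?P" using wb by (intro R_block') auto
    next
      assume "nev X Y (?v1, m) (Ld (V 28)) \<noteq> 0"
      then have nz: "m d \<noteq> 0" by simp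
      have r1: "?v1 22 = g * al" "?v1 23 = al" "?v1 28 = d" using r by auto
      have ok1: "apok (g * al) al (?v1 40) (?v1 41) (?v1 42)" using ok by simp
      have gb: "g * al + al \<le> Bd"
      proof -
        have "(g + 1) * al \<le> nsg * rho * al" using b(4) GN by (intro mult_le_mono1) linarith
        also have "\<dots> = nsg * rr" by (simp add: al(2))
        finally show ?thesis using rng(1) by simp
      qed
      have b2: "9 * al \<le> Bd" "g * al \<le> Bd" "1 \<le> al" "d + 3 \<le> Bd" using rng rr1 gb al(1) db by linarith+
      show "R w X Y isect (?v1, m) (Kf * al + tc isect + 2) 0 ?P"
      proof (rule R_mono[OF isect_correct[where m = m, OF e1 r1 b2 ok1 nz]])
        fix s' assume *: "(\<lambda>(v', m'). (\<forall>r<46. v' r = ?v1 r) \<and> m' = m \<and>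
            scanned (ap (?v1 40) (?v1 41) (?v1 42) \<inter> nodeset m d) (v' 80) (v' 81) (v' 82) (v' 83)) s'"
        obtain v2 where s': "s' = (v2, m)" using * by (cases s') auto
        have v2: "\<And>r. r < 46 \<Longrightarrow> r \<noteq> 28 \<Longrightarrow> v2 r = v r" and sc: "scanned (?A \<inter> nodeset m d) (v2 80) (v2 81) (v2 82) (v2 83)"
          using * unfolding s' by auto
        have z: "\<forall>j\<in>?A. \<not> exact x y (t * M) ((t + 2 ^ a) * M) j" if "v2 80 = 0"
        proof -
          have "?A \<inter> nodeset m d = {}" using sc unfolding scanned_def if_P[OF that] .
          then show ?thesis using comp by blast
        qed
        have nzz: "apok (g * al) al (v2 81) (v2 82) (v2 83) \<and> ap (v2 81) (v2 82) (v2 83) \<subseteq> ?A \<and>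
            (\<forall>j\<in>?A. exact x y (t * M) ((t + 2 ^ a) * M) j \<longrightarrow> j \<in> ap (v2 81) (v2 82) (v2 83)) \<and>
            (\<forall>j\<in>ap (v2 81) (v2 82) (v2 83). mism x y (t * M) ((t + 2 ^ a) * M) j \<le> 2 * (aa - 1))" if "v2 80 \<noteq> 0"
        proof -
          note sd = scannedD[OF sc that]
          have "v2 81 \<in> ?A" "v2 83 \<in> ?A" using sd(2,3) by blast+
          moreover have "v2 81 \<le> v2 83" using sd(2) unfolding sd(1) by (simp add: ap_def)
          ultimately have "apok (g * al) al (v2 81) (v2 82) (v2 83)" using ok sd(4,5) by (auto simp: apok_def ap_def)
          moreover have "\<forall>j\<in>nodeset m d. mism x y (t * M) ((t + 2 ^ a) * M) j \<le> 2 * (aa - 1)"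
            using good unfolding node_good_def Let_def d_def by blast
          ultimately show ?thesis unfolding sd(1)[symmetric] using comp by blast
        qed
        show "?P s'" unfolding s' prod.case using v2 z nzz dvd_fits[OF b(1) lt b(2)] by simp
      qed auto
    qed
  qed
  then show ?thesis by (rule R_mono) (auto simp: qtry_def)
qed

definition wst where
  "wst v0 m0 g x0 s a c \<longleftrightarrow> (case s of (v', m') \<Rightarrow> (\<forall>r<40. r < 24 \<or> 29 \<le> r \<longrightarrow> v' r = v0 r) \<and> m' = m0 \<and> v' 25 = 2 ^ a \<and>
     2 ^ a dvd v' 24 \<and> v' 24 \<le> TT + 1 \<and> a \<le> LT \<and> apok (g * al) al (v' 40) (v' 41) (v' 42) \<and> qs x0 g (ap (v' 40) (v' 41) (v' 42)) (v' 24) c)"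

definition wqd where
  "wqd x0 s a \<longleftrightarrow> (case s of (v', m' :: nat \<Rightarrow> nat) \<Rightarrow> qd x0 (ap (v' 40) (v' 41) (v' 42)) (v' 24 + 2 ^ a))"

definition wenv where
  "wenv v0 m0 g \<longleftrightarrow> env v0 \<and> v0 22 = g * al \<and> v0 23 = al \<and> v0 29 = adr (g div rho) 0 \<and> tree_good m0 \<and> g < GN"

lemma qs_mono: "qs x0 g A t c \<Longrightarrow> c \<le> c' \<Longrightarrow> qs x0 g A t c'"
  unfolding qs_def by (meson add_le_mono le_trans mult_le_mono2 order_refl)

lemma qup_correct:
  assumes we: "wenv v0 m0 g" and s: "wst v0 m0 g x0 (v, m) a c" and a: "a < LT" and up: "v 26 \<noteq> 0"
  shows "R w X Y qup (v, m) (Kf * al + 20 * tc qtry + 50) 0 (\<lambda>s'. if fst s' 26 = 0 then wst v0 m0 g x0 s' a c \<and> wqd x0 s' a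
     else wst v0 m0 g x0 s' (Suc a) (Suc c))" (is "R w X Y _ _ _ _ ?P")
proof -
  have wb: "16 * Bd \<le> 2 ^ w" "100 \<le> Bd" "H \<le> Bd" by (rule Bd)+
  have TB: "4 * TT + 8 \<le> Bd" using mem(2) by linarith
  have v: "\<And>r. r < 40 \<Longrightarrow> r < 24 \<or> 29 \<le> r \<Longrightarrow> v r = v0 r" and mm: "m = m0" and v25: "v 25 = 2 ^ a" and
    dv: "2 ^ a dvd v 24" and tT: "v 24 \<le> TT + 1" and ok: "apok (g * al) al (v 40) (v 41) (v 42)"
    and S: "qs x0 g (ap (v 40) (v 41) (v 42)) (v 24) c"
    using s unfolding wst_def prod.case by blast+
  have e: "env v" by (rule env_cong[where v = v0]) (use we v in \<open>auto simp: wenv_def\<close>)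
  have r: "v 22 = g * al" "v 23 = al" "v 29 = adr (g div rho) 0" "tree_good m" "g < GN" using we v mm by (auto simp: wenv_def)
  have aT: "2 * 2 ^ a \<le> TT" using a unfolding TT power_Suc[symmetric] by (intro power_increasing) auto
  let ?t = "v 24" and ?A = "ap (v 40) (v 41) (v 42)"
  let ?dbl = "Set 25 (C 2 *. V 25)"
  let ?ad = "Set 24 (V 24 +. V 25) ;; ?dbl ;; adopt"
  let ?g = "(V 24 div. V 25) mod. C 2"
  have "R w X Y qup (v, m) (te ?g + 1 + ((Kf * al + 10 * tc qtry) + (te (V 80) + 1 + (tc ?ad + 2)))) 0 ?P"
    unfolding qup_def
  proof (rule R_If)
    show "esafe w X Y (v, m) ?g" using wb by simp
  next
    assume "nev X Y (v, m) ?g = 0"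
    then have "even (?t div 2 ^ a)" by (simp add: v25 even_iff_mod_2_eq_zero)
    then have dv2: "2 ^ Suc a dvd ?t" using dv
      by (metis dvd_mult_div_cancel mult_dvd_mono dvd_refl power_Suc2)
    have "wst v0 m0 g x0 (v(25 := 2 * 2 ^ a), m) (Suc a) (Suc c)"
      unfolding wst_def prod.case using v mm dv2 tT ok qs_mono[OF S, of "Suc c"] a by simp
    then show "R w X Y ?dbl (v, m) ((Kf * al + 10 * tc qtry) + (te (V 80) + 1 + (tc ?ad + 2))) 0 ?P"
      using up aT TB wb by (intro R_block') (auto simp: v25)
  next
    assume "nev X Y (v, m) ?g \<noteq> 0"
    then have odd: "odd (?t div 2 ^ a)" by (simp add: v25 odd_iff_mod_2_eq_one)
    have dv2: "2 ^ Suc a dvd ?t + 2 ^ a"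
    proof -
      have "?t + 2 ^ a = (?t div 2 ^ a + 1) * 2 ^ a" using dv by simp
      moreover have "2 dvd ?t div 2 ^ a + 1" using odd by simp
      ultimately show ?thesis by (metis dvd_refl mult_dvd_mono power_Suc)
    qed
    have "R w X Y (qtry ;; IfC (V 80) ?ad (Set 26 (C 0))) (v, m) ((Kf * al + 10 * tc qtry) + (te (V 80) + 1 + (tc ?ad + 2))) (0 + 0) ?P"
    proof (rule R_Seq[OF qtry_correct[where a = a and m = m, OF e r(1,2) refl v25 r(3) ok r(4) less_imp_le[OF a] dv tT r(5)]])
      fix s' assume *: "(\<lambda>(v', m'). (\<forall>r<40. r \<noteq> 28 \<longrightarrow> v' r = v r) \<and> (\<forall>r<43. r \<noteq> 28 \<longrightarrow> v' r = v r) \<and> m' = m \<and>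
         (v' 80 = 0 \<longrightarrow> (\<forall>j\<in>?A. \<not> exact x y (?t * M) ((?t + 2 ^ a) * M) j)) \<and>
         (v' 80 \<noteq> 0 \<longrightarrow> ?t + 2 ^ a \<le> TT \<and> apok (g * al) al (v' 81) (v' 82) (v' 83) \<and> ap (v' 81) (v' 82) (v' 83) \<subseteq> ?A \<and>
            (\<forall>j\<in>?A. exact x y (?t * M) ((?t + 2 ^ a) * M) j \<longrightarrow> j \<in> ap (v' 81) (v' 82) (v' 83)) \<and>
            (\<forall>j\<in>ap (v' 81) (v' 82) (v' 83). mism x y (?t * M) ((?t + 2 ^ a) * M) j \<le> 2 * (aa - 1)))) s'"
      obtain v1 where s': "s' = (v1, m)" using * by (cases s') auto
      have v1: "\<And>r. r < 43 \<Longrightarrow> r \<noteq> 28 \<Longrightarrow> v1 r = v r"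
        and z: "v1 80 = 0 \<Longrightarrow> (\<forall>j\<in>?A. \<not> exact x y (?t * M) ((?t + 2 ^ a) * M) j)"
        and nz: "v1 80 \<noteq> 0 \<Longrightarrow> ?t + 2 ^ a \<le> TT \<and> apok (g * al) al (v1 81) (v1 82) (v1 83) \<and> ap (v1 81) (v1 82) (v1 83) \<subseteq> ?A \<and>
            (\<forall>j\<in>?A. exact x y (?t * M) ((?t + 2 ^ a) * M) j \<longrightarrow> j \<in> ap (v1 81) (v1 82) (v1 83)) \<and>
            (\<forall>j\<in>ap (v1 81) (v1 82) (v1 83). mism x y (?t * M) ((?t + 2 ^ a) * M) j \<le> 2 * (aa - 1))"
        using * unfolding s' prod.case by blast+
      show "R w X Y (IfC (V 80) ?ad (Set 26 (C 0))) s' (te (V 80) + 1 + (tc ?ad + 2)) 0 ?P"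
        unfolding s'
      proof (rule R_If)
        show "esafe w X Y (v1, m) (V 80)" by simp
      next
        assume "nev X Y (v1, m) (V 80) = 0"
        then have q: "qd x0 ?A (?t + 2 ^ a)" using z by (intro qd_none[OF S]) auto
        have 2: "wst v0 m0 g x0 (v1(26 := 0), m) a c" using s v1 unfolding wst_def prod.case by simp
        have 3: "wqd x0 (v1(26 := 0), m) a" using q v1 unfolding wqd_def prod.case by simp
        show "R w X Y (Set 26 (C 0)) (v1, m) (tc ?ad + 2) 0 ?P"
          using wb 2 3 by (intro R_block') auto
      next
        assume "nev X Y (v1, m) (V 80) \<noteq> 0"
        then have "v1 80 \<noteq> 0" by simp
        note nz = nz[OF this]
        let ?v2 = "v1(24 := ?t + 2 ^ a, 25 := 2 * 2 ^ a, 40 := v1 81, 41 := v1 82, 42 := v1 83)"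
        have n2: "nexec X Y ?ad (v1, m) = (?v2, m)" using v1 by (simp add: adopt_def v25)
        have q: "qs x0 g (ap (v1 81) (v1 82) (v1 83)) (?t + 2 ^ a) (Suc c)"
          by (rule qs_step[OF S]) (use nz ap_nonempty in auto)
        have 2: "wst v0 m0 g x0 (?v2, m) (Suc a) (Suc c)"
          unfolding wst_def prod.case using q v v1 nz mm dv2 a by simp
        have 3: "?v2 26 \<noteq> 0" using v1 up by simp
        have bs: "bsafe w X Y ?ad (v1, m)" using v1 aT TB wb tT by (simp add: adopt_def v25)
        show "R w X Y ?ad (v1, m) (tc ?ad + 2) 0 ?P"
          by (rule R_block'[OF bs]) (use 2 3 in \<open>auto simp only: n2 fst_conv if_False\<close>)
      qed
    qed
    then show "R w X Y (qtry ;; IfC (V 80) ?ad (Set 26 (C 0))) (v, m) ((Kf * al + 10 * tc qtry) + (te (V 80) + 1 + (tc ?ad + 2))) 0 ?P"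
      by (rule R_mono) auto
  qed
  then show ?thesis by (rule R_mono) (auto simp: adopt_def qtry_def)
qed

lemma qdown_correct:
  assumes we: "wenv v0 m0 g" and s: "wst v0 m0 g x0 (v, m) (Suc a) c" and q: "wqd x0 (v, m) (Suc a)"
  shows "R w X Y qdown (v, m) (Kf * al + 20 * tc qtry + 50) 0 (\<lambda>s'. wst v0 m0 g x0 s' a (Suc c) \<and> wqd x0 s' a)" (is "R w X Y _ _ _ _ ?P")
proof -
  have wb: "16 * Bd \<le> 2 ^ w" "100 \<le> Bd" "H \<le> Bd" by (rule Bd)+
  have TB: "4 * TT + 8 \<le> Bd" using mem(2) by linarith
  have v: "\<And>r. r < 40 \<Longrightarrow> r < 24 \<or> 29 \<le> r \<Longrightarrow> v r = v0 r" and mm: "m = m0" and v25: "v 25 = 2 ^ Suc a" and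
    dv: "2 ^ Suc a dvd v 24" and tT: "v 24 \<le> TT + 1" and a: "Suc a \<le> LT" and ok: "apok (g * al) al (v 40) (v 41) (v 42)"
    and S: "qs x0 g (ap (v 40) (v 41) (v 42)) (v 24) c"
    using s unfolding wst_def prod.case by blast+
  have dv1: "2 ^ a dvd v 24" using dv by (metis dvd_trans le_imp_power_dvd lessI less_imp_le)
  have qd0: "qd x0 (ap (v 40) (v 41) (v 42)) (v 24 + 2 ^ Suc a)" using q by (simp add: wqd_def)
  let ?h = "Set 25 (V 25 div. C 2)"
  let ?v = "v(25 := 2 ^ a)"
  have n: "nexec X Y ?h (v, m) = (?v, m)" by (simp add: v25)
  have e: "env ?v" by (rule env_cong[where v = v0]) (use we v in \<open>auto simp: wenv_def\<close>)
  have r: "?v 22 = g * al" "?v 23 = al" "?v 24 = v 24" "?v 25 = 2 ^ a" "?v 29 = adr (g div rho) 0" using we v by (auto simp: wenv_def)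
  have r2: "tree_good m" "g < GN" using we mm by (auto simp: wenv_def)
  have ok2: "apok (g * al) al (?v 40) (?v 41) (?v 42)" using ok by simp
  have aT: "2 * 2 ^ a \<le> TT" using a unfolding TT power_Suc[symmetric] by (intro power_increasing) auto
  let ?t = "v 24" and ?A = "ap (v 40) (v 41) (v 42)"
  let ?ad = "Set 24 (V 24 +. V 25) ;; adopt"
  have "R w X Y qdown (v, m) (tc ?h + ((Kf * al + 10 * tc qtry) + (te (V 80) + 1 + (tc ?ad + 2)))) (0 + 0) ?P"
    unfolding qdown_def
  proof (rule R_block_Seq, use wb in simp, unfold n, rule R_Seq[OF qtry_correct[where a = a and m = m, OF e r ok2 r2(1) Suc_leD[OF a] dv1 tT r2(2)]])
    fix s' assume *: "(\<lambda>(v', m'). (\<forall>r<40. r \<noteq> 28 \<longrightarrow> v' r = ?v r) \<and> (\<forall>r<43. r \<noteq> 28 \<longrightarrow> v' r = ?v r) \<and> m' = m \<and>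
       (v' 80 = 0 \<longrightarrow> (\<forall>j\<in>ap (?v 40) (?v 41) (?v 42). \<not> exact x y (?t * M) ((?t + 2 ^ a) * M) j)) \<and>
       (v' 80 \<noteq> 0 \<longrightarrow> ?t + 2 ^ a \<le> TT \<and> apok (g * al) al (v' 81) (v' 82) (v' 83) \<and> ap (v' 81) (v' 82) (v' 83) \<subseteq> ap (?v 40) (?v 41) (?v 42) \<and>
          (\<forall>j\<in>ap (?v 40) (?v 41) (?v 42). exact x y (?t * M) ((?t + 2 ^ a) * M) j \<longrightarrow> j \<in> ap (v' 81) (v' 82) (v' 83)) \<and>
          (\<forall>j\<in>ap (v' 81) (v' 82) (v' 83). mism x y (?t * M) ((?t + 2 ^ a) * M) j \<le> 2 * (aa - 1)))) s'"
    obtain v1 where s': "s' = (v1, m)" using * by (cases s') auto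
    have A: "ap (?v 40) (?v 41) (?v 42) = ?A" by simp
    have v1: "\<And>r. r < 43 \<Longrightarrow> r \<noteq> 28 \<Longrightarrow> v1 r = ?v r"
      and z: "v1 80 = 0 \<Longrightarrow> (\<forall>j\<in>?A. \<not> exact x y (?t * M) ((?t + 2 ^ a) * M) j)"
      and nz: "v1 80 \<noteq> 0 \<Longrightarrow> ?t + 2 ^ a \<le> TT \<and> apok (g * al) al (v1 81) (v1 82) (v1 83) \<and> ap (v1 81) (v1 82) (v1 83) \<subseteq> ?A \<and>
          (\<forall>j\<in>?A. exact x y (?t * M) ((?t + 2 ^ a) * M) j \<longrightarrow> j \<in> ap (v1 81) (v1 82) (v1 83)) \<and>
          (\<forall>j\<in>ap (v1 81) (v1 82) (v1 83). mism x y (?t * M) ((?t + 2 ^ a) * M) j \<le> 2 * (aa - 1))"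
      using * unfolding s' prod.case A by blast+
    show "R w X Y (IfC (V 80) ?ad Skip) s' (te (V 80) + 1 + (tc ?ad + 2)) 0 ?P"
      unfolding s'
    proof (rule R_If)
      show "esafe w X Y (v1, m) (V 80)" by simp
    next
      assume "nev X Y (v1, m) (V 80) = 0"
      then have q: "qd x0 ?A (?t + 2 ^ a)" using z by (intro qd_none[OF S]) auto
      have 2: "wst v0 m0 g x0 (v1, m) a (Suc c)" unfolding wst_def prod.case using v v1 mm dv1 tT a ok qs_mono[OF S, of "Suc c"] by simp
      have 3: "wqd x0 (v1, m) a" using q v1 unfolding wqd_def prod.case by simp
      show "R w X Y Skip (v1, m) (tc ?ad + 2) 0 ?P"
        using 2 3 by (intro R_block') auto
    next
      assume "nev X Y (v1, m) (V 80) \<noteq> 0"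
      then have "v1 80 \<noteq> 0" by simp
      note nz = nz[OF this]
      let ?v2 = "v1(24 := ?t + 2 ^ a, 40 := v1 81, 41 := v1 82, 42 := v1 83)"
      have n2: "nexec X Y ?ad (v1, m) = (?v2, m)" using v1 by (simp add: adopt_def)
      have q: "qs x0 g (ap (v1 81) (v1 82) (v1 83)) (?t + 2 ^ a) (Suc c)"
        by (rule qs_step[OF S]) (use nz ap_nonempty in auto)
      have 2: "wst v0 m0 g x0 (?v2, m) a (Suc c)"
        unfolding wst_def prod.case using q v v1 nz mm dv1 a by simp
      have "?t + 2 ^ a + 2 ^ a = ?t + 2 ^ Suc a" by simp
      then have "qd x0 (ap (v1 81) (v1 82) (v1 83)) (?t + 2 ^ a + 2 ^ a)" using qd_sub[OF qd0] nz by metis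
      then have 3: "wqd x0 (?v2, m) a" unfolding wqd_def prod.case by simp
      have bs: "bsafe w X Y ?ad (v1, m)" using v1 aT TB wb tT by (simp add: adopt_def)
      show "R w X Y ?ad (v1, m) (tc ?ad + 2) 0 ?P"
        by (rule R_block'[OF bs]) (use 2 3 in \<open>auto simp only: n2\<close>)
    qed
  qed
  then show ?thesis by (rule R_mono) (auto simp: adopt_def qtry_def)
qed

end

lemma bits_pow: "bits (2 ^ a) = a"
proof (rule antisym)
  show "bits (2 ^ a) \<le> a" by (rule bits_le) simp
  have "(2::nat) ^ a \<le> 2 ^ bits (2 ^ a)" by (rule bits_ge)
  then show "a \<le> bits (2 ^ a)" by (simp add: power_increasing_iff)
qed

context treep begin

definition tquery :: nat where "tquery = Kq * ((LB + 4) * ecost al (2 * M) + (LT + 1) * al)"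

definition qres where
  "qres x0 g PO \<longleftrightarrow> x0 \<le> PO \<and> (\<forall>j\<in>grp g. \<forall>e. exact x y x0 e j \<longrightarrow> e \<le> PO) \<and>
     (\<exists>j\<in>grp g. mism x y x0 PO j \<le> 2 * (aa - 1) * (2 * LT + 2))"

text \<open>Clipping at the end of the first string can only remove mismatches, and
  \<open>aac\<close> turns the error count of a whole chain into al - 1.\<close>

lemma qres_lce:
  assumes "qres x0 g PO" "x0 \<le> length X"
  shows "lce_ok X Y k al x0 g (min PO (length X))"
proof -
  obtain j where j: "j \<in> grp g" "mism x y x0 PO j \<le> 2 * (aa - 1) * (2 * LT + 2)" using assms unfolding qres_def by blast
  have "mism x y x0 (min PO (length X)) j \<le> al - 1"
    using mism_mono[of "min PO (length X)" PO x y x0 j] j(2) aac by linarith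
  then have "\<exists>j. j div al = g \<and> mism x y x0 (min PO (length X)) j \<le> al - 1" using j(1) unfolding grp_div by blast
  moreover have "x0 \<le> PO" "\<And>j e'. j div al = g \<Longrightarrow> exact x y x0 e' j \<Longrightarrow> e' \<le> PO"
    using assms(1) unfolding qres_def grp_div[symmetric] by blast+
  ultimately show ?thesis unfolding lce_ok_def using assms(2) by simp
qed

lemma qwalk_correct:
  assumes e: "env v" and r: "v 22 = g * al" "v 23 = al" "v 16 = g" "v 21 = t * M" and ok: "apok (g * al) al (v 40) (v 41) (v 42)"
    and S: "qs x0 g (ap (v 40) (v 41) (v 42)) t 0" and b: "t \<le> TT + 1" "tree_good m" "g < GN"
  shows "R w X Y qwalk (v, m) (tc qwinit + 20 * tc (query 0) + 2 * (LT * (Kf * al + 20 * tc qtry + 50 + 10))) 0 (\<lambda>s'. \<exists>v0 c. wenv v0 m g \<and>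
     (\<forall>r<40. r < 24 \<or> 30 \<le> r \<longrightarrow> v0 r = v r) \<and> c \<le> 2 * LT \<and> wst v0 m g x0 s' 0 c \<and> wqd x0 s' 0)" (is "R w X Y _ _ _ _ ?P")
proof -
  have wb: "16 * Bd \<le> 2 ^ w" "100 \<le> Bd" "H \<le> Bd" by (rule Bd)+
  have TB: "4 * TT + 8 \<le> Bd" using mem(2) by linarith
  have SG: "g div rho < nsg" using b(3) GN al(3) by (metis less_le_trans less_mult_imp_div_less)
  let ?v0 = "v(24 := t, 29 := adr (g div rho) 0, 25 := 1, 26 := 1)"
  have tM: "t * M div M = t" using M1 by simp
  have n: "nexec X Y qwinit (v, m) = (?v0, m)" by (simp add: qwinit_def r envD[OF e] tM adr_def)
  have bs: "bsafe w X Y qwinit (v, m)"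
  proof -
    have "g div rho * (8 * TT) \<le> nsg * (8 * TT)" using SG by (intro mult_le_mono1) simp
    then have "TB + g div rho * (8 * TT) \<le> Bd" using mem(2) by linarith
    moreover have "8 * TT \<le> Bd" using mem(2) by linarith
    ultimately show ?thesis using wb by (simp add: qwinit_def r envD[OF e] tM)
  qed
  have e0: "env ?v0" by (rule env_cong[OF e]) auto
  have we: "wenv ?v0 m g" using e0 r b by (simp add: wenv_def)
  have w0: "wst ?v0 m g x0 (?v0, m) 0 0" using b S ok by (simp add: wst_def)
  let ?g1 = "Ite (V 26) (V 25 <. V 8) (C 0)" and ?g2 = "C 1 <. V 25"
  let ?t = "Kf * al + 20 * tc qtry + 50"
  \<comment> \<open>Going up uses at most one certificate per level, so c \<le> a. Going down lowers
    a by one and adds at most one certificate, so c + a stays at most 2 LT.\<close>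
  let ?I1 = "\<lambda>s. \<exists>a c. c \<le> a \<and> wst ?v0 m g x0 s a c \<and> (fst s 26 = 0 \<longrightarrow> wqd x0 s a)"
  let ?I2 = "\<lambda>s. \<exists>a c. c + a \<le> 2 * LT \<and> wst ?v0 m g x0 s a c \<and> wqd x0 s a"
  have L1: "R w X Y (While ?g1 qup) (?v0, m) (LT * (?t + te ?g1 + 1) + te ?g1 + 1) (of_nat LT * 0) (\<lambda>s. ?I1 s \<and> nev X Y s ?g1 = 0)"
  proof (rule R_While[where \<mu> = "\<lambda>s. if fst s 26 = 0 then 0 else LT - bits (fst s 25)"])
    fix s assume I: "?I1 s" and g: "nev X Y s ?g1 \<noteq> 0"
    then obtain a c where ac: "c \<le> a" "wst ?v0 m g x0 s a c" by blast
    obtain v1 m1 where s: "s = (v1, m1)" by (cases s)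
    have "v1 25 = 2 ^ a" "v1 8 = TT" using ac(2) by (simp_all add: wst_def s envD[OF e])
    then have "(2::nat) ^ a < 2 ^ LT" and up: "v1 26 \<noteq> 0" using g by (auto simp: s TT split: if_splits)
    then have a: "a < LT" by (simp add: power_strict_increasing_iff)
    show "R w X Y qup s ?t 0 (\<lambda>s'. ?I1 s' \<and> (if fst s' 26 = 0 then 0 else LT - bits (fst s' 25)) < (if fst s 26 = 0 then 0 else LT - bits (fst s 25)))"
      unfolding s
    proof (rule R_mono[OF qup_correct[OF we ac(2)[unfolded s] a up]])
      fix s' assume *: "if fst s' 26 = 0 then wst ?v0 m g x0 s' a c \<and> wqd x0 s' a else wst ?v0 m g x0 s' (Suc a) (Suc c)"
      show "?I1 s' \<and> (if fst s' 26 = 0 then 0 else LT - bits (fst s' 25)) < (if fst (v1, m1) 26 = 0 then 0 else LT - bits (fst (v1, m1) 25))"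
      proof (cases "fst s' 26 = 0")
        case True
        then show ?thesis using * ac a up \<open>v1 25 = 2 ^ a\<close> by (auto simp: bits_pow)
      next
        case False
        then have w1: "wst ?v0 m g x0 s' (Suc a) (Suc c)" using * by simp
        then have "fst s' 25 = 2 ^ Suc a" by (auto simp: wst_def split: prod.splits)
        then have "bits (fst s' 25) = Suc a" by (simp only: bits_pow)
        moreover have "bits (v1 25) = a" using \<open>v1 25 = 2 ^ a\<close> by (simp only: bits_pow)
        moreover have "?I1 s'" using w1 ac(1) False by (intro exI[of _ "Suc a"] exI[of _ "Suc c"]) simp
        ultimately show ?thesis using a up False by simp
      qed
    qed auto
  next
    fix s assume I: "?I1 s" and g: "nev X Y s ?g1 \<noteq> 0"
    then obtain a c where ac: "c \<le> a" "wst ?v0 m g x0 s a c" by blast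
    obtain v1 m1 where s: "s = (v1, m1)" by (cases s)
    have 1: "v1 25 = 2 ^ a" "v1 8 = TT" using ac(2) by (simp_all add: wst_def s envD[OF e])
    then have "(2::nat) ^ a < 2 ^ LT" and up: "v1 26 \<noteq> 0" using g by (auto simp: s TT split: if_splits)
    then have a: "a < LT" by (simp add: power_strict_increasing_iff)
    then show "0 < (if fst s 26 = 0 then 0 else LT - bits (fst s 25))" using up 1 by (simp add: s bits_pow)
  next
    fix s show "esafe w X Y s ?g1" using wb by simp
  next
    show "?I1 (?v0, m)" using w0 by (intro exI[of _ 0]) simp
    show "(if fst (?v0, m) 26 = 0 then 0 else LT - bits (fst (?v0, m) 25)) \<le> LT" by simp
  qed
  have L2: "R w X Y (While ?g2 qdown) s (LT * (?t + te ?g2 + 1) + te ?g2 + 1) (of_nat LT * 0) (\<lambda>s. ?I2 s \<and> nev X Y s ?g2 = 0)"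
    if I2: "?I2 s" for s
  proof (rule R_While[where \<mu> = "\<lambda>s. bits (fst s 25)"])
    fix s assume I: "?I2 s" and g: "nev X Y s ?g2 \<noteq> 0"
    then obtain a c where ac: "c + a \<le> 2 * LT" "wst ?v0 m g x0 s a c" "wqd x0 s a" by blast
    obtain v1 m1 where s: "s = (v1, m1)" by (cases s)
    have 1: "v1 25 = 2 ^ a" using ac(2) by (simp add: wst_def s)
    then have "a \<noteq> 0" using g by (cases a) (auto simp: s)
    then obtain a1 where a1: "a = Suc a1" by (cases a) auto
    show "R w X Y qdown s ?t 0 (\<lambda>s'. ?I2 s' \<and> bits (fst s' 25) < bits (fst s 25))"
      unfolding s
    proof (rule R_mono[OF qdown_correct[OF we ac(2)[unfolded s a1] ac(3)[unfolded s a1]]])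
      fix s' assume *: "wst ?v0 m g x0 s' a1 (Suc c) \<and> wqd x0 s' a1"
      then have "fst s' 25 = 2 ^ a1" by (auto simp: wst_def split: prod.splits)
      then have "bits (fst s' 25) = a1" by (simp only: bits_pow)
      moreover have "bits (v1 25) = a" using 1 by (simp only: bits_pow)
      moreover have "?I2 s'" using * ac(1) a1 by (intro exI[of _ a1] exI[of _ "Suc c"]) simp
      ultimately show "?I2 s' \<and> bits (fst s' 25) < bits (fst (v1, m1) 25)" using a1 by simp
    qed auto
  next
    fix s assume I: "?I2 s" and g: "nev X Y s ?g2 \<noteq> 0"
    then obtain a c where ac: "c + a \<le> 2 * LT" "wst ?v0 m g x0 s a c" "wqd x0 s a" by blast
    obtain v1 m1 where s: "s = (v1, m1)" by (cases s)
    have 1: "v1 25 = 2 ^ a" using ac(2) by (simp add: wst_def s)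
    then have "a \<noteq> 0" using g by (cases a) (auto simp: s)
    then show "0 < bits (fst s 25)" using 1 by (simp add: s bits_pow)
  next
    fix s show "esafe w X Y s ?g2" using wb by simp
  next
    show "?I2 s" by (rule I2)
    obtain a c where "wst ?v0 m g x0 s a c" using I2 by blast
    then show "bits (fst s 25) \<le> LT" by (cases s) (simp add: wst_def bits_pow)
  qed
  have "R w X Y (While ?g1 qup ;; While ?g2 qdown) (?v0, m) ((LT * (?t + te ?g1 + 1) + te ?g1 + 1) + (LT * (?t + te ?g2 + 1) + te ?g2 + 1))
     (of_nat LT * 0 + of_nat LT * 0) (\<lambda>s. ?I2 s \<and> nev X Y s ?g2 = 0)"
  proof (rule R_Seq[OF L1], rule L2)
    fix s assume *: "?I1 s \<and> nev X Y s ?g1 = 0"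
    from conjunct1[OF *] obtain a c where ac: "c \<le> a" "wst ?v0 m g x0 s a c" "fst s 26 = 0 \<longrightarrow> wqd x0 s a"
      by (elim exE conjE) (rule that; assumption)
    obtain v1 m1 where s: "s = (v1, m1)" by (cases s)
    have 1: "v1 25 = 2 ^ a" "v1 8 = TT" "a \<le> LT" using ac(2) by (simp_all add: wst_def s envD[OF e])
    have "wqd x0 s a"
    proof (cases "v1 26 = 0")
      case True
      then show ?thesis using ac s by simp
    next
      case False
      \<comment> \<open>The ascent ended at the level of the root, and a block of that length
        reaches past the end of the first string from any position.\<close>
      then have "TT \<le> 2 ^ a" using * 1 by (auto simp: s split: if_splits)
      moreover have "x0 \<le> v1 24 * M" using ac(2) by (simp add: wst_def s qs_def)
      ultimately show ?thesis unfolding wqd_def s prod.case by (intro qd_top) auto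
    qed
    then show "?I2 s" using ac 1 by (intro exI[of _ a] exI[of _ c]) simp
  qed
  then have "R w X Y qwalk (v, m) (tc qwinit + ((LT * (?t + te ?g1 + 1) + te ?g1 + 1) + (LT * (?t + te ?g2 + 1) + te ?g2 + 1)))
     (of_nat LT * 0 + of_nat LT * 0) (\<lambda>s. ?I2 s \<and> nev X Y s ?g2 = 0)"
    unfolding qwalk_def by (intro R_block_Seq[OF bs]) (simp only: n)
  then show ?thesis
  proof (rule R_mono)
    have "LT * (?t + te ?g1 + 1) \<le> LT * (?t + 10)" "LT * (?t + te ?g2 + 1) \<le> LT * (?t + 10)" by (intro mult_le_mono2; simp)+
    moreover have "te ?g1 + 1 + te ?g2 + 1 \<le> 20 * tc (query 0)" by (simp add: query_def)
    ultimately show "tc qwinit + ((LT * (?t + te ?g1 + 1) + te ?g1 + 1) + (LT * (?t + te ?g2 + 1) + te ?g2 + 1)) \<le>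
       tc qwinit + 20 * tc (query 0) + 2 * (LT * (?t + 10))" by linarith
  next
    fix s assume *: "?I2 s \<and> nev X Y s ?g2 = 0"
    from conjunct1[OF *] obtain a c where ac: "c + a \<le> 2 * LT" "wst ?v0 m g x0 s a c" "wqd x0 s a" 
      by (elim exE conjE) (rule that; assumption)
    obtain v1 m1 where s: "s = (v1, m1)" by (cases s)
    have 1: "v1 25 = 2 ^ a" using ac(2) by (simp add: wst_def s)
    have "a = 0"
    proof (rule ccontr)
      assume "a \<noteq> 0"
      then have "(2::nat) \<le> 2 ^ a" using power_increasing[of 1 a "2::nat"] by simp
      then show False using * 1 by (simp add: s)
    qed
    then show "?P s" using ac we by (intro exI[of _ ?v0] exI[of _ c]) auto
  qed simp
qed

text \<open>If no diagonal survives the last chunk, its end point dominates all matches; if the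
  chunk is certified as a whole, \<open>qd\<close> excludes matches beyond it. The certificates are
  1 + c before and one for the last chunk, which is where 2 LT + 2 comes from.\<close>

lemma qres_last:
  assumes S: "qs x0 g A t c" and c: "c \<le> 2 * LT" and q: "qd x0 A (t + 1)" and ep: "epost (t * M) (t * M + M) G Q A ne lo p hi PO"
  shows "qres x0 g PO"
proof -
  have PO: "t * M \<le> PO" "x0 \<le> t * M" using ep S by (simp_all add: epost_def qs_def)
  obtain j where j: "j \<in> A" "mism x y (t * M) PO j \<le> 2 * (aa - 1)" using ep unfolding epost_def by blast
  have "mism x y x0 PO j = mism x y x0 (t * M) j + mism x y (t * M) PO j" by (rule mism_split[OF PO(2,1)])
  also have "\<dots> \<le> 2 * (aa - 1) * (1 + c) + 2 * (aa - 1)" using S j unfolding qs_def by (intro add_mono) blast+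
  also have "\<dots> = 2 * (aa - 1) * (c + 2)" by simp
  also have "\<dots> \<le> 2 * (aa - 1) * (2 * LT + 2)" using c by (intro mult_le_mono2) simp
  finally have m: "mism x y x0 PO j \<le> 2 * (aa - 1) * (2 * LT + 2)" .
  have "e \<le> PO" if i: "i \<in> grp g" and e: "exact x y x0 e i" for i e
  proof (cases "i \<in> A")
    case False
    then have "e \<le> t * M" using S i e unfolding qs_def by blast
    then show ?thesis using PO by linarith
  next
    case True
    show ?thesis
    proof (cases "ne = 0")
      case True
      have "exact x y (t * M) e i" by (rule exact_sub[OF e PO(2) order_refl])
      then show ?thesis using ep True \<open>i \<in> A\<close> unfolding epost_def by auto
    next
      case False
      then have "PO = t * M + M" using ep unfolding epost_def by simp
      moreover have "e \<le> (t + 1) * M" using q \<open>i \<in> A\<close> e unfolding qd_def by blast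
      ultimately show ?thesis by simp
    qed
  qed
  then show ?thesis unfolding qres_def using PO m j(1) S unfolding qs_def by (meson le_trans subsetD)
qed

lemma grp_bound: "g < GN \<Longrightarrow> g * al + al \<le> Bd"
proof -
  assume "g < GN"
  then have "(g + 1) * al \<le> nsg * rho * al" using GN by (intro mult_le_mono1) linarith
  also have "\<dots> = nsg * rr" by (simp add: al(2))
  finally show ?thesis using rng(1) by simp
qed

lemma query_correct:
  assumes e: "env v" and r: "v 15 = x0" "v 16 = g" and b: "x0 \<le> length X" "g < GN" and tg: "tree_good m"
  shows "R w X Y (query cc) (v, m) tquery (of_nat (2 * (LB + 4)) * fail0) (\<lambda>(v', m'). (\<forall>r<40. r < 20 \<or> 30 \<le> r \<longrightarrow> v' r = v r) \<and>
     (\<forall>d<ZB. m' d = m d) \<and> tree_good m' \<and> lce_ok X Y k al x0 g (min (v' 44) (length X)))" (is "R w X Y _ _ _ _ ?P")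
proof -
  have wb: "16 * Bd \<le> 2 ^ w" "100 \<le> Bd" "H \<le> Bd" by (rule Bd)+
  define t where "t = (x0 + 4 * al) div M + 1"
  let ?EN = "t * M"
  have M4: "4 * al \<le> M" using M rr1 by linarith
  have ENu: "?EN \<le> x0 + 4 * al + M"
    unfolding t_def add_mult_distrib using div_times_less_eq_dividend[of "x0 + 4 * al" M] by linarith
  have ENl: "x0 + 4 * al < ?EN"
    using dividend_less_div_times[of M "x0 + 4 * al"] M1(1) unfolding t_def add_mult_distrib by linarith
  have tT: "t \<le> TT + 1"
  proof -
    have "x0 + 4 * al < (TT + 1) * M" using b(1) TM M4 unfolding add_mult_distrib by linarith
    then have "(x0 + 4 * al) div M < TT + 1" by (simp add: less_mult_imp_div_less)
    then show ?thesis by (simp add: t_def)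
  qed
  have ENH: "?EN \<le> H" using ENu HH M4 b(1) by linarith
  have len: "?EN - x0 \<le> 2 * M" using ENu M4 by linarith
  have gb: "g * al + al \<le> Bd" by (rule grp_bound[OF b(2)])
  have alb: "9 * al \<le> Bd" "ZB + 9 * al \<le> Bd" "9 * al \<le> 9 * rr" using rng rr1 mem by linarith+
  have pre: "epre x0 ?EN (g * al) al"
  proof -
    have "(?EN - x0 + al + 1) * (cc * L) \<le> (H + rr + 1) * (cc * L)" using ENH rr1 by (intro mult_le_mono1) linarith
    then have 1: "(?EN - x0 + al + 1) * (cc * L) \<le> Bd" using samp by linarith
    show ?thesis unfolding epre_def using 1 ENl ENH alb gb al(1) by simp
  qed
  let ?v1 = "v(22 := g * al, 23 := al, 40 := g * al, 41 := 1, 42 := g * al + al - 1, 20 := x0, 21 := ?EN)"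
  have n1: "nexec X Y qinit (v, m) = (?v1, m)" by (simp add: qinit_def r envD[OF e] t_def fun_eq_iff)
  have bs: "bsafe w X Y qinit (v, m)"
  proof -
    have "x0 + 4 * al < 2 ^ w" "Suc ((x0 + 4 * al) div M) < 2 ^ w" "Suc ((x0 + 4 * al) div M) * M < 2 ^ w"
    proof -
      show 1: "Suc ((x0 + 4 * al) div M) * M < 2 ^ w" using ENH wb by (simp add: t_def)
      show "x0 + 4 * al < 2 ^ w" using ENl ENH wb by linarith
      have "Suc ((x0 + 4 * al) div M) * 1 \<le> Suc ((x0 + 4 * al) div M) * M" using M1 by (intro mult_le_mono2)
      then show "Suc ((x0 + 4 * al) div M) < 2 ^ w" unfolding mult_1_right using 1 by (rule le_less_trans)
    qed
    then show ?thesis using wb gb alb al(1) by (simp add: qinit_def r envD[OF e])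
  qed
  have e1: "env ?v1" by (rule env_cong[OF e]) auto
  have r1: "?v1 20 = x0" "?v1 21 = ?EN" "?v1 22 = g * al" "?v1 23 = al" by simp_all
  have ok1: "apok (g * al) al (?v1 40) (?v1 41) (?v1 42)" using al(1) by (simp add: apok_def)
  have A1: "ap (?v1 40) (?v1 41) (?v1 42) = grp g" using al(1) by (auto simp: ap_def grp_def)
  let ?T = "Ke * (LB + 4) * ecost al (2 * M)" and ?d = "of_nat (LB + 4) * fail0"
  have ecm: "ecost al u \<le> ecost al u'" if "u \<le> u'" for u u'
    unfolding ecost_def using that by (intro add_mono mult_le_mono order_refl div_le_mono) simp
  let ?tw = "tc qwinit + 20 * tc (query 0) + 2 * (LT * (Kf * al + 20 * tc qtry + 50 + 10))"
  let ?c2 = "Set 20 (V 24 *. V 7) ;; Set 21 (V 20 +. V 7)"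
  let ?Q = "\<lambda>(v', m'). (\<forall>r<40. r < 20 \<or> 30 \<le> r \<longrightarrow> v' r = v r) \<and>
     (\<forall>d. d < ZB \<or> ZB + 9 * al \<le> d \<longrightarrow> m' d = m d) \<and> qres x0 g (v' 44)"
  have tgc: "tree_good m'" if "\<forall>d. d < ZB \<or> ZB + 9 * al \<le> d \<longrightarrow> m' d = m d" for m'
    unfolding tree_good_def
  proof (intro allI impI)
    fix SG a t' assume *: "SG < nsg" "a \<le> LT" "t' < TT" "2 ^ a dvd t'"
    have "node_good m SG a t'" using tg * unfolding tree_good_def by blast
    then show "node_good m' SG a t'"
    proof (rule node_good_cong)
      fix i :: nat
      have "ZB + 9 * al \<le> adr SG (hidx a t') + i" using adr_bound(3)[of SG "hidx a t'"] alb(3) by linarith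
      then show "m' (adr SG (hidx a t') + i) = m (adr SG (hidx a t') + i)" using that by blast
    qed
  qed
  have E1: "R w X Y (extend cc) (?v1, m) ?T ?d (\<lambda>(v', m'). ebase ?v1 m x0 ?EN (g * al) al v' m' \<and>
       epost x0 ?EN (g * al) al (grp g) (v' 43) (v' 40) (v' 41) (v' 42) (v' 44))"
    by (rule R_mono[OF extend_correct[where m = m, OF e1 r1 pre ok1, unfolded A1]], rule mult_le_mono2[OF ecm[OF len]], rule order_refl, assumption)
  have main: "R w X Y (query cc) (v, m) (tc qinit + (?T + (te (V 43) + 1 + (?tw + (tc ?c2 + ?T))))) (?d + (0 + ?d)) ?Q"
    unfolding query_def[of cc]
  proof (rule R_block_Seq[OF bs], unfold n1, rule R_Seq[OF E1])
    fix s assume *: "(\<lambda>(v', m'). ebase ?v1 m x0 ?EN (g * al) al v' m' \<and>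
       epost x0 ?EN (g * al) al (grp g) (v' 43) (v' 40) (v' 41) (v' 42) (v' 44)) s"
    obtain v2 m2 where s: "s = (v2, m2)" by (cases s)
    have v2: "\<And>r. r < 40 \<Longrightarrow> v2 r = ?v1 r" and m2: "\<forall>d. d < ZB \<or> ZB + 9 * al \<le> d \<longrightarrow> m2 d = m d"
      and ep: "epost x0 ?EN (g * al) al (grp g) (v2 43) (v2 40) (v2 41) (v2 42) (v2 44)"
      using * unfolding s prod.case ebase_def by blast+
    have e2: "env v2" by (rule env_cong[OF e]) (use v2 in auto)
    have r2: "v2 22 = g * al" "v2 23 = al" "v2 16 = g" "v2 21 = t * M" using v2 r by auto
    have aa2: "2 * (aa - 1) \<le> 2 * (aa - 1) * (2 * LT + 2)" by simp
    show "R w X Y (IfC (V 43) (qwalk ;; qlast cc) Skip) s (te (V 43) + 1 + (?tw + (tc ?c2 + ?T))) (0 + ?d) ?Q"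
      unfolding s
    proof (rule R_If)
      show "esafe w X Y (v2, m2) (V 43)" by simp
    next
      assume "nev X Y (v2, m2) (V 43) = 0"
      then have z: "v2 43 = 0" by simp
      have "x0 \<le> v2 44" "\<exists>j\<in>grp g. mism x y x0 (v2 44) j \<le> 2 * (aa - 1)" "\<forall>j\<in>grp g. \<forall>e. exact x y x0 e j \<longrightarrow> e \<le> v2 44"
        using ep unfolding epost_def if_P[OF z] by blast+
      then have "qres x0 g (v2 44)" unfolding qres_def using aa2 by (meson le_trans)
      then have "?Q (v2, m2)" using v2 m2 by simp
      then show "R w X Y Skip (v2, m2) (?tw + (tc ?c2 + ?T)) (0 + ?d) ?Q"
        by (intro R_mono[OF R_Skip[where Q = ?Q]]) auto
    next
      assume "nev X Y (v2, m2) (V 43) \<noteq> 0"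
      then have nz: "v2 43 \<noteq> 0" by simp
      let ?A2 = "ap (v2 40) (v2 41) (v2 42)"
      have ep2: "apok (g * al) al (v2 40) (v2 41) (v2 42)" "?A2 \<subseteq> grp g" "\<forall>j\<in>grp g. exact x y x0 ?EN j \<longrightarrow> j \<in> ?A2"
        "\<forall>j\<in>?A2. mism x y x0 ?EN j \<le> 2 * (aa - 1)"
        using ep unfolding epost_def if_not_P[OF nz] by blast+
      have qs2: "qs x0 g ?A2 t 0"
      proof -
        have "e \<le> ?EN" if "j \<in> grp g - ?A2" "exact x y x0 e j" for j e
        proof (rule ccontr)
          assume "\<not> e \<le> ?EN"
          then have "exact x y x0 ?EN j" using exact_sub[OF that(2) order_refl] by simp
          then show False using that(1) ep2(3) by blast
        qed
        then show ?thesis unfolding qs_def using ap_nonempty[OF ep2(1)] ep2 ENl by simp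
      qed
      have "R w X Y (qwalk ;; qlast cc) (v2, m2) (?tw + (tc ?c2 + ?T)) (0 + ?d) ?Q"
      proof (rule R_Seq[OF qwalk_correct[where m = m2, OF e2 r2 ep2(1) qs2 tT tgc[OF m2] b(2)]])
        fix s' assume "\<exists>v0 c. wenv v0 m2 g \<and> (\<forall>r<40. r < 24 \<or> 30 \<le> r \<longrightarrow> v0 r = v2 r) \<and> c \<le> 2 * LT \<and> wst v0 m2 g x0 s' 0 c \<and> wqd x0 s' 0"
        then obtain v0 c where we: "wenv v0 m2 g" and v0: "\<And>r. r < 40 \<Longrightarrow> r < 24 \<or> 30 \<le> r \<Longrightarrow> v0 r = v2 r"
          and c: "c \<le> 2 * LT" and ws: "wst v0 m2 g x0 s' 0 c" and wq: "wqd x0 s' 0" by blast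
        obtain v3 where s': "s' = (v3, m2)" using ws by (cases s') (auto simp: wst_def)
        let ?A3 = "ap (v3 40) (v3 41) (v3 42)"
        have v3: "\<And>r. r < 40 \<Longrightarrow> r < 24 \<or> 29 \<le> r \<Longrightarrow> v3 r = v0 r" and t3: "v3 24 \<le> TT + 1"
          and ok3: "apok (g * al) al (v3 40) (v3 41) (v3 42)" and S3: "qs x0 g ?A3 (v3 24) c"
          using ws unfolding s' wst_def prod.case by blast+
        have e3: "env v3" by (rule env_cong[OF e2]) (use v3 v0 in auto)
        let ?ST = "v3 24 * M"
        let ?v4 = "v3(20 := ?ST, 21 := ?ST + M)"
        have n4: "nexec X Y ?c2 (v3, m2) = (?v4, m2)" by (simp add: envD[OF e3])
        have "?ST \<le> (TT + 1) * M" using t3 by (intro mult_le_mono1)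
        then have EH: "?ST + M \<le> H" using HH unfolding add_mult_distrib by linarith
        have q3: "qd x0 ?A3 (v3 24 + 1)" using wq by (simp add: wqd_def s')
        have e4: "env ?v4" by (rule env_cong[OF e3]) auto
        have r4: "?v4 20 = ?ST" "?v4 21 = ?ST + M" "?v4 22 = g * al" "?v4 23 = al" using v3 v0 r2 by auto
        have ok4: "apok (g * al) al (?v4 40) (?v4 41) (?v4 42)" using ok3 by simp
        have pre4: "epre ?ST (?ST + M) (g * al) al"
        proof -
          have "(?ST + M - ?ST + al + 1) * (cc * L) \<le> (H + rr + 1) * (cc * L)" using EH rr1 by (intro mult_le_mono1) linarith
          then have "(?ST + M - ?ST + al + 1) * (cc * L) \<le> Bd" using samp by linarith
          then show ?thesis unfolding epre_def using EH alb gb al(1) M4 by simp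
        qed
        have A4: "ap (?v4 40) (?v4 41) (?v4 42) = ?A3" by simp
        have bs4: "bsafe w X Y ?c2 (v3, m2)" using EH wb by (simp add: envD[OF e3])
        show "R w X Y (qlast cc) s' (tc ?c2 + ?T) ?d ?Q"
          unfolding qlast_def s'
        proof (rule R_block_Seq[OF bs4], unfold n4, rule R_mono[OF extend_correct[where m = m2, OF e4 r4 pre4 ok4, unfolded A4]])
          have "ecost al (?ST + M - ?ST) \<le> ecost al (2 * M)" by (rule ecm) simp
          then show "Ke * (LB + 4) * ecost al (?ST + M - ?ST) \<le> ?T" by (rule mult_le_mono2)
        next
          fix s4 assume *: "(\<lambda>(v', m'). ebase ?v4 m2 ?ST (?ST + M) (g * al) al v' m' \<and>
             epost ?ST (?ST + M) (g * al) al ?A3 (v' 43) (v' 40) (v' 41) (v' 42) (v' 44)) s4"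
          obtain v5 m5 where s4: "s4 = (v5, m5)" by (cases s4)
          have v5: "\<And>r. r < 40 \<Longrightarrow> v5 r = ?v4 r" and m5: "\<forall>d. d < ZB \<or> ZB + 9 * al \<le> d \<longrightarrow> m5 d = m2 d"
            and ep5: "epost ?ST (?ST + M) (g * al) al ?A3 (v5 43) (v5 40) (v5 41) (v5 42) (v5 44)"
            using * unfolding s4 prod.case ebase_def by blast+
          have "qres x0 g (v5 44)" by (rule qres_last[OF S3 c q3 ep5])
          then show "?Q s4" unfolding s4 prod.case using v5 v3 v0 v2 m5 m2 by simp
        qed auto
      qed
      then show "R w X Y (qwalk ;; qlast cc) (v2, m2) (?tw + (tc ?c2 + ?T)) (0 + ?d) ?Q" .
    qed
  qed
  show ?thesis
  proof (rule R_mono[OF main])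
    let ?E = "(LB + 4) * ecost al (2 * M)" and ?N = "(LT + 1) * al"
    have N: "1 \<le> ?N" "LT * al \<le> ?N" "LT \<le> ?N" using al(1) by (cases al; simp)+
    let ?k = "tc qinit + tc qwinit + 2 + 20 * tc (query 0) + tc ?c2"
    have k: "te (V 43) + 1 + ?k \<le> 10 * tc (query 0) + 700 + 20 * tc (query 0)" for u :: nat
      by (simp add: query_def qwalk_def qlast_def)
    have "LT * (Kf * al + 20 * tc qtry + 50 + 10) = Kf * (LT * al) + (20 * tc qtry + 60) * LT" by (simp add: algebra_simps)
    also have "\<dots> \<le> Kf * ?N + (20 * tc qtry + 60) * ?N" using N by (intro add_mono mult_le_mono2)
    finally have 1: "LT * (Kf * al + 20 * tc qtry + 50 + 10) \<le> (Kf + 20 * tc qtry + 60) * ?N" by (simp only: add_mult_distrib)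
    have 2: "(30 * tc (query 0) + 700) * 1 \<le> (30 * tc (query 0) + 700) * ?N" using N(1) by (rule mult_le_mono2)
    have 3: "te (V 43) + 1 + (tc qinit + tc qwinit + 20 * tc (query 0) + tc ?c2) \<le> (30 * tc (query 0) + 700) * ?N"
      by (rule le_trans[OF _ 2], unfold mult_1_right) (use k in linarith)
    have "tc qinit + (?T + (te (V 43) + 1 + (?tw + (tc ?c2 + ?T)))) = 2 * ?T + (te (V 43) + 1 + (tc qinit + tc qwinit + 20 * tc (query 0) + tc ?c2)) + 2 * (LT * (Kf * al + 20 * tc qtry + 50 + 10))"
      by linarith
    also have "\<dots> \<le> 2 * ?T + (30 * tc (query 0) + 700) * ?N + 2 * ((Kf + 20 * tc qtry + 60) * ?N)"
      by (intro add_mono mult_le_mono2 order_refl 3 1)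
    also have "\<dots> = 2 * Ke * ?E + (30 * tc (query 0) + 700 + 2 * (Kf + 20 * tc qtry + 60)) * ?N" by (simp add: algebra_simps)
    also have "\<dots> \<le> Kq * ?E + Kq * ?N" by (intro add_mono mult_le_mono1) (simp_all add: Kq_def)
    finally show "tc qinit + (?T + (te (V 43) + 1 + (?tw + (tc ?c2 + ?T)))) \<le> tquery" by (simp only: tquery_def add_mult_distrib2)
    show "?d + (0 + ?d) \<le> of_nat (2 * (LB + 4)) * fail0"
      by (simp only: mult_2 of_nat_add distrib_right add_0_left order_refl)
  next
    fix s assume *: "?Q s"
    obtain v5 m5 where s: "s = (v5, m5)" by (cases s)
    have fr: "\<forall>r<40. r < 20 \<or> 30 \<le> r \<longrightarrow> v5 r = v r" and m5: "\<forall>d. d < ZB \<or> ZB + 9 * al \<le> d \<longrightarrow> m5 d = m d" and q: "qres x0 g (v5 44)"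
      using * unfolding s prod.case by blast+
    show "?P s" unfolding s prod.case using fr m5 tgc[OF m5] qres_lce[OF q b(1)] by blast
  qed
qed

end

section \<open>Filling the table in place\<close>

section \<open>The dynamic program over groups of diagonals\<close>

definition incE :: "exp \<Rightarrow> exp" where "incE a = Ite a (a +. C 1) (C 0)"
definition maxE :: "exp \<Rightarrow> exp \<Rightarrow> exp" where "maxE a b = Ite (a <. b) b a"

lemma nev_incE [simp]: "nev X Y s (incE a) = (if nev X Y s a = 0 then 0 else Suc (nev X Y s a))"
  by (simp add: incE_def)

lemma nev_maxE [simp]: "nev X Y s (maxE a b) = max (nev X Y s a) (nev X Y s b)"
  by (simp add: maxE_def)

lemma esafe_maxE [simp]: "esafe w X Y s a \<Longrightarrow> esafe w X Y s b \<Longrightarrow> esafe w X Y s (maxE a b)"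
  by (simp add: maxE_def)

lemma esafe_incE [simp]: "esafe w X Y s a \<Longrightarrow> Suc (nev X Y s a) < 2 ^ w \<Longrightarrow> 1 < (2::nat) ^ w \<Longrightarrow> esafe w X Y s (incE a)"
  by (simp add: incE_def)

text \<open>A row overwrites the previous one from left to right: register 33 saves the entry about
  to be lost and 31 carries the old entry of the left neighbour, while the right neighbour is still
  old. In row 0 the test itself is the start value: it is 1, the shifted row 0, exactly in the group
  of diagonal k.\<close>

definition dstart :: com where
  "dstart = Set 33 (Ld (V 16 +. C 1)) ;;
     Set 32 (Ite (V 30) (maxE (incE (V 33)) (maxE (incE (Ld (V 16 +. C 2))) (V 31))) (V 16 =. V 2 div. V 3)) ;;
     Set 15 (minE (Ite (V 32) (V 32 -. C 1) (C 0)) (V 0))"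

definition dnext :: com where "dnext = Set 31 (V 33) ;; Set 16 (V 16 +. C 1)"

definition dstore :: com where "dstore = Put (V 16 +. C 1) (minE (V 44) (V 0) +. C 1)"

definition dcell :: "nat \<Rightarrow> com" where
  "dcell cc = dstart ;; IfC (V 32) (query cc ;; dstore) (Put (V 16 +. C 1) (C 0)) ;; dnext"

definition drow :: "nat \<Rightarrow> com" where
  "drow cc = (Set 31 (C 0) ;; Set 16 (C 0)) ;; While (V 16 <. V 14) (dcell cc)"

definition danswer :: com where
  "danswer = Set 0 (Ld ((V 1 +. V 2 -. V 0) div. V 3 +. C 1) =. V 0 +. C 1)"

definition dprog :: "nat \<Rightarrow> com" where
  "dprog cc = Set 30 (C 0) ;; While (notE (V 2 <. V 30)) (drow cc ;; Set 30 (V 30 +. C 1)) ;; danswer"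

definition Kd :: nat where "Kd = tc (dprog 0) + 100"

locale dpp = treep +
  assumes ZBG: "ZB = GN + 2" and GN2: "2 * k div al < GN"
    and nm: "length X \<le> length Y + k" "length Y \<le> length X + k"
begin

text \<open>Group g is stored at address g + 1. The word at \<open>GN + 1\<close> stays 0 and acts
  as the right neighbour of the last group.\<close>

definition dm :: "(nat \<Rightarrow> nat) \<Rightarrow> nat \<Rightarrow> nat" where "dm m g = (if g < GN then m (Suc g) else 0)"

definition sval :: "nat \<Rightarrow> (nat \<Rightarrow> nat) \<Rightarrow> nat \<Rightarrow> nat" where
  "sval i d g = (if i = 0 then of_bool (g = k div al) else next_start d g)"

definition rowrel :: "nat \<Rightarrow> (nat \<Rightarrow> nat) \<Rightarrow> (nat \<Rightarrow> nat) \<Rightarrow> nat \<Rightarrow> bool" where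
  "rowrel i d d' g \<longleftrightarrow> (if sval i d g = 0 then d' g = 0
     else d' g \<noteq> 0 \<and> lce_ok X Y k al (min (sval i d g - 1) (length X)) g (d' g - 1))"

definition cst where
  "cst v0 i d g s \<longleftrightarrow> (case s of (v', m') \<Rightarrow> (\<forall>r<15. v' r = v0 r) \<and> v' 30 = i \<and> v' 16 = g \<and> g \<le> GN \<and>
     v' 31 = (if g = 0 then 0 else d (g - 1)) \<and> tree_good m' \<and> m' (Suc GN) = 0 \<and>
     (\<forall>g'. g \<le> g' \<longrightarrow> dm m' g' = d g') \<and> (\<forall>g'<g. rowrel i d (dm m') g'))"

lemma tree_good_low: "tree_good m \<Longrightarrow> \<forall>d\<ge>ZB. m' d = m d \<Longrightarrow> tree_good m'"
  unfolding tree_good_def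
proof (intro allI impI)
  fix SG a t assume tg: "\<forall>SG a t. SG < nsg \<longrightarrow> a \<le> LT \<longrightarrow> t < TT \<longrightarrow> 2 ^ a dvd t \<longrightarrow> node_good m SG a t"
    and m': "\<forall>d\<ge>ZB. m' d = m d" and *: "SG < nsg" "a \<le> LT" "t < TT" "2 ^ a dvd t"
  have "node_good m SG a t" using tg * by blast
  then show "node_good m' SG a t"
  proof (rule node_good_cong)
    fix i :: nat
    have "ZB \<le> adr SG (hidx a t) + i" using adr_bound(3)[of SG "hidx a t"] by linarith
    then show "m' (adr SG (hidx a t) + i) = m (adr SG (hidx a t) + i)" using m' by blast
  qed
qed

lemma dcell_correct:
  assumes e: "env v0" and s: "cst v0 i d g (v, m)" and g: "g < GN" and dn: "\<And>g. d g \<le> Suc (length X)" and d0: "\<And>g. GN \<le> g \<Longrightarrow> d g = 0"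
  shows "R w X Y (dcell cc) (v, m) (tquery + tc (dcell 0) + 10) (of_nat (2 * (LB + 4)) * fail0) (cst v0 i d (Suc g))"
    (is "R w X Y _ _ _ _ ?P")
proof -
  have wb: "16 * Bd \<le> 2 ^ w" "100 \<le> Bd" "H \<le> Bd" "length X \<le> H" by (rule Bd)+
  have ZBb: "GN + 2 \<le> Bd" using mem ZBG by linarith
  have v: "\<And>r. r < 15 \<Longrightarrow> v r = v0 r" and r: "v 30 = i" "v 16 = g" "v 31 = (if g = 0 then 0 else d (g - 1))" and tg: "tree_good m"
    and mz: "m (Suc GN) = 0" and old: "\<And>g'. g \<le> g' \<Longrightarrow> dm m g' = d g'" and new: "\<And>g'. g' < g \<Longrightarrow> rowrel i d (dm m) g'"
    using s unfolding cst_def prod.case by blast+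
  have ev: "env v" by (rule env_cong[OF e]) (use v in auto)
  have m1: "m (Suc g) = d g" using old[of g] g by (simp add: dm_def)
  have m2: "m (Suc (Suc g)) = d (Suc g)"
  proof (cases "Suc g < GN")
    case True
    then show ?thesis using old[of "Suc g"] by (simp add: dm_def)
  next
    case False
    then have "Suc g = GN" using g by linarith
    then show ?thesis using mz d0[of "Suc g"] by simp
  qed
  let ?S = "sval i d g"
  let ?x0 = "min (?S - 1) (length X)"
  have ns: "next_start d g = max (if d g = 0 then 0 else Suc (d g)) (max (if d (Suc g) = 0 then 0 else Suc (d (Suc g))) (if g = 0 then 0 else d (g - 1)))"
    unfolding next_start_def by simp
  let ?va = "v(33 := d g)" and ?vb = "v(33 := d g, 32 := ?S)" and ?v1 = "v(33 := d g, 32 := ?S, 15 := ?x0)"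
  let ?E = "Ite (V 30) (maxE (incE (V 33)) (maxE (incE (Ld (V 16 +. C 2))) (V 31))) (V 16 =. V 2 div. V 3)"
  have sv: "nev X Y (?va, m) ?E = ?S"
  proof (cases "i = 0")
    case True
    then show ?thesis by (simp add: r envD[OF ev] sval_def)
  next
    case False
    have a: "nev X Y (?va, m) (incE (V 33)) = (if d g = 0 then 0 else Suc (d g))" by simp
    have b: "nev X Y (?va, m) (incE (Ld (V 16 +. C 2))) = (if d (Suc g) = 0 then 0 else Suc (d (Suc g)))" by (simp add: r m2)
    have c: "nev X Y (?va, m) (V 31) = (if g = 0 then 0 else d (g - 1))" by (simp add: r)
    have "nev X Y (?va, m) (V 30) \<noteq> 0" using False r by simp
    then show ?thesis unfolding sval_def if_not_P[OF False] ns by (simp only: nev.simps(7) nev_maxE a b c not_False_eq_True if_True)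
  qed
  have na: "nexec X Y (Set 33 (Ld (V 16 +. C 1))) (v, m) = (?va, m)" by (simp add: r m1)
  have nb: "nexec X Y (Set 32 ?E) (?va, m) = (?vb, m)" by (simp only: nexec.simps sv fst_conv snd_conv)
  have nc: "nexec X Y (Set 15 (minE (Ite (V 32) (V 32 -. C 1) (C 0)) (V 0))) (?vb, m) = (?v1, m)" by (simp add: envD[OF ev])
  have n1: "nexec X Y dstart (v, m) = (?v1, m)"
    unfolding dstart_def by (simp only: nexec.simps(6) na nb nc)
  have bs1: "bsafe w X Y dstart (v, m)"
  proof -
    have n2: "length X + 3 < 2 ^ w" using wb by linarith
    have b1: "Suc (Suc (d g)) < 2 ^ w" "Suc (Suc (d (Suc g))) < 2 ^ w" using dn[of g] dn[of "Suc g"] n2 by linarith+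
    have g3: "g + 3 < 2 ^ w" using g ZBb wb by linarith
    have "next_start d g \<le> length X + 2"
      unfolding ns by (intro max.boundedI) (use dn[of g] dn[of "Suc g"] dn[of "g - 1"] in auto)
    then have S: "?S < 2 ^ w" using n2 by (simp add: sval_def)
    have "bsafe w X Y (Set 33 (Ld (V 16 +. C 1))) (v, m)" using g3 by (simp add: r)
    moreover have "bsafe w X Y (Set 32 ?E) (?va, m)" using g3 b1 by (simp add: r m2)
    moreover have "bsafe w X Y (Set 15 (minE (Ite (V 32) (V 32 -. C 1) (C 0)) (V 0))) (?vb, m)" using S g3 by simp
    ultimately show ?thesis unfolding dstart_def by (simp only: bsafe.simps(6) na nb simp_thms)
  qed
  have e1: "env ?v1" by (rule env_cong[OF ev]) auto
  let ?Q = "\<lambda>(v', m'). (\<forall>r<15. v' r = v0 r) \<and> v' 30 = i \<and> v' 16 = g \<and> v' 33 = d g \<and> tree_good m' \<and> m' (Suc GN) = 0 \<and>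
     (\<forall>g'. g < g' \<longrightarrow> dm m' g' = d g') \<and> (\<forall>g'<Suc g. rowrel i d (dm m') g')"
  have fin: "?Q (v', m2(Suc g := q))" if "\<forall>r<40. r < 20 \<or> 30 \<le> r \<longrightarrow> v' r = ?v1 r" "\<forall>d<ZB. m2 d = m d" "tree_good m2"
    "if ?S = 0 then q = 0 else q \<noteq> 0 \<and> lce_ok X Y k al ?x0 g (q - 1)" for v' m2 q
  proof -
    let ?m = "m2(Suc g := q)"
    have dd: "dm ?m g' = (if g' = g then q else dm m g')" for g' using that(2) g ZBG by (simp add: dm_def)
    have "tree_good ?m" by (rule tree_good_low[OF that(3)]) (use g ZBG in auto)
    moreover have "rowrel i d (dm ?m) g'" if "g' < Suc g" for g'
    proof (cases "g' = g")
      case True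
      have "dm ?m g = q" by (simp add: dd)
      then show ?thesis unfolding rowrel_def True using \<open>if ?S = 0 then q = 0 else q \<noteq> 0 \<and> lce_ok X Y k al ?x0 g (q - 1)\<close> by (simp only:)
    next
      case False
      then have eq: "dm ?m g' = dm m g'" and lt: "g' < g" using that by (simp_all add: dd)
      show ?thesis using new[OF lt] unfolding rowrel_def eq .
    qed
    moreover have "?m (Suc GN) = 0" using that(2) mz g ZBG by simp
    moreover have "\<forall>g'. g < g' \<longrightarrow> dm ?m g' = d g'" using old by (simp add: dd)
    ultimately show ?thesis using that(1) v r by simp
  qed
  have mid: "R w X Y (IfC (V 32) (query cc ;; dstore) (Put (V 16 +. C 1) (C 0))) (?v1, m) (te (V 32) + 1 + (tquery + (tc dstore + 10))) (of_nat (2 * (LB + 4)) * fail0 + 0) ?Q"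
  proof (rule R_If)
    show "esafe w X Y (?v1, m) (V 32)" by simp
  next
    assume "nev X Y (?v1, m) (V 32) = 0"
    then have S0: "?S = 0" by simp
    have "?Q (?v1, m(Suc g := 0))" by (rule fin) (use tg S0 in auto)
    then have Q: "?Q (nexec X Y (Put (V 16 +. C 1) (C 0)) (?v1, m))" using r by simp
    show "R w X Y (Put (V 16 +. C 1) (C 0)) (?v1, m) (tquery + (tc dstore + 10)) (of_nat (2 * (LB + 4)) * fail0 + 0) ?Q"
    proof (rule R_block'[where Q = ?Q])
      show "bsafe w X Y (Put (V 16 +. C 1) (C 0)) (?v1, m)" using wb g ZBb r by simp
      show "?Q (nexec X Y (Put (V 16 +. C 1) (C 0)) (?v1, m))" by (rule Q)
    qed simp
  next
    assume "nev X Y (?v1, m) (V 32) \<noteq> 0"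
    then have S0: "?S \<noteq> 0" by simp
    have r1: "?v1 15 = ?x0" "?v1 16 = g" using r by simp_all
    have xn: "?x0 \<le> length X" by simp
    have "R w X Y (query cc ;; dstore) (?v1, m) (tquery + tc dstore) (of_nat (2 * (LB + 4)) * fail0 + 0) ?Q"
    proof (rule R_Seq[OF query_correct[where m = m, OF e1 r1 xn g tg]])
      fix s' assume *: "(\<lambda>(v', m'). (\<forall>r<40. r < 20 \<or> 30 \<le> r \<longrightarrow> v' r = ?v1 r) \<and> (\<forall>d<ZB. m' d = m d) \<and> tree_good m' \<and>
         lce_ok X Y k al ?x0 g (min (v' 44) (length X))) s'"
      obtain v2 m2 where s': "s' = (v2, m2)" by (cases s')
      have v2: "\<forall>r<40. r < 20 \<or> 30 \<le> r \<longrightarrow> v2 r = ?v1 r" and mm: "\<forall>d<ZB. m2 d = m d" "tree_good m2"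
        and l: "lce_ok X Y k al ?x0 g (min (v2 44) (length X))"
        using * unfolding s' prod.case by blast+
      have v216: "v2 16 = g" using v2 r by simp
      have e2: "env v2" by (rule env_cong[OF ev]) (use v2 in auto)
      have Q: "?Q (v2, m2(Suc g := Suc (min (v2 44) (length X))))" by (rule fin[OF v2 mm]) (use S0 l in auto)
      have n: "nexec X Y dstore s' = (v2, m2(Suc g := Suc (min (v2 44) (length X))))" by (simp add: s' dstore_def v216 envD[OF e2])
      have "min (v2 44) (length X) \<le> length X" by simp
      then have "Suc (min (v2 44) (length X)) < 2 ^ w" using wb by linarith
      then have b: "bsafe w X Y dstore s'" using wb g ZBb by (simp add: s' dstore_def v216 envD[OF e2])
      show "R w X Y dstore s' (tc dstore) 0 ?Q"
        by (rule R_block'[OF b _ order_refl]) (use Q in \<open>simp only: n\<close>)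
    qed
    then show "R w X Y (query cc ;; dstore) (?v1, m) (tquery + (tc dstore + 10)) (of_nat (2 * (LB + 4)) * fail0 + 0) ?Q"
      by (rule R_mono) auto
  qed
  have nx: "R w X Y dnext s' (tc dnext) 0 ?P" if "?Q s'" for s'
  proof -
    obtain v2 m2 where s': "s' = (v2, m2)" by (cases s')
    note q = that[unfolded s' prod.case]
    show ?thesis
    proof (rule R_block'[OF _ _ order_refl])
      show "bsafe w X Y dnext s'" using q wb g ZBb by (simp add: s' dnext_def)
      have n: "nexec X Y dnext s' = (v2(31 := d g, 16 := Suc g), m2)" using q by (simp add: s' dnext_def)
      show "?P (nexec X Y dnext s')" unfolding n cst_def prod.case using q g by (simp add: Suc_le_eq)
    qed
  qed
  have "R w X Y (dcell cc) (v, m) (tc dstart + ((te (V 32) + 1 + (tquery + (tc dstore + 10))) + tc dnext)) ((of_nat (2 * (LB + 4)) * fail0 + 0) + 0) ?P"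
    unfolding dcell_def[of cc]
    by (rule R_block_Seq[OF bs1], unfold n1, rule R_Seq[OF mid nx])
  then show ?thesis by (rule R_mono) (auto simp: dcell_def)
qed

lemma rowrel_le:
  assumes "rowrel i d d' g"
  shows "d' g \<le> Suc (length X)"
proof (cases "sval i d g = 0")
  case True
  then show ?thesis using assms by (simp add: rowrel_def)
next
  case False
  then have "d' g - 1 \<le> length X" using assms unfolding rowrel_def lce_ok_def by (simp only: if_False)
  then show ?thesis by linarith
qed

lemma row_reach:
  assumes rel: "\<And>g. g < GN \<Longrightarrow> rowrel i d d' g" and z: "\<And>g. GN \<le> g \<Longrightarrow> d' g = 0" "\<And>g. GN \<le> g \<Longrightarrow> d g = 0" and ik: "i \<le> k"
    and pr: "i \<noteq> 0 \<Longrightarrow> reach_complete X Y k al (i - 1) d \<and> reach_sound X Y k al (i - 1) d"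
  shows "reach_complete X Y k al i d' \<and> reach_sound X Y k al i d'"
proof -
  have al0: "0 < al" using al(1) by simp
  show ?thesis
  proof (cases "i = 0")
    case True
    let ?g = "k div al"
    have "?g \<le> 2 * k div al" by (intro div_le_mono) simp
    then have gG: "?g < GN" using GN2 by linarith
    have "sval 0 d ?g = 1" by (simp add: sval_def)
    then have 1: "d' ?g \<noteq> 0" "lce_ok X Y k al 0 ?g (d' ?g - 1)" using rel[OF gG] unfolding True rowrel_def by simp_all
    have "d' g = 0" if "g \<noteq> ?g" for g
    proof (cases "g < GN")
      case True
      then show ?thesis using rel[OF True] that unfolding \<open>i = 0\<close> rowrel_def sval_def by simp
    qed (use z in simp)
    then have "d' = (\<lambda>g. if g = ?g then Suc (d' ?g - 1) else 0)" using 1(1) by (intro ext) auto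
    from reach_init[OF al0 1(2) this] show ?thesis unfolding True by blast
  next
    case False
    then obtain i1 where i1: "i = Suc i1" by (cases i) auto
    have p: "reach_complete X Y k al i1 d" "reach_sound X Y k al i1 d" using pr False i1 by simp_all
    have l: "lce_ok X Y k al (min (next_start d g - 1) (length X)) g (d' g - 1) \<and> d' g \<noteq> 0" if "g < GN" "next_start d g \<noteq> 0" for g
      using rel[OF that(1)] that(2) False unfolding rowrel_def sval_def by simp
    have zz: "d' g = 0" if "g < GN" "next_start d g = 0" for g
      using rel[OF that(1)] that(2) False unfolding rowrel_def sval_def by simp
    show ?thesis unfolding i1
      using reach_step[OF al0 ik[unfolded i1] p GN2 z(2) l zz z(1)] by blast
  qed
qed

lemma drow_correct:
  assumes e: "env v" and r: "v 30 = i" and tg: "tree_good m" "m (Suc GN) = 0" and dn: "\<And>g. dm m g \<le> Suc (length X)"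
  shows "R w X Y (drow cc) (v, m) (GN * (tquery + tc (dcell 0) + 20) + 20) (of_nat GN * (of_nat (2 * (LB + 4)) * fail0)) (\<lambda>(v', m').
     (\<forall>r<15. v' r = v r) \<and> v' 30 = i \<and> tree_good m' \<and> m' (Suc GN) = 0 \<and> (\<forall>g<GN. rowrel i (dm m) (dm m') g))"
    (is "R w X Y _ _ _ _ ?P")
proof -
  have wb: "16 * Bd \<le> 2 ^ w" "100 \<le> Bd" by (rule Bd)+
  have d0: "\<And>g. GN \<le> g \<Longrightarrow> dm m g = 0" by (simp add: dm_def)
  let ?g = "V 16 <. V 14"
  let ?v = "v(31 := 0, 16 := 0)"
  let ?I = "\<lambda>s. \<exists>g. cst v i (dm m) g s"
  have W: "R w X Y (While ?g (dcell cc)) (?v, m) (GN * ((tquery + tc (dcell 0) + 10) + te ?g + 1) + te ?g + 1)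
     (of_nat GN * (of_nat (2 * (LB + 4)) * fail0)) (\<lambda>s. ?I s \<and> nev X Y s ?g = 0)"
  proof (rule R_While[where \<mu> = "\<lambda>s. GN - fst s 16"])
    fix s assume "?I s" and ne: "nev X Y s ?g \<noteq> 0"
    then obtain g where c: "cst v i (dm m) g s" by blast
    obtain v1 m1 where s: "s = (v1, m1)" by (cases s)
    have c1: "v1 16 = g" "v1 14 = GN" using c envD(14)[OF e] by (auto simp: cst_def s)
    then have g: "g < GN" using ne by (auto simp: s)
    show "R w X Y (dcell cc) s (tquery + tc (dcell 0) + 10) (of_nat (2 * (LB + 4)) * fail0) (\<lambda>s'. ?I s' \<and> GN - fst s' 16 < GN - fst s 16)"
      unfolding s
    proof (rule R_mono[OF dcell_correct[OF e c[unfolded s] g dn d0]])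
      fix s' assume *: "cst v i (dm m) (Suc g) s'"
      then have "fst s' 16 = Suc g" by (cases s') (simp add: cst_def)
      then show "?I s' \<and> GN - fst s' 16 < GN - fst (v1, m1) 16" using * c1 g by auto
    qed auto
  next
    fix s assume "?I s" and ne: "nev X Y s ?g \<noteq> 0"
    then obtain g where c: "cst v i (dm m) g s" by blast
    obtain v1 m1 where s: "s = (v1, m1)" by (cases s)
    have c1: "v1 14 = GN" using c envD(14)[OF e] by (auto simp: cst_def s)
    show "0 < GN - fst s 16" using ne c1 by (auto simp: s)
  next
    fix s show "esafe w X Y s ?g" by simp
  next
    show "?I (?v, m)" using r tg by (intro exI[of _ 0]) (simp add: cst_def)
    show "GN - fst (?v, m) 16 \<le> GN" by simp
  qed
  have "R w X Y (drow cc) (v, m) (tc (Set 31 (C 0) ;; Set 16 (C 0)) + (GN * ((tquery + tc (dcell 0) + 10) + te ?g + 1) + te ?g + 1))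
     (of_nat GN * (of_nat (2 * (LB + 4)) * fail0)) (\<lambda>s. ?I s \<and> nev X Y s ?g = 0)"
    unfolding drow_def by (rule R_block_Seq) (use W wb in auto)
  then show ?thesis
  proof (rule R_mono)
    have "GN * ((tquery + tc (dcell 0) + 10) + te ?g + 1) \<le> GN * (tquery + tc (dcell 0) + 20)" by (intro mult_le_mono2) simp
    moreover have "tc (Set 31 (C 0) ;; Set 16 (C 0)) + te ?g + 1 \<le> 20" by simp
    ultimately show "tc (Set 31 (C 0) ;; Set 16 (C 0)) + (GN * ((tquery + tc (dcell 0) + 10) + te ?g + 1) + te ?g + 1) \<le> GN * (tquery + tc (dcell 0) + 20) + 20"
      by linarith
  next
    fix s assume *: "?I s \<and> nev X Y s ?g = 0"
    from conjunct1[OF *] obtain g where c: "cst v i (dm m) g s" by blast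
    obtain v1 m1 where s: "s = (v1, m1)" by (cases s)
    have c1: "v1 16 = g" "v1 14 = GN" "g \<le> GN" using c envD(14)[OF e] by (auto simp: cst_def s)
    then have g: "g = GN" using * by (auto simp: s)
    show "?P s" using c unfolding s g cst_def prod.case by blast
  qed simp
qed

lemma tquery1: "1 \<le> tquery"
proof -
  have "1 * (0 + 1 * 1) \<le> Kq * ((LB + 4) * ecost al (2 * M) + (LT + 1) * al)"
    using al(1) by (intro mult_le_mono add_mono) (auto simp: Kq_def)
  then show ?thesis by (simp add: tquery_def)
qed

lemma dprog_correct:
  assumes e: "env v" and tg: "tree_good m" and m0: "\<forall>d<ZB. m d = 0"
  shows "R w X Y (dprog cc) (v, m) (Kd * ((k + 1) * (GN * tquery))) (of_nat ((k + 1) * GN * (2 * (LB + 4))) * fail0)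
     (\<lambda>s. (edit_distance X Y \<le> k \<longrightarrow> fst s 0 \<noteq> 0) \<and> (fst s 0 \<noteq> 0 \<longrightarrow> edit_distance X Y \<le> k + 3 * (k + 1) * (al - 1)))"
    (is "R w X Y _ _ _ _ ?P")
proof -
  have wb: "16 * Bd \<le> 2 ^ w" "100 \<le> Bd" "H \<le> Bd" "length X \<le> H" "k \<le> Bd" "length Y \<le> Bd" by (rule Bd)+
  have ZBb: "GN + 2 \<le> Bd" using mem ZBG by linarith
  have al0: "0 < al" using al(1) by simp
  let ?g = "notE (V 2 <. V 30)"
  let ?v = "v(30 := 0)"
  let ?D = "of_nat GN * (of_nat (2 * (LB + 4)) * fail0)"
  let ?tr = "GN * (tquery + tc (dcell 0) + 20) + 20"
  let ?J = "\<lambda>(v', m'). (\<forall>r<15. v' r = v r) \<and> tree_good m' \<and> m' (Suc GN) = 0 \<and> v' 30 \<le> Suc k \<and> (\<forall>g. dm m' g \<le> Suc (length X)) \<and>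
     (v' 30 \<noteq> 0 \<longrightarrow> reach_complete X Y k al (v' 30 - 1) (dm m') \<and> reach_sound X Y k al (v' 30 - 1) (dm m'))"
  have W: "R w X Y (While ?g (drow cc ;; Set 30 (V 30 +. C 1))) (?v, m) (Suc k * ((?tr + 4) + te ?g + 1) + te ?g + 1)
     (of_nat (Suc k) * (?D + 0)) (\<lambda>s. ?J s \<and> nev X Y s ?g = 0)"
  proof (rule R_While[where \<mu> = "\<lambda>s. Suc k - fst s 30"])
    fix s assume J: "?J s" and ne: "nev X Y s ?g \<noteq> 0"
    obtain v1 m1 where s: "s = (v1, m1)" by (cases s)
    have v1: "\<And>r. r < 15 \<Longrightarrow> v1 r = v r" and J1: "tree_good m1" "m1 (Suc GN) = 0" "\<And>g. dm m1 g \<le> Suc (length X)"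
      "v1 30 \<noteq> 0 \<Longrightarrow> reach_complete X Y k al (v1 30 - 1) (dm m1) \<and> reach_sound X Y k al (v1 30 - 1) (dm m1)"
      using J unfolding s prod.case by blast+
    have e1: "env v1" by (rule env_cong[OF e]) (use v1 in auto)
    let ?i = "v1 30"
    have ik: "?i \<le> k" using ne by (auto simp: s envD[OF e1] split: if_splits)
    show "R w X Y (drow cc ;; Set 30 (V 30 +. C 1)) s (?tr + 4) (?D + 0) (\<lambda>s'. ?J s' \<and> Suc k - fst s' 30 < Suc k - fst s 30)"
      unfolding s
    proof (rule R_Seq[OF drow_correct[OF e1 refl J1(1-3)]])
      fix s' assume *: "(\<lambda>(v', m'). (\<forall>r<15. v' r = v1 r) \<and> v' 30 = ?i \<and> tree_good m' \<and> m' (Suc GN) = 0 \<and> (\<forall>g<GN. rowrel ?i (dm m1) (dm m') g)) s'"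
      obtain v2 m2 where s': "s' = (v2, m2)" by (cases s')
      have v2: "\<And>r. r < 15 \<Longrightarrow> v2 r = v1 r" and i2: "v2 30 = ?i" and J2: "tree_good m2" "m2 (Suc GN) = 0"
        and rel: "\<And>g. g < GN \<Longrightarrow> rowrel ?i (dm m1) (dm m2) g"
        using * unfolding s' prod.case by blast+
      have z: "\<And>g. GN \<le> g \<Longrightarrow> dm m2 g = 0" "\<And>g. GN \<le> g \<Longrightarrow> dm m1 g = 0" by (simp_all add: dm_def)
      have rr: "reach_complete X Y k al ?i (dm m2) \<and> reach_sound X Y k al ?i (dm m2)"
        by (rule row_reach[OF rel z ik J1(4)])
      have le: "dm m2 g \<le> Suc (length X)" for g
        using rowrel_le[OF rel, of g] z(1)[of g] by (cases "g < GN") auto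
      let ?v3 = "v2(30 := Suc ?i)"
      have n: "nexec X Y (Set 30 (V 30 +. C 1)) s' = (?v3, m2)" by (simp add: s' i2)
      have J3: "?J (?v3, m2)" unfolding prod.case using v2 v1 J2 rr le ik by simp
      show "R w X Y (Set 30 (V 30 +. C 1)) s' 4 0 (\<lambda>s'. ?J s' \<and> Suc k - fst s' 30 < Suc k - fst (v1, m1) 30)"
      proof (rule R_block')
        show "bsafe w X Y (Set 30 (V 30 +. C 1)) s'" using ik wb by (simp add: s' i2)
        show "?J (nexec X Y (Set 30 (V 30 +. C 1)) s') \<and> Suc k - fst (nexec X Y (Set 30 (V 30 +. C 1)) s') 30 < Suc k - fst (v1, m1) 30"
          unfolding n using J3 ik by (intro conjI) simp_all
      qed simp
    qed
  next
    fix s assume J: "?J s" and ne: "nev X Y s ?g \<noteq> 0"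
    obtain v1 m1 where s: "s = (v1, m1)" by (cases s)
    have v1: "\<And>r. r < 15 \<Longrightarrow> v1 r = v r" using J unfolding s prod.case by blast
    have e1: "env v1" by (rule env_cong[OF e]) (use v1 in auto)
    show "0 < Suc k - fst s 30" using ne by (auto simp: s envD[OF e1] split: if_splits)
  next
    fix s show "esafe w X Y s ?g" using wb by simp
  next
    show "?J (?v, m)" using tg m0 ZBG by (simp add: dm_def)
    show "Suc k - fst (?v, m) 30 \<le> Suc k" by simp
  qed
  have A: "R w X Y danswer s (tc danswer) 0 ?P" if "?J s \<and> nev X Y s ?g = 0" for s
  proof -
    obtain v1 m1 where s: "s = (v1, m1)" by (cases s)
    have v1: "\<And>r. r < 15 \<Longrightarrow> v1 r = v r" and le: "v1 30 \<le> Suc k"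
      and J1: "v1 30 \<noteq> 0 \<Longrightarrow> reach_complete X Y k al (v1 30 - 1) (dm m1) \<and> reach_sound X Y k al (v1 30 - 1) (dm m1)"
      using conjunct1[OF that] unfolding s prod.case by blast+
    have e1: "env v1" by (rule env_cong[OF e]) (use v1 in auto)
    have "v1 30 = Suc k" using that le by (auto simp: s envD[OF e1] split: if_splits)
    then have rc: "reach_complete X Y k al k (dm m1)" "reach_sound X Y k al k (dm m1)" using J1 by simp_all
    let ?g = "(length Y + k - length X) div al"
    have "?g \<le> 2 * k div al" using nm by (intro div_le_mono) linarith
    then have gG: "?g < GN" using GN2 by linarith
    have n: "nexec X Y danswer s = (v1(0 := of_bool (dm m1 ?g = Suc (length X))), m1)"
      using gG by (simp add: s danswer_def envD[OF e1] dm_def)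
    have b: "bsafe w X Y danswer s" using wb gG ZBb nm by (simp add: s danswer_def envD[OF e1])
    show ?thesis
      by (rule R_block'[OF b _ order_refl]) (use reach_final[OF al0 rc nm] in \<open>auto simp: n\<close>)
  qed
  have "R w X Y (dprog cc) (v, m) (tc (Set 30 (C 0)) + ((Suc k * ((?tr + 4) + te ?g + 1) + te ?g + 1) + tc danswer)) (of_nat (Suc k) * (?D + 0) + 0) ?P"
    unfolding dprog_def
    by (rule R_block_Seq) (use wb in simp, use R_Seq[OF W A] in simp)
  then show ?thesis
  proof (rule R_mono)
    let ?U = "GN * tquery"
    have GN1: "1 \<le> GN" using GN2 by linarith
    have "GN * 1 \<le> ?U" using tquery1 by (rule mult_le_mono2)
    then have U: "GN \<le> ?U" "1 \<le> ?U" using GN1 by simp_all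
    define c where "c = tc (dcell 0)"
    have "GN * (tquery + c + 20) = ?U + (c + 20) * GN" by (simp add: algebra_simps)
    moreover have "(c + 20) * GN \<le> (c + 20) * ?U" using U(1) by (rule mult_le_mono2)
    moreover have "40 * 1 \<le> 40 * ?U" using U(2) by (rule mult_le_mono2)
    moreover have "te ?g + 1 \<le> 10" by simp
    ultimately have "(GN * (tquery + c + 20) + 20 + 4) + te ?g + 1 \<le> (c + 61) * ?U" unfolding add_mult_distrib by linarith
    then have x1: "Suc k * ((GN * (tquery + c + 20) + 20 + 4) + te ?g + 1) \<le> Suc k * ((c + 61) * ?U)" by (rule mult_le_mono2)
    have "(20 + tc danswer) * (1 * 1) \<le> (20 + tc danswer) * (Suc k * ?U)" using U by (intro mult_le_mono2 mult_le_mono) auto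
    then have x2: "tc (Set 30 (C 0)) + te ?g + 1 + tc danswer \<le> (20 + tc danswer) * (Suc k * ?U)"
      by (rule le_trans[rotated]) simp
    have "tc (Set 30 (C 0)) + ((Suc k * ((GN * (tquery + c + 20) + 20 + 4) + te ?g + 1) + te ?g + 1) + tc danswer) =
       Suc k * ((GN * (tquery + c + 20) + 20 + 4) + te ?g + 1) + (tc (Set 30 (C 0)) + te ?g + 1 + tc danswer)" by (simp only: ac_simps)
    also have "\<dots> \<le> Suc k * ((c + 61) * ?U) + (20 + tc danswer) * (Suc k * ?U)" by (rule add_mono[OF x1 x2])
    also have "\<dots> = (c + 61 + (20 + tc danswer)) * (Suc k * ?U)" by (subst mult.left_commute) (rule add_mult_distrib[symmetric])
    also have "\<dots> \<le> Kd * (Suc k * ?U)" by (intro mult_le_mono1) (simp add: Kd_def dprog_def drow_def c_def)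
    finally show "tc (Set 30 (C 0)) + ((Suc k * ((?tr + 4) + te ?g + 1) + te ?g + 1) + tc danswer) \<le> Kd * ((k + 1) * ?U)"
      unfolding c_def Suc_eq_plus1 .
    show "of_nat (Suc k) * (?D + 0) + 0 \<le> of_nat ((k + 1) * GN * (2 * (LB + 4))) * fail0"
      by (simp only: of_nat_mult mult.assoc add_0_right Suc_eq_plus1 order_refl)
  qed
qed

end

section \<open>Choosing and computing the parameters\<close>

section \<open>Parameters\<close>

text \<open>In a loop that computes a parameter the states are known in advance, so the sequence
  \<open>f\<close> replaces invariant and measure.\<close>

lemma R_loop_least:
  assumes step: "\<And>e. e < E \<Longrightarrow> esafe w X Y (f e) g \<and> nev X Y (f e) g \<noteq> 0 \<and> bsafe w X Y c (f e) \<and> nexec X Y c (f e) = f (Suc e)"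
    and fin: "esafe w X Y (f E) g" "nev X Y (f E) g = 0"
  shows "R w X Y (While g c) (f 0) (E * (tc c + te g + 1) + te g + 1) 0 (\<lambda>s. s = f E)"
proof -
  have "d \<le> E \<Longrightarrow> R w X Y (While g c) (f (E - d)) (d * (tc c + te g + 1) + te g + 1) 0 (\<lambda>s. s = f E)" for d
  proof (induction d)
    case 0
    then show ?case using R_While_False[OF fin, of "\<lambda>s. s = f E" c] by simp
  next
    case (Suc d)
    let ?e = "E - Suc d"
    have e: "?e < E" "Suc ?e = E - d" using Suc.prems by auto
    have "R w X Y (c ;; While g c) (f ?e) (tc c + (d * (tc c + te g + 1) + te g + 1)) 0 (\<lambda>s. s = f E)"
      by (rule R_block_Seq) (use step[OF e(1)] e(2) Suc in auto)
    then have "R w X Y (While g c) (f ?e) (te g + 1 + (tc c + (d * (tc c + te g + 1) + te g + 1))) 0 (\<lambda>s. s = f E)"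
      by (rule R_While_True[rotated 2]) (use step[OF e(1)] in auto)
    then show ?case by (rule R_mono) auto
  qed
  from this[of E] show ?thesis by simp
qed

definition su1 :: com where "su1 = Set 3 (minE (V 3) (V 2 +. C 1)) ;; Set 4 (C 0) ;; Set 15 (C 1)"
definition lo1 :: com where "lo1 = While (V 15 <. V 0 +. V 1 +. C 2) (Set 4 (V 4 +. C 1) ;; Set 15 (C 2 *. V 15))"
definition su2 :: com where "su2 = Set 5 (maxE (C 1) (V 3 div. (C 4 *. V 4 +. C 20))) ;; Set 15 (C 0)"
text \<open>A linear search for the integer square root is affordable: by \<open>s_le\<close> its
  \<open>ps\<close> steps stay below n / al.\<close>

definition lo2 :: com where
  "lo2 = While (notE (V 0 <. (V 15 +. C 1) *. (V 15 +. C 1) *. (V 2 +. C 1))) (Set 15 (V 15 +. C 1))"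
definition su3 :: com where
  "su3 = Set 13 (C 1 +. V 15 div. V 3) ;; Set 6 (V 3 *. V 13) ;; Set 7 (C 4 *. V 6 *. V 5) ;; Set 8 (C 1)"
definition lo3 :: com where "lo3 = While (notE (V 0 <. V 8 *. V 7)) (Set 8 (C 2 *. V 8))"
definition su4 :: com where
  "su4 = Set 9 (V 8 *. V 7 +. V 0 +. C 4 *. V 7) ;; Set 14 (C 2 *. V 2 div. V 3 +. C 1) ;;
     Set 12 ((V 14 -. C 1) div. V 13 +. C 1) ;; Set 10 (V 14 +. C 2) ;; Set 11 (V 10 +. C 9 *. V 6)"

definition setup_prog :: com where "setup_prog = su1 ;; lo1 ;; su2 ;; lo2 ;; su3 ;; lo3 ;; su4"

definition main_prog :: "nat \<Rightarrow> com" where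
  "main_prog cc = IfC (V 2 <. V 0 +. V 1)
     (IfC (V 1 +. V 2 <. V 0) (Set 0 (C 0)) (IfC (V 0 +. V 2 <. V 1) (Set 0 (C 0)) (setup_prog ;; build cc ;; dprog cc)))
     (Set 0 (C 1))"

definition Kp :: nat where "Kp = tc setup_prog + 200"

definition gapQ :: "nat list \<Rightarrow> nat list \<Rightarrow> nat \<Rightarrow> nat \<Rightarrow> vals \<Rightarrow> bool" where
  "gapQ X Y k \<alpha> s \<longleftrightarrow> (edit_distance X Y \<le> k \<longrightarrow> fst s 0 \<noteq> 0) \<and> (k + 3 * (k + 1) * (\<alpha> - 1) < edit_distance X Y \<longrightarrow> fst s 0 = 0)"

text \<open>The sum of the lengths bounds the edit distance from above and their difference bounds
  it from below, so these inputs are answered in constant time. For all others k is below the input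
  size and every parameter is polynomial in it.\<close>

lemma main_trivial:
  assumes v: "v 0 = length X" "v 1 = length Y" "v 2 = k" and triv: "\<not> (k < length X + length Y \<and> length X \<le> length Y + k \<and> length Y \<le> length X + k)"
    and w: "(length X + length Y + 2) ^ 3 \<le> 2 ^ w"
  shows "R w X Y (main_prog cc) (v, m) 50 0 (gapQ X Y k \<alpha>)"
proof -
  have v1: "v (Suc 0) = length Y" using v by simp
  let ?N = "length X + length Y + 2"
  have "?N * 2 \<le> ?N * ?N ^ 2"
  proof (rule mult_le_mono2)
    have "2 ^ 2 \<le> ?N ^ 2" by (intro power_mono) auto
    then show "2 \<le> ?N ^ 2" by simp
  qed
  also have "\<dots> = ?N ^ 3" by (simp add: power2_eq_square power3_eq_cube)
  finally have N: "?N * 2 \<le> 2 ^ w" using w by (rule le_trans)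
  have w1: "length X + length Y < 2 ^ w" "(1::nat) < 2 ^ w" by (rule less_le_trans[OF _ N], simp)+
  let ?g1 = "V 2 <. V 0 +. V 1" and ?g2 = "V 1 +. V 2 <. V 0" and ?g3 = "V 0 +. V 2 <. V 1"
  let ?in = "IfC ?g2 (Set 0 (C 0)) (IfC ?g3 (Set 0 (C 0)) (setup_prog ;; build cc ;; dprog cc))"
  have S0: "R w X Y (Set 0 (C 0)) (v, m) 2 0 (gapQ X Y k \<alpha>)" if "k < edit_distance X Y"
    by (rule R_block') (use that in \<open>simp_all add: gapQ_def\<close>)
  have "R w X Y (main_prog cc) (v, m) (te ?g1 + 1 + (te ?g2 + 1 + (te ?g3 + 1 + 2))) 0 (gapQ X Y k \<alpha>)"
    unfolding main_prog_def
  proof (rule R_If)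
    show "esafe w X Y (v, m) ?g1" using w1 by (simp add: v v1)
  next
    assume "nev X Y (v, m) ?g1 = 0"
    then have "edit_distance X Y \<le> k" using edit_distance_trivial[of X Y] by (simp add: v v1)
    then show "R w X Y (Set 0 (C 1)) (v, m) (te ?g2 + 1 + (te ?g3 + 1 + 2)) 0 (gapQ X Y k \<alpha>)"
      using w1 by (intro R_block') (simp_all add: gapQ_def)
  next
    assume "nev X Y (v, m) ?g1 \<noteq> 0"
    then have kn: "k < length X + length Y" by (simp add: v v1)
    have sum: "length Y + k < 2 ^ w" "length X + k < 2 ^ w" by (rule less_le_trans[OF _ N], use kn in simp)+
    show "R w X Y ?in (v, m) (te ?g2 + 1 + (te ?g3 + 1 + 2)) 0 (gapQ X Y k \<alpha>)"
    proof (rule R_If)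
      show "esafe w X Y (v, m) ?g2" using sum by (simp add: v v1)
    next
      assume "nev X Y (v, m) ?g2 \<noteq> 0"
      then have "k < edit_distance X Y" using edit_distance_length[of X Y] by (simp add: v v1)
      then show "R w X Y (Set 0 (C 0)) (v, m) (te ?g3 + 1 + 2) 0 (gapQ X Y k \<alpha>)" by (intro R_mono[OF S0]) auto
    next
      assume g2: "nev X Y (v, m) ?g2 = 0"
      then have l: "length X < length Y - k" using triv kn by (simp add: v v1)
      show "R w X Y (IfC ?g3 (Set 0 (C 0)) (setup_prog ;; build cc ;; dprog cc)) (v, m) (te ?g3 + 1 + 2) 0 (gapQ X Y k \<alpha>)"
      proof (rule R_If)
        show "esafe w X Y (v, m) ?g3" using sum by (simp add: v v1)
        have "k < edit_distance X Y" using edit_distance_length[of X Y] l by linarith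
        then show "R w X Y (Set 0 (C 0)) (v, m) 2 0 (gapQ X Y k \<alpha>)" by (rule S0)
      qed (use l in \<open>simp add: v v1\<close>)
    qed
  qed
  then show ?thesis by (rule R_mono) auto
qed

locale pars =
  fixes w :: nat and X Y :: "nat list" and k \<alpha> cc :: nat
  assumes al1: "1 \<le> \<alpha>" and kn: "k < length X + length Y" and nm: "length X \<le> length Y + k" "length Y \<le> length X + k"
    and wide: "16 * (1000 * (cc + 1) * (length X + length Y + 2) ^ 3) \<le> 2 ^ w"
begin

abbreviation "n \<equiv> length X"

definition pN :: nat where "pN = length X + length Y + 2"
text \<open>Lowering \<alpha> only tightens the answer, and by \<alpha> \<le> A (k + 1) the cap
  changes the time by a constant factor. The cap keeps the parameters polynomial and gives ps * al
  \<le> n in \<open>s_le\<close>.\<close>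

definition pal :: nat where "pal = min \<alpha> (k + 1)"
definition pL :: nat where "pL = bits pN"
text \<open>From LT \<le> L follows 2 (2 LT + 2) \<le> 4 L + 20, so a chain of certificates keeps
  within al - 1 errors. For small \<alpha> the value is 1, which makes certificates exact.\<close>

definition paa :: nat where "paa = max 1 (pal div (4 * pL + 20))"
text \<open>The integer part of sqrt (n / (k + 1)); using k + 1 avoids a division by zero.\<close>

definition ps :: nat where "ps = (LEAST s. n < (s + 1) * (s + 1) * (k + 1))"
text \<open>Chosen so that \<open>prr\<close> is a multiple of \<open>pal\<close> that exceeds
  \<open>ps\<close> but is at most pal + ps.\<close>

definition prho :: nat where "prho = 1 + ps div pal"
definition prr :: nat where "prr = pal * prho"
text \<open>A chunk must hold a window of 4 rr rows. The factor \<open>paa\<close> balances the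
  costs per chunk: about M / aa samples against the rr steps for a window.\<close>

definition pM :: nat where "pM = 4 * prr * paa"
definition pLT :: nat where "pLT = (LEAST e. n < 2 ^ e * pM)"
definition pTT :: nat where "pTT = 2 ^ pLT"
definition pH :: nat where "pH = pTT * pM + n + 4 * pM"
definition pGN :: nat where "pGN = 2 * k div pal + 1"
definition pnsg :: nat where "pnsg = (pGN - 1) div prho + 1"
definition pZB :: nat where "pZB = pGN + 2"
definition pTB :: nat where "pTB = pZB + 9 * prr"
definition pBd :: nat where "pBd = 1000 * (cc + 1) * pN ^ 3"
text \<open>The generous summand stands in for the logarithm of 2000 (cc + 1), so that
  \<open>pLB_bound\<close> needs only m < 2 ^ m; for fixed \<open>cc\<close> the value is still of
  the order of the logarithm.\<close>

definition pLB :: nat where "pLB = 3 * pL + 2000 * (cc + 1)"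

lemma pN_bounds: "2 \<le> pN" "n + 2 \<le> pN" "length Y + 2 \<le> pN" "k + 3 \<le> pN" "pN \<le> pN ^ 2" "pN ^ 2 \<le> pN ^ 3" "4 \<le> pN ^ 2" "2 * pN \<le> pN ^ 2"
proof -
  show 2: "2 \<le> pN" "n + 2 \<le> pN" "length Y + 2 \<le> pN" "k + 3 \<le> pN" using kn by (simp_all add: pN_def)
  show "pN \<le> pN ^ 2" using 2 by (simp add: power2_eq_square)
  show "pN ^ 2 \<le> pN ^ 3" using 2 by (intro power_increasing) auto
  have "2 ^ 2 \<le> pN ^ 2" using 2(1) by (intro power_mono) auto
  then show "4 \<le> pN ^ 2" by simp
  have "2 * pN \<le> pN * pN" using 2(1) by (rule mult_le_mono1)
  then show "2 * pN \<le> pN ^ 2" by (simp add: power2_eq_square)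
qed

lemma pal_bounds: "1 \<le> pal" "pal \<le> k + 1" "pal \<le> pN" "pal \<le> \<alpha>"
  using al1 pN_bounds(4) by (auto simp: pal_def)

lemma pL_bounds: "1 \<le> pL" "pN \<le> 2 ^ pL" "2 ^ pL \<le> 2 * pN" "pL \<le> pN"
proof -
  show N: "pN \<le> 2 ^ pL" unfolding pL_def by (rule bits_ge)
  have "pL \<noteq> 0"
  proof
    assume "pL = 0"
    then show False using N pN_bounds(1) by simp
  qed
  then show "1 \<le> pL" by simp
  obtain e where e: "pL = Suc e" using \<open>pL \<noteq> 0\<close> by (cases pL) auto
  have "2 ^ e < pN"
  proof (rule ccontr)
    assume "\<not> 2 ^ e < pN"
    then have "pL \<le> e" unfolding pL_def by (intro bits_le) simp
    then show False using e by simp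
  qed
  then show "2 ^ pL \<le> 2 * pN" using e by simp
  have "e < 2 ^ e" by (rule less_exp)
  then show "pL \<le> pN" using \<open>2 ^ e < pN\<close> e by linarith
qed

lemma ps_bounds: "n < (ps + 1) * (ps + 1) * (k + 1)" "s < ps \<Longrightarrow> (s + 1) * (s + 1) * (k + 1) \<le> n" "ps * ps * (k + 1) \<le> n" "ps \<le> n"
proof -
  have "n < (n + 1) * (n + 1) * (k + 1)" by simp
  then show "n < (ps + 1) * (ps + 1) * (k + 1)" unfolding ps_def by (rule LeastI)
  show *: "(s + 1) * (s + 1) * (k + 1) \<le> n" if "s < ps" for s
    using not_less_Least[OF that[unfolded ps_def]] by simp
  show sq: "ps * ps * (k + 1) \<le> n"
  proof (cases ps)
    case (Suc s)
    then show ?thesis using *[of s] by simp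
  qed simp
  show "ps \<le> n"
  proof (cases "ps = 0")
    case False
    then have "ps * 1 * 1 \<le> ps * ps * (k + 1)" by (intro mult_le_mono) auto
    then show ?thesis using sq by linarith
  qed simp
qed

lemma prr_bounds: "1 \<le> prho" "prr \<le> pal + ps" "ps < prr" "1 \<le> prr" "prho \<le> prr" "prr \<le> 2 * pN" "pal \<le> prr"
proof -
  show r: "1 \<le> prho" by (simp add: prho_def)
  have "pal * (ps div pal) \<le> ps" by simp
  then show rr: "prr \<le> pal + ps" by (simp add: prr_def prho_def)
  then show "prr \<le> 2 * pN" using pal_bounds(3) ps_bounds(4) pN_bounds(2) by linarith
  have "ps < pal + ps div pal * pal" using pal_bounds(1) by (intro dividend_less_div_times) simp
  then show "ps < prr" by (simp add: prr_def prho_def mult.commute)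
  then show "1 \<le> prr" by simp
  have "1 * prho \<le> prr" "pal * 1 \<le> prr" unfolding prr_def using pal_bounds(1) r by (intro mult_le_mono; simp)+
  then show "prho \<le> prr" "pal \<le> prr" by simp_all
qed

lemma paa_bounds: "1 \<le> paa" "paa \<le> pN" "pal < (paa + 1) * (4 * pL + 20)" "paa = 1 \<or> paa * (4 * pL + 20) \<le> pal"
proof -
  show "1 \<le> paa" by (simp add: paa_def)
  have "pal div (4 * pL + 20) \<le> pal" by simp
  then show "paa \<le> pN" using pal_bounds(3) pN_bounds(1) unfolding paa_def by linarith
  show "paa = 1 \<or> paa * (4 * pL + 20) \<le> pal"
    by (cases "pal div (4 * pL + 20) \<le> 1") (auto simp: paa_def max_def intro: div_times_less_eq_dividend)
  have "pal < (4 * pL + 20) + pal div (4 * pL + 20) * (4 * pL + 20)" by (intro dividend_less_div_times) simp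
  moreover have "pal div (4 * pL + 20) * (4 * pL + 20) \<le> paa * (4 * pL + 20)" by (intro mult_le_mono1) (simp add: paa_def)
  ultimately show "pal < (paa + 1) * (4 * pL + 20)" unfolding add_mult_distrib mult_1 by linarith
qed

lemma pM_bounds: "4 * prr \<le> pM" "1 \<le> pM" "pM \<le> 8 * pN ^ 2"
proof -
  have "4 * prr * 1 \<le> 4 * prr * paa" using paa_bounds(1) by (rule mult_le_mono2)
  then show 1: "4 * prr \<le> pM" by (simp add: pM_def)
  then show "1 \<le> pM" using prr_bounds(4) by linarith
  have "4 * prr * paa \<le> 4 * (2 * pN) * pN" using prr_bounds(6) paa_bounds(2) by (intro mult_le_mono) auto
  then show "pM \<le> 8 * pN ^ 2" by (simp add: pM_def power2_eq_square)
qed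

lemma pTT_bounds: "n < pTT * pM" "e < pLT \<Longrightarrow> 2 ^ e * pM \<le> n" "pLT = 0 \<or> pTT * pM \<le> 2 * n" "pTT \<le> 2 * pN" "pLT \<le> pL" "pTT * pM \<le> pM + 2 * n"
proof -
  have "n < 2 ^ n * 1" by (simp add: less_exp)
  also have "\<dots> \<le> 2 ^ n * pM" using pM_bounds(2) by (rule mult_le_mono2)
  finally show "n < pTT * pM" unfolding pTT_def pLT_def by (rule LeastI)
  show *: "2 ^ e * pM \<le> n" if "e < pLT" for e
    using not_less_Least[OF that[unfolded pLT_def]] by simp
  show d: "pLT = 0 \<or> pTT * pM \<le> 2 * n"
  proof (cases pLT)
    case (Suc e)
    then show ?thesis using *[of e] by (simp add: pTT_def)
  qed simp
  have "pTT * 1 \<le> pTT * pM" using pM_bounds(2) by (rule mult_le_mono2)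
  moreover have "pLT = 0 \<Longrightarrow> pTT = 1" by (simp add: pTT_def)
  ultimately show "pTT \<le> 2 * pN" using d pN_bounds(1,2) by linarith
  show "pTT * pM \<le> pM + 2 * n" using d by (auto simp: pTT_def)
  show "pLT \<le> pL"
  proof (cases pLT)
    case (Suc e)
    have "2 ^ e * 1 \<le> 2 ^ e * pM" using pM_bounds(2) by (rule mult_le_mono2)
    moreover have "2 ^ e * pM \<le> n" using *[of e] Suc by simp
    ultimately have "(2::nat) ^ e \<le> n" by linarith
    then have "(2::nat) ^ e < 2 ^ pL" using pN_bounds(2) pL_bounds(2) by linarith
    then show ?thesis using Suc by (simp add: power_strict_increasing_iff)
  qed simp
qed

lemma pH_bound: "pH \<le> 50 * pN ^ 2"
  using pTT_bounds(6) pM_bounds(3) pN_bounds unfolding pH_def by linarith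

lemma pGN_bounds: "pGN \<le> 2 * pN" "pnsg \<le> pGN" "1 \<le> pnsg" "pGN \<le> pnsg * prho" "pnsg = 2 * k div prr + 1"
proof -
  have "2 * k div pal \<le> 2 * k" by simp
  then show "pGN \<le> 2 * pN" using pN_bounds(4) unfolding pGN_def by linarith
  have "(pGN - 1) div prho \<le> pGN - 1" by simp
  then show "pnsg \<le> pGN" unfolding pnsg_def pGN_def by linarith
  show "1 \<le> pnsg" by (simp add: pnsg_def)
  have "pGN - 1 < prho + (pGN - 1) div prho * prho" using prr_bounds(1) by (intro dividend_less_div_times) simp
  then show "pGN \<le> pnsg * prho" unfolding pnsg_def add_mult_distrib mult_1 by linarith
  show "pnsg = 2 * k div prr + 1" by (simp add: pnsg_def pGN_def prr_def div_mult2_eq)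
qed

lemma pBd_bounds: "1000 * pN ^ 3 \<le> pBd" "1000 * (cc * pN ^ 3) \<le> pBd" "16 * pBd \<le> 2 ^ w"
  using wide by (simp_all add: pBd_def pN_def)

lemma pLB_bound: "2 * pBd \<le> 2 ^ pLB"
proof -
  have "2 * (1000 * (cc + 1)) \<le> 2 ^ (2000 * (cc + 1))" using less_exp[of "2000 * (cc + 1)"] by simp
  moreover have "pN ^ 3 \<le> (2 ^ pL) ^ 3" using pL_bounds(2) by (intro power_mono) auto
  ultimately have "2 * (1000 * (cc + 1)) * pN ^ 3 \<le> 2 ^ (2000 * (cc + 1)) * (2 ^ pL) ^ 3" by (rule mult_le_mono)
  also have "\<dots> = 2 ^ pLB" by (simp add: pLB_def power_add power_mult[symmetric] mult.commute)
  finally show ?thesis by (simp only: pBd_def mult.assoc)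
qed

lemma paa_pLT_bound: "2 * (paa - 1) * (2 * pLT + 2) \<le> pal - 1"
proof (cases "paa = 1")
  case False
  then have a: "paa * (4 * pL + 20) \<le> pal" using paa_bounds(4) by blast
  obtain q where q: "paa = Suc q" using paa_bounds(1) by (cases paa) auto
  have "2 * q * (2 * pLT + 2) = q * (4 * pLT + 4)" by (simp add: algebra_simps)
  also have "\<dots> \<le> q * (4 * pL + 20)" using pTT_bounds(5) by (intro mult_le_mono2) simp
  also have "\<dots> \<le> pal - 1" using a q by simp
  finally show ?thesis using q by simp
qed simp

lemma N_le: "pN \<le> pBd" "pN ^ 2 \<le> pBd" "1000 * pN ^ 2 \<le> pBd" "1000 * pN \<le> pBd" "2000 \<le> pBd" "cc \<le> pBd" "cc * pL \<le> pBd"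
proof -
  show "pN \<le> pBd" "pN ^ 2 \<le> pBd" "1000 * pN ^ 2 \<le> pBd" "1000 * pN \<le> pBd" "2000 \<le> pBd" using pN_bounds pBd_bounds(1) by linarith+
  have "cc * 1 \<le> cc * pN ^ 3" "cc * pL \<le> cc * pN ^ 3" using pN_bounds pL_bounds(4) by (intro mult_le_mono2; linarith)+
  then show "cc \<le> pBd" "cc * pL \<le> pBd" using pBd_bounds(2) by linarith+
qed

lemma memory_bound: "pTB + pnsg * (8 * pTT) + 8 * pTT + 8 \<le> pBd"
proof -
  have "pnsg * (8 * pTT) \<le> (2 * pN) * (8 * (2 * pN))" using pGN_bounds pTT_bounds(4) by (intro mult_le_mono) linarith+
  then have "pnsg * (8 * pTT) \<le> 32 * pN ^ 2" by (simp add: power2_eq_square)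
  moreover have "pTB \<le> 2 * pN + 2 + 18 * pN" using pGN_bounds(1) prr_bounds(6) unfolding pTB_def pZB_def by linarith
  ultimately show ?thesis using pTT_bounds(4) pN_bounds N_le by linarith
qed

lemma sampling_bound: "(pH + prr + 1) * (cc * pL) \<le> pBd"
proof -
  have "(pH + prr + 1) * (cc * pL) \<le> (60 * pN ^ 2) * (cc * pN)" using pH_bound prr_bounds(6) pN_bounds pL_bounds(4) by (intro mult_le_mono) (linarith, simp)
  also have "\<dots> = 60 * (cc * pN ^ 3)" by (simp add: power2_eq_square power3_eq_cube)
  finally show ?thesis using pBd_bounds(2) by linarith
qed

lemma diagonal_bounds: "pnsg * prr + prr \<le> pBd" "9 * prr \<le> pBd"
proof -
  have "pnsg * prr \<le> (2 * pN) * (2 * pN)" using pGN_bounds prr_bounds(6) by (intro mult_le_mono) linarith+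
  then have "pnsg * prr \<le> 4 * pN ^ 2" by (simp add: power2_eq_square)
  then show "pnsg * prr + prr \<le> pBd" using prr_bounds(6) pN_bounds N_le by linarith
  show "9 * prr \<le> pBd" using prr_bounds(6) pN_bounds N_le by linarith
qed

lemma small: "pH \<le> pBd" "n \<le> pH" "k \<le> pBd" "length Y \<le> pBd" "100 \<le> pBd" "pL \<le> pBd"
  using pH_bound pN_bounds N_le pL_bounds(4) unfolding pH_def by linarith+

sublocale dpp w X Y k pal pL paa prr pM pTT pH pZB pTB prho pGN cc pBd pLB pnsg pLT
  by unfold_locales (rule pBd_bounds small pLB_bound N_le paa_bounds pL_bounds pal_bounds prr_def prr_bounds pM_bounds pTT_def pTT_bounds memory_bound sampling_bound diagonal_bounds paa_pLT_bound pGN_bounds nm | simp add: pH_def pTB_def pZB_def pGN_def)+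

lemma wN: "16 * (1000 * pN ^ 3) \<le> 2 ^ w" "16 * (1000 * pN ^ 2) \<le> 2 ^ w" "16 * (1000 * pN) \<le> 2 ^ w"
  using pBd_bounds pN_bounds by linarith+

lemma setup_correct:
  assumes v: "v 0 = n" "v 1 = length Y" "v 2 = k" "v 3 = \<alpha>"
  shows "R w X Y setup_prog (v, m) (Kp * (3 * pL + ps + 1)) 0 (\<lambda>(v', m'). env v' \<and> v' 12 = pnsg \<and> m' = m)"
    (is "R w X Y _ _ _ _ ?P")
proof -
  let ?f1 = "\<lambda>e. (v(3 := pal, 4 := e, 15 := 2 ^ e), m)"
  let ?f2 = "\<lambda>s. (v(3 := pal, 4 := pL, 5 := paa, 15 := s), m)"
  let ?f3 = "\<lambda>e. (v(3 := pal, 4 := pL, 5 := paa, 15 := ps, 13 := prho, 6 := prr, 7 := pM, 8 := 2 ^ e), m)"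
  let ?v4 = "v(3 := pal, 4 := pL, 5 := paa, 15 := ps, 13 := prho, 6 := prr, 7 := pM, 8 := pTT, 9 := pH, 14 := pGN, 12 := pnsg, 10 := pZB, 11 := pTB)"
  have v1: "v (Suc 0) = length Y" using v by simp
  have n1: "nexec X Y su1 (v, m) = ?f1 0" by (simp add: su1_def v pal_def)
  have k1: "k + 1 < 2 ^ w" "1 < (2::nat) ^ w" using wN(3) pN_bounds by linarith+
  then have s1: "bsafe w X Y su1 (v, m)" by (simp add: su1_def v)
  let ?g1 = "V 15 <. V 0 +. V 1 +. C 2" and ?c1 = "Set 4 (V 4 +. C 1) ;; Set 15 (C 2 *. V 15)"
  have l1: "R w X Y lo1 (?f1 0) (pL * (tc ?c1 + te ?g1 + 1) + te ?g1 + 1) 0 (\<lambda>s. s = ?f1 pL)"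
    unfolding lo1_def
  proof (rule R_loop_least[where f = ?f1])
    have nm2: "n + length Y + 2 < 2 ^ w" using wN(3) pN_bounds(1) by (simp add: pN_def)
    fix e assume e: "e < pL"
    have "2 ^ e < pN"
    proof (rule ccontr)
      assume "\<not> 2 ^ e < pN"
      then have "pL \<le> e" unfolding pL_def by (intro bits_le) simp
      then show False using e by simp
    qed
    moreover have "2 * (2::nat) ^ e < 2 ^ w" "Suc e < 2 ^ w" using calculation wN(3) pN_bounds(1) e pL_bounds(4) by linarith+
    ultimately show "esafe w X Y (?f1 e) ?g1 \<and> nev X Y (?f1 e) ?g1 \<noteq> 0 \<and> bsafe w X Y ?c1 (?f1 e) \<and> nexec X Y ?c1 (?f1 e) = ?f1 (Suc e)"
      using nm2 wN(3) pN_bounds(1) by (simp add: v v1 pN_def)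
  next
    have nm2: "n + length Y + 2 < 2 ^ w" using wN(3) pN_bounds(1) by (simp add: pN_def)
    show "esafe w X Y (?f1 pL) ?g1" using nm2 by (simp add: v v1)
    show "nev X Y (?f1 pL) ?g1 = 0" using pL_bounds(2) by (simp add: v v1 pN_def)
  qed
  have n2: "nexec X Y su2 (?f1 pL) = ?f2 0" by (simp add: su2_def paa_def)
  have s2: "bsafe w X Y su2 (?f1 pL)" using wN(3) pN_bounds(1) pL_bounds(4) by (simp add: su2_def)
  let ?g2 = "notE (V 0 <. (V 15 +. C 1) *. (V 15 +. C 1) *. (V 2 +. C 1))" and ?c2 = "Set 15 (V 15 +. C 1)"
  have safe2: "esafe w X Y (?f2 s) ?g2" "Suc s < 2 ^ w" if "s \<le> ps" for s
  proof -
    have 1: "s + 1 \<le> pN" using that ps_bounds(4) pN_bounds(2) by linarith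
    have "(s + 1) * (s + 1) \<le> pN * pN" using 1 by (rule mult_le_mono) (rule 1)
    moreover have "(s + 1) * (s + 1) * (k + 1) \<le> pN * pN * pN" using 1 pN_bounds(4) by (intro mult_le_mono) linarith+
    moreover have "pN * pN * pN < 2 ^ w" "pN * pN < 2 ^ w" "pN < 2 ^ w" using wN pN_bounds by (simp_all add: power2_eq_square power3_eq_cube)
    ultimately have b: "(s + 1) * (s + 1) < 2 ^ w" "(s + 1) * (s + 1) * (k + 1) < 2 ^ w" "s + 1 < 2 ^ w" "k + 1 < 2 ^ w" using 1 pN_bounds(4) by linarith+
    then have "s + 1 < 2 ^ w \<and> k + 1 < 2 ^ w \<and> 1 < (2::nat) ^ w" using pN_bounds wN(3) by simp
    then show "esafe w X Y (?f2 s) ?g2" using b(1,2) by (simp add: v)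
    show "Suc s < 2 ^ w" using b(3) by simp
  qed
  have l2: "R w X Y lo2 (?f2 0) (ps * (tc ?c2 + te ?g2 + 1) + te ?g2 + 1) 0 (\<lambda>s. s = ?f2 ps)"
    unfolding lo2_def
  proof (rule R_loop_least[where f = ?f2])
    fix s assume s: "s < ps"
    have "nev X Y (?f2 s) ?g2 \<noteq> 0" using ps_bounds(2)[OF s] by (simp add: v)
    moreover have "bsafe w X Y ?c2 (?f2 s)" using safe2(2)[OF less_imp_le[OF s]] wN(3) pN_bounds(1) by simp
    moreover have "nexec X Y ?c2 (?f2 s) = ?f2 (Suc s)" by simp
    ultimately show "esafe w X Y (?f2 s) ?g2 \<and> nev X Y (?f2 s) ?g2 \<noteq> 0 \<and> bsafe w X Y ?c2 (?f2 s) \<and> nexec X Y ?c2 (?f2 s) = ?f2 (Suc s)"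
      using safe2(1)[OF less_imp_le[OF s]] by blast
  next
    show "esafe w X Y (?f2 ps) ?g2" by (rule safe2) simp
    show "nev X Y (?f2 ps) ?g2 = 0" using ps_bounds(1) by (simp add: v)
  qed
  have n3: "nexec X Y su3 (?f2 ps) = ?f3 0" by (simp add: su3_def prho_def prr_def pM_def)
  have s3: "bsafe w X Y su3 (?f2 ps)"
  proof -
    have "prho < 2 ^ w" "prr < 2 ^ w" "4 * prr < 2 ^ w" "pM < 2 ^ w" using wN prr_bounds(5,6) pM_bounds(3) pN_bounds by linarith+
    then have "prho < 2 ^ w" "pal * prho < 2 ^ w" "4 * (pal * prho) < 2 ^ w" "4 * (pal * prho) * paa < 2 ^ w"
      unfolding pM_def prr_def .
    then show ?thesis using wN(3) pN_bounds(1) by (simp add: su3_def prho_def)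
  qed
  let ?g3 = "notE (V 0 <. V 8 *. V 7)" and ?c3 = "Set 8 (C 2 *. V 8)"
  have l3: "R w X Y lo3 (?f3 0) (pLT * (tc ?c3 + te ?g3 + 1) + te ?g3 + 1) 0 (\<lambda>s. s = ?f3 pLT)"
    unfolding lo3_def
  proof (rule R_loop_least[where f = ?f3])
    fix e assume e: "e < pLT"
    have 1: "2 ^ e * pM \<le> n" by (rule pTT_bounds(2)[OF e])
    have "2 * 2 ^ e \<le> pTT" using e unfolding pTT_def power_Suc[symmetric] by (intro power_increasing) auto
    then have "2 * (2::nat) ^ e < 2 ^ w" "2 ^ e * pM < 2 ^ w" using 1 pTT_bounds(4) wN(3) pN_bounds(1,2) by linarith+
    then show "esafe w X Y (?f3 e) ?g3 \<and> nev X Y (?f3 e) ?g3 \<noteq> 0 \<and> bsafe w X Y ?c3 (?f3 e) \<and> nexec X Y ?c3 (?f3 e) = ?f3 (Suc e)"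
      using 1 wN(3) pN_bounds(1) by (simp add: v)
  next
    have "2 ^ pLT * pM < 2 ^ w" using pTT_bounds(6) pM_bounds(3) pN_bounds wN unfolding pTT_def by linarith
    then show "esafe w X Y (?f3 pLT) ?g3" using wN(3) pN_bounds(1) by (simp add: v)
    show "nev X Y (?f3 pLT) ?g3 = 0" using pTT_bounds(1) by (simp add: v pTT_def)
  qed
  have n4: "nexec X Y su4 (?f3 pLT) = (?v4, m)"
    by (simp add: su4_def v pH_def pGN_def pnsg_def pZB_def pTB_def pTT_def fun_eq_iff)
  have s4: "bsafe w X Y su4 (?f3 pLT)"
  proof -
    have "pTT * pM < 2 ^ w" "pTT * pM + n < 2 ^ w" "4 * pM < 2 ^ w" "pTT * pM + n + 4 * pM < 2 ^ w"
      using pTT_bounds(6) pM_bounds(3) pN_bounds wN by linarith+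
    moreover have "2 * k < 2 ^ w" "Suc (2 * k div pal) < 2 ^ w" "Suc (Suc (Suc (2 * k div pal))) < 2 ^ w"
      using pN_bounds wN pGN_bounds(1) unfolding pGN_def by linarith+
    moreover have "Suc (2 * k div pal div prho) < 2 ^ w"
    proof -
      have "2 * k div pal div prho \<le> 2 * k div pal" by simp
      then show ?thesis using pGN_bounds(1) pN_bounds wN unfolding pGN_def by linarith
    qed
    moreover have "9 * prr < 2 ^ w" "Suc (Suc (Suc (2 * k div pal))) + 9 * prr < 2 ^ w"
      using prr_bounds(6) pN_bounds wN pGN_bounds(1) unfolding pGN_def by linarith+
    ultimately show ?thesis using wN(3) pN_bounds(1) by (simp add: su4_def v pTT_def)
  qed
  have env4: "env ?v4" unfolding env_def using v by simp
  have r4: "R w X Y su4 (?f3 pLT) (tc su4) 0 ?P"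
    by (rule R_block'[OF s4 _ order_refl]) (use env4 in \<open>simp add: n4\<close>)
  have r3: "R w X Y (su3 ;; lo3 ;; su4) (?f2 ps) (tc su3 + ((pLT * (tc ?c3 + te ?g3 + 1) + te ?g3 + 1) + tc su4)) (0 + 0) ?P"
    by (rule R_block_Seq[OF s3], unfold n3, rule R_Seq[OF l3]) (use r4 in simp)
  have r2: "R w X Y (su2 ;; lo2 ;; su3 ;; lo3 ;; su4) (?f1 pL) (tc su2 + ((ps * (tc ?c2 + te ?g2 + 1) + te ?g2 + 1) +
      (tc su3 + ((pLT * (tc ?c3 + te ?g3 + 1) + te ?g3 + 1) + tc su4)))) (0 + (0 + 0)) ?P"
    by (rule R_block_Seq[OF s2], unfold n2, rule R_Seq[OF l2]) (use r3 in simp)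
  have "R w X Y setup_prog (v, m) (tc su1 + ((pL * (tc ?c1 + te ?g1 + 1) + te ?g1 + 1) + (tc su2 + ((ps * (tc ?c2 + te ?g2 + 1) + te ?g2 + 1) +
      (tc su3 + ((pLT * (tc ?c3 + te ?g3 + 1) + te ?g3 + 1) + tc su4)))))) (0 + (0 + (0 + 0))) ?P"
    unfolding setup_prog_def by (rule R_block_Seq[OF s1], unfold n1, rule R_Seq[OF l1]) (use r2 in simp)
  then show ?thesis
  proof (rule R_mono)
    have gen: "a1 + ((p1 + t1 + 1) + (a2 + ((p2 + t2 + 1) + (a3 + ((p3 + t3 + 1) + a4))))) \<le> Kp * (3 * pL + ps + 1)"
      if "p1 \<le> pL * 40" "p2 \<le> ps * 40" "p3 \<le> pLT * 40" "t1 + 1 \<le> 40" "t2 + 1 \<le> 40" "t3 + 1 \<le> 40" "a1 + a2 + a3 + a4 + 120 \<le> Kp"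
      for a1 a2 a3 a4 p1 p2 p3 t1 t2 t3 :: nat
    proof -
      define z where "z = 3 * pL + ps"
      have "40 * z \<le> Kp * z" using that(7) by (intro mult_le_mono1) linarith
      moreover have "Kp * (z + 1) = Kp * z + Kp" by simp
      moreover have "p1 + p2 + p3 \<le> 40 * z"
      proof -
        have "40 * z = 40 * pL + 40 * ps + 40 * pL + 40 * pL" by (simp add: z_def)
        moreover have "p3 \<le> 40 * pL" using that(3) pTT_bounds(5) by simp
        moreover have "p1 \<le> 40 * pL" "p2 \<le> 40 * ps" using that(1,2) by simp_all
        ultimately show ?thesis by (simp del: One_nat_def)
      qed
      ultimately have "a1 + ((p1 + t1 + 1) + (a2 + ((p2 + t2 + 1) + (a3 + ((p3 + t3 + 1) + a4))))) \<le> Kp * (z + 1)" using that by linarith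
      then show ?thesis by (simp only: z_def)
    qed
    show "tc su1 + ((pL * (tc ?c1 + te ?g1 + 1) + te ?g1 + 1) + (tc su2 + ((ps * (tc ?c2 + te ?g2 + 1) + te ?g2 + 1) +
      (tc su3 + ((pLT * (tc ?c3 + te ?g3 + 1) + te ?g3 + 1) + tc su4))))) \<le> Kp * (3 * pL + ps + 1)"
      by (rule gen) (simp_all add: Kp_def setup_prog_def)
  qed auto
qed

definition ptime :: nat where
  "ptime = Kp * (3 * pL + ps + 1) + (Kt * ((pnsg + 1) * ((pLT + 1) * lcost)) + Kd * ((k + 1) * (pGN * tquery)))"

text \<open>Bounds the number of sampling calls: trees, levels, nodes per level and rounds per node,
  plus two extensions for each entry of each row.\<close>

definition pfail :: nat where
  "pfail = pnsg * ((pLT + 1) * pTT * (pLB + 4)) + (k + 1) * pGN * (2 * (pLB + 4))"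

lemma main_correct:
  assumes v: "v 0 = n" "v 1 = length Y" "v 2 = k" "v 3 = \<alpha>"
  shows "R w X Y (main_prog cc) (v, \<lambda>_. 0) (50 + ptime) (of_nat pfail * fail0) (gapQ X Y k \<alpha>)"
proof -
  have v1: "v (Suc 0) = length Y" using v by simp
  let ?P = "\<lambda>s. (edit_distance X Y \<le> k \<longrightarrow> fst s 0 \<noteq> 0) \<and> (fst s 0 \<noteq> 0 \<longrightarrow> edit_distance X Y \<le> k + 3 * (k + 1) * (pal - 1))"
  let ?d1 = "of_nat (pnsg * ((pLT + 1) * pTT * (pLB + 4))) * fail0" and ?d2 = "of_nat ((k + 1) * pGN * (2 * (pLB + 4))) * fail0"
  have D: "R w X Y (build cc ;; dprog cc) s (Kt * ((pnsg + 1) * ((pLT + 1) * lcost)) + Kd * ((k + 1) * (pGN * tquery))) (?d1 + ?d2) ?P"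
    if "(\<lambda>(v', m'). env v' \<and> v' 12 = pnsg \<and> m' = (\<lambda>_. 0)) s" for s
  proof -
    obtain v1 m1 where s0: "s = (v1, m1)" by (cases s)
    have e1: "env v1" and r: "v1 12 = pnsg" and m1: "m1 = (\<lambda>_. 0)" using that unfolding s0 prod.case by blast+
    have s: "s = (v1, \<lambda>_. 0)" using s0 m1 by simp
    show ?thesis unfolding s
    proof (rule R_Seq[OF build_correct[OF e1 r]])
      fix s' assume *: "(\<lambda>(v', m'). (\<forall>r<20. v' r = v1 r) \<and> (\<forall>d<pZB. m' d = 0) \<and> tree_good m') s'"
      obtain v2 m2 where s': "s' = (v2, m2)" by (cases s')
      have v2: "\<forall>r<20. v2 r = v1 r" and m2: "\<forall>d<pZB. m2 d = 0" and tg: "tree_good m2" using * unfolding s' prod.case by blast+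
      have e2: "env v2" by (rule env_cong[OF e1]) (use v2 in simp)
      show "R w X Y (dprog cc) s' (Kd * ((k + 1) * (pGN * tquery))) ?d2 ?P"
        unfolding s' by (rule dprog_correct[OF e2 tg m2])
    qed
  qed
  have S: "R w X Y (setup_prog ;; build cc ;; dprog cc) (v, \<lambda>_. 0) ptime (0 + (?d1 + ?d2)) ?P"
    unfolding ptime_def by (rule R_Seq[OF setup_correct[OF v] D])
  have sum: "n + length Y < 2 ^ w" "length Y + k < 2 ^ w" "n + k < 2 ^ w" using wN(3) pN_bounds kn by (simp_all add: pN_def)
  let ?g1 = "V 2 <. V 0 +. V 1" and ?g2 = "V 1 +. V 2 <. V 0" and ?g3 = "V 0 +. V 2 <. V 1"
  have "R w X Y (main_prog cc) (v, \<lambda>_. 0) (te ?g1 + 1 + (te ?g2 + 1 + (te ?g3 + 1 + ptime))) (0 + (?d1 + ?d2)) ?P"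
    unfolding main_prog_def
  proof (rule R_If)
    show "R w X Y (IfC ?g2 (Set 0 (C 0)) (IfC ?g3 (Set 0 (C 0)) (setup_prog ;; build cc ;; dprog cc))) (v, \<lambda>_. 0)
       (te ?g2 + 1 + (te ?g3 + 1 + ptime)) (0 + (?d1 + ?d2)) ?P"
    proof (rule R_If)
      show "R w X Y (IfC ?g3 (Set 0 (C 0)) (setup_prog ;; build cc ;; dprog cc)) (v, \<lambda>_. 0) (te ?g3 + 1 + ptime) (0 + (?d1 + ?d2)) ?P"
        by (rule R_If[OF _ _ S]) (use sum nm in \<open>simp_all add: v v1\<close>)
    qed (use sum nm in \<open>simp_all add: v v1\<close>)
  qed (use sum kn in \<open>simp_all add: v v1\<close>)
  then show ?thesis
  proof (rule R_mono)
    show "te ?g1 + 1 + (te ?g2 + 1 + (te ?g3 + 1 + ptime)) \<le> 50 + ptime" by simp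
    show "0 + (?d1 + ?d2) \<le> of_nat pfail * fail0"
      by (simp only: pfail_def of_nat_add distrib_right add_0_left order_refl)
  next
    fix s :: vals assume P: "?P s"
    have "3 * (k + 1) * (pal - 1) \<le> 3 * (k + 1) * (\<alpha> - 1)" using pal_bounds(4) by (intro mult_le_mono2) simp
    then show "gapQ X Y k \<alpha> s" unfolding gapQ_def using P by (meson add_le_cancel_left le_trans not_le)
  qed
qed

end

section \<open>Balancing the costs and the union bound\<close>

section \<open>Running time and error probability\<close>

text \<open>Chosen for \<open>LB4_le\<close>: 2007 = 3 + 2000 + 4 collects the factor of L, the
  constant of \<open>pLB\<close> and the extra rounds.\<close>

definition q1 :: "nat \<Rightarrow> nat" where "q1 cc = 2007 + 2000 * cc"

context pars begin

lemma LB4_le: "pLB + 4 \<le> q1 cc * pL"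
proof -
  have "(2004 + 2000 * cc) * 1 \<le> (2004 + 2000 * cc) * pL" using pL_bounds(1) by (rule mult_le_mono2)
  then show ?thesis unfolding pLB_def q1_def by (simp add: add_mult_distrib)
qed

lemma div_aa: "(c * pM + prr) div paa \<le> (4 * c + 1) * prr"
proof -
  have "prr * 1 \<le> prr * paa" using paa_bounds(1) by (rule mult_le_mono2)
  then have "c * pM + prr \<le> (4 * c + 1) * prr * paa" by (simp add: pM_def algebra_simps)
  then have "(c * pM + prr) div paa \<le> (4 * c + 1) * prr * paa div paa" by (rule div_le_mono)
  then show ?thesis using paa_bounds(1) by simp
qed

lemma row_le:
  assumes "a \<le> prr" "b \<le> c * prr"
  shows "a + b * (cc * pL) + pLB + 1 \<le> prr * ((1 + c * cc + q1 cc) * pL)"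
proof -
  have "a \<le> prr * pL" using mult_le_mono[OF assms(1) pL_bounds(1)] by simp
  moreover have "b * (cc * pL) \<le> c * prr * (cc * pL)" using assms(2) by (rule mult_le_mono1)
  moreover have "1 * (q1 cc * pL) \<le> prr * (q1 cc * pL)" using prr_bounds(4) by (rule mult_le_mono1)
  moreover have "prr * ((1 + c * cc + q1 cc) * pL) = prr * pL + c * prr * (cc * pL) + prr * (q1 cc * pL)" by (simp add: algebra_simps)
  ultimately show ?thesis using LB4_le by linarith
qed

lemma lcost_le: "lcost \<le> q1 cc * pL * (pTT * (prr * ((1 + 7 * cc + q1 cc) * pL)))"
proof -
  have "(pM + prr) div paa + 2 \<le> 7 * prr" using div_aa[of 1] prr_bounds(4) by simp
  from row_le[OF order_refl this] show ?thesis
    unfolding lcost_def by (intro mult_le_mono LB4_le order_refl)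
qed

lemma tquery_le: "tquery \<le> Kq * ((q1 cc * (1 + 10 * cc + q1 cc) + 2) * (pL * (pL * prr)))"
proof -
  have "(2 * pM + pal) div paa \<le> (2 * pM + prr) div paa" using prr_bounds(7) by (intro div_le_mono) simp
  moreover have "(2 * pM + prr) div paa \<le> 9 * prr" using div_aa[of 2] by simp
  ultimately have "(2 * pM + pal) div paa + 1 \<le> 10 * prr" using prr_bounds(4) by linarith
  from row_le[OF prr_bounds(7) this] have e: "ecost pal (2 * pM) \<le> prr * ((1 + 10 * cc + q1 cc) * pL)" by (simp only: ecost_def)
  have 1: "(pLB + 4) * ecost pal (2 * pM) \<le> q1 cc * pL * (prr * ((1 + 10 * cc + q1 cc) * pL))" by (intro mult_le_mono LB4_le e)
  have "(pLT + 1) * pal \<le> (2 * pL) * prr" using pTT_bounds(5) pL_bounds(1) prr_bounds(7) by (intro mult_le_mono) linarith+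
  also have "\<dots> \<le> (2 * pL) * (pL * prr)" using mult_le_mono1[OF pL_bounds(1), of prr] by (intro mult_le_mono2) simp
  finally have "(pLB + 4) * ecost pal (2 * pM) + (pLT + 1) * pal \<le> q1 cc * pL * (prr * ((1 + 10 * cc + q1 cc) * pL)) + (2 * pL) * (pL * prr)"
    by (rule add_mono[OF 1])
  also have "\<dots> = (q1 cc * (1 + 10 * cc + q1 cc) + 2) * (pL * (pL * prr))" by (simp add: algebra_simps)
  finally show ?thesis unfolding tquery_def by (rule mult_le_mono2)
qed

definition B0 :: real where
  "B0 = 1 + real n / pal + real k ^ 2 + real k / pal * sqrt (real n * real k)"

lemma pos: "0 < real pal" "0 < real prr" "1 \<le> real pL" "0 \<le> real k / pal * sqrt (real n * real k)" "0 \<le> real n / pal"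
  using pal_bounds(1) prr_bounds(4) pL_bounds(1) by simp_all

lemma B0_ge: "1 \<le> B0" "real n / pal \<le> B0" "real k ^ 2 \<le> B0" "real k / pal * sqrt (real n * real k) \<le> B0"
  using pos(4,5) unfolding B0_def by simp_all

lemma sqrt_k1: "real k * sqrt (real n * (real k + 1)) \<le> 2 * (real k * sqrt (real n * real k))"
proof (cases "k = 0")
  case False
  then have "real n * (real k + 1) \<le> real n * (4 * real k)" by (intro mult_left_mono) auto
  then have "real n * (real k + 1) \<le> 4 * (real n * real k)" by (simp only: mult.left_commute)
  then have "sqrt (real n * (real k + 1)) \<le> sqrt (4 * (real n * real k))" by (rule real_sqrt_le_mono)
  also have "\<dots> = 2 * sqrt (real n * real k)" by (simp add: real_sqrt_mult)
  finally have "real k * sqrt (real n * (real k + 1)) \<le> real k * (2 * sqrt (real n * real k))" by (intro mult_left_mono) auto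
  then show ?thesis by simp
qed simp

text \<open>By the choice of \<open>ps\<close> and ps < rr, n is below rr ^ 2 (k + 1); multiply by n
  and take roots.\<close>

lemma n_rr: "real n / prr \<le> sqrt (real n * (real k + 1))"
proof -
  have "n \<le> prr * prr * (k + 1)"
  proof -
    have "(ps + 1) * (ps + 1) * (k + 1) \<le> prr * prr * (k + 1)" using prr_bounds(3) by (intro mult_le_mono) auto
    then show ?thesis using ps_bounds(1) by linarith
  qed
  then have "n * n \<le> n * (prr * prr * (k + 1))" by (rule mult_le_mono2)
  then have "real (n * n) \<le> real (n * (prr * prr * (k + 1)))" by (rule of_nat_mono)
  then have "(real n)\<^sup>2 \<le> (real prr)\<^sup>2 * (real n * (real k + 1))" by (simp add: power2_eq_square algebra_simps)
  then have "(real n / prr)\<^sup>2 \<le> real n * (real k + 1)" using pos(2) by (simp add: power_divide divide_le_eq mult.commute)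
  then show ?thesis by (rule real_le_rsqrt)
qed

lemma s_sqrt: "(real k + 1) * ps \<le> sqrt (real n * (real k + 1))"
proof (rule real_le_rsqrt)
  have "(k + 1) * (ps * ps * (k + 1)) \<le> (k + 1) * n" using ps_bounds(3) by (rule mult_le_mono2)
  then have "real ((k + 1) * (ps * ps * (k + 1))) \<le> real ((k + 1) * n)" by (rule of_nat_mono)
  then show "((real k + 1) * ps)\<^sup>2 \<le> real n * (real k + 1)" by (simp add: power2_eq_square algebra_simps)
qed

text \<open>The cap al \<le> k + 1 turns ps ^ 2 (k + 1) \<le> n into ps * al \<le> n.\<close>

lemma s_le: "real ps \<le> real n / pal"
proof -
  have "ps * pal \<le> n"
  proof (cases "ps = 0")
    case False
    then have "ps * 1 * pal \<le> ps * ps * (k + 1)" using pal_bounds(2) by (intro mult_le_mono) auto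
    then show ?thesis using ps_bounds(3) by linarith
  qed simp
  then have "real (ps * pal) \<le> real n" by (rule of_nat_mono)
  then show ?thesis using pos(1) by (simp add: pos_le_divide_eq)
qed

lemma rr_le: "real prr \<le> real k + 1 + real n / pal" "real prr \<le> pal + ps"
proof -
  show 1: "real prr \<le> pal + ps" using of_nat_mono[OF prr_bounds(2), where 'a = real] by simp
  have "real pal \<le> real k + 1" using of_nat_mono[OF pal_bounds(2), where 'a = real] by simp
  then show "real prr \<le> real k + 1 + real n / pal" using 1 s_le by linarith
qed

text \<open>Unless the tree is a single leaf, TT * M is at most 2 n, and M = 4 rr aa bounds TT * rr
  by n / aa. Passing from aa to al costs a factor 48 L, because al < (aa + 1) (4 L + 20).\<close>

lemma TT_rr: "real (pTT * prr) \<le> real prr + 48 * real pL * (real n / pal)"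
proof (cases "pLT = 0")
  case True
  then show ?thesis using pos by (simp add: pTT_def)
next
  case False
  have "pTT * pM \<le> 2 * n" using pTT_bounds(3) False by auto
  then have "real (pTT * pM) \<le> real (2 * n)" by (rule of_nat_mono)
  then have 1: "real (pTT * prr) * real paa \<le> real n" by (simp add: pM_def algebra_simps)
  have "pal \<le> 2 * paa * (24 * pL)"
  proof -
    have "(paa + 1) * (4 * pL + 20) \<le> (2 * paa) * (24 * pL)" using paa_bounds(1) pL_bounds(1) by (intro mult_le_mono) linarith+
    then show ?thesis using paa_bounds(3) by linarith
  qed
  then have "real pal \<le> real (2 * paa * (24 * pL))" by (rule of_nat_mono)
  then have "real pal \<le> 48 * real pL * real paa" by (simp add: mult.commute mult.left_commute)
  then have "real (pTT * prr) * real pal \<le> real (pTT * prr) * (48 * real pL * real paa)" by (rule mult_left_mono) simp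
  also have "\<dots> = 48 * real pL * (real (pTT * prr) * real paa)" by (simp only: ac_simps)
  also have "\<dots> \<le> 48 * real pL * real n" using 1 pos(3) by (intro mult_left_mono) auto
  finally have "real (pTT * prr) \<le> 48 * real pL * real n / real pal" using pos(1) by (simp add: pos_le_divide_eq)
  then show ?thesis using pos(2) by simp
qed

text \<open>There are about 2 k / rr + 1 trees, each of weight rr + L n / al. In the product,
  \<open>n_rr\<close> turns (k / rr) (n / al) into the term k / al sqrt (n k); this is the
  preprocessing side of the balance.\<close>

lemma tree_size: "real ((pnsg + 1) * (pTT * prr)) \<le> 400 * real pL * B0"
proof -
  have "2 * k div prr * prr \<le> 2 * k" by simp
  then have "real (2 * k div prr * prr) \<le> real (2 * k)" by (rule of_nat_mono)
  then have g: "real (pnsg + 1) * real prr \<le> 2 * real k + 2 * real prr" unfolding pGN_bounds(5) by (simp add: distrib_right)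
  then have g': "real (pnsg + 1) \<le> 2 * (real k / prr) + 2" using pos(2) by (simp add: field_simps)
  let ?u = "real n / pal" and ?l = "real pL"
  have "real ((pnsg + 1) * (pTT * prr)) \<le> real (pnsg + 1) * (real prr + 48 * ?l * ?u)"
    unfolding of_nat_mult[of "pnsg + 1"] by (intro mult_left_mono TT_rr) simp
  also have "\<dots> = real (pnsg + 1) * real prr + real (pnsg + 1) * (48 * ?l * ?u)" by (rule distrib_left)
  also have "real (pnsg + 1) * (48 * ?l * ?u) \<le> (2 * (real k / prr) + 2) * (48 * ?l * ?u)"
    using g' pos by (intro mult_right_mono) auto
  also have "\<dots> = 96 * ?l * (real k * (real n / prr) / pal) + 96 * ?l * ?u"
    by (simp only: distrib_right) (simp add: mult.commute mult.left_commute)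
  finally have 1: "real ((pnsg + 1) * (pTT * prr)) \<le> 2 * real k + 2 * real prr + (96 * ?l * (real k * (real n / prr) / pal) + 96 * ?l * ?u)"
    using g by linarith
  have "real k * (real n / prr) \<le> real k * sqrt (real n * (real k + 1))" by (intro mult_left_mono n_rr) simp
  then have "real k * (real n / prr) \<le> 2 * (real k * sqrt (real n * real k))" using sqrt_k1 by linarith
  then have "real k * (real n / prr) / pal \<le> 2 * (real k * sqrt (real n * real k)) / pal" using pos(1) by (intro divide_right_mono) auto
  also have "\<dots> = 2 * (real k / pal * sqrt (real n * real k))" by simp
  also have "\<dots> \<le> 2 * B0" using B0_ge(4) by simp
  finally have "96 * ?l * (real k * (real n / prr) / pal) \<le> 96 * ?l * (2 * B0)" using pos(3) by (intro mult_left_mono) auto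
  moreover have "96 * ?l * ?u \<le> 96 * ?l * B0" using pos(3) B0_ge(2) by (intro mult_left_mono) auto
  moreover have "real k \<le> real k ^ 2" by (cases k) (auto simp: power2_eq_square algebra_simps)
  moreover have "1 * B0 \<le> ?l * B0" using pos(3) B0_ge(1) by (intro mult_right_mono) auto
  ultimately show ?thesis using 1 rr_le(1) B0_ge by linarith
qed

text \<open>The query side of the balance: k + 1 rows with at most 3 (k + 1) / al groups, each query
  weighing rr \<le> al + ps. The part al contributes k ^ 2, and by \<open>s_sqrt\<close> the part ps
  contributes the square root term.\<close>

lemma dp_size: "real ((k + 1) * (pGN * prr)) \<le> 30 * B0"
proof -
  have "pGN * pal \<le> 3 * k + 1"
  proof -
    have "2 * k div pal * pal \<le> 2 * k" by simp
    then show ?thesis using pal_bounds(2) unfolding pGN_def add_mult_distrib mult_1 by linarith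
  qed
  then have "real (pGN * pal) \<le> real (3 * k + 1)" by (rule of_nat_mono)
  then have G: "real pGN * pal \<le> 3 * (real k + 1)" by simp
  then have G': "real pGN \<le> 3 * (real k + 1) / pal" using pos(1) by (simp add: pos_le_divide_eq)
  have "real ((k + 1) * (pGN * prr)) = (real k + 1) * (real pGN * real prr)" by (simp only: of_nat_mult of_nat_add of_nat_1)
  also have "\<dots> \<le> (real k + 1) * (real pGN * (real pal + real ps))" using rr_le(2) by (intro mult_left_mono) auto
  also have "\<dots> = (real k + 1) * (real pGN * pal) + ((real k + 1) * ps) * real pGN" by (simp add: algebra_simps)
  also have "\<dots> \<le> (real k + 1) * (3 * (real k + 1)) + sqrt (real n * (real k + 1)) * (3 * (real k + 1) / pal)"
    by (intro add_mono mult_left_mono[OF G] mult_mono[OF s_sqrt G']) auto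
  finally have 1: "real ((k + 1) * (pGN * prr)) \<le> 3 * (real k + 1)\<^sup>2 + 3 * ((real k + 1) * sqrt (real n * (real k + 1)) / pal)"
    by (simp add: power2_eq_square algebra_simps)
  have 2: "(real k + 1)\<^sup>2 \<le> 2 * real k ^ 2 + 2"
    using sum_squares_ge_zero[of "real k - 1" 0] by (simp add: power2_eq_square algebra_simps)
  have 3: "(real k + 1) * sqrt (real n * (real k + 1)) / pal \<le> 5 * B0"
  proof (cases "k = 0")
    case True
    \<comment> \<open>For k = 0 the square root term of \<open>B0\<close> vanishes, but al = 1 and
      sqrt n is absorbed by n / al.\<close>
    then have p: "pal = 1" using pal_bounds by simp
    have "sqrt (real n) \<le> 1 + real n" by (rule real_le_lsqrt) (auto simp: power2_eq_square algebra_simps)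
    moreover have "0 \<le> real n" "5 * (1 + real n) = 5 + 5 * real n" by simp_all
    ultimately have "sqrt (real n) \<le> 5 * (1 + real n)" by linarith
    then show ?thesis unfolding B0_def using True p by simp
  next
    case False
    then have "real k + 1 \<le> 2 * real k" by simp
    then have "(real k + 1) * sqrt (real n * (real k + 1)) \<le> 2 * real k * sqrt (real n * (real k + 1))" by (intro mult_right_mono) auto
    then have "(real k + 1) * sqrt (real n * (real k + 1)) \<le> 4 * (real k * sqrt (real n * real k))" using sqrt_k1 by linarith
    then have "(real k + 1) * sqrt (real n * (real k + 1)) / pal \<le> 4 * (real k * sqrt (real n * real k)) / pal" using pos(1) by (intro divide_right_mono) auto
    also have "\<dots> = 4 * (real k / pal * sqrt (real n * real k))" by simp
    finally show ?thesis using B0_ge(1,4) by linarith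
  qed
  show ?thesis using 1 2 3 B0_ge by linarith
qed

text \<open>The fourth power arises in the trees: one logarithm each for the levels, the rounds of
  an extension, the repetitions of the sampling, and the passage from \<open>aa\<close> to
  \<open>al\<close>. The queries need only two.\<close>

lemma ptime_le: "real (50 + ptime) \<le> real (50 + 5 * Kp + 800 * Kt * (q1 cc * (1 + 7 * cc + q1 cc)) +
    30 * Kd * Kq * (q1 cc * (1 + 10 * cc + q1 cc) + 2)) * (real pL ^ 4 * B0)"
proof -
  let ?l = "real pL" and ?U = "real pL ^ 4 * B0" and ?a = "q1 cc * (1 + 7 * cc + q1 cc)" and ?b = "q1 cc * (1 + 10 * cc + q1 cc) + 2"
  have pw: "1 \<le> ?l ^ 4" "?l \<le> ?l ^ 4" "?l ^ 2 \<le> ?l ^ 4"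
    using power_increasing[of 0 4 ?l] power_increasing[of 1 4 ?l] power_increasing[of 2 4 ?l] pos(3) by simp_all
  have B: "0 \<le> B0" using B0_ge(1) by linarith
  have U: "1 \<le> ?U" "?l \<le> ?U" "B0 \<le> ?U" "?l ^ 2 * B0 \<le> ?U"
    using mult_mono[OF pw(1) B0_ge(1)] mult_mono[OF pw(2) B0_ge(1)] mult_right_mono[OF pw(1) B] mult_right_mono[OF pw(3) B] by simp_all
  have "real (Kp * (3 * pL + ps + 1)) = Kp * (3 * ?l + ps + 1)" by (simp only: of_nat_mult of_nat_add of_nat_1 of_nat_numeral)
  also have "\<dots> \<le> Kp * (5 * ?U)" using U s_le B0_ge(2) by (intro mult_left_mono) linarith+
  finally have 1: "real (Kp * (3 * pL + ps + 1)) \<le> Kp * (5 * ?U)" .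
  have "(pnsg + 1) * ((pLT + 1) * lcost) \<le> (pnsg + 1) * ((2 * pL) * (q1 cc * pL * (pTT * (prr * ((1 + 7 * cc + q1 cc) * pL)))))"
    using pTT_bounds(5) pL_bounds(1) by (intro mult_le_mono order_refl lcost_le) linarith
  also have "\<dots> = (2 * ?a * pL ^ 3) * ((pnsg + 1) * (pTT * prr))" by (simp only: power3_eq_cube mult.assoc mult.commute mult.left_commute)
  finally have "real ((pnsg + 1) * ((pLT + 1) * lcost)) \<le> real ((2 * ?a * pL ^ 3) * ((pnsg + 1) * (pTT * prr)))" by (rule of_nat_mono)
  also have "\<dots> = (2 * real ?a * ?l ^ 3) * real ((pnsg + 1) * (pTT * prr))" by (simp only: of_nat_mult of_nat_power of_nat_numeral)
  also have "\<dots> \<le> (2 * real ?a * ?l ^ 3) * (400 * ?l * B0)" by (intro mult_left_mono tree_size) simp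
  also have "\<dots> = 800 * real ?a * ?U" by (simp add: power3_eq_cube power4_eq_xxxx)
  finally have "real (Kt * ((pnsg + 1) * ((pLT + 1) * lcost))) \<le> real Kt * (800 * real ?a * ?U)"
    unfolding of_nat_mult[of Kt] by (rule mult_left_mono) simp
  then have 2: "real (Kt * ((pnsg + 1) * ((pLT + 1) * lcost))) \<le> real (800 * Kt * ?a) * ?U" by (simp add: mult.assoc mult.left_commute)
  have "(k + 1) * (pGN * tquery) \<le> (k + 1) * (pGN * (Kq * (?b * (pL * (pL * prr)))))" by (intro mult_le_mono order_refl tquery_le)
  also have "\<dots> = (Kq * ?b * pL ^ 2) * ((k + 1) * (pGN * prr))" by (simp only: power2_eq_square ac_simps)
  finally have "real ((k + 1) * (pGN * tquery)) \<le> real ((Kq * ?b * pL ^ 2) * ((k + 1) * (pGN * prr)))" by (rule of_nat_mono)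
  also have "\<dots> = (real (Kq * ?b) * ?l ^ 2) * real ((k + 1) * (pGN * prr))" by (simp only: of_nat_mult of_nat_power)
  also have "\<dots> \<le> (real (Kq * ?b) * ?l ^ 2) * (30 * B0)" by (intro mult_left_mono dp_size) simp
  also have "\<dots> = 30 * real (Kq * ?b) * (?l ^ 2 * B0)" by simp
  also have "\<dots> \<le> 30 * real (Kq * ?b) * ?U" using U(4) by (intro mult_left_mono) auto
  finally have "real (Kd * ((k + 1) * (pGN * tquery))) \<le> real Kd * (30 * real (Kq * ?b) * ?U)"
    unfolding of_nat_mult[of Kd] by (rule mult_left_mono) simp
  then have 3: "real (Kd * ((k + 1) * (pGN * tquery))) \<le> real (30 * Kd * Kq * ?b) * ?U" by (simp only: of_nat_mult of_nat_numeral ac_simps)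
  have "real (50 + ptime) = 50 + (real (Kp * (3 * pL + ps + 1)) + (real (Kt * ((pnsg + 1) * ((pLT + 1) * lcost))) + real (Kd * ((k + 1) * (pGN * tquery)))))"
    unfolding ptime_def by (simp only: of_nat_add of_nat_numeral)
  also have "\<dots> \<le> 50 * ?U + (Kp * (5 * ?U) + (real (800 * Kt * ?a) * ?U + real (30 * Kd * Kq * ?b) * ?U))"
    using 1 2 3 U(1) by (intro add_mono) auto
  also have "\<dots> = (50 + real (5 * Kp) + real (800 * Kt * ?a) + real (30 * Kd * Kq * ?b)) * ?U"
    by (simp only: of_nat_mult[of 5 Kp] of_nat_numeral distrib_right)
  also have "\<dots> = real (50 + 5 * Kp + 800 * Kt * ?a + 30 * Kd * Kq * ?b) * ?U" by (simp only: of_nat_add of_nat_numeral)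
  finally show ?thesis .
qed

lemma pL_log: "real pL \<le> 2 * log 2 pN" "1 \<le> log 2 pN"
proof -
  have "2 \<le> real pN" using of_nat_mono[OF pN_bounds(1), where 'a = real] by simp
  then have l: "log 2 2 \<le> log 2 pN" by (subst log_le_cancel_iff) auto
  then show 1: "1 \<le> log 2 pN" by simp
  have "real (2 ^ pL) \<le> real (2 * pN)" using pL_bounds(3) by (rule of_nat_mono)
  then have "log 2 (2 ^ pL) \<le> log 2 (2 * real pN)" using \<open>2 \<le> real pN\<close> by (subst log_le_cancel_iff) auto
  then have "real pL \<le> 1 + log 2 pN" using \<open>2 \<le> real pN\<close> by (simp add: log_mult)
  then show "real pL \<le> 2 * log 2 pN" using 1 by linarith
qed

text \<open>In both cases of the minimum \<alpha> is at most (A + 1) al, so replacing al by \<alpha>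
  in a denominator costs the factor A + 1.\<close>

lemma B0_le: "\<alpha> \<le> A * (k + 1) \<Longrightarrow> B0 \<le> (real A + 1) * time_bound X k \<alpha>"
proof -
  assume A: "\<alpha> \<le> A * (k + 1)"
  have "\<alpha> \<le> (A + 1) * pal"
  proof (cases "\<alpha> \<le> k + 1")
    case True
    then show ?thesis by (simp add: pal_def)
  next
    case False
    then show ?thesis using A by (simp add: pal_def)
  qed
  then have "real \<alpha> \<le> real ((A + 1) * pal)" by (rule of_nat_mono)
  then have a: "1 / real pal \<le> (real A + 1) / \<alpha>" using pos(1) al1 by (simp add: field_simps)
  have scale: "u / pal \<le> (real A + 1) * (u / \<alpha>)" if "0 \<le> u" for u :: real
  proof -
    have "u * (1 / pal) \<le> u * ((real A + 1) / \<alpha>)" using that by (intro mult_left_mono a)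
    moreover have "u * (1 / pal) = u / pal" by simp
    moreover have "u * ((real A + 1) / \<alpha>) = (real A + 1) * (u / \<alpha>)" by (simp add: mult.commute)
    ultimately show ?thesis by linarith
  qed
  let ?S = "sqrt (real n * real k)"
  have "B0 = 1 + real n / pal + real k ^ 2 + real k * ?S / pal" unfolding B0_def by simp
  also have "\<dots> \<le> (real A + 1) * 1 + (real A + 1) * (real n / \<alpha>) + (real A + 1) * real k ^ 2 + (real A + 1) * (real k * ?S / \<alpha>)"
  proof (intro add_mono)
    show "1 \<le> (real A + 1) * 1" by simp
    show "real n / pal \<le> (real A + 1) * (real n / \<alpha>)" by (rule scale) simp
    have "1 * real k ^ 2 \<le> (real A + 1) * real k ^ 2" by (intro mult_right_mono) auto
    then show "real k ^ 2 \<le> (real A + 1) * real k ^ 2" by (simp only: mult_1)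
    show "real k * ?S / pal \<le> (real A + 1) * (real k * ?S / \<alpha>)" by (rule scale) simp
  qed
  also have "\<dots> = (real A + 1) * time_bound X k \<alpha>"
    unfolding time_bound_def by (simp only: distrib_left times_divide_eq_left)
  finally show ?thesis .
qed

lemma pfail_le: "pfail \<le> 12 * q1 cc * pN ^ 4"
proof -
  have q: "pLB + 4 \<le> q1 cc * pN" using LB4_le mult_le_mono2[OF pL_bounds(4), of "q1 cc"] by linarith
  have "pnsg * ((pLT + 1) * pTT * (pLB + 4)) \<le> (2 * pN) * ((2 * pN) * (2 * pN) * (q1 cc * pN))"
    using pGN_bounds(1,2) pTT_bounds(4,5) pL_bounds(4) pN_bounds(1) by (intro mult_le_mono q) linarith+
  also have "\<dots> = 8 * q1 cc * pN ^ 4" by (simp add: power4_eq_xxxx)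
  finally have 1: "pnsg * ((pLT + 1) * pTT * (pLB + 4)) \<le> 8 * q1 cc * pN ^ 4" .
  have "(k + 1) * pGN * (2 * (pLB + 4)) \<le> pN * (2 * pN) * (2 * (q1 cc * pN))"
    using pGN_bounds(1) pN_bounds(4) by (intro mult_le_mono q) linarith+
  also have "\<dots> = 4 * q1 cc * (pN * pN * pN * 1)" by simp
  also have "\<dots> \<le> 4 * q1 cc * (pN * pN * pN * pN)" using pN_bounds(1) by (intro mult_le_mono2) simp
  finally have "(k + 1) * pGN * (2 * (pLB + 4)) \<le> 4 * q1 cc * pN ^ 4" by (simp add: power4_eq_xxxx mult.assoc)
  then show ?thesis using 1 unfolding pfail_def by simp
qed

text \<open>The exponent splits into c for the target probability, 4 for the number of sampling
  calls, and c + 30 to absorb the factor 12 q1 cc, which itself grows with c.\<close>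

lemma pfail_prob:
  assumes cc: "cc = 2 * c + 34"
  shows "of_nat pfail * fail0 \<le> ennreal (1 / real pN ^ c)"
proof -
  have N: "2 \<le> real pN" using of_nat_mono[OF pN_bounds(1), where 'a = real] by simp
  have "c < 2 ^ c" by (rule less_exp)
  moreover have "12 * q1 cc = 840084 + 48000 * c" by (simp add: q1_def cc)
  moreover have "(2::nat) ^ (c + 30) = 1073741824 * 2 ^ c" by (simp add: power_add)
  ultimately have "12 * q1 cc \<le> 2 ^ (c + 30)" by linarith
  also have "\<dots> \<le> pN ^ (c + 30)" using pN_bounds(1) by (intro power_mono) auto
  finally have "12 * q1 cc * pN ^ 4 \<le> pN ^ (c + 30) * pN ^ 4" by (rule mult_le_mono1)
  then have "pfail * pN ^ c \<le> pN ^ (c + 30) * pN ^ 4 * pN ^ c" using pfail_le by (intro mult_le_mono1) linarith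
  also have "\<dots> = pN ^ cc"
  proof -
    have "cc = c + 30 + 4 + c" using cc by simp
    then show ?thesis by (simp only: power_add)
  qed
  also have "\<dots> \<le> (2 ^ pL) ^ cc" using pL_bounds(2) by (intro power_mono) auto
  also have "\<dots> = 2 ^ (cc * pL)" by (simp add: power_mult[symmetric] mult.commute)
  finally have "real (pfail * pN ^ c) \<le> real (2 ^ (cc * pL))" by (rule of_nat_mono)
  then have "real pfail * real pN ^ c \<le> 2 ^ (cc * pL)" by simp
  then have "real pfail * (1 / 2) ^ (cc * pL) \<le> 1 / real pN ^ c" using N by (simp add: power_divide field_simps)
  moreover have "of_nat pfail * fail0 = ennreal (real pfail * (1 / 2) ^ (cc * pL))"
    unfolding fail0_def by (simp add: ennreal_mult ennreal_of_nat_eq_real_of_nat)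
  ultimately show ?thesis by (simp add: ennreal_leI)
qed

end

text \<open>The order of quantifiers matters: the exponent d of the logarithm is absolute, the
  program and the word length requirement may depend on the error exponent c, and only the constant
  C depends on the factor A that makes \<alpha> = O(k) explicit. Words must have at least b times as
  many bits as the logarithm of the input size.\<close>

theorem theorem4p3:
  shows "\<exists>d::nat. \<forall>c::nat. \<exists>(P :: stmt list) (b :: nat). \<forall>A::nat. \<exists>C::real.
    \<forall>(w::nat) (X :: nat list) (Y :: nat list) (k::nat) (\<alpha>::nat).
      1 \<le> \<alpha> \<and> \<alpha> \<le> A * (k + 1) \<and>
      fits w X Y k \<alpha> \<and> input_size X Y ^ b \<le> 2 ^ w \<longrightarrow>
      success_prob P w X Y k \<alpha>
        (nat \<lfloor>C * time_bound X k \<alpha> * log 2 (real (input_size X Y)) ^ d\<rfloor>)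
      \<ge> 1 - 1 / real (input_size X Y) ^ c"
proof (intro exI[of _ 4] allI)
  fix c :: nat
  define cc where "cc = 2 * c + 34"
  define K where "K = 50 + 5 * Kp + 800 * Kt * (q1 cc * (1 + 7 * cc + q1 cc)) + 30 * Kd * Kq * (q1 cc * (1 + 10 * cc + q1 cc) + 2)"
  show "\<exists>(P :: stmt list) (b :: nat). \<forall>A::nat. \<exists>C::real. \<forall>(w::nat) (X :: nat list) (Y :: nat list) (k::nat) (\<alpha>::nat).
      1 \<le> \<alpha> \<and> \<alpha> \<le> A * (k + 1) \<and> fits w X Y k \<alpha> \<and> input_size X Y ^ b \<le> 2 ^ w \<longrightarrow>
      success_prob P w X Y k \<alpha> (nat \<lfloor>C * time_bound X k \<alpha> * log 2 (real (input_size X Y)) ^ 4\<rfloor>) \<ge> 1 - 1 / real (input_size X Y) ^ c"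
  \<comment> \<open>As N \<ge> 2, the exponent 16000 (cc + 1) yields at least that constant and the
    remaining 3 yields N ^ 3; together they give the word length assumption of
    \<open>pars\<close>.\<close>
  proof (rule exI[of _ "comp (main_prog cc)"], rule exI[of _ "16000 * (cc + 1) + 3"], rule allI)
    fix A :: nat
    \<comment> \<open>16 = 2 ^ 4 comes from L \<le> 2 log N in the fourth power, and A + 1 from the
      cap on \<alpha>.\<close>
    let ?C = "real K * 16 * (real A + 1)"
    show "\<exists>C::real. \<forall>(w::nat) (X :: nat list) (Y :: nat list) (k::nat) (\<alpha>::nat).
      1 \<le> \<alpha> \<and> \<alpha> \<le> A * (k + 1) \<and> fits w X Y k \<alpha> \<and> input_size X Y ^ (16000 * (cc + 1) + 3) \<le> 2 ^ w \<longrightarrow>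
      success_prob (comp (main_prog cc)) w X Y k \<alpha> (nat \<lfloor>C * time_bound X k \<alpha> * log 2 (real (input_size X Y)) ^ 4\<rfloor>) \<ge> 1 - 1 / real (input_size X Y) ^ c"
    proof (rule exI[of _ ?C], intro allI impI)
      fix w k \<alpha> :: nat and X Y :: "nat list"
      assume asm: "1 \<le> \<alpha> \<and> \<alpha> \<le> A * (k + 1) \<and> fits w X Y k \<alpha> \<and> input_size X Y ^ (16000 * (cc + 1) + 3) \<le> 2 ^ w"
      define N where "N = input_size X Y"
      have Ne: "N = length X + length Y + 2" by (simp add: N_def input_size_def)
      have N2: "2 \<le> real N" by (simp add: Ne)
      let ?lg = "log 2 (real N)"
      let ?T = "nat \<lfloor>?C * time_bound X k \<alpha> * ?lg ^ 4\<rfloor>"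
      have lg: "1 \<le> ?lg" using N2 by (simp add: le_log_iff)
      have tb: "1 \<le> time_bound X k \<alpha>" unfolding time_bound_def by simp
      have wide: "16 * (1000 * (cc + 1) * N ^ 3) \<le> 2 ^ w"
      proof -
        have "16000 * (cc + 1) \<le> 2 ^ (16000 * (cc + 1))" by (rule less_imp_le[OF less_exp])
        also have "\<dots> \<le> N ^ (16000 * (cc + 1))" by (intro power_mono) (auto simp: Ne)
        finally have "16000 * (cc + 1) * N ^ 3 \<le> N ^ (16000 * (cc + 1)) * N ^ 3" by (rule mult_le_mono1)
        also have "\<dots> = N ^ (16000 * (cc + 1) + 3)" by (simp only: power_add)
        also have "\<dots> \<le> 2 ^ w" using asm unfolding N_def by blast
        finally show ?thesis by (simp add: algebra_simps)
      qed
      let ?s0 = "init_state X Y k \<alpha>"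
      obtain v where pv: "proj ?s0 = (v, \<lambda>_. 0)" and v: "v 0 = length X" "v 1 = length Y" "v 2 = k" "v 3 = \<alpha>"
        by (simp add: proj_def init_state_def)
      have pN0: "0 \<le> 1 / real N ^ c" by simp
      have R: "R w X Y (main_prog cc) (v, \<lambda>_. 0) ?T (ennreal (1 / real N ^ c)) (gapQ X Y k \<alpha>)"
      proof (cases "k < length X + length Y \<and> length X \<le> length Y + k \<and> length Y \<le> length X + k")
        case True
        interpret pars w X Y k \<alpha> cc
          using True asm wide unfolding Ne by unfold_locales auto
        have NN: "pN = N" by (simp add: pN_def Ne)
        show ?thesis
        proof (rule R_mono[OF main_correct[OF v]])
          have "real (50 + ptime) \<le> real K * (real pL ^ 4 * B0)" unfolding K_def by (rule ptime_le)
          also have "\<dots> \<le> real K * ((2 * ?lg) ^ 4 * ((real A + 1) * time_bound X k \<alpha>))"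
            using pL_log(1) B0_le[of A] B0_ge(1) asm unfolding NN by (intro mult_left_mono mult_mono power_mono) auto
          also have "\<dots> = ?C * time_bound X k \<alpha> * ?lg ^ 4" by (simp add: power_mult_distrib)
          finally have "real (50 + ptime) \<le> ?C * time_bound X k \<alpha> * ?lg ^ 4" .
          then have "int (50 + ptime) \<le> \<lfloor>?C * time_bound X k \<alpha> * ?lg ^ 4\<rfloor>" by (simp add: le_floor_iff)
          then show "50 + ptime \<le> ?T" by linarith
          show "of_nat pfail * fail0 \<le> ennreal (1 / real N ^ c)" using pfail_prob[OF cc_def] by (simp only: NN)
        qed
      next
        case False
        have "N ^ 3 \<le> 2 ^ w"
        proof -
          have "1 * N ^ 3 \<le> 16 * (1000 * (cc + 1)) * N ^ 3" by (intro mult_le_mono1) simp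
          also have "\<dots> = 16 * (1000 * (cc + 1) * N ^ 3)" by (simp only: mult.assoc)
          also note wide
          finally show ?thesis by (simp only: mult_1)
        qed
        then have w3: "(length X + length Y + 2) ^ 3 \<le> 2 ^ w" by (simp only: Ne)
        show ?thesis
        proof (rule R_mono[OF main_trivial[OF v(1-3) False w3]])
          have "50 * 1 * 1 \<le> ?C * time_bound X k \<alpha> * ?lg ^ 4"
          proof (intro mult_mono)
            have "50 \<le> real K" by (simp add: K_def)
            then have "50 * 1 * 1 \<le> ?C" by (intro mult_mono) auto
            then show "50 \<le> ?C" by simp
          qed (use tb lg in \<open>auto intro: one_le_power\<close>)
          then have "50 \<le> \<lfloor>?C * time_bound X k \<alpha> * ?lg ^ 4\<rfloor>" by (simp add: le_floor_iff)
          then show "50 \<le> ?T" by linarith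
        qed auto
      qed
      have "1 - 1 / real N ^ c \<le> measure_pmf.prob (run w X Y ?T (comp (main_prog cc), ?s0)) {c'. fst c' = [] \<and> gapQ X Y k \<alpha> (proj (snd c'))}"
        by (rule R_prob[OF R pv pN0])
      also have "{c'. fst c' = [] \<and> gapQ X Y k \<alpha> (proj (snd c'))} = {c'. halted c' \<and> gap_correct X Y k \<alpha> c'}"
        by (auto simp: halted_def gapQ_def gap_correct_def answers_yes_def answers_no_def proj_def)
      finally show "success_prob (comp (main_prog cc)) w X Y k \<alpha> (nat \<lfloor>?C * time_bound X k \<alpha> * log 2 (real (input_size X Y)) ^ 4\<rfloor>) \<ge> 1 - 1 / real (input_size X Y) ^ c"
        by (simp add: success_prob_def N_def)
    qed
  qed
qed

end
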